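(* Let $k$ be a commutative ring with unit and let $a,b$ be positive integers. Then there are isomorphisms $$\mathrm{Hom}_{\mathcal{F}(\overline{\mathbf{Fin}};k)}\big(\overline{k[-]}^{\otimes a},\overline{k[-]}^{\otimes b}\big)\cong H^0\big(\mathsf{Kz}\,k\,\mathrm{Hom}_{\mathbf{\Omega}}(-,\mathbf{a})(\mathbf{b})\big)\cong\ker(R_{b,a}).$$ In particular, this allows $\mathrm{Hom}_{\mathcal{F}(\overline{\mathbf{Fin}};k)}(\overline{k[-]}^{\otimes a},\overline{k[-]}^{\otimes b})$ to be considered as a submodule of $k\,\mathrm{Hom}_{\mathbf{\Omega}}(\mathbf{b},\mathbf{a})$, equipped with its natural $\mathfrak{S}_a\times\mathfrak{S}_b^{\mathrm{op}}$-action.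
   Context: $\overline{\mathbf{Fin}}$ is the category of finite non-empty sets and all maps; $\mathcal{F}(\overline{\mathbf{Fin}};k)$ is the category of functors from $\overline{\mathbf{Fin}}$ to $k$-modules with pointwise tensor product; $\overline{k[-]}$ sends $X$ to the kernel of the augmentation $k[X]\to k$, $[x]\mapsto 1$. $\mathbf{n}=\{1,\dots,n\}$. $\mathbf{\Omega}$ is the category of finite sets and surjections; $k\,\mathrm{Hom}_{\mathbf{\Omega}}(S,\mathbf{a})$ is the free $k$-module on the set of surjections $S\to\mathbf{a}$, with $\mathfrak{S}_a$ acting by postcomposition and (for $S=\mathbf{b}$) $\mathfrak{S}_b^{\mathrm{op}}$ by precomposition. It is contravariantly functorial in $S$ for injections: for an injection $i:S'\hookrightarrow S$, $[f]\mapsto[f\circ i]$ if $f\circ i$ is surjective and $[f]\mapsto0$ otherwise ("restriction"). $R_{b,a}:k\,\mathrm{Hom}_{\mathbf{\Omega}}(\mathbf{b},\mathbf{a})\to\bigoplus_{\mathbf{b}'\subsetneq\mathbf{b},\ |\mathbf{b}'|=b-1}k\,\mathrm{Hom}_{\mathbf{\Omega}}(\mathbf{b}',\mathbf{a})$ is the map whose components are restriction along the inclusions $\mathbf{b}'\subsetneq\mathbf{b}$. $\mathsf{Kz}\,k\,\mathrm{Hom}_{\mathbf{\Omega}}(-,\mathbf{a})(\mathbf{b})$ is the cochain complex with degree $t\in\mathbb{N}$ term $\bigoplus_{\mathbf{b}^{(t)}\subset\mathbf{b},\,|\mathbf{b}^{(t)}|=b-t}k\,\mathrm{Hom}_{\mathbf{\Omega}}(\mathbf{b}^{(t)},\mathbf{a})\otimes\mathrm{Or}(\mathbf{b}\setminus\mathbf{b}^{(t)})$,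 where $\mathrm{Or}(S)=\Lambda^{|S|}(kS)$ is the top exterior power of the free $k$-module $kS$ on $S$, and differential $d(Y\otimes\alpha)=\sum_{x\in\mathbf{b}^{(t)}}\iota_x^*Y\otimes(x\wedge\alpha)$, where $\iota_x^*$ is restriction along $\iota_x:\mathbf{b}^{(t)}\setminus\{x\}\hookrightarrow\mathbf{b}^{(t)}$. *)

theory Defs
  imports "HOL-Algebra.Module" "HOL-Algebra.AbelCoset" "HOL-Combinatorics.Permutations" "HOL-Library.Infinite_Typeclass"
begin

section \<open>Modules over a commutative ring\<close>

text \<open>The record type of modules extends that of rings; the multiplication and the unit play no
  role for a module.\<close>

definition mk_module ::
  "'m set \<Rightarrow> 'm \<Rightarrow> ('m \<Rightarrow> 'm \<Rightarrow> 'm) \<Rightarrow> ('k \<Rightarrow> 'm \<Rightarrow> 'm) \<Rightarrow> ('k, 'm) module" where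
  "mk_module C z p s =
     \<lparr>carrier = C, monoid.mult = undefined, one = undefined, zero = z, add = p, smult = s\<rparr>"

definition mod_hom ::
  "('k, 'r) ring_scheme \<Rightarrow> ('k, 'm) module \<Rightarrow> ('k, 'n) module \<Rightarrow> ('m \<Rightarrow> 'n) set" where
  "mod_hom K M N = {h \<in> carrier M \<rightarrow>\<^sub>E carrier N.
     (\<forall>x\<in>carrier M. \<forall>y\<in>carrier M. h (x \<oplus>\<^bsub>M\<^esub> y) = h x \<oplus>\<^bsub>N\<^esub> h y) \<and>
     (\<forall>c\<in>carrier K. \<forall>x\<in>carrier M. h (c \<odot>\<^bsub>M\<^esub> x) = c \<odot>\<^bsub>N\<^esub> h x)}"

definition mod_iso ::
  "('k, 'r) ring_scheme \<Rightarrow> ('k, 'm) module \<Rightarrow> ('k, 'n) module \<Rightarrow> ('m \<Rightarrow> 'n) set" where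
  "mod_iso K M N = {h \<in> mod_hom K M N. bij_betw h (carrier M) (carrier N)}"

definition self_module :: "('k, 'r) ring_scheme \<Rightarrow> ('k, 'k) module" where
  "self_module K = mk_module (carrier K) \<zero>\<^bsub>K\<^esub> (add K) (monoid.mult K)"

definition submod_span ::
  "('k, 'r) ring_scheme \<Rightarrow> ('k, 'm) module \<Rightarrow> 'm set \<Rightarrow> 'm set" where
  "submod_span K M A = \<Inter>{N. submodule N K M \<and> A \<subseteq> N}"

definition quot_module :: "('k, 'm) module \<Rightarrow> 'm set \<Rightarrow> ('k, 'm set) module" where
  "quot_module M N = mk_module (a_rcosets\<^bsub>M\<^esub> N) N (set_add M)
     (\<lambda>c C. \<Union>x\<in>C. N +>\<^bsub>M\<^esub> (c \<odot>\<^bsub>M\<^esub> x))"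

text \<open>Used for finite index sets only, where it is the direct sum.\<close>

definition dsum_module :: "'i set \<Rightarrow> ('i \<Rightarrow> ('k, 'm) module) \<Rightarrow> ('k, 'i \<Rightarrow> 'm) module" where
  "dsum_module I M = mk_module (\<Pi>\<^sub>E i\<in>I. carrier (M i)) (\<lambda>i\<in>I. \<zero>\<^bsub>M i\<^esub>)
     (\<lambda>u v. \<lambda>i\<in>I. u i \<oplus>\<^bsub>M i\<^esub> v i) (\<lambda>c v. \<lambda>i\<in>I. c \<odot>\<^bsub>M i\<^esub> v i)"


subsection \<open>Free modules\<close>

text \<open>\<open>k[S]\<close> consists of the finitely supported functions vanishing outside \<open>S\<close>; hence
  \<open>k[S]\<close> is literally contained in \<open>k[T]\<close> whenever \<open>S\<close> is contained in \<open>T\<close>.\<close>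

definition free_module :: "('k, 'r) ring_scheme \<Rightarrow> 's set \<Rightarrow> ('k, 's \<Rightarrow> 'k) module" where
  "free_module K S = mk_module
     {v. (\<forall>s. v s \<in> carrier K) \<and> (\<forall>s. s \<notin> S \<longrightarrow> v s = \<zero>\<^bsub>K\<^esub>) \<and> finite {s. v s \<noteq> \<zero>\<^bsub>K\<^esub>}}
     (\<lambda>s. \<zero>\<^bsub>K\<^esub>) (\<lambda>u v s. u s \<oplus>\<^bsub>K\<^esub> v s) (\<lambda>c v s. c \<otimes>\<^bsub>K\<^esub> v s)"

definition gen :: "('k, 'r) ring_scheme \<Rightarrow> 's \<Rightarrow> 's \<Rightarrow> 'k" where
  "gen K s = (\<lambda>t. if t = s then \<one>\<^bsub>K\<^esub> else \<zero>\<^bsub>K\<^esub>)"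

definition lin_ext ::
  "('k, 'r) ring_scheme \<Rightarrow> 's set \<Rightarrow> ('k, 'm) module \<Rightarrow> ('s \<Rightarrow> 'm) \<Rightarrow> ('s \<Rightarrow> 'k) \<Rightarrow> 'm" where
  "lin_ext K S N g = (\<lambda>v\<in>carrier (free_module K S).
     \<Oplus>\<^bsub>N\<^esub>s\<in>{s\<in>S. v s \<noteq> \<zero>\<^bsub>K\<^esub>}. v s \<odot>\<^bsub>N\<^esub> g s)"


subsection \<open>Modules given by generators and relations\<close>

definition pres_module ::
  "('k, 'r) ring_scheme \<Rightarrow> 's set \<Rightarrow> ('s \<Rightarrow> 'k) set \<Rightarrow> ('k, ('s \<Rightarrow> 'k) set) module" where
  "pres_module K S W = quot_module (free_module K S) (submod_span K (free_module K S) W)"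

definition pres_gen ::
  "('k, 'r) ring_scheme \<Rightarrow> 's set \<Rightarrow> ('s \<Rightarrow> 'k) set \<Rightarrow> 's \<Rightarrow> ('s \<Rightarrow> 'k) set" where
  "pres_gen K S W s = submod_span K (free_module K S) W +>\<^bsub>free_module K S\<^esub> gen K s"

text \<open>The linear map with prescribed values \<open>g s\<close> on the generators. It is meaningful only if the
  linear extension of \<open>g\<close> kills \<open>W\<close>, that is, is constant on cosets.\<close>

definition pres_lift ::
  "('k, 'r) ring_scheme \<Rightarrow> 's set \<Rightarrow> ('s \<Rightarrow> 'k) set \<Rightarrow> ('k, 'm) module \<Rightarrow> ('s \<Rightarrow> 'm) \<Rightarrow>
     ('s \<Rightarrow> 'k) set \<Rightarrow> 'm" where
  "pres_lift K S W N g = (\<lambda>C\<in>carrier (pres_module K S W). the_elem (lin_ext K S N g ` C))"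


subsection \<open>Tensor products\<close>

definition tensor2_rels ::
  "('k, 'r) ring_scheme \<Rightarrow> ('k, 'm) module \<Rightarrow> ('k, 'n) module \<Rightarrow> ('m \<times> 'n \<Rightarrow> 'k) set" where
  "tensor2_rels K M N = (let F = free_module K (carrier M \<times> carrier N) in
     {gen K (x \<oplus>\<^bsub>M\<^esub> x', y) \<ominus>\<^bsub>F\<^esub> (gen K (x, y) \<oplus>\<^bsub>F\<^esub> gen K (x', y)) | x x' y.
        x \<in> carrier M \<and> x' \<in> carrier M \<and> y \<in> carrier N} \<union>
     {gen K (x, y \<oplus>\<^bsub>N\<^esub> y') \<ominus>\<^bsub>F\<^esub> (gen K (x, y) \<oplus>\<^bsub>F\<^esub> gen K (x, y')) | x y y'.
        x \<in> carrier M \<and> y \<in> carrier N \<and> y' \<in> carrier N} \<union>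
     {gen K (c \<odot>\<^bsub>M\<^esub> x, y) \<ominus>\<^bsub>F\<^esub> c \<odot>\<^bsub>F\<^esub> gen K (x, y) | c x y.
        c \<in> carrier K \<and> x \<in> carrier M \<and> y \<in> carrier N} \<union>
     {gen K (x, c \<odot>\<^bsub>N\<^esub> y) \<ominus>\<^bsub>F\<^esub> c \<odot>\<^bsub>F\<^esub> gen K (x, y) | c x y.
        c \<in> carrier K \<and> x \<in> carrier M \<and> y \<in> carrier N})"

definition tensor2 ::
  "('k, 'r) ring_scheme \<Rightarrow> ('k, 'm) module \<Rightarrow> ('k, 'n) module \<Rightarrow>
     ('k, ('m \<times> 'n \<Rightarrow> 'k) set) module" where
  "tensor2 K M N = pres_module K (carrier M \<times> carrier N) (tensor2_rels K M N)"

definition tensor2_elt ::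
  "('k, 'r) ring_scheme \<Rightarrow> ('k, 'm) module \<Rightarrow> ('k, 'n) module \<Rightarrow> 'm \<Rightarrow> 'n \<Rightarrow>
     ('m \<times> 'n \<Rightarrow> 'k) set" where
  "tensor2_elt K M N x y = pres_gen K (carrier M \<times> carrier N) (tensor2_rels K M N) (x, y)"

definition tensor2_map ::
  "('k, 'r) ring_scheme \<Rightarrow> ('k, 'm) module \<Rightarrow> ('k, 'n) module \<Rightarrow>
     ('k, 'm1) module \<Rightarrow> ('k, 'n1) module \<Rightarrow> ('m \<Rightarrow> 'm1) \<Rightarrow> ('n \<Rightarrow> 'n1) \<Rightarrow>
     ('m \<times> 'n \<Rightarrow> 'k) set \<Rightarrow> ('m1 \<times> 'n1 \<Rightarrow> 'k) set" where
  "tensor2_map K M N M' N' f g =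
     pres_lift K (carrier M \<times> carrier N) (tensor2_rels K M N) (tensor2 K M' N')
       (\<lambda>(x, y). tensor2_elt K M' N' (f x) (g y))"

text \<open>The tensor product of a finite family of modules. Families with varying numbers of factors
  have the same carrier type, which iterated binary tensor products would not.\<close>

definition multilin_rels ::
  "('k, 'r) ring_scheme \<Rightarrow> 'i set \<Rightarrow> ('i \<Rightarrow> ('k, 'm) module) \<Rightarrow> (('i \<Rightarrow> 'm) \<Rightarrow> 'k) set" where
  "multilin_rels K I M = (let S = (\<Pi>\<^sub>E i\<in>I. carrier (M i)); F = free_module K S in
     {gen K (t(i := x \<oplus>\<^bsub>M i\<^esub> y)) \<ominus>\<^bsub>F\<^esub> (gen K (t(i := x)) \<oplus>\<^bsub>F\<^esub> gen K (t(i := y))) | t i x y.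
        t \<in> S \<and> i \<in> I \<and> x \<in> carrier (M i) \<and> y \<in> carrier (M i)} \<union>
     {gen K (t(i := c \<odot>\<^bsub>M i\<^esub> x)) \<ominus>\<^bsub>F\<^esub> c \<odot>\<^bsub>F\<^esub> gen K (t(i := x)) | t i c x.
        t \<in> S \<and> i \<in> I \<and> c \<in> carrier K \<and> x \<in> carrier (M i)})"

definition tensor ::
  "('k, 'r) ring_scheme \<Rightarrow> 'i set \<Rightarrow> ('i \<Rightarrow> ('k, 'm) module) \<Rightarrow>
     ('k, (('i \<Rightarrow> 'm) \<Rightarrow> 'k) set) module" where
  "tensor K I M = pres_module K (\<Pi>\<^sub>E i\<in>I. carrier (M i)) (multilin_rels K I M)"

definition tensor_elt ::
  "('k, 'r) ring_scheme \<Rightarrow> 'i set \<Rightarrow> ('i \<Rightarrow> ('k, 'm) module) \<Rightarrow> ('i \<Rightarrow> 'm) \<Rightarrow>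
     (('i \<Rightarrow> 'm) \<Rightarrow> 'k) set" where
  "tensor_elt K I M t = pres_gen K (\<Pi>\<^sub>E i\<in>I. carrier (M i)) (multilin_rels K I M) t"

definition tensor_lift ::
  "('k, 'r) ring_scheme \<Rightarrow> 'i set \<Rightarrow> ('i \<Rightarrow> ('k, 'm) module) \<Rightarrow> ('k, 'n) module \<Rightarrow>
     (('i \<Rightarrow> 'm) \<Rightarrow> 'n) \<Rightarrow> (('i \<Rightarrow> 'm) \<Rightarrow> 'k) set \<Rightarrow> 'n" where
  "tensor_lift K I M N g = pres_lift K (\<Pi>\<^sub>E i\<in>I. carrier (M i)) (multilin_rels K I M) N g"


subsection \<open>Exterior powers and orientation modules\<close>

definition ext_rels ::
  "('k, 'r) ring_scheme \<Rightarrow> nat \<Rightarrow> ('k, 'm) module \<Rightarrow> ((nat \<Rightarrow> 'm) \<Rightarrow> 'k) set" where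
  "ext_rels K n M = multilin_rels K {..<n} (\<lambda>_. M) \<union>
     {gen K t | t i j. t \<in> {..<n} \<rightarrow>\<^sub>E carrier M \<and> i < n \<and> j < n \<and> i \<noteq> j \<and> t i = t j}"

definition ext_power ::
  "('k, 'r) ring_scheme \<Rightarrow> nat \<Rightarrow> ('k, 'm) module \<Rightarrow> ('k, ((nat \<Rightarrow> 'm) \<Rightarrow> 'k) set) module" where
  "ext_power K n M = pres_module K ({..<n} \<rightarrow>\<^sub>E carrier M) (ext_rels K n M)"

definition ext_elt ::
  "('k, 'r) ring_scheme \<Rightarrow> nat \<Rightarrow> ('k, 'm) module \<Rightarrow> (nat \<Rightarrow> 'm) \<Rightarrow> ((nat \<Rightarrow> 'm) \<Rightarrow> 'k) set" where
  "ext_elt K n M t = pres_gen K ({..<n} \<rightarrow>\<^sub>E carrier M) (ext_rels K n M) t"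

definition orient ::
  "('k, 'r) ring_scheme \<Rightarrow> 's set \<Rightarrow> ('k, ((nat \<Rightarrow> 's \<Rightarrow> 'k) \<Rightarrow> 'k) set) module" where
  "orient K S = ext_power K (card S) (free_module K S)"

text \<open>For \<open>x\<close> not in \<open>S\<close>, the map \<open>\<alpha> \<mapsto> x \<and> \<alpha>\<close> from the orientation module of \<open>S\<close> to that of
  \<open>insert x S\<close>.\<close>

definition orient_wedge ::
  "('k, 'r) ring_scheme \<Rightarrow> 's set \<Rightarrow> 's \<Rightarrow>
     ((nat \<Rightarrow> 's \<Rightarrow> 'k) \<Rightarrow> 'k) set \<Rightarrow> ((nat \<Rightarrow> 's \<Rightarrow> 'k) \<Rightarrow> 'k) set" where
  "orient_wedge K S x =
     pres_lift K ({..<card S} \<rightarrow>\<^sub>E carrier (free_module K S)) (ext_rels K (card S) (free_module K S))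
       (orient K (insert x S))
       (\<lambda>t. ext_elt K (Suc (card S)) (free_module K (insert x S)) (case_nat (gen K x) t))"


section \<open>Functors on finite non-empty sets\<close>

text \<open>The finite non-empty subsets of an infinite type \<open>'x\<close>, with all maps between them, form a
  category equivalent to that of all finite non-empty sets. Maps from \<open>X\<close> to \<open>Y\<close> are the elements
  of \<open>X \<rightarrow>\<^sub>E Y\<close>.\<close>

definition fin_sets :: "'x set set" where
  "fin_sets = {X. finite X \<and> X \<noteq> {}}"

record ('x, 'k, 'm) fin_functor =
  Obj :: "'x set \<Rightarrow> ('k, 'm) module"
  Mor :: "'x set \<Rightarrow> 'x set \<Rightarrow> ('x \<Rightarrow> 'x) \<Rightarrow> 'm \<Rightarrow> 'm"

definition is_fin_functor :: "('k, 'r) ring_scheme \<Rightarrow> ('x, 'k, 'm) fin_functor \<Rightarrow> bool" where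
  "is_fin_functor K F \<longleftrightarrow>
     (\<forall>X\<in>fin_sets. Module.module K (Obj F X)) \<and>
     (\<forall>X\<in>fin_sets. \<forall>Y\<in>fin_sets. \<forall>f\<in>X \<rightarrow>\<^sub>E Y. Mor F X Y f \<in> mod_hom K (Obj F X) (Obj F Y)) \<and>
     (\<forall>X\<in>fin_sets. \<forall>v\<in>carrier (Obj F X). Mor F X X (\<lambda>x\<in>X. x) v = v) \<and>
     (\<forall>X\<in>fin_sets. \<forall>Y\<in>fin_sets. \<forall>Z\<in>fin_sets. \<forall>f\<in>X \<rightarrow>\<^sub>E Y. \<forall>g\<in>Y \<rightarrow>\<^sub>E Z. \<forall>v\<in>carrier (Obj F X).
        Mor F X Z (compose X g f) v = Mor F Y Z g (Mor F X Y f v))"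

definition nat_trans ::
  "('k, 'r) ring_scheme \<Rightarrow> ('x, 'k, 'm) fin_functor \<Rightarrow> ('x, 'k, 'n) fin_functor \<Rightarrow>
     ('x set \<Rightarrow> 'm \<Rightarrow> 'n) set" where
  "nat_trans K F G = {\<eta> \<in> (\<Pi>\<^sub>E X\<in>fin_sets. mod_hom K (Obj F X) (Obj G X)).
     \<forall>X\<in>fin_sets. \<forall>Y\<in>fin_sets. \<forall>f\<in>X \<rightarrow>\<^sub>E Y. \<forall>v\<in>carrier (Obj F X).
       \<eta> Y (Mor F X Y f v) = Mor G X Y f (\<eta> X v)}"

definition Hom_functors ::
  "('k, 'r) ring_scheme \<Rightarrow> ('x, 'k, 'm) fin_functor \<Rightarrow> ('x, 'k, 'n) fin_functor \<Rightarrow>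
     ('k, 'x set \<Rightarrow> 'm \<Rightarrow> 'n) module" where
  "Hom_functors K F G = mk_module (nat_trans K F G)
     (\<lambda>X\<in>fin_sets. \<lambda>v\<in>carrier (Obj F X). \<zero>\<^bsub>Obj G X\<^esub>)
     (\<lambda>\<eta> \<theta>. \<lambda>X\<in>fin_sets. \<lambda>v\<in>carrier (Obj F X). \<eta> X v \<oplus>\<^bsub>Obj G X\<^esub> \<theta> X v)
     (\<lambda>c \<eta>. \<lambda>X\<in>fin_sets. \<lambda>v\<in>carrier (Obj F X). c \<odot>\<^bsub>Obj G X\<^esub> \<eta> X v)"

definition tensor_functor ::
  "('k, 'r) ring_scheme \<Rightarrow> 'i set \<Rightarrow> ('i \<Rightarrow> ('x, 'k, 'm) fin_functor) \<Rightarrow>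
     ('x, 'k, (('i \<Rightarrow> 'm) \<Rightarrow> 'k) set) fin_functor" where
  "tensor_functor K I F = \<lparr>
     Obj = (\<lambda>X. tensor K I (\<lambda>i. Obj (F i) X)),
     Mor = (\<lambda>X Y f. tensor_lift K I (\<lambda>i. Obj (F i) X) (tensor K I (\<lambda>i. Obj (F i) Y))
       (\<lambda>t. tensor_elt K I (\<lambda>i. Obj (F i) Y) (\<lambda>i\<in>I. Mor (F i) X Y f (t i))))\<rparr>"

definition augmentation :: "('k, 'r) ring_scheme \<Rightarrow> 'x set \<Rightarrow> ('x \<Rightarrow> 'k) \<Rightarrow> 'k" where
  "augmentation K X = lin_ext K X (self_module K) (\<lambda>x. \<one>\<^bsub>K\<^esub>)"

definition aug_kernel :: "('k, 'r) ring_scheme \<Rightarrow> 'x set \<Rightarrow> ('k, 'x \<Rightarrow> 'k) module" where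
  "aug_kernel K X = (free_module K X)
     \<lparr>carrier := a_kernel (free_module K X) (self_module K) (augmentation K X)\<rparr>"

definition kbar :: "('k, 'r) ring_scheme \<Rightarrow> ('x, 'k, 'x \<Rightarrow> 'k) fin_functor" where
  "kbar K = \<lparr>
     Obj = aug_kernel K,
     Mor = (\<lambda>X Y f. restrict (lin_ext K X (free_module K Y) (\<lambda>x. gen K (f x)))
       (carrier (aug_kernel K X)))\<rparr>"

definition kbar_power ::
  "('k, 'r) ring_scheme \<Rightarrow> nat \<Rightarrow> ('x, 'k, ((nat \<Rightarrow> 'x \<Rightarrow> 'k) \<Rightarrow> 'k) set) fin_functor" where
  "kbar_power K n = tensor_functor K {1..n} (\<lambda>_. kbar K)"

text \<open>Permutations of \<open>{1..n}\<close> act on the right of the \<open>n\<close>-th tensor power by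
  \<open>t\<^sub>1 \<otimes> \<dots> \<otimes> t\<^sub>n \<mapsto> t\<^bsub>\<sigma> 1\<^esub> \<otimes> \<dots> \<otimes> t\<^bsub>\<sigma> n\<^esub>\<close>. Precomposition then yields a left action of the
  permutations of \<open>{1..a}\<close> on homomorphisms, postcomposition a right action of those of \<open>{1..b}\<close>.\<close>

definition place_perm ::
  "('k, 'r) ring_scheme \<Rightarrow> nat \<Rightarrow> (nat \<Rightarrow> nat) \<Rightarrow> 'x set \<Rightarrow>
     ((nat \<Rightarrow> 'x \<Rightarrow> 'k) \<Rightarrow> 'k) set \<Rightarrow> ((nat \<Rightarrow> 'x \<Rightarrow> 'k) \<Rightarrow> 'k) set" where
  "place_perm K n \<sigma> X = tensor_lift K {1..n} (\<lambda>_. aug_kernel K X) (Obj (kbar_power K n) X)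
     (\<lambda>t. tensor_elt K {1..n} (\<lambda>_. aug_kernel K X) (\<lambda>i\<in>{1..n}. t (\<sigma> i)))"

definition Hom_act ::
  "('k, 'r) ring_scheme \<Rightarrow> nat \<Rightarrow> nat \<Rightarrow> (nat \<Rightarrow> nat) \<Rightarrow> (nat \<Rightarrow> nat) \<Rightarrow>
     ('x set \<Rightarrow> ((nat \<Rightarrow> 'x \<Rightarrow> 'k) \<Rightarrow> 'k) set \<Rightarrow> ((nat \<Rightarrow> 'x \<Rightarrow> 'k) \<Rightarrow> 'k) set) \<Rightarrow>
     'x set \<Rightarrow> ((nat \<Rightarrow> 'x \<Rightarrow> 'k) \<Rightarrow> 'k) set \<Rightarrow> ((nat \<Rightarrow> 'x \<Rightarrow> 'k) \<Rightarrow> 'k) set" where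
  "Hom_act K a b \<sigma> \<tau> \<eta> = (\<lambda>X\<in>fin_sets. \<lambda>v\<in>carrier (Obj (kbar_power K a) X).
     place_perm K b \<tau> X (\<eta> X (place_perm K a \<sigma> X v)))"


section \<open>Surjections and restriction\<close>

definition surjs :: "'s set \<Rightarrow> nat \<Rightarrow> ('s \<Rightarrow> nat) set" where
  "surjs S a = {f \<in> S \<rightarrow>\<^sub>E {1..a}. f ` S = {1..a}}"

definition kOmega :: "('k, 'r) ring_scheme \<Rightarrow> 's set \<Rightarrow> nat \<Rightarrow> ('k, ('s \<Rightarrow> nat) \<Rightarrow> 'k) module" where
  "kOmega K S a = free_module K (surjs S a)"

text \<open>Restriction along the inclusion of a subset \<open>S'\<close> of \<open>S\<close>.\<close>

definition kOmega_restrict ::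
  "('k, 'r) ring_scheme \<Rightarrow> nat \<Rightarrow> 's set \<Rightarrow> 's set \<Rightarrow> (('s \<Rightarrow> nat) \<Rightarrow> 'k) \<Rightarrow> ('s \<Rightarrow> nat) \<Rightarrow> 'k" where
  "kOmega_restrict K a S S' = lin_ext K (surjs S a) (kOmega K S' a)
     (\<lambda>f. if restrict f S' \<in> surjs S' a then gen K (restrict f S') else \<zero>\<^bsub>kOmega K S' a\<^esub>)"

definition kOmega_act ::
  "('k, 'r) ring_scheme \<Rightarrow> nat \<Rightarrow> nat \<Rightarrow> (nat \<Rightarrow> nat) \<Rightarrow> (nat \<Rightarrow> nat) \<Rightarrow>
     ((nat \<Rightarrow> nat) \<Rightarrow> 'k) \<Rightarrow> (nat \<Rightarrow> nat) \<Rightarrow> 'k" where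
  "kOmega_act K a b \<sigma> \<tau> = lin_ext K (surjs {1..b} a) (kOmega K {1..b} a)
     (\<lambda>f. gen K (\<lambda>i\<in>{1..b}. \<sigma> (f (\<tau> i))))"

text \<open>The subsets of \<open>{1..b}\<close> of cardinality \<open>b - t\<close> (there are none if \<open>t > b\<close>).\<close>

definition cosubsets :: "nat \<Rightarrow> nat \<Rightarrow> nat set set" where
  "cosubsets b t = {B. B \<subseteq> {1..b} \<and> card B + t = b}"

definition R_target ::
  "('k, 'r) ring_scheme \<Rightarrow> nat \<Rightarrow> nat \<Rightarrow> ('k, nat set \<Rightarrow> (nat \<Rightarrow> nat) \<Rightarrow> 'k) module" where
  "R_target K b a = dsum_module (cosubsets b 1) (\<lambda>B. kOmega K B a)"

definition R_map ::
  "('k, 'r) ring_scheme \<Rightarrow> nat \<Rightarrow> nat \<Rightarrow>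
     ((nat \<Rightarrow> nat) \<Rightarrow> 'k) \<Rightarrow> nat set \<Rightarrow> (nat \<Rightarrow> nat) \<Rightarrow> 'k" where
  "R_map K b a = (\<lambda>v\<in>carrier (kOmega K {1..b} a).
     \<lambda>B\<in>cosubsets b 1. kOmega_restrict K a {1..b} B v)"

definition ker_R ::
  "('k, 'r) ring_scheme \<Rightarrow> nat \<Rightarrow> nat \<Rightarrow> ('k, (nat \<Rightarrow> nat) \<Rightarrow> 'k) module" where
  "ker_R K b a = (kOmega K {1..b} a)
     \<lparr>carrier := a_kernel (kOmega K {1..b} a) (R_target K b a) (R_map K b a)\<rparr>"


section \<open>The Koszul complex\<close>

record ('k, 'm) cochain_complex =
  Ch :: "nat \<Rightarrow> ('k, 'm) module"
  Diff :: "nat \<Rightarrow> 'm \<Rightarrow> 'm"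

definition coboundaries :: "('k, 'm) cochain_complex \<Rightarrow> nat \<Rightarrow> 'm set" where
  "coboundaries C t = (case t of 0 \<Rightarrow> {\<zero>\<^bsub>Ch C 0\<^esub>} | Suc s \<Rightarrow> Diff C s ` carrier (Ch C s))"

definition cohomology :: "('k, 'm) cochain_complex \<Rightarrow> nat \<Rightarrow> ('k, 'm set) module" where
  "cohomology C t = quot_module
     ((Ch C t)\<lparr>carrier := a_kernel (Ch C t) (Ch C (Suc t)) (Diff C t)\<rparr>) (coboundaries C t)"

type_synonym 'k kz_carrier =
  "((((nat \<Rightarrow> nat) \<Rightarrow> 'k) \<times> ((nat \<Rightarrow> nat \<Rightarrow> 'k) \<Rightarrow> 'k) set) \<Rightarrow> 'k) set"

definition Kz_summand ::
  "('k, 'r) ring_scheme \<Rightarrow> nat \<Rightarrow> nat \<Rightarrow> nat set \<Rightarrow> ('k, 'k kz_carrier) module" where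
  "Kz_summand K a b B = tensor2 K (kOmega K B a) (orient K ({1..b} - B))"

text \<open>The component of the differential indexed by \<open>x \<in> B\<close>:
  \<open>Y \<otimes> \<alpha> \<mapsto> \<iota>\<^sub>x\<^sup>* Y \<otimes> (x \<and> \<alpha>)\<close>, from the summand of \<open>B\<close> to that of \<open>B - {x}\<close>.\<close>

definition Kz_component ::
  "('k, 'r) ring_scheme \<Rightarrow> nat \<Rightarrow> nat \<Rightarrow> nat set \<Rightarrow> nat \<Rightarrow> 'k kz_carrier \<Rightarrow> 'k kz_carrier" where
  "Kz_component K a b B x =
     tensor2_map K (kOmega K B a) (orient K ({1..b} - B))
       (kOmega K (B - {x}) a) (orient K ({1..b} - (B - {x})))
       (kOmega_restrict K a B (B - {x})) (orient_wedge K ({1..b} - B) x)"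

text \<open>The \<open>B'\<close>-component of the differential collects the contributions of the summands of
  \<open>B = insert x B'\<close> for \<open>x\<close> in the complement of \<open>B'\<close>.\<close>

definition Kz :: "('k, 'r) ring_scheme \<Rightarrow> nat \<Rightarrow> nat \<Rightarrow> ('k, nat set \<Rightarrow> 'k kz_carrier) cochain_complex" where
  "Kz K a b = \<lparr>
     Ch = (\<lambda>t. dsum_module (cosubsets b t) (Kz_summand K a b)),
     Diff = (\<lambda>t. \<lambda>y\<in>carrier (dsum_module (cosubsets b t) (Kz_summand K a b)).
       \<lambda>B'\<in>cosubsets b (Suc t). \<Oplus>\<^bsub>Kz_summand K a b B'\<^esub>x\<in>{1..b} - B'.
         Kz_component K a b (insert x B') x (y (insert x B')))\<rparr>"

section \<open>The tensor powers are functors\<close>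

text \<open>The facts below show that the constructions above are well defined (quotients are modules,
  linear maps on presented modules and tensor products exist with the expected values on generators)
  and that \<open>kbar_power K n\<close> is an object of the functor category.\<close>

lemma mk_module_simps [simp]:
  "carrier (mk_module C z p s) = C" "zero (mk_module C z p s) = z"
  "add (mk_module C z p s) = p" "smult (mk_module C z p s) = s"
  by (simp_all add: mk_module_def)

lemma free_carrier: "v \<in> carrier (free_module K S) \<longleftrightarrow>
   (\<forall>s. v s \<in> carrier K) \<and> (\<forall>s. s \<notin> S \<longrightarrow> v s = \<zero>\<^bsub>K\<^esub>) \<and> finite {s. v s \<noteq> \<zero>\<^bsub>K\<^esub>}"
  by (simp add: free_module_def)

lemma free_ops [simp]:
  "\<zero>\<^bsub>free_module K S\<^esub> = (\<lambda>s. \<zero>\<^bsub>K\<^esub>)"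
  "u \<oplus>\<^bsub>free_module K S\<^esub> v = (\<lambda>s. u s \<oplus>\<^bsub>K\<^esub> v s)"
  "c \<odot>\<^bsub>free_module K S\<^esub> v = (\<lambda>s. c \<otimes>\<^bsub>K\<^esub> v s)"
  by (simp_all add: free_module_def)

lemma mk_abelian_group:
  fixes M (structure)
  assumes "\<And>x y. x \<in> carrier M \<Longrightarrow> y \<in> carrier M \<Longrightarrow> x \<oplus> y \<in> carrier M"
    "\<zero> \<in> carrier M"
    "\<And>x y z. x \<in> carrier M \<Longrightarrow> y \<in> carrier M \<Longrightarrow> z \<in> carrier M \<Longrightarrow> (x \<oplus> y) \<oplus> z = x \<oplus> (y \<oplus> z)"
    "\<And>x y. x \<in> carrier M \<Longrightarrow> y \<in> carrier M \<Longrightarrow> x \<oplus> y = y \<oplus> x"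
    "\<And>x. x \<in> carrier M \<Longrightarrow> \<zero> \<oplus> x = x"
    "\<And>x. x \<in> carrier M \<Longrightarrow> \<exists>y\<in>carrier M. y \<oplus> x = \<zero>"
  shows "abelian_group M"
  by (rule abelian_groupI) (use assms in auto)

lemma free_is_module:
  assumes "cring K" shows "Module.module K (free_module K S)"
proof -
  interpret K: cring K by fact
  have fin: "finite {s. u s \<oplus>\<^bsub>K\<^esub> v s \<noteq> \<zero>\<^bsub>K\<^esub>}"
    if "finite {s. u s \<noteq> \<zero>\<^bsub>K\<^esub>}" "finite {s. v s \<noteq> \<zero>\<^bsub>K\<^esub>}" for u v
    by (rule finite_subset[OF _ finite_UnI[OF that]]) auto
  have fin2: "finite {s. c \<otimes>\<^bsub>K\<^esub> v s \<noteq> \<zero>\<^bsub>K\<^esub>}"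
    if "finite {s. v s \<noteq> \<zero>\<^bsub>K\<^esub>}" "c \<in> carrier K" for c v
    by (rule finite_subset[OF _ that(1)]) (use that in auto)
  show ?thesis
  proof (rule moduleI[OF assms])
    show "abelian_group (free_module K S)"
    proof (rule mk_abelian_group, goal_cases)
      case (6 x)
      show ?case
        by (rule bexI[of _ "\<lambda>s. \<ominus>\<^bsub>K\<^esub> x s"])
           (use 6 fin2[of x "\<ominus>\<^bsub>K\<^esub> \<one>\<^bsub>K\<^esub>"] in \<open>auto simp: free_carrier K.l_neg K.l_minus\<close>)
    qed (auto simp: free_carrier fin K.a_ac)
  qed (auto simp: free_carrier fin2 K.l_distr K.r_distr K.m_assoc)
qed

lemma gen_carrier: "cring K \<Longrightarrow> s \<in> S \<Longrightarrow> gen K s \<in> carrier (free_module K S)"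
proof -
  assume "cring K" "s \<in> S"
  interpret K: cring K by fact
  show ?thesis using \<open>s\<in>S\<close> finite_subset[of "{t. gen K s t \<noteq> \<zero>\<^bsub>K\<^esub>}" "{s}"]
    by (auto simp: free_carrier gen_def split: if_splits)
qed

lemma lin_ext_sum:
  assumes "Module.module K N" "v \<in> carrier (free_module K S)" "g \<in> S \<rightarrow> carrier N"
    "finite A" "A \<subseteq> S" "{s. v s \<noteq> \<zero>\<^bsub>K\<^esub>} \<subseteq> A"
  shows "lin_ext K S N g v = (\<Oplus>\<^bsub>N\<^esub>s\<in>A. v s \<odot>\<^bsub>N\<^esub> g s)"
proof -
  interpret N: Module.module K N by fact
  have "\<And>s. v s \<in> carrier K" using assms by (auto simp: free_carrier)
  show ?thesis unfolding lin_ext_def using assms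
    by (auto simp: Pi_def subset_iff intro!: N.add.finprod_mono_neutral_cong_left simp: free_carrier)
qed

lemma lin_ext_hom:
  assumes "Module.module K N" "g \<in> S \<rightarrow> carrier N"
  shows "lin_ext K S N g \<in> mod_hom K (free_module K S) N"
proof -
  interpret N: Module.module K N by fact
  interpret F: Module.module K "free_module K S" by (rule free_is_module) unfold_locales
  have clos: "lin_ext K S N g v \<in> carrier N" if "v \<in> carrier (free_module K S)" for v
    using that assms unfolding lin_ext_def
    by (auto intro!: N.M.finsum_closed simp: free_carrier Pi_def)
  have add: "lin_ext K S N g (u \<oplus>\<^bsub>free_module K S\<^esub> v) = lin_ext K S N g u \<oplus>\<^bsub>N\<^esub> lin_ext K S N g v"
    if u: "u \<in> carrier (free_module K S)" and v: "v \<in> carrier (free_module K S)" for u v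
  proof -
    let ?A = "{s. u s \<noteq> \<zero>\<^bsub>K\<^esub>} \<union> {s. v s \<noteq> \<zero>\<^bsub>K\<^esub>}"
    have A: "finite ?A" "?A \<subseteq> S" using u v by (auto simp: free_carrier)
    have uK: "\<And>s. u s \<in> carrier K" "\<And>s. v s \<in> carrier K" using u v by (auto simp: free_carrier)
    have g: "\<And>s. s \<in> ?A \<Longrightarrow> g s \<in> carrier N" using A assms by auto
    have "lin_ext K S N g (u \<oplus>\<^bsub>free_module K S\<^esub> v) = (\<Oplus>\<^bsub>N\<^esub>s\<in>?A. (u s \<oplus>\<^bsub>K\<^esub> v s) \<odot>\<^bsub>N\<^esub> g s)"
      by (subst lin_ext_sum[OF assms(1) F.M.a_closed[OF u v] assms(2) A]) auto
    also have "\<dots> = (\<Oplus>\<^bsub>N\<^esub>s\<in>?A. u s \<odot>\<^bsub>N\<^esub> g s \<oplus>\<^bsub>N\<^esub> v s \<odot>\<^bsub>N\<^esub> g s)"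
      by (rule N.M.finsum_cong') (use g uK in \<open>auto simp: N.smult_l_distr\<close>)
    also have "\<dots> = (\<Oplus>\<^bsub>N\<^esub>s\<in>?A. u s \<odot>\<^bsub>N\<^esub> g s) \<oplus>\<^bsub>N\<^esub> (\<Oplus>\<^bsub>N\<^esub>s\<in>?A. v s \<odot>\<^bsub>N\<^esub> g s)"
      by (rule N.M.finsum_addf) (use g uK in auto)
    finally show ?thesis
      using lin_ext_sum[OF assms(1) u assms(2) A] lin_ext_sum[OF assms(1) v assms(2) A] by auto
  qed
  have sm: "lin_ext K S N g (c \<odot>\<^bsub>free_module K S\<^esub> v) = c \<odot>\<^bsub>N\<^esub> lin_ext K S N g v"
    if c: "c \<in> carrier K" and v: "v \<in> carrier (free_module K S)" for c v
  proof -
    let ?A = "{s. v s \<noteq> \<zero>\<^bsub>K\<^esub>}"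
    have A: "finite ?A" "?A \<subseteq> S" using v by (auto simp: free_carrier)
    have uK: "\<And>s. v s \<in> carrier K" using v by (auto simp: free_carrier)
    have g: "\<And>s. s \<in> ?A \<Longrightarrow> g s \<in> carrier N" using A assms by auto
    have "lin_ext K S N g (c \<odot>\<^bsub>free_module K S\<^esub> v) = (\<Oplus>\<^bsub>N\<^esub>s\<in>?A. (c \<otimes>\<^bsub>K\<^esub> v s) \<odot>\<^bsub>N\<^esub> g s)"
      by (subst lin_ext_sum[OF assms(1) F.smult_closed[OF c v] assms(2) A]) (use c in auto)
    also have "\<dots> = (\<Oplus>\<^bsub>N\<^esub>s\<in>?A. c \<odot>\<^bsub>N\<^esub> (v s \<odot>\<^bsub>N\<^esub> g s))"
      by (rule N.M.finsum_cong') (use g uK c in \<open>auto simp: N.smult_assoc1\<close>)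
    also have "\<dots> = c \<odot>\<^bsub>N\<^esub> (\<Oplus>\<^bsub>N\<^esub>s\<in>?A. v s \<odot>\<^bsub>N\<^esub> g s)"
      by (rule N.finsum_smult_ldistr[symmetric]) (use g uK A c in auto)
    finally show ?thesis using lin_ext_sum[OF assms(1) v assms(2) A] by auto
  qed
  show ?thesis
    using clos add sm by (auto simp: mod_hom_def lin_ext_def)
qed

lemma lin_ext_gen:
  assumes "Module.module K N" "g \<in> S \<rightarrow> carrier N" "s \<in> S"
  shows "lin_ext K S N g (gen K s) = g s"
proof -
  interpret N: Module.module K N by fact
  have gs: "g s \<in> carrier N" using assms by auto
  have "lin_ext K S N g (gen K s) = (\<Oplus>\<^bsub>N\<^esub>t\<in>{s}. gen K s t \<odot>\<^bsub>N\<^esub> g t)"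
    by (rule lin_ext_sum[OF assms(1) gen_carrier assms(2)])
       (use assms in \<open>auto simp: gen_def N.R.cring_axioms intro: N.R.is_cring\<close>)
  also have "\<dots> = g s" using gs by (simp add: gen_def)
  finally show ?thesis .
qed

lemma mod_hom_zero:
  assumes "Module.module K M" "Module.module K N" "h \<in> mod_hom K M N"
  shows "h \<zero>\<^bsub>M\<^esub> = \<zero>\<^bsub>N\<^esub>"
proof -
  interpret M: Module.module K M by fact
  interpret N: Module.module K N by fact
  have "h (\<zero>\<^bsub>K\<^esub> \<odot>\<^bsub>M\<^esub> \<zero>\<^bsub>M\<^esub>) = \<zero>\<^bsub>K\<^esub> \<odot>\<^bsub>N\<^esub> h \<zero>\<^bsub>M\<^esub>" "h \<zero>\<^bsub>M\<^esub> \<in> carrier N"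
    using assms(3) unfolding mod_hom_def by (blast, auto)
  thus ?thesis by simp
qed

lemma mod_hom_minus:
  assumes "Module.module K M" "Module.module K N" "h \<in> mod_hom K M N" "x \<in> carrier M" "y \<in> carrier M"
  shows "h (x \<ominus>\<^bsub>M\<^esub> y) = h x \<ominus>\<^bsub>N\<^esub> h y"
proof -
  interpret M: Module.module K M by fact
  interpret N: Module.module K N by fact
  have h: "h x \<in> carrier N" "h y \<in> carrier N" "h (x \<ominus>\<^bsub>M\<^esub> y) \<in> carrier N"
    using assms unfolding mod_hom_def by auto
  have "h ((x \<ominus>\<^bsub>M\<^esub> y) \<oplus>\<^bsub>M\<^esub> y) = h (x \<ominus>\<^bsub>M\<^esub> y) \<oplus>\<^bsub>N\<^esub> h y"
    using assms unfolding mod_hom_def by auto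
  moreover have "(x \<ominus>\<^bsub>M\<^esub> y) \<oplus>\<^bsub>M\<^esub> y = x" using assms
    by (simp add: a_minus_def M.M.a_assoc M.M.l_neg)
  ultimately show ?thesis using h
    by (metis N.M.add.inv_closed N.M.add.inv_solve_right' N.M.minus_eq)
qed

lemma span_submodule:
  assumes "Module.module K M" "A \<subseteq> carrier M"
  shows "submodule (submod_span K M A) K M" "A \<subseteq> submod_span K M A"
proof -
  interpret M: Module.module K M by fact
  have c: "carrier M \<in> {N. submodule N K M \<and> A \<subseteq> N}" using assms M.carrier_is_submodule by auto
  show "submodule (submod_span K M A) K M"
  proof (rule M.submoduleI)
    show "submod_span K M A \<subseteq> carrier M" using c unfolding submod_span_def by blast
    show "\<zero>\<^bsub>M\<^esub> \<in> submod_span K M A" unfolding submod_span_def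
      using subgroup.one_closed[OF submodule.axioms(1)] by force
  next
    fix x assume "x \<in> submod_span K M A" thus "\<ominus>\<^bsub>M\<^esub> x \<in> submod_span K M A"
      unfolding submod_span_def using M.submoduleE(3) by blast
  next
    fix x y assume "x \<in> submod_span K M A" "y \<in> submod_span K M A"
    thus "x \<oplus>\<^bsub>M\<^esub> y \<in> submod_span K M A" unfolding submod_span_def using M.submoduleE(5) by blast
  next
    fix c x assume "c \<in> carrier K" "x \<in> submod_span K M A"
    thus "c \<odot>\<^bsub>M\<^esub> x \<in> submod_span K M A" unfolding submod_span_def using M.submoduleE(4) by blast
  qed
  show "A \<subseteq> submod_span K M A" unfolding submod_span_def by blast
qed

lemma hom_kills_span:
  assumes "Module.module K M" "Module.module K N" "h \<in> mod_hom K M N" "A \<subseteq> carrier M"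
    "\<And>x. x \<in> A \<Longrightarrow> h x = \<zero>\<^bsub>N\<^esub>" "x \<in> submod_span K M A"
  shows "h x = \<zero>\<^bsub>N\<^esub>"
proof -
  interpret M: Module.module K M by fact
  interpret N: Module.module K N by fact
  let ?Z = "{x \<in> carrier M. h x = \<zero>\<^bsub>N\<^esub>}"
  have "submodule ?Z K M"
  proof (rule M.submoduleI)
    fix y assume "y \<in> ?Z"
    thus "\<ominus>\<^bsub>M\<^esub> y \<in> ?Z" using mod_hom_minus[OF assms(1-3), of "\<zero>\<^bsub>M\<^esub>" y] mod_hom_zero[OF assms(1-3)]
      by (simp add: a_minus_def)
  qed (use assms(3) mod_hom_zero[OF assms(1-3)] in \<open>auto simp: mod_hom_def\<close>)
  with assms show ?thesis unfolding submod_span_def by blast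
qed

lemma quot_facts:
  assumes "Module.module K M" "submodule N K M"
  shows "Module.module K (quot_module M N)"
    "(\<lambda>x\<in>carrier M. N +>\<^bsub>M\<^esub> x) \<in> mod_hom K M (quot_module M N)"
    "carrier (quot_module M N) = (\<lambda>x. N +>\<^bsub>M\<^esub> x) ` carrier M"
proof -
  interpret M: Module.module K M by fact
  interpret N: submodule N K M by fact
  interpret A: abelian_subgroup N M
    by (rule abelian_subgroupI3) (auto simp: additive_subgroup_def N.subgroup_axioms M.M.abelian_group_axioms)
  show car: "carrier (quot_module M N) = (\<lambda>x. N +>\<^bsub>M\<^esub> x) ` carrier M"
    by (auto simp: quot_module_def A_RCOSETS_def RCOSETS_def a_r_coset_def)
  have z: "\<zero>\<^bsub>quot_module M N\<^esub> = N +>\<^bsub>M\<^esub> \<zero>\<^bsub>M\<^esub>"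
    by (simp add: quot_module_def M.M.a_coset_join2 A.a_subgroup N.one_closed[simplified])
  have ad: "(N +>\<^bsub>M\<^esub> x) \<oplus>\<^bsub>quot_module M N\<^esub> (N +>\<^bsub>M\<^esub> y) = N +>\<^bsub>M\<^esub> (x \<oplus>\<^bsub>M\<^esub> y)"
    if "x \<in> carrier M" "y \<in> carrier M" for x y
    using that by (simp add: quot_module_def A.a_rcos_sum)
  have sm: "c \<odot>\<^bsub>quot_module M N\<^esub> (N +>\<^bsub>M\<^esub> x) = N +>\<^bsub>M\<^esub> (c \<odot>\<^bsub>M\<^esub> x)"
    if c: "c \<in> carrier K" "x \<in> carrier M" for c x
  proof -
    have "N +>\<^bsub>M\<^esub> (c \<odot>\<^bsub>M\<^esub> y) = N +>\<^bsub>M\<^esub> (c \<odot>\<^bsub>M\<^esub> x)" if y: "y \<in> N +>\<^bsub>M\<^esub> x" for y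
    proof -
      obtain n where n: "n \<in> N" "y = n \<oplus>\<^bsub>M\<^esub> x" using y by (auto simp: a_r_coset_def' )
      have "c \<odot>\<^bsub>M\<^esub> y = c \<odot>\<^bsub>M\<^esub> n \<oplus>\<^bsub>M\<^esub> c \<odot>\<^bsub>M\<^esub> x" using n c N.subset by (auto simp: M.smult_r_distr)
      moreover have "c \<odot>\<^bsub>M\<^esub> n \<in> N" using n c by auto
      ultimately have "c \<odot>\<^bsub>M\<^esub> y \<in> N +>\<^bsub>M\<^esub> (c \<odot>\<^bsub>M\<^esub> x)" by (auto simp: a_r_coset_def')
      thus ?thesis using M.M.a_repr_independence[OF _ _ A.a_subgroup] c by (metis M.smult_closed)
    qed
    moreover have "x \<in> N +>\<^bsub>M\<^esub> x" using A.a_rcos_self c by auto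
    ultimately show ?thesis unfolding quot_module_def mk_module_simps by blast
  qed
  show "Module.module K (quot_module M N)"
  proof (rule moduleI[OF M.R.is_cring])
    show "abelian_group (quot_module M N)"
    proof (rule mk_abelian_group, goal_cases)
      case (6 x)
      then obtain u where "u \<in> carrier M" "x = N +>\<^bsub>M\<^esub> u" by (auto simp: car)
      thus ?case by (intro bexI[of _ "N +>\<^bsub>M\<^esub> (\<ominus>\<^bsub>M\<^esub> u)"]) (auto simp: car ad z M.M.l_neg)
    qed (auto simp: car ad z M.M.a_ac)
  qed (auto simp: car ad sm M.smult_l_distr M.smult_r_distr M.smult_assoc1)
  show "(\<lambda>x\<in>carrier M. N +>\<^bsub>M\<^esub> x) \<in> mod_hom K M (quot_module M N)"
    by (auto simp: mod_hom_def car ad sm)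
qed

lemma pres_is_module:
  assumes "cring K" "W \<subseteq> carrier (free_module K S)"
  shows "Module.module K (pres_module K S W)"
  unfolding pres_module_def
  by (intro quot_facts span_submodule free_is_module assms)

lemma pres_gen_carrier:
  assumes "cring K" "W \<subseteq> carrier (free_module K S)" "s \<in> S"
  shows "pres_gen K S W s \<in> carrier (pres_module K S W)"
  unfolding pres_module_def pres_gen_def
    quot_facts(3)[OF free_is_module[OF assms(1)] span_submodule(1)[OF free_is_module[OF assms(1)] assms(2)]]
  using assms by (auto simp: gen_carrier)

lemma mod_hom_eqI:
  assumes N: "Module.module K N" and K: "cring K"
    and h: "h \<in> mod_hom K (free_module K S) N"
    and v: "v \<in> carrier (free_module K S)"
  shows "h v = lin_ext K S N (\<lambda>s. h (gen K s)) v"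
proof -
  interpret N: Module.module K N by fact
  interpret F: Module.module K "free_module K S" by (rule free_is_module) fact
  have hg: "(\<lambda>s. h (gen K s)) \<in> S \<rightarrow> carrier N" using h gen_carrier[OF K] by (fastforce simp: mod_hom_def)
  let ?L = "lin_ext K S N (\<lambda>s. h (gen K s))"
  have L: "?L \<in> mod_hom K (free_module K S) N" by (rule lin_ext_hom[OF N hg])
  have "\<forall>v\<in>carrier (free_module K S). {s. v s \<noteq> \<zero>\<^bsub>K\<^esub>} \<subseteq> A \<longrightarrow> h v = ?L v" if "finite A" for A
    using that
  proof (induction A rule: finite_induct)
    case empty
    show ?case
    proof (intro ballI impI)
      fix v :: "'d \<Rightarrow> 'a" assume "{s. v s \<noteq> \<zero>\<^bsub>K\<^esub>} \<subseteq> {}"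
      hence "v = \<zero>\<^bsub>free_module K S\<^esub>" by auto
      thus "h v = ?L v" using mod_hom_zero[OF F.module_axioms N h] mod_hom_zero[OF F.module_axioms N L] by simp
    qed
  next
    case (insert x A)
    show ?case
    proof (intro ballI impI)
      fix v assume v: "v \<in> carrier (free_module K S)" and s: "{s. v s \<noteq> \<zero>\<^bsub>K\<^esub>} \<subseteq> insert x A"
      show "h v = ?L v"
      proof (cases "x \<in> S")
        case False
        hence "{s. v s \<noteq> \<zero>\<^bsub>K\<^esub>} \<subseteq> A" using v s by (auto simp: free_carrier)
        thus ?thesis using insert v by auto
      next
        case True
        define w where "w = v(x := \<zero>\<^bsub>K\<^esub>)"
        have w: "w \<in> carrier (free_module K S)"
          using v finite_subset[of "{s. w s \<noteq> \<zero>\<^bsub>K\<^esub>}" "{s. v s \<noteq> \<zero>\<^bsub>K\<^esub>}"] True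
          by (auto simp: free_carrier w_def intro: rev_finite_subset)
        have e: "v = w \<oplus>\<^bsub>free_module K S\<^esub> v x \<odot>\<^bsub>free_module K S\<^esub> gen K x"
          using v by (auto simp: w_def gen_def free_carrier fun_eq_iff)
        have vx: "v x \<in> carrier K" using v by (auto simp: free_carrier)
        have g: "gen K x \<in> carrier (free_module K S)" by (rule gen_carrier[OF K True])
        have expand: "f v = f w \<oplus>\<^bsub>N\<^esub> v x \<odot>\<^bsub>N\<^esub> f (gen K x)" if "f \<in> mod_hom K (free_module K S) N" for f
          apply (subst e)
          using that w g vx F.smult_closed[OF vx g] unfolding mod_hom_def by (simp del: free_ops)
        have "{s. w s \<noteq> \<zero>\<^bsub>K\<^esub>} \<subseteq> A" using s by (auto simp: w_def)
        hence "h w = ?L w" using insert w by blast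
        thus ?thesis using expand[OF h] expand[OF L] lin_ext_gen[OF N hg True] by simp
      qed
    qed
  qed
  thus ?thesis using v by (auto simp: free_carrier)
qed

lemma pres_lift_coset:
  assumes K: "cring K" and W: "W \<subseteq> carrier (free_module K S)" and N: "Module.module K N" and g: "g \<in> S \<rightarrow> carrier N"
    and kills: "\<And>w. w \<in> W \<Longrightarrow> lin_ext K S N g w = \<zero>\<^bsub>N\<^esub>"
    and v: "v \<in> carrier (free_module K S)"
  shows "pres_lift K S W N g (submod_span K (free_module K S) W +>\<^bsub>free_module K S\<^esub> v) = lin_ext K S N g v"
proof -
  note F = free_is_module[OF K, of S]
  interpret F: Module.module K "free_module K S" by (rule F)
  interpret N: Module.module K N by fact
  let ?N = "submod_span K (free_module K S) W"
  note sub = span_submodule(1)[OF F W]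
  note L = lin_ext_hom[OF N g]
  have 1: "lin_ext K S N g y = lin_ext K S N g v" if y: "y \<in> ?N +>\<^bsub>free_module K S\<^esub> v" for y
  proof -
    obtain n where n: "n \<in> ?N" "y = n \<oplus>\<^bsub>free_module K S\<^esub> v" using y by (auto simp: a_r_coset_def')
    have "n \<in> carrier (free_module K S)" using F.submoduleE(1)[OF sub] n by auto
    moreover have "lin_ext K S N g n = \<zero>\<^bsub>N\<^esub>" using hom_kills_span[OF F N L W kills n(1)] by simp
    moreover have "lin_ext K S N g v \<in> carrier N" using L v by (auto simp: mod_hom_def)
    moreover have "lin_ext K S N g y = lin_ext K S N g n \<oplus>\<^bsub>N\<^esub> lin_ext K S N g v" using n v L \<open>n \<in> carrier _\<close>
      unfolding mod_hom_def by auto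
    ultimately show ?thesis by simp
  qed
  have "\<zero>\<^bsub>free_module K S\<^esub> \<in> ?N" using subgroup.one_closed[OF submodule.axioms(1)[OF sub]] by simp
  hence "v \<in> ?N +>\<^bsub>free_module K S\<^esub> v" unfolding a_r_coset_def' using F.M.l_zero[OF v]
    by (simp del: free_ops) metis
  hence "lin_ext K S N g ` (?N +>\<^bsub>free_module K S\<^esub> v) = {lin_ext K S N g v}" using 1 by blast
  moreover have "?N +>\<^bsub>free_module K S\<^esub> v \<in> carrier (pres_module K S W)"
    unfolding pres_module_def quot_facts(3)[OF F sub] using v by auto
  ultimately show ?thesis by (simp add: pres_lift_def)
qed

lemma pres_lift_hom:
  assumes K: "cring K" and W: "W \<subseteq> carrier (free_module K S)" and N: "Module.module K N" and g: "g \<in> S \<rightarrow> carrier N"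
    and kills: "\<And>w. w \<in> W \<Longrightarrow> lin_ext K S N g w = \<zero>\<^bsub>N\<^esub>"
  shows "pres_lift K S W N g \<in> mod_hom K (pres_module K S W) N"
    "s \<in> S \<Longrightarrow> pres_lift K S W N g (pres_gen K S W s) = g s"
proof -
  note F = free_is_module[OF K, of S]
  interpret F: Module.module K "free_module K S" by (rule F)
  interpret N: Module.module K N by fact
  let ?N = "submod_span K (free_module K S) W"
  note sub = span_submodule(1)[OF F W]
  note q = quot_facts[OF F sub]
  note L = lin_ext_hom[OF N g]
  note c = pres_lift_coset[OF assms]
  have q2: "(?N +>\<^bsub>free_module K S\<^esub> u) \<oplus>\<^bsub>pres_module K S W\<^esub> (?N +>\<^bsub>free_module K S\<^esub> v)
      = ?N +>\<^bsub>free_module K S\<^esub> (u \<oplus>\<^bsub>free_module K S\<^esub> v)"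
    if "u \<in> carrier (free_module K S)" "v \<in> carrier (free_module K S)" for u v
    using q(2) that F.M.a_closed[OF that] unfolding pres_module_def mod_hom_def by (simp del: free_ops)
  have q3: "k \<odot>\<^bsub>pres_module K S W\<^esub> (?N +>\<^bsub>free_module K S\<^esub> v)
      = ?N +>\<^bsub>free_module K S\<^esub> (k \<odot>\<^bsub>free_module K S\<^esub> v)"
    if "k \<in> carrier K" "v \<in> carrier (free_module K S)" for k v
    using q(2) that F.smult_closed[OF that] unfolding pres_module_def mod_hom_def by (simp del: free_ops)
  have car: "carrier (pres_module K S W) = (\<lambda>x. ?N +>\<^bsub>free_module K S\<^esub> x) ` carrier (free_module K S)"
    using q(3) by (simp add: pres_module_def)
  show "pres_lift K S W N g \<in> mod_hom K (pres_module K S W) N"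
    unfolding mod_hom_def
  proof (intro CollectI conjI ballI, goal_cases)
    case 1
    have "pres_lift K S W N g \<in> extensional (carrier (pres_module K S W))" by (simp add: pres_lift_def)
    moreover have "pres_lift K S W N g x \<in> carrier N" if "x \<in> carrier (pres_module K S W)" for x
      using that L unfolding car by (auto simp: c mod_hom_def)
    ultimately show ?case by (intro PiE_I) (auto simp: extensional_def)
  next
    case (2 x y)
    thus ?case using L F.M.a_closed unfolding car mod_hom_def
      by (auto simp: q2 c simp del: free_ops)
  next
    case (3 k x)
    thus ?case using L F.smult_closed unfolding car mod_hom_def
      by (auto simp: q3 c simp del: free_ops)
  qed
  show "pres_lift K S W N g (pres_gen K S W s) = g s" if "s \<in> S"
    unfolding pres_gen_def using that by (simp add: c gen_carrier[OF K] lin_ext_gen[OF N g])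
qed


lemma pres_hom_ext:
  assumes K: "cring K" and W: "W \<subseteq> carrier (free_module K S)" and N: "Module.module K N"
    and h: "h \<in> mod_hom K (pres_module K S W) N" and h': "h' \<in> mod_hom K (pres_module K S W) N"
    and eq: "\<And>s. s \<in> S \<Longrightarrow> h (pres_gen K S W s) = h' (pres_gen K S W s)"
    and C: "C \<in> carrier (pres_module K S W)"
  shows "h C = h' C"
proof -
  note F = free_is_module[OF K, of S]
  interpret F: Module.module K "free_module K S" by (rule F)
  interpret N: Module.module K N by fact
  let ?N = "submod_span K (free_module K S) W"
  note q = quot_facts[OF F span_submodule(1)[OF F W], folded pres_module_def]
  let ?q = "\<lambda>x\<in>carrier (free_module K S). ?N +>\<^bsub>free_module K S\<^esub> x"
  have comp: "compose (carrier (free_module K S)) f ?q \<in> mod_hom K (free_module K S) N"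
    if "f \<in> mod_hom K (pres_module K S W) N" for f
    using that q(2) unfolding mod_hom_def by (auto simp: compose_def PiE_iff simp del: free_ops)
  obtain v where v: "v \<in> carrier (free_module K S)" "C = ?q v" using C q(3) by auto
  have *: "f C = lin_ext K S N (\<lambda>s. f (?q (gen K s))) v" if "f \<in> mod_hom K (pres_module K S W) N" for f
  proof -
    have "f C = compose (carrier (free_module K S)) f ?q v" using v by (simp add: compose_def)
    also have "\<dots> = lin_ext K S N (\<lambda>s. compose (carrier (free_module K S)) f ?q (gen K s)) v"
      by (rule mod_hom_eqI[OF N K comp[OF that] v(1)])
    also have "\<dots> = lin_ext K S N (\<lambda>s. f (?q (gen K s))) v"
      unfolding lin_ext_def using v(1)
      apply simp
      apply (rule N.M.finsum_cong')
      using that gen_carrier[OF K, of _ S] q(2) unfolding mod_hom_def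
      by (auto simp: compose_def free_carrier PiE_iff)
    finally show ?thesis .
  qed
  have "lin_ext K S N (\<lambda>s. h (?q (gen K s))) v = lin_ext K S N (\<lambda>s. h' (?q (gen K s))) v"
    unfolding lin_ext_def using v(1)
    apply simp
    apply (rule N.M.finsum_cong')
    using h' eq gen_carrier[OF K, of _ S] q(2) unfolding mod_hom_def pres_gen_def
    by (auto simp: compose_def free_carrier PiE_iff)
  thus ?thesis using *[OF h] *[OF h'] by simp
qed

lemma module_closed:
  assumes "Module.module K M"
  shows "x \<in> carrier M \<Longrightarrow> y \<in> carrier M \<Longrightarrow> x \<oplus>\<^bsub>M\<^esub> y \<in> carrier M"
    "c \<in> carrier K \<Longrightarrow> y \<in> carrier M \<Longrightarrow> c \<odot>\<^bsub>M\<^esub> y \<in> carrier M"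
proof -
  interpret Module.module K M by fact
  show "x \<in> carrier M \<Longrightarrow> y \<in> carrier M \<Longrightarrow> x \<oplus>\<^bsub>M\<^esub> y \<in> carrier M"
    "c \<in> carrier K \<Longrightarrow> y \<in> carrier M \<Longrightarrow> c \<odot>\<^bsub>M\<^esub> y \<in> carrier M" by auto
qed

lemma multilin_rels_carrier:
  assumes "cring K" "\<And>i. i \<in> I \<Longrightarrow> Module.module K (M i)"
  shows "multilin_rels K I M \<subseteq> carrier (free_module K (\<Pi>\<^sub>E i\<in>I. carrier (M i)))"
proof -
  let ?S = "\<Pi>\<^sub>E i\<in>I. carrier (M i)"
  interpret F: Module.module K "free_module K ?S" by (rule free_is_module) fact
  have g: "gen K (t(i := x)) \<in> carrier (free_module K ?S)" if "t \<in> ?S" "i \<in> I" "x \<in> carrier (M i)" for t i x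
    by (rule gen_carrier[OF assms(1)]) (use that in auto)
  have M: "x \<oplus>\<^bsub>M i\<^esub> y \<in> carrier (M i)" if "i \<in> I" "x \<in> carrier (M i)" "y \<in> carrier (M i)" for i x y
    by (rule module_closed(1)[OF assms(2)[OF that(1)] that(2,3)])
  have M2: "c \<odot>\<^bsub>M i\<^esub> y \<in> carrier (M i)" if "i \<in> I" "c \<in> carrier K" "y \<in> carrier (M i)" for i c y
    by (rule module_closed(2)[OF assms(2)[OF that(1)] that(2,3)])
  show ?thesis unfolding multilin_rels_def Let_def
    by (auto simp del: free_ops intro!: F.M.minus_closed F.M.a_closed F.smult_closed g M M2)
qed

definition multilin ::
  "('k, 'r) ring_scheme \<Rightarrow> 'i set \<Rightarrow> ('i \<Rightarrow> ('k, 'm) module) \<Rightarrow> ('k, 'n) module \<Rightarrow>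
     (('i \<Rightarrow> 'm) \<Rightarrow> 'n) \<Rightarrow> bool" where
  "multilin K I M N g \<longleftrightarrow>
  (\<forall>t\<in>\<Pi>\<^sub>E i\<in>I. carrier (M i). \<forall>i\<in>I.
     (\<forall>x\<in>carrier (M i). \<forall>y\<in>carrier (M i). g (t(i := x \<oplus>\<^bsub>M i\<^esub> y)) = g (t(i := x)) \<oplus>\<^bsub>N\<^esub> g (t(i := y))) \<and>
     (\<forall>c\<in>carrier K. \<forall>x\<in>carrier (M i). g (t(i := c \<odot>\<^bsub>M i\<^esub> x)) = c \<odot>\<^bsub>N\<^esub> g (t(i := x))))"

lemma multilin_kills:
  assumes K: "cring K" and M: "\<And>i. i \<in> I \<Longrightarrow> Module.module K (M i)"
    and N: "Module.module K N" and h: "h \<in> mod_hom K (free_module K (\<Pi>\<^sub>E i\<in>I. carrier (M i))) N"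
  shows "(\<forall>w\<in>multilin_rels K I M. h w = \<zero>\<^bsub>N\<^esub>) \<longleftrightarrow> multilin K I M N (\<lambda>t. h (gen K t))"
proof -
  let ?S = "\<Pi>\<^sub>E i\<in>I. carrier (M i)"
  let ?F = "free_module K ?S"
  interpret F: Module.module K "?F" by (rule free_is_module) fact
  interpret N: Module.module K N by fact
  have g: "gen K (t(i := x)) \<in> carrier ?F" if "t \<in> ?S" "i \<in> I" "x \<in> carrier (M i)" for t i x
    by (rule gen_carrier[OF K]) (use that in auto)
  have Ma: "x \<oplus>\<^bsub>M i\<^esub> y \<in> carrier (M i)" if "i \<in> I" "x \<in> carrier (M i)" "y \<in> carrier (M i)" for i x y
    by (rule module_closed(1)[OF M[OF that(1)] that(2,3)])
  have M2: "c \<odot>\<^bsub>M i\<^esub> y \<in> carrier (M i)" if "i \<in> I" "c \<in> carrier K" "y \<in> carrier (M i)" for i c y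
    by (rule module_closed(2)[OF M[OF that(1)] that(2,3)])
  have hc: "h x \<in> carrier N" if "x \<in> carrier ?F" for x using h that by (auto simp: mod_hom_def)
  have hm: "h (x \<ominus>\<^bsub>?F\<^esub> y) = \<zero>\<^bsub>N\<^esub> \<longleftrightarrow> h x = h y" if "x \<in> carrier ?F" "y \<in> carrier ?F" for x y
    using mod_hom_minus[OF F.module_axioms N h that]
      N.M.add.inv_solve_right[OF N.M.zero_closed hc[OF that(1)] hc[OF that(2)]] hc[OF that(2)]
    by (auto simp: a_minus_def)
  have ha: "h (x \<oplus>\<^bsub>?F\<^esub> y) = h x \<oplus>\<^bsub>N\<^esub> h y" if "x \<in> carrier ?F" "y \<in> carrier ?F" for x y
    using h that by (auto simp: mod_hom_def)
  have hs: "h (c \<odot>\<^bsub>?F\<^esub> y) = c \<odot>\<^bsub>N\<^esub> h y" if "c \<in> carrier K" "y \<in> carrier ?F" for c y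
    using h that by (auto simp: mod_hom_def)
  have r1: "h (gen K (t(i := x \<oplus>\<^bsub>M i\<^esub> y)) \<ominus>\<^bsub>?F\<^esub> (gen K (t(i := x)) \<oplus>\<^bsub>?F\<^esub> gen K (t(i := y)))) = \<zero>\<^bsub>N\<^esub> \<longleftrightarrow>
     h (gen K (t(i := x \<oplus>\<^bsub>M i\<^esub> y))) = h (gen K (t(i := x))) \<oplus>\<^bsub>N\<^esub> h (gen K (t(i := y)))"
    if "t \<in> ?S" "i \<in> I" "x \<in> carrier (M i)" "y \<in> carrier (M i)" for t i x y
    using that by (subst hm) (auto simp: ha g Ma simp del: free_ops)
  have r2: "h (gen K (t(i := c \<odot>\<^bsub>M i\<^esub> x)) \<ominus>\<^bsub>?F\<^esub> c \<odot>\<^bsub>?F\<^esub> gen K (t(i := x))) = \<zero>\<^bsub>N\<^esub> \<longleftrightarrow>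
     h (gen K (t(i := c \<odot>\<^bsub>M i\<^esub> x))) = c \<odot>\<^bsub>N\<^esub> h (gen K (t(i := x)))"
    if "t \<in> ?S" "i \<in> I" "c \<in> carrier K" "x \<in> carrier (M i)" for t i x c
    using that by (subst hm) (auto simp: hs g M2 simp del: free_ops)
  show ?thesis
  proof
    assume W: "\<forall>w\<in>multilin_rels K I M. h w = \<zero>\<^bsub>N\<^esub>"
    show "multilin K I M N (\<lambda>t. h (gen K t))"
      unfolding multilin_def
    proof (intro ballI conjI)
      fix t i x y assume *: "t \<in> ?S" "i \<in> I" "x \<in> carrier (M i)" "y \<in> carrier (M i)"
      show "h (gen K (t(i := x \<oplus>\<^bsub>M i\<^esub> y))) = h (gen K (t(i := x))) \<oplus>\<^bsub>N\<^esub> h (gen K (t(i := y)))"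
        by (rule iffD1[OF r1[OF *]], rule bspec[OF W], unfold multilin_rels_def Let_def,
            rule UnI1, rule CollectI, intro exI conjI, rule refl) (rule *)+
    next
      fix t i c x assume *: "t \<in> ?S" "i \<in> I" "c \<in> carrier K" "x \<in> carrier (M i)"
      show "h (gen K (t(i := c \<odot>\<^bsub>M i\<^esub> x))) = c \<odot>\<^bsub>N\<^esub> h (gen K (t(i := x)))"
        by (rule iffD1[OF r2[OF *]], rule bspec[OF W], unfold multilin_rels_def Let_def,
            rule UnI2, rule CollectI, intro exI conjI, rule refl) (rule *)+
    qed
  next
    assume m: "multilin K I M N (\<lambda>t. h (gen K t))"
    show "\<forall>w\<in>multilin_rels K I M. h w = \<zero>\<^bsub>N\<^esub>"
    proof
      fix w assume "w \<in> multilin_rels K I M"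
      then consider t i x y where "w = gen K (t(i := x \<oplus>\<^bsub>M i\<^esub> y)) \<ominus>\<^bsub>?F\<^esub> (gen K (t(i := x)) \<oplus>\<^bsub>?F\<^esub> gen K (t(i := y)))"
          "t \<in> ?S" "i \<in> I" "x \<in> carrier (M i)" "y \<in> carrier (M i)"
        | t i c x where "w = gen K (t(i := c \<odot>\<^bsub>M i\<^esub> x)) \<ominus>\<^bsub>?F\<^esub> c \<odot>\<^bsub>?F\<^esub> gen K (t(i := x))"
          "t \<in> ?S" "i \<in> I" "c \<in> carrier K" "x \<in> carrier (M i)"
        unfolding multilin_rels_def Let_def by (elim UnE CollectE exE conjE) blast+
      thus "h w = \<zero>\<^bsub>N\<^esub>"
      proof cases
        case 1
        note b = bspec[OF bspec[OF m[unfolded multilin_def] 1(2)] 1(3)]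
        show ?thesis unfolding 1(1) by (rule iffD2[OF r1[OF 1(2-5)]], rule bspec[OF bspec[OF conjunct1[OF b] 1(4)] 1(5)])
      next
        case 2
        note b = bspec[OF bspec[OF m[unfolded multilin_def] 2(2)] 2(3)]
        show ?thesis unfolding 2(1) by (rule iffD2[OF r2[OF 2(2-5)]], rule bspec[OF bspec[OF conjunct2[OF b] 2(4)] 2(5)])
      qed
    qed
  qed
qed

lemma tensor_facts:
  assumes K: "cring K" and M: "\<And>i. i \<in> I \<Longrightarrow> Module.module K (M i)"
  shows "Module.module K (tensor K I M)"
    "t \<in> (\<Pi>\<^sub>E i\<in>I. carrier (M i)) \<Longrightarrow> tensor_elt K I M t \<in> carrier (tensor K I M)"
    "multilin K I M (tensor K I M) (tensor_elt K I M)"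
proof -
  let ?S = "\<Pi>\<^sub>E i\<in>I. carrier (M i)"
  note W = multilin_rels_carrier[of K I M, OF K M]
  note F = free_is_module[OF K, of ?S]
  interpret F: Module.module K "free_module K ?S" by (rule F)
  note sub = span_submodule[OF F W]
  note q = quot_facts[OF F sub(1), folded pres_module_def]
  show mod: "Module.module K (tensor K I M)" unfolding tensor_def by (rule pres_is_module[OF K W])
  show "t \<in> ?S \<Longrightarrow> tensor_elt K I M t \<in> carrier (tensor K I M)"
    unfolding tensor_def tensor_elt_def by (rule pres_gen_carrier[OF K W])
  let ?q = "\<lambda>x\<in>carrier (free_module K ?S). submod_span K (free_module K ?S) (multilin_rels K I M) +>\<^bsub>free_module K ?S\<^esub> x"
  have q0: "\<forall>w\<in>multilin_rels K I M. ?q w = \<zero>\<^bsub>tensor K I M\<^esub>"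
  proof
    fix w assume w: "w \<in> multilin_rels K I M"
    hence "w \<in> submod_span K (free_module K ?S) (multilin_rels K I M)" using sub(2) by auto
    hence "submod_span K (free_module K ?S) (multilin_rels K I M) +>\<^bsub>free_module K ?S\<^esub> w
       = submod_span K (free_module K ?S) (multilin_rels K I M)"
      using w W by (intro F.M.a_coset_join2 submodule.axioms(1)[OF sub(1)]) auto
    thus "?q w = \<zero>\<^bsub>tensor K I M\<^esub>" using w W
      by (auto simp: tensor_def pres_module_def quot_module_def)
  qed
  have q2: "?q \<in> mod_hom K (free_module K ?S) (tensor K I M)" unfolding tensor_def by (rule q(2))
  have m: "multilin K I M (tensor K I M) (\<lambda>t. ?q (gen K t))"
    by (rule iffD1[OF multilin_kills[of K I M "tensor K I M" ?q, OF K M mod q2] q0])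
  have "gen K t \<in> carrier (free_module K ?S)" if "t \<in> ?S" for t by (rule gen_carrier[OF K that])
  hence e: "?q (gen K t) = tensor_elt K I M t" if "t \<in> ?S" for t using that
    by (simp add: tensor_elt_def pres_gen_def)
  have Ma: "x \<oplus>\<^bsub>M i\<^esub> y \<in> carrier (M i)" if "i \<in> I" "x \<in> carrier (M i)" "y \<in> carrier (M i)" for i x y
    by (rule module_closed(1)[OF M[OF that(1)] that(2,3)])
  have M2: "c \<odot>\<^bsub>M i\<^esub> y \<in> carrier (M i)" if "i \<in> I" "c \<in> carrier K" "y \<in> carrier (M i)" for i c y
    by (rule module_closed(2)[OF M[OF that(1)] that(2,3)])
  have u: "t(i := x) \<in> ?S" if "t \<in> ?S" "i \<in> I" "x \<in> carrier (M i)" for t i x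
    using that by auto
  show "multilin K I M (tensor K I M) (tensor_elt K I M)"
    using m unfolding multilin_def
    by (simp only: e u Ma M2 simp_thms ball_triv cong: ball_cong)
qed

lemma tensor_lift_hom:
  assumes K: "cring K" and M: "\<And>i. i \<in> I \<Longrightarrow> Module.module K (M i)"
    and N: "Module.module K N" and g: "g \<in> (\<Pi>\<^sub>E i\<in>I. carrier (M i)) \<rightarrow> carrier N"
    and m: "multilin K I M N g"
  shows "tensor_lift K I M N g \<in> mod_hom K (tensor K I M) N"
    "t \<in> (\<Pi>\<^sub>E i\<in>I. carrier (M i)) \<Longrightarrow> tensor_lift K I M N g (tensor_elt K I M t) = g t"
proof -
  let ?S = "\<Pi>\<^sub>E i\<in>I. carrier (M i)"
  note W = multilin_rels_carrier[of K I M, OF K M]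
  have Ma: "x \<oplus>\<^bsub>M i\<^esub> y \<in> carrier (M i)" if "i \<in> I" "x \<in> carrier (M i)" "y \<in> carrier (M i)" for i x y
    by (rule module_closed(1)[OF M[OF that(1)] that(2,3)])
  have M2: "c \<odot>\<^bsub>M i\<^esub> y \<in> carrier (M i)" if "i \<in> I" "c \<in> carrier K" "y \<in> carrier (M i)" for i c y
    by (rule module_closed(2)[OF M[OF that(1)] that(2,3)])
  have u: "t(i := x) \<in> ?S" if "t \<in> ?S" "i \<in> I" "x \<in> carrier (M i)" for t i x
    using that by auto
  have e: "lin_ext K ?S N g (gen K t) = g t" if "t \<in> ?S" for t by (rule lin_ext_gen[OF N g that])
  have "multilin K I M N (\<lambda>t. lin_ext K ?S N g (gen K t))"
    using m unfolding multilin_def by (simp only: e u Ma M2 simp_thms ball_triv cong: ball_cong)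
  hence k: "\<And>w. w \<in> multilin_rels K I M \<Longrightarrow> lin_ext K ?S N g w = \<zero>\<^bsub>N\<^esub>"
    using multilin_kills[OF K M N lin_ext_hom[OF N g]] by blast
  show "tensor_lift K I M N g \<in> mod_hom K (tensor K I M) N"
    "t \<in> ?S \<Longrightarrow> tensor_lift K I M N g (tensor_elt K I M t) = g t"
    using pres_lift_hom[OF K W N g k] by (simp_all add: tensor_lift_def tensor_def tensor_elt_def)
qed

lemma tensor_hom_ext:
  assumes K: "cring K" and M: "\<And>i. i \<in> I \<Longrightarrow> Module.module K (M i)"
    and N: "Module.module K N"
    and h: "h \<in> mod_hom K (tensor K I M) N" and h': "h' \<in> mod_hom K (tensor K I M) N"
    and eq: "\<And>t. t \<in> (\<Pi>\<^sub>E i\<in>I. carrier (M i)) \<Longrightarrow> h (tensor_elt K I M t) = h' (tensor_elt K I M t)"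
    and C: "C \<in> carrier (tensor K I M)"
  shows "h C = h' C"
proof (rule pres_hom_ext[where h = h and h' = h' and C = C and W = "multilin_rels K I M"
      and S = "\<Pi>\<^sub>E i\<in>I. carrier (M i)", OF K _ N])
  show "multilin_rels K I M \<subseteq> carrier (free_module K (\<Pi>\<^sub>E i\<in>I. carrier (M i)))"
    by (rule multilin_rels_carrier[OF K M])
  show "h \<in> mod_hom K (pres_module K (\<Pi>\<^sub>E i\<in>I. carrier (M i)) (multilin_rels K I M)) N"
    using h by (simp only: tensor_def)
  show "h' \<in> mod_hom K (pres_module K (\<Pi>\<^sub>E i\<in>I. carrier (M i)) (multilin_rels K I M)) N"
    using h' by (simp only: tensor_def)
  show "C \<in> carrier (pres_module K (\<Pi>\<^sub>E i\<in>I. carrier (M i)) (multilin_rels K I M))"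
    using C by (simp only: tensor_def)
  fix t assume "t \<in> (\<Pi>\<^sub>E i\<in>I. carrier (M i))"
  from eq[OF this] show "h (pres_gen K (\<Pi>\<^sub>E i\<in>I. carrier (M i)) (multilin_rels K I M) t) =
      h' (pres_gen K (\<Pi>\<^sub>E i\<in>I. carrier (M i)) (multilin_rels K I M) t)"
    by (simp only: tensor_elt_def)
qed

lemma tensor_map:
  assumes K: "cring K" and M: "\<And>i. i \<in> I \<Longrightarrow> Module.module K (M i)"
    and N: "\<And>i. i \<in> I \<Longrightarrow> Module.module K (N i)"
    and f: "\<And>i. i \<in> I \<Longrightarrow> f i \<in> mod_hom K (M i) (N i)"
  defines "g \<equiv> \<lambda>t. tensor_elt K I N (\<lambda>i\<in>I. f i (t i))"
  shows "tensor_lift K I M (tensor K I N) g \<in> mod_hom K (tensor K I M) (tensor K I N)"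
    "t \<in> (\<Pi>\<^sub>E i\<in>I. carrier (M i)) \<Longrightarrow> tensor_lift K I M (tensor K I N) g (tensor_elt K I M t) = g t"
proof -
  have T1: "Module.module K (tensor K I N)"
    by (rule tensor_facts(1)[OF K]) (rule N)
  have T2: "tensor_elt K I N t \<in> carrier (tensor K I N)" if "t \<in> (\<Pi>\<^sub>E i\<in>I. carrier (N i))" for t
    by (rule tensor_facts(2)[OF K _ that]) (rule N)
  have T3: "multilin K I N (tensor K I N) (tensor_elt K I N)"
    by (rule tensor_facts(3)[OF K]) (rule N)
  have t: "(\<lambda>i\<in>I. f i (t i)) \<in> (\<Pi>\<^sub>E i\<in>I. carrier (N i))" if "t \<in> (\<Pi>\<^sub>E i\<in>I. carrier (M i))" for t
  proof (rule PiE_I)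
    fix i assume i: "i \<in> I"
    have "t i \<in> carrier (M i)" using that i by auto
    thus "(\<lambda>i\<in>I. f i (t i)) i \<in> carrier (N i)" using f[OF i] i unfolding mod_hom_def by auto
  qed simp
  have gc: "g \<in> (\<Pi>\<^sub>E i\<in>I. carrier (M i)) \<rightarrow> carrier (tensor K I N)"
    unfolding g_def by (rule Pi_I) (rule T2[OF t])
  have upd: "(\<lambda>j\<in>I. f j ((t(i := x)) j)) = (\<lambda>j\<in>I. f j (t j))(i := f i x)" if "i \<in> I" for i t x
    using that by auto
  have m: "multilin K I M (tensor K I N) g"
    unfolding multilin_def g_def
  proof (intro ballI conjI)
    fix t i assume ti: "t \<in> (\<Pi>\<^sub>E i\<in>I. carrier (M i))" "i \<in> I"
    let ?s = "\<lambda>j\<in>I. f j (t j)"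
    have s: "?s \<in> (\<Pi>\<^sub>E i\<in>I. carrier (N i))" by (rule t[OF ti(1)])
    have mm: "tensor_elt K I N (?s(i := x \<oplus>\<^bsub>N i\<^esub> y)) =
        tensor_elt K I N (?s(i := x)) \<oplus>\<^bsub>tensor K I N\<^esub> tensor_elt K I N (?s(i := y))"
      if "x \<in> carrier (N i)" "y \<in> carrier (N i)" for x y
      by (rule bspec[OF bspec[OF conjunct1[OF bspec[OF bspec[OF T3[unfolded multilin_def] s] ti(2)]] that(1)] that(2)])
    have mm2: "tensor_elt K I N (?s(i := c \<odot>\<^bsub>N i\<^esub> x)) =
        c \<odot>\<^bsub>tensor K I N\<^esub> tensor_elt K I N (?s(i := x))"
      if "c \<in> carrier K" "x \<in> carrier (N i)" for c x
      by (rule bspec[OF bspec[OF conjunct2[OF bspec[OF bspec[OF T3[unfolded multilin_def] s] ti(2)]] that(1)] that(2)])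
    fix x assume x: "x \<in> carrier (M i)"
    { fix y assume y: "y \<in> carrier (M i)"
      have 1: "f i (x \<oplus>\<^bsub>M i\<^esub> y) = f i x \<oplus>\<^bsub>N i\<^esub> f i y" "f i x \<in> carrier (N i)" "f i y \<in> carrier (N i)"
        using f[OF ti(2)] x y by (auto simp: mod_hom_def)
      show "tensor_elt K I N (\<lambda>j\<in>I. f j ((t(i := x \<oplus>\<^bsub>M i\<^esub> y)) j)) =
        tensor_elt K I N (\<lambda>j\<in>I. f j ((t(i := x)) j)) \<oplus>\<^bsub>tensor K I N\<^esub> tensor_elt K I N (\<lambda>j\<in>I. f j ((t(i := y)) j))"
        unfolding upd[OF ti(2)] 1(1) by (rule mm[OF 1(2,3)]) }
    fix c assume c: "c \<in> carrier K"
    have 1: "f i (c \<odot>\<^bsub>M i\<^esub> x) = c \<odot>\<^bsub>N i\<^esub> f i x" "f i x \<in> carrier (N i)"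
      using f[OF ti(2)] x c by (auto simp: mod_hom_def)
    show "tensor_elt K I N (\<lambda>j\<in>I. f j ((t(i := c \<odot>\<^bsub>M i\<^esub> x)) j)) =
        c \<odot>\<^bsub>tensor K I N\<^esub> tensor_elt K I N (\<lambda>j\<in>I. f j ((t(i := x)) j))"
      unfolding upd[OF ti(2)] 1(1) by (rule mm2[OF c 1(2)])
  qed
  show "tensor_lift K I M (tensor K I N) g \<in> mod_hom K (tensor K I M) (tensor K I N)"
    by (rule tensor_lift_hom(1)[OF K M T1 gc m])
  show "tensor_lift K I M (tensor K I N) g (tensor_elt K I M t) = g t"
    if "t \<in> (\<Pi>\<^sub>E i\<in>I. carrier (M i))"
    by (rule tensor_lift_hom(2)[OF K M T1 gc m that])
qed

lemma mod_hom_comp: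
  assumes "Module.module K M" "f \<in> mod_hom K M N" "g \<in> mod_hom K N P"
  shows "compose (carrier M) g f \<in> mod_hom K M P"
proof -
  interpret M: Module.module K M by fact
  show ?thesis using assms(2,3) unfolding mod_hom_def by (auto simp: compose_def PiE_iff)
qed

lemma is_fin_functorD:
  assumes "is_fin_functor K F"
  shows "X \<in> fin_sets \<Longrightarrow> Module.module K (Obj F X)"
    "X \<in> fin_sets \<Longrightarrow> Y \<in> fin_sets \<Longrightarrow> f \<in> X \<rightarrow>\<^sub>E Y \<Longrightarrow> Mor F X Y f \<in> mod_hom K (Obj F X) (Obj F Y)"
    "X \<in> fin_sets \<Longrightarrow> v \<in> carrier (Obj F X) \<Longrightarrow> Mor F X X (\<lambda>x\<in>X. x) v = v"
    "X \<in> fin_sets \<Longrightarrow> Y \<in> fin_sets \<Longrightarrow> Z \<in> fin_sets \<Longrightarrow> f \<in> X \<rightarrow>\<^sub>E Y \<Longrightarrow> g \<in> Y \<rightarrow>\<^sub>E Z \<Longrightarrow>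
       v \<in> carrier (Obj F X) \<Longrightarrow> Mor F X Z (compose X g f) v = Mor F Y Z g (Mor F X Y f v)"
  using assms by (simp_all add: is_fin_functor_def)

lemma tensor_functor_is_functor:
  assumes K: "cring K" and F: "\<And>i. i \<in> I \<Longrightarrow> is_fin_functor K (F i)"
  shows "is_fin_functor K (tensor_functor K I F)"
proof -
  have mod: "Module.module K (Obj (F i) X)" if "i \<in> I" "X \<in> fin_sets" for i X
    by (rule is_fin_functorD(1)[OF F[OF that(1)] that(2)])
  have hom: "Mor (F i) X Y f \<in> mod_hom K (Obj (F i) X) (Obj (F i) Y)"
    if "i \<in> I" "X \<in> fin_sets" "Y \<in> fin_sets" "f \<in> X \<rightarrow>\<^sub>E Y" for i X Y f
    by (rule is_fin_functorD(2)[OF F[OF that(1)] that(2-)])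
  let ?T = "\<lambda>X. tensor K I (\<lambda>i. Obj (F i) X)"
  have tm: "Module.module K (?T X)" if "X \<in> fin_sets" for X
    by (rule tensor_facts(1)[OF K]) (rule mod[OF _ that])
  let ?m = "\<lambda>X Y f. Mor (tensor_functor K I F) X Y f"
  have m_eq: "?m X Y f = tensor_lift K I (\<lambda>i. Obj (F i) X) (?T Y)
       (\<lambda>t. tensor_elt K I (\<lambda>i. Obj (F i) Y) (\<lambda>i\<in>I. Mor (F i) X Y f (t i)))" for X Y f
    by (simp add: tensor_functor_def)
  have Obj_eq: "Obj (tensor_functor K I F) X = ?T X" for X
    by (simp add: tensor_functor_def)
  have th: "?m X Y f \<in> mod_hom K (?T X) (?T Y)"
    if "X \<in> fin_sets" "Y \<in> fin_sets" "f \<in> X \<rightarrow>\<^sub>E Y" for X Y f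
    unfolding m_eq
    by (rule tensor_map(1)[where I = I and M = "\<lambda>i. Obj (F i) X" and N = "\<lambda>i. Obj (F i) Y"
          and f = "\<lambda>i. Mor (F i) X Y f", OF K]) (rule mod[OF _ that(1)] mod[OF _ that(2)] hom[OF _ that]; assumption)+
  have te: "?m X Y f (tensor_elt K I (\<lambda>i. Obj (F i) X) t) =
      tensor_elt K I (\<lambda>i. Obj (F i) Y) (\<lambda>i\<in>I. Mor (F i) X Y f (t i))"
    if X: "X \<in> fin_sets" and Y: "Y \<in> fin_sets" and f: "f \<in> X \<rightarrow>\<^sub>E Y"
      and t: "t \<in> (\<Pi>\<^sub>E i\<in>I. carrier (Obj (F i) X))" for X Y f t
    unfolding m_eq
    by (rule tensor_map(2)[where I = I and M = "\<lambda>i. Obj (F i) X" and N = "\<lambda>i. Obj (F i) Y"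
          and f = "\<lambda>i. Mor (F i) X Y f", OF K _ _ _ t]) (rule mod[OF _ X] mod[OF _ Y] hom[OF _ X Y f]; assumption)+
  show ?thesis
    unfolding is_fin_functor_def
  proof (intro conjI ballI, goal_cases)
    case (1 X) show ?case unfolding Obj_eq by (rule tm[OF 1])
  next
    case (2 X Y f) show ?case unfolding Obj_eq by (rule th[OF 2])
  next
    case (3 X v)
    have idf: "(\<lambda>x\<in>X. x) \<in> X \<rightarrow>\<^sub>E X" by auto
    let ?T = "tensor K I (\<lambda>i. Obj (F i) X)"
    have v: "v \<in> carrier ?T" using 3 by (simp add: tensor_functor_def)
    have "?m X X (\<lambda>x\<in>X. x) v = (\<lambda>w\<in>carrier ?T. w) v"
    proof (rule tensor_hom_ext[of K I "\<lambda>i. Obj (F i) X" ?T, OF K mod[OF _ 3(1)] tm[OF 3(1)] th[OF 3(1,1) idf] _ _ v])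
      show "(\<lambda>w\<in>carrier ?T. w) \<in> mod_hom K ?T ?T"
        using module_closed[OF tm[OF 3(1)]] by (auto simp: mod_hom_def)
    next
      fix t assume t: "t \<in> (\<Pi>\<^sub>E i\<in>I. carrier (Obj (F i) X))"
      have "(\<lambda>i\<in>I. Mor (F i) X X (\<lambda>x\<in>X. x) (t i)) = t"
      proof
        fix i
        show "(\<lambda>i\<in>I. Mor (F i) X X (\<lambda>x\<in>X. x) (t i)) i = t i"
        proof (cases "i \<in> I")
          case True
          have "t i \<in> carrier (Obj (F i) X)" using t True by auto
          hence "Mor (F i) X X (\<lambda>x\<in>X. x) (t i) = t i"
            by (rule is_fin_functorD(3)[OF F[OF True] 3(1)])
          thus ?thesis using True by simp
        qed (use t in \<open>auto simp: PiE_iff extensional_def\<close>)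
      qed
      thus "?m X X (\<lambda>x\<in>X. x) (tensor_elt K I (\<lambda>i. Obj (F i) X) t) =
         (\<lambda>w\<in>carrier ?T. w) (tensor_elt K I (\<lambda>i. Obj (F i) X) t)"
        using te[OF 3(1,1) idf t] tensor_facts(2)[of K I "\<lambda>i. Obj (F i) X", OF K mod[OF _ 3(1)] t] by simp
    qed
    thus ?case using v by simp
  next
    case (4 X Y Z f g v)
    have fg: "compose X g f \<in> X \<rightarrow>\<^sub>E Z" using 4 by (auto simp: compose_def)
    have v: "v \<in> carrier (?T X)" using 4 by (simp add: tensor_functor_def)
    have "?m X Z (compose X g f) v = compose (carrier (?T X)) (?m Y Z g) (?m X Y f) v"
    proof (rule tensor_hom_ext[of K I "\<lambda>i. Obj (F i) X" "?T Z", OF K mod[OF _ 4(1)] tm[OF 4(3)] th[OF 4(1,3) fg] _ _ v])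
      show "compose (carrier (?T X)) (?m Y Z g) (?m X Y f) \<in> mod_hom K (?T X) (?T Z)"
        by (rule mod_hom_comp[OF tm[OF 4(1)] th[OF 4(1,2,4)] th[OF 4(2,3,5)]])
    next
      fix t assume t: "t \<in> (\<Pi>\<^sub>E i\<in>I. carrier (Obj (F i) X))"
      have t2: "(\<lambda>i\<in>I. Mor (F i) X Y f (t i)) \<in> (\<Pi>\<^sub>E i\<in>I. carrier (Obj (F i) Y))"
      proof (rule PiE_I)
        fix i assume i: "i \<in> I"
        have "t i \<in> carrier (Obj (F i) X)" using t i by auto
        thus "(\<lambda>i\<in>I. Mor (F i) X Y f (t i)) i \<in> carrier (Obj (F i) Y)"
          using hom[OF i 4(1,2,4)] i unfolding mod_hom_def by auto
      qed simp
      have "(\<lambda>i\<in>I. Mor (F i) X Z (compose X g f) (t i)) =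
        (\<lambda>i\<in>I. Mor (F i) Y Z g ((\<lambda>i\<in>I. Mor (F i) X Y f (t i)) i))"
      proof (rule restrict_ext)
        fix i assume i: "i \<in> I"
        have "t i \<in> carrier (Obj (F i) X)" using t i by auto
        hence "Mor (F i) X Z (compose X g f) (t i) = Mor (F i) Y Z g (Mor (F i) X Y f (t i))"
          by (rule is_fin_functorD(4)[OF F[OF i] 4(1-5)])
        thus "Mor (F i) X Z (compose X g f) (t i) = Mor (F i) Y Z g ((\<lambda>i\<in>I. Mor (F i) X Y f (t i)) i)"
          using i by simp
      qed
      thus "?m X Z (compose X g f) (tensor_elt K I (\<lambda>i. Obj (F i) X) t) =
        compose (carrier (?T X)) (?m Y Z g) (?m X Y f) (tensor_elt K I (\<lambda>i. Obj (F i) X) t)"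
        using te[OF 4(1,3) fg t] te[OF 4(1,2,4) t] te[OF 4(2,3,5) t2]
          tensor_facts(2)[of K I "\<lambda>i. Obj (F i) X", OF K mod[OF _ 4(1)] t]
        by (simp add: compose_def)
    qed
    thus ?case using v by (simp add: compose_def)
  qed
qed

lemma free_hom_ext:
  assumes K: "cring K" and N: "Module.module K N"
    and h: "h \<in> mod_hom K (free_module K S) N" and h': "h' \<in> mod_hom K (free_module K S) N"
    and eq: "\<And>s. s \<in> S \<Longrightarrow> h (gen K s) = h' (gen K s)"
    and v: "v \<in> carrier (free_module K S)"
  shows "h v = h' v"
proof -
  interpret N: Module.module K N by fact
  have "lin_ext K S N (\<lambda>s. h (gen K s)) v = lin_ext K S N (\<lambda>s. h' (gen K s)) v"
    unfolding lin_ext_def using v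
    apply simp
    apply (rule N.M.finsum_cong')
    using h' eq gen_carrier[OF K, of _ S] unfolding mod_hom_def
    by (auto simp: free_carrier PiE_iff)
  thus ?thesis using mod_hom_eqI[OF N K h v] mod_hom_eqI[OF N K h' v] by simp
qed

lemma self_is_module: "cring K \<Longrightarrow> Module.module K (self_module K)"
proof -
  assume "cring K"
  then interpret K: cring K .
  show ?thesis
  proof (rule moduleI[OF \<open>cring K\<close>])
    show "abelian_group (self_module K)"
    proof (rule mk_abelian_group, goal_cases)
      case (6 x) thus ?case by (intro bexI[of _ "\<ominus>\<^bsub>K\<^esub> x"]) (auto simp: self_module_def K.l_neg)
    qed (auto simp: self_module_def K.a_ac)
  qed (auto simp: self_module_def K.l_distr K.r_distr K.m_assoc)
qed

lemma kbar_is_functor: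
  assumes K: "cring K" shows "is_fin_functor K (kbar K)"
proof -
  interpret K: cring K by fact
  note self = self_is_module[OF K]
  have aug: "augmentation K X \<in> mod_hom K (free_module K X) (self_module K)" for X :: "'x set"
    unfolding augmentation_def by (rule lin_ext_hom[OF self]) (auto simp: self_module_def)
  have auggen: "augmentation K X (gen K x) = \<one>\<^bsub>K\<^esub>" if "x \<in> X" for X and x :: 'x
    unfolding augmentation_def by (rule lin_ext_gen[OF self _ that]) (auto simp: self_module_def)
  have car: "carrier (aug_kernel K X) = {v \<in> carrier (free_module K X). augmentation K X v = \<zero>\<^bsub>self_module K\<^esub>}" for X :: "'x set"
    by (simp add: aug_kernel_def a_kernel_def kernel_def)
  have ops: "add (aug_kernel K X) = add (free_module K X)" "smult (aug_kernel K X) = smult (free_module K X)" for X :: "'x set"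
    by (simp_all add: aug_kernel_def)
  have sub: "submodule (carrier (aug_kernel K X)) K (free_module K X)" for X :: "'x set"
  proof -
    interpret F: Module.module K "free_module K X" by (rule free_is_module[OF K])
    interpret S: Module.module K "self_module K" by (rule self)
    note z = mod_hom_zero[OF F.module_axioms self aug]
    show ?thesis
    proof (rule F.submoduleI, unfold car)
      fix y assume "y \<in> {v \<in> carrier (free_module K X). augmentation K X v = \<zero>\<^bsub>self_module K\<^esub>}"
      thus "\<ominus>\<^bsub>free_module K X\<^esub> y \<in> {v \<in> carrier (free_module K X). augmentation K X v = \<zero>\<^bsub>self_module K\<^esub>}"
        using mod_hom_minus[OF F.module_axioms self aug F.M.zero_closed, of y] z
        by (simp add: a_minus_def del: free_ops)
    qed (use z aug[of X] in \<open>auto simp: mod_hom_def simp del: free_ops\<close>)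
  qed
  have mod: "Module.module K (aug_kernel K X)" for X :: "'x set"
    using submodule.submodule_is_module[OF sub free_is_module[OF K]] by (simp add: aug_kernel_def)
  let ?L = "\<lambda>X Y f. lin_ext K X (free_module K Y) (\<lambda>x. gen K (f x))"
  have L: "?L X Y f \<in> mod_hom K (free_module K X) (free_module K Y)"
    and Lg: "x \<in> X \<Longrightarrow> ?L X Y f (gen K x) = gen K (f x)"
    if "f \<in> X \<rightarrow>\<^sub>E Y" for X Y :: "'x set" and f x
  proof -
    have g: "(\<lambda>x. gen K (f x)) \<in> X \<rightarrow> carrier (free_module K Y)"
    proof (rule Pi_I)
      fix x assume "x \<in> X"
      hence "f x \<in> Y" using that by auto
      thus "gen K (f x) \<in> carrier (free_module K Y)" by (rule gen_carrier[OF K])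
    qed
    show "?L X Y f \<in> mod_hom K (free_module K X) (free_module K Y)"
      by (rule lin_ext_hom[OF free_is_module[OF K] g])
    show "?L X Y f (gen K x) = gen K (f x)" if "x \<in> X"
      by (rule lin_ext_gen[OF free_is_module[OF K] g that])
  qed
  have augL: "augmentation K Y (?L X Y f v) = augmentation K X v"
    if f: "f \<in> X \<rightarrow>\<^sub>E Y" and v: "v \<in> carrier (free_module K X)" for X Y :: "'x set" and f v
  proof -
    have "compose (carrier (free_module K X)) (augmentation K Y) (?L X Y f) v = augmentation K X v"
    proof (rule free_hom_ext[OF K self mod_hom_comp[OF free_is_module[OF K] L[OF f] aug] aug _ v])
      fix x assume x: "x \<in> X"
      thus "compose (carrier (free_module K X)) (augmentation K Y) (?L X Y f) (gen K x) = augmentation K X (gen K x)"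
        using PiE_mem[OF f x] by (simp add: compose_def gen_carrier[OF K] Lg[OF f] auggen)
    qed
    thus ?thesis using v by (simp add: compose_def)
  qed
  have Mor: "Mor (kbar K) X Y f v = ?L X Y f v" if "v \<in> carrier (aug_kernel K X)" for X Y :: "'x set" and f v
    using that by (simp add: kbar_def)
  have Obj: "Obj (kbar K) X = aug_kernel K X" for X :: "'x set" by (simp add: kbar_def)
  have Lc: "?L X Y f v \<in> carrier (aug_kernel K Y)" if "f \<in> X \<rightarrow>\<^sub>E Y" "v \<in> carrier (aug_kernel K X)" for X Y :: "'x set" and f v
    using that augL[OF that(1)] L[OF that(1)] by (auto simp: car mod_hom_def)
  show ?thesis
    unfolding is_fin_functor_def Obj
  proof (intro conjI ballI, goal_cases)
    case (1 X) show ?case by (rule mod)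
  next
    case (2 X Y f)
    interpret A: Module.module K "aug_kernel K X" by (rule mod)
    have "Mor (kbar K) X Y f \<in> extensional (carrier (aug_kernel K X))" by (simp add: kbar_def)
    moreover have "Mor (kbar K) X Y f v \<in> carrier (aug_kernel K Y)" if "v \<in> carrier (aug_kernel K X)" for v
      using Lc[OF 2(3) that] Mor[OF that] by simp
    moreover have "\<forall>x\<in>carrier (aug_kernel K X). \<forall>y\<in>carrier (aug_kernel K X).
       Mor (kbar K) X Y f (x \<oplus>\<^bsub>aug_kernel K X\<^esub> y) = Mor (kbar K) X Y f x \<oplus>\<^bsub>aug_kernel K Y\<^esub> Mor (kbar K) X Y f y"
      using L[OF 2(3)] A.M.a_closed by (simp add: Mor) (simp add: ops mod_hom_def car del: free_ops)
    moreover have "\<forall>c\<in>carrier K. \<forall>x\<in>carrier (aug_kernel K X).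
       Mor (kbar K) X Y f (c \<odot>\<^bsub>aug_kernel K X\<^esub> x) = c \<odot>\<^bsub>aug_kernel K Y\<^esub> Mor (kbar K) X Y f x"
      using L[OF 2(3)] A.smult_closed by (simp add: Mor) (simp add: ops mod_hom_def car del: free_ops)
    ultimately show ?case unfolding mod_hom_def by (auto intro!: PiE_I simp: extensional_def simp del: free_ops)
  next
    case (3 X v)
    have idf: "(\<lambda>x\<in>X. x) \<in> X \<rightarrow>\<^sub>E X" by auto
    interpret F: Module.module K "free_module K X" by (rule free_is_module[OF K])
    have v: "v \<in> carrier (free_module K X)" using 3 by (simp add: car)
    have "?L X X (\<lambda>x\<in>X. x) v = (\<lambda>w\<in>carrier (free_module K X). w) v"
      by (rule free_hom_ext[OF K F.module_axioms L[OF idf] _ _ v])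
        (use Lg[OF idf] in \<open>auto simp: mod_hom_def gen_carrier[OF K] restrict_def simp del: free_ops\<close>)
    thus ?case using v Mor[OF 3(2)] by simp
  next
    case (4 X Y Z f g v)
    have fg: "compose X g f \<in> X \<rightarrow>\<^sub>E Z" using 4 by (auto simp: compose_def)
    have v: "v \<in> carrier (free_module K X)" using 4 by (simp add: car)
    have "?L X Z (compose X g f) v = compose (carrier (free_module K X)) (?L Y Z g) (?L X Y f) v"
    proof (rule free_hom_ext[OF K free_is_module[OF K] L[OF fg] mod_hom_comp[OF free_is_module[OF K] L[OF 4(4)] L[OF 4(5)]] _ v])
      fix x assume x: "x \<in> X"
      hence "f x \<in> Y" using 4(4) by auto
      thus "?L X Z (compose X g f) (gen K x) = compose (carrier (free_module K X)) (?L Y Z g) (?L X Y f) (gen K x)"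
        using x Lg[OF fg x] by (simp add: Lg[OF 4(4)] Lg[OF 4(5)] compose_def gen_carrier[OF K])
    qed
    thus ?case using v Mor[OF 4(6)] Mor[OF Lc[OF 4(4,6)]] by (simp add: compose_def)
  qed
qed

lemma kbar_power_is_functor: "cring K \<Longrightarrow> is_fin_functor K (kbar_power K n)"
  unfolding kbar_power_def by (intro tensor_functor_is_functor kbar_is_functor)

end

theory Submission
  imports Defs
begin

text \<open>
  Put \<open>I = {1..a}\<close> and \<open>J = {1..b}\<close>. For \<open>X\<close> finite and non-empty, the \<open>I\<close>-th tensor power of the
  augmentation kernel of \<open>k[X]\<close> is the module of functions on \<open>X\<^sup>I\<close> all of whose marginals, the
  sums along a single coordinate, vanish (\<open>tensor_coord_of\<close>, \<open>tensor_of_coord\<close>), and a map \<open>h\<close> of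
  sets acts by pushing functions forward along \<open>x \<mapsto> h \<circ> x\<close> (\<open>tensor_coord_natural\<close>). A map \<open>f\<close>
  from \<open>J\<close> to \<open>I\<close> pushes functions on \<open>X\<^sup>I\<close> forward to functions on \<open>X\<^sup>J\<close> along \<open>x \<mapsto> x \<circ> f\<close>,
  naturally in \<open>X\<close>. So a linear combination \<open>v\<close> of surjections from \<open>J\<close> to \<open>I\<close> defines natural
  maps of functions, and the question is whether these preserve vanishing marginals. In the
  marginal in direction \<open>j\<close> the surjections \<open>f\<close> with the same restriction \<open>g\<close> to \<open>J - {j}\<close>
  contribute together. If \<open>g\<close> is not onto they contribute a marginal of the given function, which
  is zero; if \<open>g\<close> is onto they contribute a multiple of \<open>\<Sum>i. v (g(j := i))\<close>, the coefficient at
  \<open>g\<close> of the restriction of \<open>v\<close>. Hence the elements of the kernel of the restriction maps give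
  natural transformations (\<open>theta_zero_marg\<close>, \<open>nat_of_nat_trans\<close>).

  Conversely, let \<open>\<eta>\<close> be natural and consider the generator \<open>e = ([p i] - [q i])\<^sub>i\<close> for \<open>2a\<close> different
  points. Generators with a common second point span, and each of them is the image of \<open>e\<close> under a map
  of sets, so \<open>\<eta>\<close> is determined by the function \<open>\<eta>(e)\<close> on \<open>X\<^sup>J\<close>. At which \<open>y\<close> can it be nonzero? Naturality for inclusions
  shows that \<open>y\<close> takes values among the points \<open>p i\<close>, \<open>q i\<close> (\<open>ev_outside\<close>); collapsing \<open>q i\<close> to \<open>p i\<close>
  kills \<open>e\<close> and shows that \<open>y\<close> meets each pair \<open>{p i, q i}\<close> (\<open>ev_missing\<close>); and splitting
  \<open>[p i] - [q i]\<close> at a further point shows that \<open>y\<close> does not contain both (\<open>ev_mixed\<close>). So \<open>y = x \<circ> f\<close> for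
  a surjection \<open>f\<close> and a choice \<open>x i \<in> {p i, q i}\<close>, and exchanging \<open>p i\<close> with \<open>q i\<close>, which only changes
  the sign of \<open>e\<close>, reduces to \<open>x = p\<close>. With \<open>v f\<close> the value of \<open>\<eta>(e)\<close> at \<open>p \<circ> f\<close>, the transformation \<open>\<eta>\<close>
  is the one defined by \<open>v\<close> (\<open>ev_theta\<close>, \<open>coord_nat_eq_theta\<close>), and the vanishing marginals of \<open>\<eta>(e)\<close>
  put \<open>v\<close> into the kernel (\<open>coeff_kernel\<close>). This is a linear bijection (\<open>nat_coeff_iso\<close>), and it is
  equivariant because coefficients may be read off at any \<open>2a\<close> different points (\<open>nat_coeff_act\<close>).

  The Koszul complex enters only through degrees zero and one. The orientation module of the empty
  set is the ring, and that of a point admits a linear form with value \<open>1\<close> on the generator. So degree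
  zero consists of the elements \<open>v \<otimes> 1\<close>, and the differential of \<open>v \<otimes> 1\<close> vanishes exactly if every
  restriction of \<open>v\<close> does (\<open>Kz_kernel_iff\<close>). As zero is the only coboundary in degree zero, the zeroth
  cohomology is the kernel of the restriction maps (\<open>ker_R_cohomology_iso\<close>).
\<close>

section \<open>Finite sums\<close>

context abelian_monoid
begin

lemma finsum_swap:
  assumes "finite A" "finite B" "\<And>a b. a \<in> A \<Longrightarrow> b \<in> B \<Longrightarrow> f a b \<in> carrier G"
  shows "(\<Oplus>a\<in>A. \<Oplus>b\<in>B. f a b) = (\<Oplus>b\<in>B. \<Oplus>a\<in>A. f a b)"
  using assms(1,3)
proof (induction A rule: finite_induct)
  case empty
  show ?case by (simp add: finsum_zero)
next
  case (insert x A)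
  have "(\<Oplus>a\<in>insert x A. \<Oplus>b\<in>B. f a b) = (\<Oplus>b\<in>B. f x b) \<oplus> (\<Oplus>b\<in>B. \<Oplus>a\<in>A. f a b)"
    using insert by (subst finsum_insert) (auto intro!: finsum_closed)
  also have "\<dots> = (\<Oplus>b\<in>B. f x b \<oplus> (\<Oplus>a\<in>A. f a b))"
    by (rule finsum_addf[symmetric]) (use insert in \<open>auto intro!: finsum_closed\<close>)
  also have "\<dots> = (\<Oplus>b\<in>B. \<Oplus>a\<in>insert x A. f a b)"
    by (rule finsum_cong'[OF refl]) (use insert in \<open>auto intro!: finsum_closed finsum_insert[symmetric]\<close>)
  finally show ?case .
qed

lemma finsum_single:
  assumes "finite A" "x \<in> A" "f x \<in> carrier G" "\<And>y. y \<in> A \<Longrightarrow> y \<noteq> x \<Longrightarrow> f y = \<zero>"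
  shows "finsum G f A = f x"
proof -
  have "finsum G f {x} = finsum G f A"
    by (rule add.finprod_mono_neutral_cong_left) (use assms in \<open>auto, metis zero_closed\<close>)
  thus ?thesis using assms(3) by simp
qed

lemma finsum_all_zero: "(\<And>y. y \<in> A \<Longrightarrow> f y = \<zero>) \<Longrightarrow> finsum G f A = \<zero>"
  by (rule add.finprod_one_eqI)

lemma finsum_PiE_insert:
  assumes "finite I" "i \<notin> I" "\<And>j. j \<in> insert i I \<Longrightarrow> finite (A j)"
    "\<And>x. x \<in> PiE (insert i I) A \<Longrightarrow> h x \<in> carrier G"
  shows "(\<Oplus>x\<in>PiE (insert i I) A. h x) = (\<Oplus>x\<in>PiE I A. \<Oplus>z\<in>A i. h (x(i := z)))"
proof -
  have U: "PiE (insert i I) A = (\<Union>g\<in>PiE I A. (\<lambda>z. g(i := z)) ` A i)"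
    unfolding PiE_insert_eq by auto
  have mem: "g(i := z) \<in> PiE (insert i I) A" if "g \<in> PiE I A" "z \<in> A i" for g z
    using that by (intro PiE_fun_upd)
  have "(\<Oplus>x\<in>PiE (insert i I) A. h x) = (\<Oplus>g\<in>PiE I A. \<Oplus>x\<in>(\<lambda>z. g(i := z)) ` A i. h x)"
    unfolding U
  proof (rule add.finprod_UN_disjoint)
    show "finite (PiE I A)" using assms by (intro finite_PiE) auto
    show "finite ((\<lambda>z. g(i := z)) ` A i)" if "g \<in> PiE I A" for g using assms by auto
    show "pairwise (\<lambda>g g'. disjnt ((\<lambda>z. g(i := z)) ` A i) ((\<lambda>z. g'(i := z)) ` A i)) (PiE I A)"
    proof (rule pairwiseI)
      fix g g' assume g: "g \<in> PiE I A" "g' \<in> PiE I A" "g \<noteq> g'"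
      have "g = g'" if "g(i := z) = g'(i := z')" for z z'
      proof
        fix j show "g j = g' j"
          using fun_cong[OF that, of j] g(1,2) assms(2) by (cases "j = i") (auto simp: PiE_def extensional_def)
      qed
      thus "disjnt ((\<lambda>z. g(i := z)) ` A i) ((\<lambda>z. g'(i := z)) ` A i)" using g(3) by (auto simp: disjnt_def)
    qed
    show "h x \<in> carrier G" if "g \<in> PiE I A" "x \<in> (\<lambda>z. g(i := z)) ` A i" for g x
      using that mem assms(4) by auto
  qed
  also have "\<dots> = (\<Oplus>x\<in>PiE I A. \<Oplus>z\<in>A i. h (x(i := z)))"
  proof (rule finsum_cong'[OF refl])
    show "(\<lambda>x. \<Oplus>z\<in>A i. h (x(i := z))) \<in> PiE I A \<rightarrow> carrier G"
      by (intro Pi_I finsum_closed) (use mem assms(4) in auto)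
    fix g assume g: "g \<in> PiE I A"
    have "inj_on (\<lambda>z. g(i := z)) (A i)" by (rule inj_onI) (metis fun_upd_same)
    thus "(\<Oplus>x\<in>(\<lambda>z. g(i := z)) ` A i. h x) = (\<Oplus>z\<in>A i. h (g(i := z)))"
      by (intro finsum_reindex) (use mem[OF g] assms(4) in auto)
  qed
  finally show ?thesis .
qed

lemma finsum_PiE_remove:
  assumes "finite I" "i \<in> I" "\<And>j. j \<in> I \<Longrightarrow> finite (A j)"
    "\<And>x. x \<in> PiE I A \<Longrightarrow> h x \<in> carrier G"
  shows "(\<Oplus>x\<in>PiE I A. h x) = (\<Oplus>x\<in>PiE (I - {i}) A. \<Oplus>z\<in>A i. h (x(i := z)))"
  using finsum_PiE_insert[of "I - {i}" i A h] assms by (auto simp: insert_absorb)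

end

section \<open>Modules and multilinear maps\<close>

lemma mod_homD:
  assumes "h \<in> mod_hom K M N"
  shows "x \<in> carrier M \<Longrightarrow> h x \<in> carrier N"
    "x \<in> carrier M \<Longrightarrow> y \<in> carrier M \<Longrightarrow> h (x \<oplus>\<^bsub>M\<^esub> y) = h x \<oplus>\<^bsub>N\<^esub> h y"
    "c \<in> carrier K \<Longrightarrow> x \<in> carrier M \<Longrightarrow> h (c \<odot>\<^bsub>M\<^esub> x) = c \<odot>\<^bsub>N\<^esub> h x"
  using assms by (auto simp: mod_hom_def)

lemma mod_homI:
  assumes "\<And>x. x \<in> carrier M \<Longrightarrow> h x \<in> carrier N" "h \<in> extensional (carrier M)"
    "\<And>x y. x \<in> carrier M \<Longrightarrow> y \<in> carrier M \<Longrightarrow> h (x \<oplus>\<^bsub>M\<^esub> y) = h x \<oplus>\<^bsub>N\<^esub> h y"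
    "\<And>c x. c \<in> carrier K \<Longrightarrow> x \<in> carrier M \<Longrightarrow> h (c \<odot>\<^bsub>M\<^esub> x) = c \<odot>\<^bsub>N\<^esub> h x"
  shows "h \<in> mod_hom K M N"
  using assms by (auto simp: mod_hom_def PiE_def)

lemma mod_hom_finsum:
  assumes M: "Module.module K M" and N: "Module.module K N" and h: "h \<in> mod_hom K M N"
    and "finite A" "\<And>a. a \<in> A \<Longrightarrow> f a \<in> carrier M"
  shows "h (\<Oplus>\<^bsub>M\<^esub>a\<in>A. f a) = (\<Oplus>\<^bsub>N\<^esub>a\<in>A. h (f a))"
proof -
  interpret M: Module.module K M by fact
  interpret N: Module.module K N by fact
  show ?thesis using assms(4,5)
  proof (induction A rule: finite_induct)
    case empty
    show ?case using mod_hom_zero[OF M N h] by simp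
  next
    case (insert x A)
    have "h (\<Oplus>\<^bsub>M\<^esub>a\<in>insert x A. f a) = h (f x \<oplus>\<^bsub>M\<^esub> (\<Oplus>\<^bsub>M\<^esub>a\<in>A. f a))"
      using insert by (subst M.M.finsum_insert) auto
    also have "\<dots> = h (f x) \<oplus>\<^bsub>N\<^esub> h (\<Oplus>\<^bsub>M\<^esub>a\<in>A. f a)"
      by (rule mod_homD[OF h]) (use insert in \<open>auto intro!: M.M.finsum_closed\<close>)
    also have "\<dots> = (\<Oplus>\<^bsub>N\<^esub>a\<in>insert x A. h (f a))"
      using insert mod_homD(1)[OF h] by (subst N.M.finsum_insert) auto
    finally show ?case .
  qed
qed

lemma zero_mod_hom:
  assumes M: "Module.module K M" and N: "Module.module K N"
  shows "(\<lambda>x\<in>carrier M. \<zero>\<^bsub>N\<^esub>) \<in> mod_hom K M N"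
proof -
  interpret M: Module.module K M by fact
  interpret N: Module.module K N by fact
  show ?thesis by (rule mod_homI) auto
qed

lemma id_mod_hom:
  assumes "Module.module K M" shows "(\<lambda>x\<in>carrier M. x) \<in> mod_hom K M M"
proof -
  interpret M: Module.module K M by fact
  show ?thesis by (rule mod_homI) auto
qed

lemma mod_iso_sym:
  assumes M: "Module.module K M" and h: "h \<in> mod_iso K M N"
  shows "restrict (inv_into (carrier M) h) (carrier N) \<in> mod_iso K N M"
proof -
  interpret M: Module.module K M by fact
  have hh: "h \<in> mod_hom K M N" and b: "bij_betw h (carrier M) (carrier N)" using h by (auto simp: mod_iso_def)
  let ?g = "restrict (inv_into (carrier M) h) (carrier N)"
  have bg: "bij_betw ?g (carrier N) (carrier M)"
    using bij_betw_inv_into[OF b] by (rule bij_betw_cong[THEN iffD1, rotated]) simp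
  have gc: "?g x \<in> carrier M" if "x \<in> carrier N" for x using bg that by (auto dest: bij_betwE)
  have hg: "h (?g x) = x" if "x \<in> carrier N" for x using that b by (simp add: bij_betw_inv_into_right)
  have gh: "?g (h x) = x" if "x \<in> carrier M" for x using that b mod_homD(1)[OF hh] by (simp add: bij_betw_inv_into_left)
  have "?g \<in> mod_hom K N M"
  proof (rule mod_homI)
    fix x y assume x: "x \<in> carrier N" and y: "y \<in> carrier N"
    have "x \<oplus>\<^bsub>N\<^esub> y = h (?g x \<oplus>\<^bsub>M\<^esub> ?g y)" using mod_homD(2)[OF hh gc[OF x] gc[OF y]] hg x y by simp
    thus "?g (x \<oplus>\<^bsub>N\<^esub> y) = ?g x \<oplus>\<^bsub>M\<^esub> ?g y" using gh[OF M.M.a_closed[OF gc[OF x] gc[OF y]]] by simp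
  next
    fix c x assume c: "c \<in> carrier K" and x: "x \<in> carrier N"
    have "c \<odot>\<^bsub>N\<^esub> x = h (c \<odot>\<^bsub>M\<^esub> ?g x)" using mod_homD(3)[OF hh c gc[OF x]] hg x by simp
    thus "?g (c \<odot>\<^bsub>N\<^esub> x) = c \<odot>\<^bsub>M\<^esub> ?g x" using gh[OF M.smult_closed[OF c gc[OF x]]] by simp
  qed (use gc in auto)
  thus ?thesis using bg by (simp add: mod_iso_def)
qed

lemma mod_iso_comp:
  assumes "\<And>x y. x \<in> carrier M \<Longrightarrow> y \<in> carrier M \<Longrightarrow> x \<oplus>\<^bsub>M\<^esub> y \<in> carrier M"
    "\<And>c x. c \<in> carrier K \<Longrightarrow> x \<in> carrier M \<Longrightarrow> c \<odot>\<^bsub>M\<^esub> x \<in> carrier M"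
    and f: "f \<in> mod_iso K M N" and g: "g \<in> mod_iso K N P"
  shows "compose (carrier M) g f \<in> mod_iso K M P"
proof -
  have fh: "f \<in> mod_hom K M N" and gh: "g \<in> mod_hom K N P" using f g by (auto simp: mod_iso_def)
  have "compose (carrier M) g f \<in> mod_hom K M P"
    by (rule mod_homI) (use assms(1,2) mod_homD[OF fh] mod_homD[OF gh] in \<open>auto simp: compose_def\<close>)
  thus ?thesis using f g bij_betw_compose[of f "carrier M" "carrier N" g "carrier P"] by (simp add: mod_iso_def)
qed

lemma multilinI:
  assumes "\<And>t i x y. t \<in> (\<Pi>\<^sub>E i\<in>I. carrier (M i)) \<Longrightarrow> i \<in> I \<Longrightarrow> x \<in> carrier (M i) \<Longrightarrow> y \<in> carrier (M i) \<Longrightarrow>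
     g (t(i := x \<oplus>\<^bsub>M i\<^esub> y)) = g (t(i := x)) \<oplus>\<^bsub>N\<^esub> g (t(i := y))"
    "\<And>t i c x. t \<in> (\<Pi>\<^sub>E i\<in>I. carrier (M i)) \<Longrightarrow> i \<in> I \<Longrightarrow> c \<in> carrier K \<Longrightarrow> x \<in> carrier (M i) \<Longrightarrow>
     g (t(i := c \<odot>\<^bsub>M i\<^esub> x)) = c \<odot>\<^bsub>N\<^esub> g (t(i := x))"
  shows "multilin K I M N g"
  using assms unfolding multilin_def by blast

lemma multilinD:
  assumes "multilin K I M N g" "t \<in> (\<Pi>\<^sub>E i\<in>I. carrier (M i))" "i \<in> I"
  shows "x \<in> carrier (M i) \<Longrightarrow> y \<in> carrier (M i) \<Longrightarrow>
     g (t(i := x \<oplus>\<^bsub>M i\<^esub> y)) = g (t(i := x)) \<oplus>\<^bsub>N\<^esub> g (t(i := y))"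
    "c \<in> carrier K \<Longrightarrow> x \<in> carrier (M i) \<Longrightarrow> g (t(i := c \<odot>\<^bsub>M i\<^esub> x)) = c \<odot>\<^bsub>N\<^esub> g (t(i := x))"
  using assms unfolding multilin_def by blast+

lemma multilin_zero:
  assumes m: "multilin K I M N g" and M: "\<And>i. i \<in> I \<Longrightarrow> Module.module K (M i)" and N: "Module.module K N"
    and gc: "g \<in> (\<Pi>\<^sub>E i\<in>I. carrier (M i)) \<rightarrow> carrier N"
    and t: "t \<in> (\<Pi>\<^sub>E i\<in>I. carrier (M i))" and i: "i \<in> I" "t i = \<zero>\<^bsub>M i\<^esub>"
  shows "g t = \<zero>\<^bsub>N\<^esub>"
proof -
  interpret Mi: Module.module K "M i" using M i by blast
  interpret N: Module.module K N by fact
  have "t(i := \<zero>\<^bsub>K\<^esub> \<odot>\<^bsub>M i\<^esub> \<zero>\<^bsub>M i\<^esub>) = t" using i by auto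
  moreover have "t(i := \<zero>\<^bsub>M i\<^esub>) = t" using i by auto
  ultimately have "g t = \<zero>\<^bsub>K\<^esub> \<odot>\<^bsub>N\<^esub> g t"
    using multilinD(2)[OF m t i(1), of "\<zero>\<^bsub>K\<^esub>" "\<zero>\<^bsub>M i\<^esub>"] by simp
  also have "\<dots> = \<zero>\<^bsub>N\<^esub>" using gc t by (intro N.smult_l_null) auto
  finally show ?thesis .
qed

lemma multilin_finsum_slot:
  assumes m: "multilin K I M N g" and M: "\<And>i. i \<in> I \<Longrightarrow> Module.module K (M i)" and N: "Module.module K N"
    and gc: "g \<in> (\<Pi>\<^sub>E i\<in>I. carrier (M i)) \<rightarrow> carrier N"
    and t: "t \<in> (\<Pi>\<^sub>E i\<in>I. carrier (M i))" and i: "i \<in> I"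
    and X: "finite X" and c: "\<And>z. z \<in> X \<Longrightarrow> c z \<in> carrier K" and u: "\<And>z. z \<in> X \<Longrightarrow> u z \<in> carrier (M i)"
  shows "g (t(i := (\<Oplus>\<^bsub>M i\<^esub>z\<in>X. c z \<odot>\<^bsub>M i\<^esub> u z))) = (\<Oplus>\<^bsub>N\<^esub>z\<in>X. c z \<odot>\<^bsub>N\<^esub> g (t(i := u z)))"
proof -
  interpret Mi: Module.module K "M i" using M i by blast
  interpret N: Module.module K N by fact
  have tu: "t(i := x) \<in> (\<Pi>\<^sub>E i\<in>I. carrier (M i))" if "x \<in> carrier (M i)" for x using t i that by auto
  have gu: "g (t(i := x)) \<in> carrier N" if "x \<in> carrier (M i)" for x using gc tu[OF that] by auto
  show ?thesis using X c u
  proof (induction X rule: finite_induct)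
    case empty
    have "g (t(i := \<zero>\<^bsub>M i\<^esub>)) = \<zero>\<^bsub>N\<^esub>"
      by (rule multilin_zero[OF m M N gc tu[OF Mi.M.zero_closed] i]) auto
    thus ?case by (simp add: fun_upd_def)
  next
    case (insert x X)
    have S: "(\<Oplus>\<^bsub>M i\<^esub>z\<in>X. c z \<odot>\<^bsub>M i\<^esub> u z) \<in> carrier (M i)"
      using insert by (intro Mi.M.finsum_closed) auto
    have "(\<Oplus>\<^bsub>M i\<^esub>z\<in>insert x X. c z \<odot>\<^bsub>M i\<^esub> u z) = c x \<odot>\<^bsub>M i\<^esub> u x \<oplus>\<^bsub>M i\<^esub> (\<Oplus>\<^bsub>M i\<^esub>z\<in>X. c z \<odot>\<^bsub>M i\<^esub> u z)"
      using insert by (subst Mi.M.finsum_insert) auto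
    hence "g (t(i := (\<Oplus>\<^bsub>M i\<^esub>z\<in>insert x X. c z \<odot>\<^bsub>M i\<^esub> u z))) =
       g (t(i := c x \<odot>\<^bsub>M i\<^esub> u x)) \<oplus>\<^bsub>N\<^esub> g (t(i := (\<Oplus>\<^bsub>M i\<^esub>z\<in>X. c z \<odot>\<^bsub>M i\<^esub> u z)))"
      using multilinD(1)[OF m t i _ S, of "c x \<odot>\<^bsub>M i\<^esub> u x"] insert.prems by (simp del: fun_upd_apply)
    also have "\<dots> = c x \<odot>\<^bsub>N\<^esub> g (t(i := u x)) \<oplus>\<^bsub>N\<^esub> (\<Oplus>\<^bsub>N\<^esub>z\<in>X. c z \<odot>\<^bsub>N\<^esub> g (t(i := u z)))"
      using insert multilinD(2)[OF m t i, of "c x" "u x"] by (simp del: fun_upd_apply)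
    also have "\<dots> = (\<Oplus>\<^bsub>N\<^esub>z\<in>insert x X. c z \<odot>\<^bsub>N\<^esub> g (t(i := u z)))"
      using insert gu by (subst N.M.finsum_insert) auto
    finally show ?case .
  qed
qed

text \<open>Full distributivity, both for products of finite sums in the ring and for the expansion of an
  elementary tensor in a basis. The proof expands the slots of a growing set \<open>J\<close> and leaves the others at a fixed tuple.\<close>

lemma multilin_expand:
  fixes I :: "'i set" and M :: "'i \<Rightarrow> ('k, 'm) module"
  assumes m: "multilin K I M N g" and M: "\<And>i. i \<in> I \<Longrightarrow> Module.module K (M i)" and N: "Module.module K N"
    and gc: "g \<in> (\<Pi>\<^sub>E i\<in>I. carrier (M i)) \<rightarrow> carrier N"
    and I: "finite I" and X: "finite X"
    and c: "\<And>i z. i \<in> I \<Longrightarrow> z \<in> X \<Longrightarrow> c i z \<in> carrier K"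
    and u: "\<And>i z. i \<in> I \<Longrightarrow> z \<in> X \<Longrightarrow> u i z \<in> carrier (M i)"
  shows "g (\<lambda>i\<in>I. \<Oplus>\<^bsub>M i\<^esub>z\<in>X. c i z \<odot>\<^bsub>M i\<^esub> u i z) =
    (\<Oplus>\<^bsub>N\<^esub>x\<in>I \<rightarrow>\<^sub>E X. (\<Otimes>\<^bsub>K\<^esub>i\<in>I. c i (x i)) \<odot>\<^bsub>N\<^esub> g (\<lambda>i\<in>I. u i (x i)))"
proof -
  interpret N: Module.module K N by fact
  let ?S = "\<lambda>i. \<Oplus>\<^bsub>M i\<^esub>z\<in>X. c i z \<odot>\<^bsub>M i\<^esub> u i z"
  have S: "?S i \<in> carrier (M i)" if "i \<in> I" for i
  proof -
    interpret Mi: Module.module K "M i" using M that by blast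
    show ?thesis using c u that by (intro Mi.M.finsum_closed) auto
  qed
  have "\<forall>t\<in>\<Pi>\<^sub>E i\<in>I. carrier (M i). g (\<lambda>i\<in>I. if i \<in> J then ?S i else t i) =
    (\<Oplus>\<^bsub>N\<^esub>x\<in>J \<rightarrow>\<^sub>E X. (\<Otimes>\<^bsub>K\<^esub>i\<in>J. c i (x i)) \<odot>\<^bsub>N\<^esub> g (\<lambda>i\<in>I. if i \<in> J then u i (x i) else t i))"
    if "finite J" "J \<subseteq> I" for J
    using that
  proof (induction J rule: finite_induct)
    case empty
    show ?case
    proof
      fix t assume t: "t \<in> (\<Pi>\<^sub>E i\<in>I. carrier (M i))"
      have "(\<lambda>i\<in>I. t i) = t" using t by (simp add: PiE_restrict)
      moreover have "g t \<in> carrier N" using gc t by auto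
      ultimately show "g (\<lambda>i\<in>I. if i \<in> {} then ?S i else t i) =
        (\<Oplus>\<^bsub>N\<^esub>x\<in>{} \<rightarrow>\<^sub>E X. (\<Otimes>\<^bsub>K\<^esub>i\<in>{}. c i (x i)) \<odot>\<^bsub>N\<^esub> g (\<lambda>i\<in>I. if i \<in> {} then u i (x i) else t i))"
        by simp
    qed
  next
    case (insert j J)
    have j: "j \<in> I" and J: "J \<subseteq> I" using insert by auto
    show ?case
    proof
      fix t assume t: "t \<in> (\<Pi>\<^sub>E i\<in>I. carrier (M i))"
      let ?s = "\<lambda>x. \<lambda>i\<in>I. if i \<in> J then u i (x i) else t i"
      have s: "?s x \<in> (\<Pi>\<^sub>E i\<in>I. carrier (M i))" if "x \<in> J \<rightarrow>\<^sub>E X" for x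
        using t that u J by (auto simp: PiE_iff)
      have upd: "(?s x)(j := w) \<in> (\<Pi>\<^sub>E i\<in>I. carrier (M i))" if "x \<in> J \<rightarrow>\<^sub>E X" "w \<in> carrier (M j)" for x w
        using PiE_fun_upd[OF that(2) s[OF that(1)]] j by (simp add: insert_absorb)
      have cc: "(\<Otimes>\<^bsub>K\<^esub>i\<in>J. c i (x i)) \<in> carrier K" if "x \<in> J \<rightarrow>\<^sub>E X" for x
        by (rule N.R.finprod_closed) (use that c J in \<open>auto simp: PiE_iff\<close>)
      have T: "(\<Otimes>\<^bsub>K\<^esub>i\<in>insert j J. c i (x i)) \<odot>\<^bsub>N\<^esub> g (\<lambda>i\<in>I. if i \<in> insert j J then u i (x i) else t i) \<in> carrier N"
        if x: "x \<in> insert j J \<rightarrow>\<^sub>E X" for x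
      proof -
        have "(\<Otimes>\<^bsub>K\<^esub>i\<in>insert j J. c i (x i)) \<in> carrier K"
          by (rule N.R.finprod_closed) (use x c J j in \<open>auto simp: PiE_iff\<close>)
        moreover have "(\<lambda>i\<in>I. if i \<in> insert j J then u i (x i) else t i) \<in> (\<Pi>\<^sub>E i\<in>I. carrier (M i))"
          using x t u J j by (auto simp: PiE_iff)
        ultimately show ?thesis by (intro N.smult_closed funcset_mem[OF gc])
      qed
      have ext: "x(j := z) \<in> insert j J \<rightarrow>\<^sub>E X" if "x \<in> J \<rightarrow>\<^sub>E X" "z \<in> X" for x z
        using that by (auto simp: PiE_insert_eq)
      have t': "t(j := ?S j) \<in> (\<Pi>\<^sub>E i\<in>I. carrier (M i))" using t j S by auto
      have A: "(\<lambda>i\<in>I. if i \<in> insert j J then ?S i else t i) = (\<lambda>i\<in>I. if i \<in> J then ?S i else (t(j := ?S j)) i)"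
        using insert by auto
      have "g (\<lambda>i\<in>I. if i \<in> insert j J then ?S i else t i) =
        (\<Oplus>\<^bsub>N\<^esub>x\<in>J \<rightarrow>\<^sub>E X. (\<Otimes>\<^bsub>K\<^esub>i\<in>J. c i (x i)) \<odot>\<^bsub>N\<^esub> g (\<lambda>i\<in>I. if i \<in> J then u i (x i) else (t(j := ?S j)) i))"
        by (intro trans[OF arg_cong[of _ _ g, OF A]] bspec[OF insert.IH[OF J] t'])
      also have "\<dots> = (\<Oplus>\<^bsub>N\<^esub>x\<in>J \<rightarrow>\<^sub>E X. \<Oplus>\<^bsub>N\<^esub>z\<in>X. (\<Otimes>\<^bsub>K\<^esub>i\<in>insert j J. c i ((x(j := z)) i)) \<odot>\<^bsub>N\<^esub>
           g (\<lambda>i\<in>I. if i \<in> insert j J then u i ((x(j := z)) i) else t i))"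
      proof (rule N.M.finsum_cong'[OF refl])
        fix x assume x: "x \<in> J \<rightarrow>\<^sub>E X"
        have gj: "g ((?s x)(j := u j z)) \<in> carrier N" if "z \<in> X" for z
          using gc upd[OF x u[OF j that]] by auto
        have "(\<lambda>i\<in>I. if i \<in> J then u i (x i) else (t(j := ?S j)) i) = (?s x)(j := ?S j)"
          using insert j by auto
        hence "g (\<lambda>i\<in>I. if i \<in> J then u i (x i) else (t(j := ?S j)) i) = g ((?s x)(j := ?S j))"
          by simp
        also have "\<dots> = (\<Oplus>\<^bsub>N\<^esub>z\<in>X. c j z \<odot>\<^bsub>N\<^esub> g ((?s x)(j := u j z)))"
          by (rule multilin_finsum_slot[OF m M N gc s[OF x] j X c[OF j] u[OF j]])
        finally have "(\<Otimes>\<^bsub>K\<^esub>i\<in>J. c i (x i)) \<odot>\<^bsub>N\<^esub> g (\<lambda>i\<in>I. if i \<in> J then u i (x i) else (t(j := ?S j)) i) =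
          (\<Oplus>\<^bsub>N\<^esub>z\<in>X. (\<Otimes>\<^bsub>K\<^esub>i\<in>J. c i (x i)) \<odot>\<^bsub>N\<^esub> (c j z \<odot>\<^bsub>N\<^esub> g ((?s x)(j := u j z))))"
          using N.finsum_smult_ldistr[OF X cc[OF x], of "\<lambda>z. c j z \<odot>\<^bsub>N\<^esub> g ((?s x)(j := u j z))"] gj c[OF j]
          by auto
        also have "\<dots> = (\<Oplus>\<^bsub>N\<^esub>z\<in>X. (\<Otimes>\<^bsub>K\<^esub>i\<in>insert j J. c i ((x(j := z)) i)) \<odot>\<^bsub>N\<^esub>
           g (\<lambda>i\<in>I. if i \<in> insert j J then u i ((x(j := z)) i) else t i))"
        proof (rule N.M.finsum_cong'[OF refl])
          show "(\<lambda>z. (\<Otimes>\<^bsub>K\<^esub>i\<in>insert j J. c i ((x(j := z)) i)) \<odot>\<^bsub>N\<^esub>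
           g (\<lambda>i\<in>I. if i \<in> insert j J then u i ((x(j := z)) i) else t i)) \<in> X \<rightarrow> carrier N"
            by (rule Pi_I) (rule T[OF ext[OF x]])
          fix z assume z: "z \<in> X"
          have a: "(?s x)(j := u j z) = (\<lambda>i\<in>I. if i \<in> insert j J then u i ((x(j := z)) i) else t i)"
            using insert j by (auto simp: fun_eq_iff)
          have "(\<Otimes>\<^bsub>K\<^esub>i\<in>J. c i ((x(j := z)) i)) = (\<Otimes>\<^bsub>K\<^esub>i\<in>J. c i (x i))"
            by (rule N.R.finprod_cong'[OF refl]) (use x J c insert in \<open>auto simp: PiE_iff\<close>)
          moreover have "(\<lambda>i. c i ((x(j := z)) i)) \<in> J \<rightarrow> carrier K"
            using x J c insert z by (auto simp: PiE_iff)
          ultimately have "(\<Otimes>\<^bsub>K\<^esub>i\<in>insert j J. c i ((x(j := z)) i)) = c j z \<otimes>\<^bsub>K\<^esub> (\<Otimes>\<^bsub>K\<^esub>i\<in>J. c i (x i))"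
            using insert c[OF j z] by (subst N.R.finprod_insert) auto
          also have "\<dots> = (\<Otimes>\<^bsub>K\<^esub>i\<in>J. c i (x i)) \<otimes>\<^bsub>K\<^esub> c j z"
            by (rule N.R.m_comm[OF c[OF j z] cc[OF x]])
          finally show "(\<Otimes>\<^bsub>K\<^esub>i\<in>J. c i (x i)) \<odot>\<^bsub>N\<^esub> (c j z \<odot>\<^bsub>N\<^esub> g ((?s x)(j := u j z))) =
            (\<Otimes>\<^bsub>K\<^esub>i\<in>insert j J. c i ((x(j := z)) i)) \<odot>\<^bsub>N\<^esub>
           g (\<lambda>i\<in>I. if i \<in> insert j J then u i ((x(j := z)) i) else t i)"
            using N.smult_assoc1[OF cc[OF x] c[OF j z] gj[OF z]] a by simp
        qed
        finally show "(\<Otimes>\<^bsub>K\<^esub>i\<in>J. c i (x i)) \<odot>\<^bsub>N\<^esub> g (\<lambda>i\<in>I. if i \<in> J then u i (x i) else (t(j := ?S j)) i) = \<dots>" .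
      qed (rule Pi_I, rule N.M.finsum_closed, rule Pi_I, rule T[OF ext])
      also have "\<dots> = (\<Oplus>\<^bsub>N\<^esub>x\<in>insert j J \<rightarrow>\<^sub>E X. (\<Otimes>\<^bsub>K\<^esub>i\<in>insert j J. c i (x i)) \<odot>\<^bsub>N\<^esub>
          g (\<lambda>i\<in>I. if i \<in> insert j J then u i (x i) else t i))"
        by (rule N.M.finsum_PiE_insert[symmetric])
          (use insert J X T in \<open>auto intro: finite_subset[OF _ I]\<close>)
      finally show "g (\<lambda>i\<in>I. if i \<in> insert j J then ?S i else t i) = \<dots>" .
    qed
  qed
  note * = this[OF I subset_refl]
  have e: "(\<lambda>i\<in>I. if i \<in> I then w i else w' i) = (\<lambda>i\<in>I. w i)" for w w' :: "'i \<Rightarrow> 'm"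
    by (auto simp: fun_eq_iff)
  have "(\<lambda>i\<in>I. \<zero>\<^bsub>M i\<^esub>) \<in> (\<Pi>\<^sub>E i\<in>I. carrier (M i))"
  proof (rule PiE_I)
    fix i assume i: "i \<in> I"
    interpret Mi: Module.module K "M i" using M i by blast
    show "(\<lambda>i\<in>I. \<zero>\<^bsub>M i\<^esub>) i \<in> carrier (M i)" using i by simp
  qed simp
  from bspec[OF * this] show ?thesis unfolding e .
qed

section \<open>Coordinates on tensor powers\<close>

text \<open>The elements \<open>[x] - [y]\<close> span the augmentation kernel, and the tensors
  \<open>([p i] - [q i])\<^sub>i\<close> built from them are the elements on which natural transformations are
  evaluated below.\<close>

definition point_diff :: "('k, 'r) ring_scheme \<Rightarrow> 'x \<Rightarrow> 'x \<Rightarrow> 'x \<Rightarrow> 'k" where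
  "point_diff K x y = (\<lambda>s. gen K x s \<ominus>\<^bsub>K\<^esub> gen K y s)"

abbreviation aug_tensor ::
  "('k, 'r) ring_scheme \<Rightarrow> 'i set \<Rightarrow> 'x set \<Rightarrow> ('k, (('i \<Rightarrow> 'x \<Rightarrow> 'k) \<Rightarrow> 'k) set) module" where
  "aug_tensor K I X \<equiv> tensor K I (\<lambda>_. aug_kernel K X)"

definition diff_tensor ::
  "('k, 'r) ring_scheme \<Rightarrow> 'i set \<Rightarrow> 'x set \<Rightarrow> ('i \<Rightarrow> 'x) \<Rightarrow> ('i \<Rightarrow> 'x) \<Rightarrow> (('i \<Rightarrow> 'x \<Rightarrow> 'k) \<Rightarrow> 'k) set" where
  "diff_tensor K I X p q = tensor_elt K I (\<lambda>_. aug_kernel K X) (\<lambda>i\<in>I. point_diff K (p i) (q i))"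

text \<open>The inclusion of the augmentation kernel into \<open>k[X]\<close> embeds its \<open>I\<close>-th tensor power into
  \<open>k[X\<^sup>I]\<close>, the functions on \<open>X\<^sup>I\<close>. Computing with functions avoids all further reasoning about
  presentations of tensor products.\<close>

definition tensor_coord ::
  "('k, 'r) ring_scheme \<Rightarrow> 'i set \<Rightarrow> 'x set \<Rightarrow> (('i \<Rightarrow> 'x \<Rightarrow> 'k) \<Rightarrow> 'k) set \<Rightarrow> ('i \<Rightarrow> 'x) \<Rightarrow> 'k" where
  "tensor_coord K I X = tensor_lift K I (\<lambda>_. aug_kernel K X) (free_module K (I \<rightarrow>\<^sub>E X))
     (\<lambda>t y. if y \<in> I \<rightarrow>\<^sub>E X then \<Otimes>\<^bsub>K\<^esub>i\<in>I. t i (y i) else \<zero>\<^bsub>K\<^esub>)"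

text \<open>The image of the coordinates.\<close>

definition zero_marg :: "('k, 'r) ring_scheme \<Rightarrow> 'i set \<Rightarrow> 'x set \<Rightarrow> (('i \<Rightarrow> 'x) \<Rightarrow> 'k) set" where
  "zero_marg K I X = {\<phi> \<in> carrier (free_module K (I \<rightarrow>\<^sub>E X)).
     \<forall>i\<in>I. \<forall>y\<in>I \<rightarrow>\<^sub>E X. (\<Oplus>\<^bsub>K\<^esub>z\<in>X. \<phi> (y(i := z))) = \<zero>\<^bsub>K\<^esub>}"

text \<open>With the base point \<open>x0\<close> the tensors \<open>([y i] - [x0])\<^sub>i\<close> without a factor zero form a basis. On functions
  with vanishing marginals this is the inverse of the coordinates.\<close>

definition tensor_of ::
  "('k, 'r) ring_scheme \<Rightarrow> 'i set \<Rightarrow> 'x set \<Rightarrow> 'x \<Rightarrow> (('i \<Rightarrow> 'x) \<Rightarrow> 'k) \<Rightarrow> (('i \<Rightarrow> 'x \<Rightarrow> 'k) \<Rightarrow> 'k) set" where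
  "tensor_of K I X x0 = lin_ext K (I \<rightarrow>\<^sub>E X) (aug_tensor K I X) (\<lambda>y. diff_tensor K I X y (\<lambda>_. x0))"

definition push ::
  "('k, 'r) ring_scheme \<Rightarrow> 'i set \<Rightarrow> 'x set \<Rightarrow> 'x set \<Rightarrow> ('x \<Rightarrow> 'x) \<Rightarrow> (('i \<Rightarrow> 'x) \<Rightarrow> 'k) \<Rightarrow> ('i \<Rightarrow> 'x) \<Rightarrow> 'k" where
  "push K I X Y h = lin_ext K (I \<rightarrow>\<^sub>E X) (free_module K (I \<rightarrow>\<^sub>E Y)) (\<lambda>x. gen K (\<lambda>i\<in>I. h (x i)))"

abbreviation aug_mor where
  "aug_mor K I X Y h \<equiv> Mor (tensor_functor K I (\<lambda>_. kbar K)) X Y h"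

lemma Obj_tensor_kbar: "Obj (tensor_functor K I (\<lambda>_. kbar K)) X = aug_tensor K I X"
  by (simp add: tensor_functor_def kbar_def)

lemma finsum_self_module: "finsum (self_module K) f A = finsum K f A"
  by (simp add: finsum_def finprod_def self_module_def)

lemma self_module_simps [simp]:
  "carrier (self_module K) = carrier K" "\<zero>\<^bsub>self_module K\<^esub> = \<zero>\<^bsub>K\<^esub>"
  "x \<oplus>\<^bsub>self_module K\<^esub> y = x \<oplus>\<^bsub>K\<^esub> y" "x \<odot>\<^bsub>self_module K\<^esub> y = x \<otimes>\<^bsub>K\<^esub> y"
  by (simp_all add: self_module_def)

lemma aug_kernel_ops [simp]:
  "\<zero>\<^bsub>aug_kernel K X\<^esub> = (\<lambda>s. \<zero>\<^bsub>K\<^esub>)"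
  "u \<oplus>\<^bsub>aug_kernel K X\<^esub> v = (\<lambda>s. u s \<oplus>\<^bsub>K\<^esub> v s)"
  "c \<odot>\<^bsub>aug_kernel K X\<^esub> v = (\<lambda>s. c \<otimes>\<^bsub>K\<^esub> v s)"
  by (simp_all add: aug_kernel_def free_module_def)

context cring
begin

lemmas R_cring = is_cring

lemma free_module_R: "Module.module R (free_module R S)"
  by (rule free_is_module[OF R_cring])

lemma free_mem: "v \<in> carrier (free_module R S) \<Longrightarrow> v s \<in> carrier R"
  by (simp add: free_carrier)

lemma free_outside: "v \<in> carrier (free_module R S) \<Longrightarrow> s \<notin> S \<Longrightarrow> v s = \<zero>"
  by (simp add: free_carrier)

lemma free_memI:
  "finite S \<Longrightarrow> (\<And>s. v s \<in> carrier R) \<Longrightarrow> (\<And>s. s \<notin> S \<Longrightarrow> v s = \<zero>) \<Longrightarrow> v \<in> carrier (free_module R S)"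
  by (auto simp: free_carrier intro: rev_finite_subset)

lemma gen_closed [simp]: "gen R x s \<in> carrier R"
  by (simp add: gen_def)

lemma point_diff_closed [simp]: "point_diff R x y s \<in> carrier R"
  by (simp add: point_diff_def)

lemma finsum_minus:
  assumes "finite A" "\<And>a. a \<in> A \<Longrightarrow> f a \<in> carrier R" "\<And>a. a \<in> A \<Longrightarrow> g a \<in> carrier R"
  shows "(\<Oplus>a\<in>A. f a \<ominus> g a) = (\<Oplus>a\<in>A. f a) \<ominus> (\<Oplus>a\<in>A. g a)"
  using assms
proof (induction A rule: finite_induct)
  case (insert x A)
  have c: "f x \<in> carrier R" "g x \<in> carrier R" "(\<Oplus>a\<in>A. f a) \<in> carrier R" "(\<Oplus>a\<in>A. g a) \<in> carrier R"
    using insert by (auto intro!: finsum_closed)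
  have "(\<Oplus>a\<in>insert x A. f a \<ominus> g a) = (f x \<ominus> g x) \<oplus> ((\<Oplus>a\<in>A. f a) \<ominus> (\<Oplus>a\<in>A. g a))"
    using insert by (subst finsum_insert) auto
  also have "\<dots> = (f x \<oplus> (\<Oplus>a\<in>A. f a)) \<ominus> (g x \<oplus> (\<Oplus>a\<in>A. g a))"
    using c by (simp add: a_minus_def minus_add a_ac)
  finally show ?case using insert by (simp add: finsum_insert Pi_def)
qed (simp add: a_minus_def)

text \<open>Stated for any module of functions because it serves free modules and augmentation kernels,
  which share their operations but not their carriers.\<close>

lemma finsum_pointwise:
  assumes N: "Module.module R N" and z: "\<zero>\<^bsub>N\<^esub> = (\<lambda>s. \<zero>)"
    and a: "\<And>u v. u \<oplus>\<^bsub>N\<^esub> v = (\<lambda>s. u s \<oplus> v s)"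
    and c: "\<And>v s. v \<in> carrier N \<Longrightarrow> v s \<in> carrier R"
    and "finite A" "\<And>a. a \<in> A \<Longrightarrow> F a \<in> carrier N"
  shows "(\<Oplus>\<^bsub>N\<^esub>a\<in>A. F a) s = (\<Oplus>a\<in>A. F a s)"
proof -
  interpret N: Module.module R N by fact
  show ?thesis using assms(5,6)
    by (induction A rule: finite_induct) (simp_all add: z a c Pi_def)
qed

lemma finsum_free:
  assumes "finite A" "\<And>a. a \<in> A \<Longrightarrow> F a \<in> carrier (free_module R S)"
  shows "(\<Oplus>\<^bsub>free_module R S\<^esub>a\<in>A. F a) s = (\<Oplus>a\<in>A. F a s)"
  by (rule finsum_pointwise[OF free_module_R]) (use assms in \<open>auto simp: free_mem\<close>)

lemma lin_ext_apply:
  assumes "finite S" "g \<in> S \<rightarrow> carrier (free_module R S')" "v \<in> carrier (free_module R S)"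
  shows "lin_ext R S (free_module R S') g v s' = (\<Oplus>s\<in>S. v s \<otimes> g s s')"
proof -
  interpret F: Module.module R "free_module R S'" by (rule free_module_R)
  have e: "lin_ext R S (free_module R S') g v = (\<Oplus>\<^bsub>free_module R S'\<^esub>s\<in>S. v s \<odot>\<^bsub>free_module R S'\<^esub> g s)"
    by (rule lin_ext_sum[OF free_module_R assms(3,2,1)]) (use assms(3) in \<open>auto simp: free_carrier\<close>)
  have "lin_ext R S (free_module R S') g v s' = (\<Oplus>s\<in>S. (v s \<odot>\<^bsub>free_module R S'\<^esub> g s) s')"
    unfolding e by (rule finsum_free[OF assms(1)])
       (use assms(2) free_mem[OF assms(3)] F.smult_closed in \<open>auto simp del: free_ops\<close>)
  thus ?thesis by simp
qed

lemma augmentation_apply: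
  assumes "finite X" "v \<in> carrier (free_module R X)"
  shows "augmentation R X v = (\<Oplus>x\<in>X. v x)"
proof -
  have "augmentation R X v = (\<Oplus>\<^bsub>self_module R\<^esub>x\<in>X. v x \<odot>\<^bsub>self_module R\<^esub> \<one>)"
    unfolding augmentation_def
    by (rule lin_ext_sum[OF self_is_module[OF R_cring] assms(2) _ assms(1)])
       (use assms(2) in \<open>auto simp: free_carrier\<close>)
  thus ?thesis using free_mem[OF assms(2)] by (simp add: finsum_self_module)
qed

lemma aug_kernel_carrier:
  "carrier (aug_kernel R X) = {v \<in> carrier (free_module R X). augmentation R X v = \<zero>}"
  by (simp add: aug_kernel_def a_kernel_def')

lemma aug_kernel_iff:
  "finite X \<Longrightarrow> v \<in> carrier (aug_kernel R X) \<longleftrightarrow> v \<in> carrier (free_module R X) \<and> (\<Oplus>x\<in>X. v x) = \<zero>"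
  by (auto simp: aug_kernel_carrier augmentation_apply)

lemma aug_kernel_mem: "v \<in> carrier (aug_kernel R X) \<Longrightarrow> v s \<in> carrier R"
  by (auto simp: aug_kernel_carrier free_mem)

lemma aug_kernel_module:
  assumes "finite X" shows "Module.module R (aug_kernel R X)"
proof (cases "X = {}")
  case False
  with assms have "X \<in> fin_sets" by (simp add: fin_sets_def)
  from is_fin_functorD(1)[OF kbar_is_functor[OF R_cring] this] show ?thesis by (simp add: kbar_def)
next
  case True
  have "carrier (aug_kernel R X) = carrier (free_module R X)"
    using True by (auto simp: aug_kernel_iff)
  hence "aug_kernel R X = free_module R X" by (simp add: aug_kernel_def)
  thus ?thesis by (simp add: free_module_R)
qed

lemma point_diff_aug:
  assumes "finite X" "x \<in> X" "y \<in> X"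
  shows "point_diff R x y \<in> carrier (aug_kernel R X)"
proof -
  have 1: "point_diff R x y \<in> carrier (free_module R X)"
    by (rule free_memI) (use assms in \<open>auto simp: point_diff_def gen_def a_minus_def\<close>)
  have s: "(\<Oplus>s\<in>X. gen R x s) = \<one>" if "x \<in> X" for x
    using finsum_single[OF assms(1) that, of "gen R x"] by (auto simp: gen_def)
  have "(\<Oplus>s\<in>X. point_diff R x y s) = (\<Oplus>s\<in>X. gen R x s) \<ominus> (\<Oplus>s\<in>X. gen R y s)"
    unfolding point_diff_def by (rule finsum_minus) (use assms in auto)
  also have "\<dots> = \<zero>" using s assms by (simp add: a_minus_def r_neg)
  finally show ?thesis using 1 assms by (simp add: aug_kernel_iff)
qed

lemma tensor_module: "finite X \<Longrightarrow> Module.module R (aug_tensor R I X)"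
  by (rule tensor_facts(1)[OF R_cring]) (rule aug_kernel_module)

lemma tensor_elt_closed:
  "finite X \<Longrightarrow> t \<in> I \<rightarrow>\<^sub>E carrier (aug_kernel R X) \<Longrightarrow>
     tensor_elt R I (\<lambda>_. aug_kernel R X) t \<in> carrier (aug_tensor R I X)"
  by (rule tensor_facts(2)[OF R_cring]) (auto intro: aug_kernel_module)

lemma tensor_elt_multilin:
  "finite X \<Longrightarrow> multilin R I (\<lambda>_. aug_kernel R X) (aug_tensor R I X) (tensor_elt R I (\<lambda>_. aug_kernel R X))"
  by (rule tensor_facts(3)[OF R_cring]) (rule aug_kernel_module)

lemma diff_tuple:
  "finite X \<Longrightarrow> p \<in> I \<rightarrow> X \<Longrightarrow> q \<in> I \<rightarrow> X \<Longrightarrow>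
     (\<lambda>i\<in>I. point_diff R (p i) (q i)) \<in> I \<rightarrow>\<^sub>E carrier (aug_kernel R X)"
  by (auto intro!: point_diff_aug)

lemma diff_tensor_closed:
  "finite X \<Longrightarrow> p \<in> I \<rightarrow> X \<Longrightarrow> q \<in> I \<rightarrow> X \<Longrightarrow> diff_tensor R I X p q \<in> carrier (aug_tensor R I X)"
  unfolding diff_tensor_def by (intro tensor_elt_closed diff_tuple)

lemma finprod_upd:
  assumes "finite I" "i \<in> I" "a \<in> carrier R" "\<And>j. j \<in> I \<Longrightarrow> f j \<in> carrier R"
  shows "(\<Otimes>j\<in>I. (f(i := a)) j) = a \<otimes> (\<Otimes>j\<in>I - {i}. f j)"
proof -
  have "(\<Otimes>j\<in>insert i (I - {i}). (f(i := a)) j) = a \<otimes> (\<Otimes>j\<in>I - {i}. (f(i := a)) j)"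
    using assms by (subst finprod_insert) auto
  also have "(\<Otimes>j\<in>I - {i}. (f(i := a)) j) = (\<Otimes>j\<in>I - {i}. f j)"
    by (rule finprod_cong'[OF refl]) (use assms in auto)
  finally show ?thesis using assms by (simp add: insert_absorb)
qed

lemma finprod_zero:
  assumes "finite I" "i \<in> I" "f i = \<zero>" "\<And>j. j \<in> I \<Longrightarrow> f j \<in> carrier R"
  shows "(\<Otimes>j\<in>I. f j) = \<zero>"
proof -
  have "(\<Otimes>j\<in>I. f j) = (\<Otimes>j\<in>I. (f(i := \<zero>)) j)" using assms(3) by (simp add: fun_upd_idem)
  also have "\<dots> = \<zero>" using assms by (subst finprod_upd) (auto intro!: finprod_closed)
  finally show ?thesis .
qed

lemma finprod_gen:
  assumes "finite I"
  shows "(\<Otimes>i\<in>I. gen R (x i) (y i)) = (if \<forall>i\<in>I. x i = y i then \<one> else \<zero>)"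
proof (cases "\<forall>i\<in>I. x i = y i")
  case True
  thus ?thesis by (auto intro!: finprod_one_eqI simp: gen_def)
next
  case False
  then obtain i where "i \<in> I" "x i \<noteq> y i" by auto
  thus ?thesis using False finprod_zero[OF assms, of i "\<lambda>i. gen R (x i) (y i)"] by (auto simp: gen_def)
qed

lemma finprod_multilin:
  assumes I: "finite I"
  shows "multilin R I (\<lambda>_. self_module R) (self_module R) (\<lambda>t. \<Otimes>i\<in>I. t i)"
proof -
  have e: "(\<Otimes>j\<in>I. (t(i := a)) j) = a \<otimes> (\<Otimes>j\<in>I - {i}. t j)" "(\<Otimes>j\<in>I - {i}. t j) \<in> carrier R"
    if "t \<in> I \<rightarrow>\<^sub>E carrier R" "i \<in> I" "a \<in> carrier R" for t i a
    by (rule finprod_upd[OF I]; use that in auto) (rule finprod_closed, use that in auto)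
  show ?thesis
    by (rule multilinI) (simp_all only: self_module_simps e a_closed m_closed l_distr m_assoc)
qed

lemma finprod_finsum_distrib:
  assumes I: "finite I" and X: "finite X"
    and c: "\<And>i z. i \<in> I \<Longrightarrow> z \<in> X \<Longrightarrow> c i z \<in> carrier R"
    and u: "\<And>i z. i \<in> I \<Longrightarrow> z \<in> X \<Longrightarrow> u i z \<in> carrier R"
  shows "(\<Otimes>i\<in>I. \<Oplus>z\<in>X. c i z \<otimes> u i z) = (\<Oplus>x\<in>I \<rightarrow>\<^sub>E X. (\<Otimes>i\<in>I. c i (x i)) \<otimes> (\<Otimes>i\<in>I. u i (x i)))"
proof -
  note S = self_is_module[OF R_cring]
  have r: "(\<Otimes>i\<in>I. (\<lambda>i\<in>I. w i) i) = (\<Otimes>i\<in>I. w i)" if "\<And>i. i \<in> I \<Longrightarrow> w i \<in> carrier R" for w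
    by (rule finprod_cong'[OF refl]) (use that in auto)
  have "(\<Otimes>i\<in>I. (\<lambda>i\<in>I. \<Oplus>\<^bsub>self_module R\<^esub>z\<in>X. c i z \<odot>\<^bsub>self_module R\<^esub> u i z) i) =
    (\<Oplus>\<^bsub>self_module R\<^esub>x\<in>I \<rightarrow>\<^sub>E X. (\<Otimes>i\<in>I. c i (x i)) \<odot>\<^bsub>self_module R\<^esub> (\<Otimes>i\<in>I. (\<lambda>i\<in>I. u i (x i)) i))"
    by (rule multilin_expand[OF finprod_multilin[OF I] S S _ I X])
       (use c u in \<open>auto intro!: finprod_closed simp: PiE_iff\<close>)
  also have "(\<Otimes>i\<in>I. (\<lambda>i\<in>I. \<Oplus>\<^bsub>self_module R\<^esub>z\<in>X. c i z \<odot>\<^bsub>self_module R\<^esub> u i z) i) = (\<Otimes>i\<in>I. \<Oplus>z\<in>X. c i z \<otimes> u i z)"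
    by (subst r) (use c u in \<open>auto simp: finsum_self_module intro!: finsum_closed\<close>)
  also have "(\<Oplus>\<^bsub>self_module R\<^esub>x\<in>I \<rightarrow>\<^sub>E X. (\<Otimes>i\<in>I. c i (x i)) \<odot>\<^bsub>self_module R\<^esub> (\<Otimes>i\<in>I. (\<lambda>i\<in>I. u i (x i)) i)) =
    (\<Oplus>x\<in>I \<rightarrow>\<^sub>E X. (\<Otimes>i\<in>I. c i (x i)) \<otimes> (\<Otimes>i\<in>I. u i (x i)))"
    unfolding finsum_self_module self_module_simps
    by (rule finsum_cong'[OF refl]) (use c u in \<open>auto simp: PiE_iff r intro!: finprod_closed m_closed\<close>)
  finally show ?thesis .
qed

lemma tensor_coord_hom:
  assumes I: "finite I" and X: "finite X"
  shows "tensor_coord R I X \<in> mod_hom R (aug_tensor R I X) (free_module R (I \<rightarrow>\<^sub>E X))"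
    and "t \<in> I \<rightarrow>\<^sub>E carrier (aug_kernel R X) \<Longrightarrow>
       tensor_coord R I X (tensor_elt R I (\<lambda>_. aug_kernel R X) t) =
         (\<lambda>y. if y \<in> I \<rightarrow>\<^sub>E X then \<Otimes>i\<in>I. t i (y i) else \<zero>)"
proof -
  let ?g = "\<lambda>t y. if y \<in> I \<rightarrow>\<^sub>E X then \<Otimes>i\<in>I. t i (y i) else \<zero>"
  have IX: "finite (I \<rightarrow>\<^sub>E X)" using I X by (intro finite_PiE) auto
  have A: "\<And>i. i \<in> I \<Longrightarrow> Module.module R (aug_kernel R X)" by (rule aug_kernel_module[OF X])
  have tc: "t i s \<in> carrier R" if "t \<in> I \<rightarrow>\<^sub>E carrier (aug_kernel R X)" "i \<in> I" for t i s
    by (rule aug_kernel_mem[OF PiE_mem[OF that]])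
  have P: "(\<Otimes>i\<in>J. t i (y i)) \<in> carrier R" if "t \<in> I \<rightarrow>\<^sub>E carrier (aug_kernel R X)" "J \<subseteq> I" for t y J
    by (rule finprod_closed) (use tc that in auto)
  have g: "?g \<in> (I \<rightarrow>\<^sub>E carrier (aug_kernel R X)) \<rightarrow> carrier (free_module R (I \<rightarrow>\<^sub>E X))"
    by (intro Pi_I free_memI[OF IX]) (auto simp: P)
  have upd: "(\<Otimes>j\<in>I. (t(i := a)) j (y j)) = a (y i) \<otimes> (\<Otimes>j\<in>I - {i}. t j (y j))"
    if "t \<in> I \<rightarrow>\<^sub>E carrier (aug_kernel R X)" "i \<in> I" "a (y i) \<in> carrier R" for t i a y
  proof -
    have "(\<Otimes>j\<in>I. (t(i := a)) j (y j)) = (\<Otimes>j\<in>I. ((\<lambda>j. t j (y j))(i := a (y i))) j)"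
      by (rule finprod_cong'[OF refl]) (use tc that in auto)
    thus ?thesis using finprod_upd[OF I that(2,3), of "\<lambda>j. t j (y j)"] tc that(1) by simp
  qed
  have m: "multilin R I (\<lambda>_. aug_kernel R X) (free_module R (I \<rightarrow>\<^sub>E X)) ?g"
  proof (rule multilinI)
    fix t i u v assume *: "t \<in> I \<rightarrow>\<^sub>E carrier (aug_kernel R X)" "i \<in> I" and u: "u \<in> carrier (aug_kernel R X)"
      and v: "v \<in> carrier (aug_kernel R X)"
    show "?g (t(i := u \<oplus>\<^bsub>aug_kernel R X\<^esub> v)) = ?g (t(i := u)) \<oplus>\<^bsub>free_module R (I \<rightarrow>\<^sub>E X)\<^esub> ?g (t(i := v))"
      using upd[OF *] P[OF *(1), of "I - {i}"] u v by (auto simp: aug_kernel_mem l_distr fun_eq_iff simp del: fun_upd_apply)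
  next
    fix t i c u assume *: "t \<in> I \<rightarrow>\<^sub>E carrier (aug_kernel R X)" "i \<in> I" and u: "u \<in> carrier (aug_kernel R X)"
      and c: "c \<in> carrier R"
    show "?g (t(i := c \<odot>\<^bsub>aug_kernel R X\<^esub> u)) = c \<odot>\<^bsub>free_module R (I \<rightarrow>\<^sub>E X)\<^esub> ?g (t(i := u))"
      using upd[OF *] P[OF *(1), of "I - {i}"] u c by (auto simp: aug_kernel_mem m_assoc fun_eq_iff simp del: fun_upd_apply)
  qed
  show "tensor_coord R I X \<in> mod_hom R (aug_tensor R I X) (free_module R (I \<rightarrow>\<^sub>E X))"
    unfolding tensor_coord_def by (rule tensor_lift_hom(1)[OF R_cring A free_module_R g m])
  show "tensor_coord R I X (tensor_elt R I (\<lambda>_. aug_kernel R X) t) = ?g t"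
    if "t \<in> I \<rightarrow>\<^sub>E carrier (aug_kernel R X)"
    unfolding tensor_coord_def by (rule tensor_lift_hom(2)[OF R_cring A free_module_R g m that])
qed

lemma tensor_coord_diff:
  assumes "finite I" "finite X" "p \<in> I \<rightarrow> X" "q \<in> I \<rightarrow> X" "y \<in> I \<rightarrow>\<^sub>E X"
  shows "tensor_coord R I X (diff_tensor R I X p q) y = (\<Otimes>i\<in>I. point_diff R (p i) (q i) (y i))"
proof -
  have "tensor_coord R I X (diff_tensor R I X p q) y = (\<Otimes>i\<in>I. (\<lambda>i\<in>I. point_diff R (p i) (q i)) i (y i))"
    unfolding diff_tensor_def using assms by (subst tensor_coord_hom(2)) (auto intro!: point_diff_aug)
  also have "\<dots> = (\<Otimes>i\<in>I. point_diff R (p i) (q i) (y i))"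
    by (rule finprod_cong'[OF refl]) auto
  finally show ?thesis .
qed

lemma tensor_coord_zero_marg:
  assumes I: "finite I" and X: "finite X" and T: "T \<in> carrier (aug_tensor R I X)"
  shows "tensor_coord R I X T \<in> zero_marg R I X"
proof -
  let ?F = "free_module R (I \<rightarrow>\<^sub>E X)" and ?J = "tensor_coord R I X"
  note J = tensor_coord_hom(1)[OF I X]
  have "(\<Oplus>z\<in>X. ?J T (y(i := z))) = \<zero>" if i: "i \<in> I" and y: "y \<in> I \<rightarrow>\<^sub>E X" for i y
  proof -
    let ?m = "\<lambda>\<phi>\<in>carrier ?F. \<Oplus>z\<in>X. \<phi> (y(i := z))"
    have m: "?m \<in> mod_hom R ?F (self_module R)"
    proof (rule mod_homI)
      fix u v assume "u \<in> carrier ?F" "v \<in> carrier ?F"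
      thus "?m (u \<oplus>\<^bsub>?F\<^esub> v) = ?m u \<oplus>\<^bsub>self_module R\<^esub> ?m v"
        using module_closed(1)[OF free_module_R, of u "I \<rightarrow>\<^sub>E X" v]
        by (auto intro!: finsum_addf simp: free_mem Pi_def simp del: fun_upd_apply)
    next
      fix c u assume "c \<in> carrier R" "u \<in> carrier ?F"
      thus "?m (c \<odot>\<^bsub>?F\<^esub> u) = c \<odot>\<^bsub>self_module R\<^esub> ?m u"
        using module_closed(2)[OF free_module_R, of c u "I \<rightarrow>\<^sub>E X"] X
        by (auto intro!: finsum_rdistr[symmetric] simp: free_mem Pi_def simp del: fun_upd_apply)
    qed (auto intro!: finsum_closed simp: free_mem)
    note S = self_is_module[OF R_cring] and TM = tensor_module[OF X]
    have "compose (carrier (aug_tensor R I X)) ?m ?J T = (\<lambda>x\<in>carrier (aug_tensor R I X). \<zero>\<^bsub>self_module R\<^esub>) T"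
    proof (rule tensor_hom_ext[OF R_cring aug_kernel_module[OF X] S mod_hom_comp[OF TM J m] zero_mod_hom[OF TM S] _ T])
      fix t assume t: "t \<in> I \<rightarrow>\<^sub>E carrier (aug_kernel R X)"
      note te = tensor_elt_closed[OF X t]
      have tc: "t i s \<in> carrier R" if "i \<in> I" for i s
        by (rule aug_kernel_mem[OF PiE_mem[OF t that]])
      have P: "(\<Otimes>j\<in>I - {i}. t j (y j)) \<in> carrier R"
        by (rule finprod_closed) (use tc in auto)
      have "(\<Oplus>z\<in>X. ?J (tensor_elt R I (\<lambda>_. aug_kernel R X) t) (y(i := z))) =
        (\<Oplus>z\<in>X. t i z \<otimes> (\<Otimes>j\<in>I - {i}. t j (y j)))"
      proof (rule finsum_cong'[OF refl])
        fix z assume z: "z \<in> X"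
        have "(\<Otimes>j\<in>I. t j ((y(i := z)) j)) = (\<Otimes>j\<in>I. ((\<lambda>j. t j (y j))(i := t i z)) j)"
          by (rule finprod_cong'[OF refl]) (use tc i in auto)
        also have "\<dots> = t i z \<otimes> (\<Otimes>j\<in>I - {i}. t j (y j))"
          by (rule finprod_upd[OF I i]) (use tc i in auto)
        finally show "?J (tensor_elt R I (\<lambda>_. aug_kernel R X) t) (y(i := z)) = t i z \<otimes> (\<Otimes>j\<in>I - {i}. t j (y j))"
          using PiE_fun_upd[OF z y, of i] i by (simp add: tensor_coord_hom(2)[OF I X t] insert_absorb del: fun_upd_apply)
      qed (use tc i P in auto)
      also have "\<dots> = (\<Oplus>z\<in>X. t i z) \<otimes> (\<Otimes>j\<in>I - {i}. t j (y j))"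
        by (rule finsum_ldistr[symmetric]) (use X P tc i in auto)
      also have "(\<Oplus>z\<in>X. t i z) = \<zero>"
        using t i aug_kernel_iff[OF X, of "t i"] by auto
      finally show "compose (carrier (aug_tensor R I X)) ?m ?J (tensor_elt R I (\<lambda>_. aug_kernel R X) t) =
         (\<lambda>x\<in>carrier (aug_tensor R I X). \<zero>\<^bsub>self_module R\<^esub>) (tensor_elt R I (\<lambda>_. aug_kernel R X) t)"
        using te P mod_homD(1)[OF J te] by (simp add: compose_def del: fun_upd_apply)
    qed
    thus ?thesis using T mod_homD(1)[OF J T] by (simp add: compose_def)
  qed
  thus ?thesis using mod_homD(1)[OF J T] by (simp add: zero_marg_def)
qed

lemma zero_marg_free: "\<phi> \<in> zero_marg R I X \<Longrightarrow> \<phi> \<in> carrier (free_module R (I \<rightarrow>\<^sub>E X))"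
  by (simp add: zero_marg_def)

lemma zero_margD:
  "\<phi> \<in> zero_marg R I X \<Longrightarrow> i \<in> I \<Longrightarrow> y \<in> I \<rightarrow>\<^sub>E X \<Longrightarrow> (\<Oplus>z\<in>X. \<phi> (y(i := z))) = \<zero>"
  by (simp add: zero_marg_def)

text \<open>A vanishing marginal expresses a value at a point with a coordinate \<open>x0\<close> by values at points
  with fewer such coordinates. So the values away from \<open>x0\<close> determine the function, in agreement
  with the rank \<open>(|X| - 1)\<^bsup>|I|\<^esup>\<close> of the tensor power.\<close>

lemma zero_marg_eqI:
  assumes I: "finite I" and X: "finite X" "x0 \<in> X"
    and \<phi>: "\<phi> \<in> zero_marg R I X" and \<psi>: "\<psi> \<in> zero_marg R I X"
    and eq: "\<And>y. y \<in> I \<rightarrow>\<^sub>E (X - {x0}) \<Longrightarrow> \<phi> y = \<psi> y"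
  shows "\<phi> = \<psi>"
proof
  fix y
  have c: "\<phi> y \<in> carrier R" "\<psi> y \<in> carrier R" for y
    using \<phi> \<psi> by (auto simp: zero_marg_def free_mem)
  show "\<phi> y = \<psi> y"
  proof (cases "y \<in> I \<rightarrow>\<^sub>E X")
    case False
    thus ?thesis using free_outside[OF zero_marg_free[OF \<phi>]] free_outside[OF zero_marg_free[OF \<psi>]] by metis
  next
    case True
    thus ?thesis
    proof (induction "card {i \<in> I. y i = x0}" arbitrary: y rule: less_induct)
      case less
      show ?case
      proof (cases "\<exists>i\<in>I. y i = x0")
        case False
        hence "y \<in> I \<rightarrow>\<^sub>E (X - {x0})" using less.prems by (auto simp: PiE_iff)
        thus ?thesis by (rule eq)
      next
        case True
        then obtain i where i: "i \<in> I" "y i = x0" by blast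
        have s: "\<chi> y \<oplus> (\<Oplus>z\<in>X - {x0}. \<chi> (y(i := z))) = \<zero>"
          if "\<chi> \<in> zero_marg R I X" "\<And>y. \<chi> y \<in> carrier R" for \<chi>
        proof -
          have "(\<Oplus>z\<in>insert x0 (X - {x0}). \<chi> (y(i := z))) = \<chi> (y(i := x0)) \<oplus> (\<Oplus>z\<in>X - {x0}. \<chi> (y(i := z)))"
            using that X by (subst finsum_insert) auto
          moreover have "y(i := x0) = y" using i by auto
          ultimately show ?thesis using zero_margD[OF that(1) i(1) less.prems] X by (simp add: insert_absorb)
        qed
        have e: "(\<Oplus>z\<in>X - {x0}. \<phi> (y(i := z))) = (\<Oplus>z\<in>X - {x0}. \<psi> (y(i := z)))"
        proof (rule finsum_cong'[OF refl])
          fix z assume z: "z \<in> X - {x0}"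
          show "\<phi> (y(i := z)) = \<psi> (y(i := z))"
          proof (rule less.hyps)
            show "y(i := z) \<in> I \<rightarrow>\<^sub>E X" using PiE_fun_upd[of z "\<lambda>_. X" i y I] z i less.prems by (simp add: insert_absorb)
            have "{j \<in> I. (y(i := z)) j = x0} \<subset> {j \<in> I. y j = x0}" using i z by auto
            thus "card {j \<in> I. (y(i := z)) j = x0} < card {j \<in> I. y j = x0}" using I by (intro psubset_card_mono) auto
          qed
        qed (use c in auto)
        have "\<ominus> (\<Oplus>z\<in>X - {x0}. \<psi> (y(i := z))) = \<phi> y" "\<ominus> (\<Oplus>z\<in>X - {x0}. \<psi> (y(i := z))) = \<psi> y"
          using s[OF \<phi> c(1)] s[OF \<psi> c(2)] c unfolding e by (auto intro!: minus_equality finsum_closed)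
        thus ?thesis by simp
      qed
    qed
  qed
qed

lemma finsum_gen:
  assumes "finite S" "v \<in> carrier (free_module R S)"
  shows "(\<Oplus>s\<in>S. v s \<otimes> gen R s t) = v t"
proof (cases "t \<in> S")
  case True
  have "(\<Oplus>s\<in>S. v s \<otimes> gen R s t) = v t \<otimes> gen R t t"
    by (rule finsum_single[OF assms(1) True]) (use free_mem[OF assms(2)] in \<open>auto simp: gen_def\<close>)
  thus ?thesis using free_mem[OF assms(2)] by (simp add: gen_def)
next
  case False
  hence "(\<Oplus>s\<in>S. v s \<otimes> gen R s t) = \<zero>"
    by (intro finsum_all_zero) (use free_mem[OF assms(2)] in \<open>auto simp: gen_def\<close>)
  thus ?thesis using free_outside[OF assms(2) False] by simp
qed

text \<open>Summing \<open>v z ([z] - [x0])\<close> gives \<open>v - (\<Sum>z. v z) [x0]\<close>, and the correction vanishes.\<close>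

lemma aug_kernel_expand:
  assumes X: "finite X" "x0 \<in> X" and v: "v \<in> carrier (aug_kernel R X)"
  shows "(\<Oplus>\<^bsub>aug_kernel R X\<^esub>z\<in>X. v z \<odot>\<^bsub>aug_kernel R X\<^esub> point_diff R z x0) = v"
proof
  fix s
  interpret A: Module.module R "aug_kernel R X" by (rule aug_kernel_module[OF X(1)])
  note vc = aug_kernel_mem[OF v]
  have vf: "v \<in> carrier (free_module R X)" and v0: "(\<Oplus>z\<in>X. v z) = \<zero>"
    using v aug_kernel_iff[OF X(1)] by auto
  have "(\<Oplus>\<^bsub>aug_kernel R X\<^esub>z\<in>X. v z \<odot>\<^bsub>aug_kernel R X\<^esub> point_diff R z x0) s =
     (\<Oplus>z\<in>X. (v z \<odot>\<^bsub>aug_kernel R X\<^esub> point_diff R z x0) s)"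
    by (rule finsum_pointwise[OF A.module_axioms])
       (use X vc A.smult_closed[OF vc point_diff_aug[OF X(1) _ X(2)]] in \<open>auto simp: aug_kernel_mem\<close>)
  also have "\<dots> = (\<Oplus>z\<in>X. v z \<otimes> gen R z s \<ominus> v z \<otimes> gen R x0 s)"
    by (rule finsum_cong'[OF refl]) (use vc in \<open>auto simp: point_diff_def a_minus_def r_distr r_minus\<close>)
  also have "\<dots> = (\<Oplus>z\<in>X. v z \<otimes> gen R z s) \<ominus> (\<Oplus>z\<in>X. v z \<otimes> gen R x0 s)"
    by (rule finsum_minus) (use X vc in auto)
  also have "(\<Oplus>z\<in>X. v z \<otimes> gen R x0 s) = (\<Oplus>z\<in>X. v z) \<otimes> gen R x0 s"
    by (rule finsum_ldistr[symmetric]) (use X vc in auto)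
  finally show "(\<Oplus>\<^bsub>aug_kernel R X\<^esub>z\<in>X. v z \<odot>\<^bsub>aug_kernel R X\<^esub> point_diff R z x0) s = v s"
    using vc by (simp add: v0 finsum_gen[OF X(1) vf] a_minus_def)
qed

lemma tensor_of_hom:
  assumes "finite I" "finite X" "x0 \<in> X"
  shows "tensor_of R I X x0 \<in> mod_hom R (free_module R (I \<rightarrow>\<^sub>E X)) (aug_tensor R I X)"
    "y \<in> I \<rightarrow>\<^sub>E X \<Longrightarrow> tensor_of R I X x0 (gen R y) = diff_tensor R I X y (\<lambda>_. x0)"
proof -
  have g: "(\<lambda>y. diff_tensor R I X y (\<lambda>_. x0)) \<in> (I \<rightarrow>\<^sub>E X) \<rightarrow> carrier (aug_tensor R I X)"
    by (rule Pi_I, rule diff_tensor_closed) (use assms in auto)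
  show "tensor_of R I X x0 \<in> mod_hom R (free_module R (I \<rightarrow>\<^sub>E X)) (aug_tensor R I X)"
    unfolding tensor_of_def by (rule lin_ext_hom[OF tensor_module[OF assms(2)] g])
  show "y \<in> I \<rightarrow>\<^sub>E X \<Longrightarrow> tensor_of R I X x0 (gen R y) = diff_tensor R I X y (\<lambda>_. x0)"
    unfolding tensor_of_def by (rule lin_ext_gen[OF tensor_module[OF assms(2)] g])
qed

text \<open>For an elementary tensor \<open>t\<close> each slot expands as \<open>\<Sum>z. t\<^sub>i(z) ([z] - [x0])\<close>, and full
  distributivity produces exactly the coefficients \<open>\<Prod>i. t\<^sub>i(x\<^sub>i)\<close>, the coordinates of \<open>t\<close>.\<close>

lemma tensor_of_coord:
  assumes I: "finite I" and X: "finite X" "x0 \<in> X" and T: "T \<in> carrier (aug_tensor R I X)"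
  shows "tensor_of R I X x0 (tensor_coord R I X T) = T"
proof -
  let ?T = "aug_tensor R I X" and ?J = "tensor_coord R I X" and ?e = "tensor_elt R I (\<lambda>_. aug_kernel R X)"
  interpret T: Module.module R ?T by (rule tensor_module[OF X(1)])
  have IX: "finite (I \<rightarrow>\<^sub>E X)" using I X by (intro finite_PiE) auto
  note J = tensor_coord_hom(1)[OF I X(1)]
  have g: "(\<lambda>y. diff_tensor R I X y (\<lambda>_. x0)) \<in> (I \<rightarrow>\<^sub>E X) \<rightarrow> carrier ?T"
    by (rule Pi_I, rule diff_tensor_closed) (use X in auto)
  note id = id_mod_hom[OF T.module_axioms]
  have "compose (carrier ?T) (tensor_of R I X x0) ?J T = (\<lambda>x\<in>carrier ?T. x) T"
  proof (rule tensor_hom_ext[OF R_cring aug_kernel_module[OF X(1)] T.module_axioms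
        mod_hom_comp[OF T.module_axioms J tensor_of_hom(1)[OF I X]] id _ T])
    fix t assume t: "t \<in> I \<rightarrow>\<^sub>E carrier (aug_kernel R X)"
    have te: "?e t \<in> carrier ?T" by (rule tensor_elt_closed[OF X(1) t])
    have tc: "t i s \<in> carrier R" if "i \<in> I" for i s
      by (rule aug_kernel_mem[OF PiE_mem[OF t that]])
    have P: "(\<Otimes>i\<in>I. t i (y i)) \<in> carrier R" for y
      by (rule finprod_closed) (use tc in auto)
    have gen: "?e \<in> (I \<rightarrow>\<^sub>E carrier (aug_kernel R X)) \<rightarrow> carrier ?T"
      by (rule Pi_I) (rule tensor_elt_closed[OF X(1)])
    have "t = (\<lambda>i\<in>I. \<Oplus>\<^bsub>aug_kernel R X\<^esub>z\<in>X. t i z \<odot>\<^bsub>aug_kernel R X\<^esub> point_diff R z x0)"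
    proof
      fix i
      show "t i = (\<lambda>i\<in>I. \<Oplus>\<^bsub>aug_kernel R X\<^esub>z\<in>X. t i z \<odot>\<^bsub>aug_kernel R X\<^esub> point_diff R z x0) i"
      proof (cases "i \<in> I")
        case True
        show ?thesis using True aug_kernel_expand[OF X PiE_mem[OF t True]] by (simp del: aug_kernel_ops)
      qed (use t in \<open>auto simp: PiE_iff extensional_def\<close>)
    qed
    hence "?e t = ?e (\<lambda>i\<in>I. \<Oplus>\<^bsub>aug_kernel R X\<^esub>z\<in>X. t i z \<odot>\<^bsub>aug_kernel R X\<^esub> point_diff R z x0)" by (rule arg_cong)
    also have "\<dots> = (\<Oplus>\<^bsub>?T\<^esub>x\<in>I \<rightarrow>\<^sub>E X. (\<Otimes>i\<in>I. t i (x i)) \<odot>\<^bsub>?T\<^esub> ?e (\<lambda>i\<in>I. point_diff R (x i) x0))"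
      by (rule multilin_expand[OF tensor_elt_multilin[OF X(1)] aug_kernel_module[OF X(1)] T.module_axioms gen I X(1) tc])
         (use point_diff_aug[OF X(1) _ X(2)] in auto)
    also have "\<dots> = (\<Oplus>\<^bsub>?T\<^esub>x\<in>I \<rightarrow>\<^sub>E X. ?J (?e t) x \<odot>\<^bsub>?T\<^esub> diff_tensor R I X x (\<lambda>_. x0))"
    proof (rule T.M.finsum_cong'[OF refl])
      fix x assume x: "x \<in> I \<rightarrow>\<^sub>E X"
      have "?J (?e t) x = (\<Otimes>i\<in>I. t i (x i))" unfolding tensor_coord_hom(2)[OF I X(1) t] using x by (rule if_P)
      thus "(\<Otimes>i\<in>I. t i (x i)) \<odot>\<^bsub>?T\<^esub> ?e (\<lambda>i\<in>I. point_diff R (x i) x0) = ?J (?e t) x \<odot>\<^bsub>?T\<^esub> diff_tensor R I X x (\<lambda>_. x0)"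
        unfolding diff_tensor_def by (simp only:)
    qed (rule Pi_I, rule T.smult_closed[OF free_mem[OF mod_homD(1)[OF J te]] funcset_mem[OF g]])
    also have "\<dots> = tensor_of R I X x0 (?J (?e t))"
      unfolding tensor_of_def
      by (rule lin_ext_sum[OF T.module_axioms mod_homD(1)[OF J te] g IX subset_refl, symmetric])
         (use mod_homD(1)[OF J te] in \<open>auto simp: free_carrier\<close>)
    finally show "compose (carrier ?T) (tensor_of R I X x0) ?J (?e t) = (\<lambda>x\<in>carrier ?T. x) (?e t)"
      using te by (simp add: compose_def)
  qed
  thus ?thesis using T by (simp add: compose_def)
qed

lemma tensor_coord_inj:
  assumes "finite I" "finite X" "X \<noteq> {}" "S \<in> carrier (aug_tensor R I X)" "T \<in> carrier (aug_tensor R I X)"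
    "tensor_coord R I X S = tensor_coord R I X T"
  shows "S = T"
proof -
  obtain x0 where x0: "x0 \<in> X" using assms(3) by auto
  have "S = tensor_of R I X x0 (tensor_coord R I X S)" by (rule tensor_of_coord[OF assms(1,2) x0 assms(4), symmetric])
  also have "\<dots> = tensor_of R I X x0 (tensor_coord R I X T)" by (rule arg_cong[OF assms(6)])
  also have "\<dots> = T" by (rule tensor_of_coord[OF assms(1,2) x0 assms(5)])
  finally show ?thesis .
qed

text \<open>Both sides have vanishing marginals, so they may be compared at points with no coordinate \<open>x0\<close>,
  where \<open>\<Prod>i. ([x\<^sub>i] - [x0])(y\<^sub>i)\<close> is just the indicator of \<open>x = y\<close>.\<close>

lemma tensor_coord_of:
  assumes I: "finite I" and X: "finite X" "x0 \<in> X" and \<phi>: "\<phi> \<in> zero_marg R I X"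
  shows "tensor_coord R I X (tensor_of R I X x0 \<phi>) = \<phi>"
proof (rule zero_marg_eqI[OF I X _ \<phi>])
  let ?T = "aug_tensor R I X" and ?J = "tensor_coord R I X" and ?F = "free_module R (I \<rightarrow>\<^sub>E X)"
  have IX: "finite (I \<rightarrow>\<^sub>E X)" using I X by (intro finite_PiE) auto
  note J = tensor_coord_hom(1)[OF I X(1)] and tof = tensor_of_hom(1)[OF I X] and \<phi>F = zero_marg_free[OF \<phi>]
  show "?J (tensor_of R I X x0 \<phi>) \<in> zero_marg R I X"
    by (rule tensor_coord_zero_marg[OF I X(1) mod_homD(1)[OF tof \<phi>F]])
  fix y assume y: "y \<in> I \<rightarrow>\<^sub>E (X - {x0})"
  let ?h = "compose (carrier ?F) ?J (tensor_of R I X x0)"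
  have h: "?h \<in> mod_hom R ?F ?F" by (rule mod_hom_comp[OF free_module_R tof J])
  have hg: "?h (gen R x) = ?J (diff_tensor R I X x (\<lambda>_. x0))" if "x \<in> I \<rightarrow>\<^sub>E X" for x
    using that by (simp add: compose_def gen_carrier[OF R_cring] tensor_of_hom(2)[OF I X])
  have hc: "?h (gen R x) \<in> carrier ?F" if "x \<in> I \<rightarrow>\<^sub>E X" for x
    by (rule mod_homD(1)[OF h gen_carrier[OF R_cring that]])
  have "?J (tensor_of R I X x0 \<phi>) y = ?h \<phi> y" using \<phi>F by (simp add: compose_def)
  also have "?h \<phi> = lin_ext R (I \<rightarrow>\<^sub>E X) ?F (\<lambda>x. ?h (gen R x)) \<phi>"
    by (rule mod_hom_eqI[OF free_module_R R_cring h \<phi>F])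
  also have "\<dots> y = (\<Oplus>x\<in>I \<rightarrow>\<^sub>E X. \<phi> x \<otimes> ?h (gen R x) y)"
    by (rule lin_ext_apply[OF IX _ \<phi>F]) (use hc in auto)
  also have "\<dots> = (\<Oplus>x\<in>I \<rightarrow>\<^sub>E X. \<phi> x \<otimes> gen R x y)"
  proof (rule finsum_cong'[OF refl])
    fix x assume x: "x \<in> I \<rightarrow>\<^sub>E X"
    have yX: "y \<in> I \<rightarrow>\<^sub>E X" using y by (auto simp: PiE_iff)
    have "?J (diff_tensor R I X x (\<lambda>_. x0)) y = (\<Otimes>i\<in>I. point_diff R (x i) x0 (y i))"
      by (rule tensor_coord_diff[OF I X(1) _ _ yX]) (use x X in auto)
    also have "\<dots> = (\<Otimes>i\<in>I. gen R (x i) (y i))"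
      by (rule finprod_cong'[OF refl]) (use y in \<open>auto simp: point_diff_def gen_def PiE_iff a_minus_def\<close>)
    also have "\<dots> = gen R x y"
    proof -
      have "(\<forall>i\<in>I. x i = y i) \<longleftrightarrow> y = x" using x yX by (metis PiE_ext)
      thus ?thesis unfolding finprod_gen[OF I] by (simp add: gen_def)
    qed
    finally show "\<phi> x \<otimes> ?h (gen R x) y = \<phi> x \<otimes> gen R x y" using hg[OF x] by simp
  qed (use free_mem[OF \<phi>F] in auto)
  also have "\<dots> = \<phi> y" by (rule finsum_gen[OF IX \<phi>F])
  finally show "?J (tensor_of R I X x0 \<phi>) y = \<phi> y" .
qed

lemma push_hom:
  assumes "finite I" "finite X" "finite Y" "h \<in> X \<rightarrow> Y"
  shows "push R I X Y h \<in> mod_hom R (free_module R (I \<rightarrow>\<^sub>E X)) (free_module R (I \<rightarrow>\<^sub>E Y))"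
    "x \<in> I \<rightarrow>\<^sub>E X \<Longrightarrow> push R I X Y h (gen R x) = gen R (\<lambda>i\<in>I. h (x i))"
    "\<phi> \<in> carrier (free_module R (I \<rightarrow>\<^sub>E X)) \<Longrightarrow>
       push R I X Y h \<phi> y = (\<Oplus>x\<in>I \<rightarrow>\<^sub>E X. if (\<lambda>i\<in>I. h (x i)) = y then \<phi> x else \<zero>)"
proof -
  have IX: "finite (I \<rightarrow>\<^sub>E X)" using assms by (intro finite_PiE) auto
  have g: "(\<lambda>x. gen R (\<lambda>i\<in>I. h (x i))) \<in> (I \<rightarrow>\<^sub>E X) \<rightarrow> carrier (free_module R (I \<rightarrow>\<^sub>E Y))"
    by (rule Pi_I, rule gen_carrier[OF R_cring]) (use assms(4) in \<open>auto simp: PiE_iff\<close>)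
  show "push R I X Y h \<in> mod_hom R (free_module R (I \<rightarrow>\<^sub>E X)) (free_module R (I \<rightarrow>\<^sub>E Y))"
    unfolding push_def by (rule lin_ext_hom[OF free_module_R g])
  show "x \<in> I \<rightarrow>\<^sub>E X \<Longrightarrow> push R I X Y h (gen R x) = gen R (\<lambda>i\<in>I. h (x i))"
    unfolding push_def by (rule lin_ext_gen[OF free_module_R g])
  show "push R I X Y h \<phi> y = (\<Oplus>x\<in>I \<rightarrow>\<^sub>E X. if (\<lambda>i\<in>I. h (x i)) = y then \<phi> x else \<zero>)"
    if \<phi>: "\<phi> \<in> carrier (free_module R (I \<rightarrow>\<^sub>E X))"
    unfolding push_def lin_ext_apply[OF IX g \<phi>]
    by (rule finsum_cong'[OF refl]) (use free_mem[OF \<phi>] in \<open>auto simp: gen_def\<close>)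
qed

text \<open>The two cases of pushing forward that occur when naturality is exploited: a point with exactly
  one preimage and, next, a point with none.\<close>

lemma push_single:
  assumes "finite I" "finite X" "finite Y" "h \<in> X \<rightarrow> Y" "\<phi> \<in> carrier (free_module R (I \<rightarrow>\<^sub>E X))"
    and x: "x \<in> I \<rightarrow>\<^sub>E X" "(\<lambda>i\<in>I. h (x i)) = y"
    and u: "\<And>x'. x' \<in> I \<rightarrow>\<^sub>E X \<Longrightarrow> (\<lambda>i\<in>I. h (x' i)) = y \<Longrightarrow> x' = x"
  shows "push R I X Y h \<phi> y = \<phi> x"
proof -
  have IX: "finite (I \<rightarrow>\<^sub>E X)" using assms(1,2) by (intro finite_PiE) auto
  have "(\<Oplus>x\<in>I \<rightarrow>\<^sub>E X. if (\<lambda>i\<in>I. h (x i)) = y then \<phi> x else \<zero>) =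
      (if (\<lambda>i\<in>I. h (x i)) = y then \<phi> x else \<zero>)"
  proof (rule finsum_single[OF IX x(1)])
    show "(if (\<lambda>i\<in>I. h (x i)) = y then \<phi> x else \<zero>) \<in> carrier R"
      using free_mem[OF assms(5)] by (metis zero_closed)
    show "(if (\<lambda>i\<in>I. h (x' i)) = y then \<phi> x' else \<zero>) = \<zero>"
      if "x' \<in> I \<rightarrow>\<^sub>E X" "x' \<noteq> x" for x'
      using u[OF that(1)] that(2) by metis
  qed
  also have "\<dots> = \<phi> x" using x(2) by (rule if_P)
  finally show ?thesis unfolding push_hom(3)[OF assms(1-5)] .
qed

lemma push_none:
  assumes "finite I" "finite X" "finite Y" "h \<in> X \<rightarrow> Y" "\<phi> \<in> carrier (free_module R (I \<rightarrow>\<^sub>E X))"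
    and "\<And>x. x \<in> I \<rightarrow>\<^sub>E X \<Longrightarrow> (\<lambda>i\<in>I. h (x i)) \<noteq> y"
  shows "push R I X Y h \<phi> y = \<zero>"
  unfolding push_hom(3)[OF assms(1-5)] by (rule finsum_all_zero) (use assms(6) in auto)

lemma aug_mor_hom:
  assumes "X \<in> fin_sets" "Y \<in> fin_sets" "h \<in> X \<rightarrow>\<^sub>E Y"
  shows "aug_mor R I X Y h \<in> mod_hom R (aug_tensor R I X) (aug_tensor R I Y)"
    "t \<in> I \<rightarrow>\<^sub>E carrier (aug_kernel R X) \<Longrightarrow>
      aug_mor R I X Y h (tensor_elt R I (\<lambda>_. aug_kernel R X) t) =
        tensor_elt R I (\<lambda>_. aug_kernel R Y) (\<lambda>i\<in>I. Mor (kbar R) X Y h (t i))"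
proof -
  have fin: "finite X" "finite Y" using assms by (auto simp: fin_sets_def)
  have m: "aug_mor R I X Y h = tensor_lift R I (\<lambda>_. aug_kernel R X) (aug_tensor R I Y)
     (\<lambda>t. tensor_elt R I (\<lambda>_. aug_kernel R Y) (\<lambda>i\<in>I. Mor (kbar R) X Y h (t i)))"
    by (simp add: tensor_functor_def kbar_def)
  have k: "Mor (kbar R) X Y h \<in> mod_hom R (aug_kernel R X) (aug_kernel R Y)"
    using is_fin_functorD(2)[OF kbar_is_functor[OF R_cring] assms] by (simp add: kbar_def)
  show "aug_mor R I X Y h \<in> mod_hom R (aug_tensor R I X) (aug_tensor R I Y)"
    unfolding m by (rule tensor_map(1)[OF R_cring aug_kernel_module[OF fin(1)] aug_kernel_module[OF fin(2)] k])
  show "t \<in> I \<rightarrow>\<^sub>E carrier (aug_kernel R X) \<Longrightarrow>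
      aug_mor R I X Y h (tensor_elt R I (\<lambda>_. aug_kernel R X) t) =
        tensor_elt R I (\<lambda>_. aug_kernel R Y) (\<lambda>i\<in>I. Mor (kbar R) X Y h (t i))"
    unfolding m by (rule tensor_map(2)[OF R_cring aug_kernel_module[OF fin(1)] aug_kernel_module[OF fin(2)] k])
qed

lemma kbar_mor_apply:
  assumes "finite X" "h \<in> X \<rightarrow>\<^sub>E Y" "v \<in> carrier (aug_kernel R X)"
  shows "Mor (kbar R) X Y h v s = (\<Oplus>z\<in>X. v z \<otimes> gen R (h z) s)"
proof -
  have "Mor (kbar R) X Y h v s = lin_ext R X (free_module R Y) (\<lambda>x. gen R (h x)) v s"
    using assms(3) by (simp add: kbar_def)
  also have "\<dots> = (\<Oplus>z\<in>X. v z \<otimes> gen R (h z) s)"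
    by (rule lin_ext_apply[OF assms(1)]) (use assms in \<open>auto simp: aug_kernel_carrier intro!: gen_carrier[OF R_cring]\<close>)
  finally show ?thesis .
qed

lemma kbar_mor_point_diff:
  assumes "X \<in> fin_sets" "h \<in> X \<rightarrow>\<^sub>E Y" "x \<in> X" "y \<in> X"
  shows "Mor (kbar R) X Y h (point_diff R x y) = point_diff R (h x) (h y)"
proof
  fix s
  have X: "finite X" using assms by (simp add: fin_sets_def)
  have a: "(\<Oplus>z\<in>X. gen R x z \<otimes> gen R (h z) s) = gen R (h x) s" if "x \<in> X" for x
  proof -
    have "(\<Oplus>z\<in>X. gen R x z \<otimes> gen R (h z) s) = gen R x x \<otimes> gen R (h x) s"
      by (rule finsum_single[OF X that]) (auto simp: gen_def)
    thus ?thesis by (simp add: gen_def)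
  qed
  have "Mor (kbar R) X Y h (point_diff R x y) s = (\<Oplus>z\<in>X. point_diff R x y z \<otimes> gen R (h z) s)"
    by (rule kbar_mor_apply[OF X assms(2) point_diff_aug[OF X assms(3,4)]])
  also have "\<dots> = (\<Oplus>z\<in>X. gen R x z \<otimes> gen R (h z) s \<ominus> gen R y z \<otimes> gen R (h z) s)"
    by (rule finsum_cong'[OF refl]) (auto simp: point_diff_def a_minus_def l_distr l_minus)
  also have "\<dots> = (\<Oplus>z\<in>X. gen R x z \<otimes> gen R (h z) s) \<ominus> (\<Oplus>z\<in>X. gen R y z \<otimes> gen R (h z) s)"
    by (rule finsum_minus) (use X in auto)
  finally show "Mor (kbar R) X Y h (point_diff R x y) s = point_diff R (h x) (h y) s"
    using a assms by (simp add: point_diff_def)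
qed

lemma aug_mor_diff:
  assumes "X \<in> fin_sets" "Y \<in> fin_sets" "h \<in> X \<rightarrow>\<^sub>E Y" "p \<in> I \<rightarrow> X" "q \<in> I \<rightarrow> X"
  shows "aug_mor R I X Y h (diff_tensor R I X p q) = diff_tensor R I Y (\<lambda>i. h (p i)) (\<lambda>i. h (q i))"
proof -
  have X: "finite X" using assms by (simp add: fin_sets_def)
  have "(\<lambda>i\<in>I. Mor (kbar R) X Y h ((\<lambda>i\<in>I. point_diff R (p i) (q i)) i)) = (\<lambda>i\<in>I. point_diff R (h (p i)) (h (q i)))"
    by (rule restrict_ext) (use assms(4,5) kbar_mor_point_diff[OF assms(1,3)] in auto)
  thus ?thesis unfolding diff_tensor_def using aug_mor_hom(2)[OF assms(1-3) diff_tuple[OF X assms(4,5)]] by simp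
qed

text \<open>In coordinates the functoriality of the tensor power is the pushforward of functions along
  \<open>x \<mapsto> h \<circ> x\<close>; on elementary tensors this is the distributive law for products of sums.\<close>

lemma tensor_coord_natural:
  assumes I: "finite I" and XY: "X \<in> fin_sets" "Y \<in> fin_sets" and h: "h \<in> X \<rightarrow>\<^sub>E Y"
    and T: "T \<in> carrier (aug_tensor R I X)"
  shows "tensor_coord R I Y (aug_mor R I X Y h T) = push R I X Y h (tensor_coord R I X T)"
proof -
  let ?T = "aug_tensor R I X" and ?J = "\<lambda>X. tensor_coord R I X" and ?e = "tensor_elt R I (\<lambda>_. aug_kernel R X)"
  have fin: "finite X" "finite Y" using XY by (auto simp: fin_sets_def)
  have IX: "finite (I \<rightarrow>\<^sub>E X)" using I fin by (intro finite_PiE) auto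
  have hXY: "h \<in> X \<rightarrow> Y" using h by auto
  note J = tensor_coord_hom(1)[OF I fin(1)] and JY = tensor_coord_hom(1)[OF I fin(2)] and TM = tensor_module[OF fin(1)]
    and M = aug_mor_hom[OF XY h] and P = push_hom[OF I fin hXY]
  have "compose (carrier ?T) (?J Y) (aug_mor R I X Y h) T = compose (carrier ?T) (push R I X Y h) (?J X) T"
  proof (rule tensor_hom_ext[OF R_cring aug_kernel_module[OF fin(1)] free_module_R
        mod_hom_comp[OF TM M(1) JY] mod_hom_comp[OF TM J P(1)] _ T])
    fix t assume t: "t \<in> I \<rightarrow>\<^sub>E carrier (aug_kernel R X)"
    have te: "?e t \<in> carrier ?T" by (rule tensor_elt_closed[OF fin(1) t])
    have tc: "t i s \<in> carrier R" if "i \<in> I" for i s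
      by (rule aug_kernel_mem[OF PiE_mem[OF t that]])
    have Pc: "(\<Otimes>i\<in>I. t i (y i)) \<in> carrier R" for y
      by (rule finprod_closed) (use tc in auto)
    have k: "Mor (kbar R) X Y h \<in> mod_hom R (aug_kernel R X) (aug_kernel R Y)"
      using is_fin_functorD(2)[OF kbar_is_functor[OF R_cring] XY h] by (simp add: kbar_def)
    have t': "(\<lambda>i\<in>I. Mor (kbar R) X Y h (t i)) \<in> I \<rightarrow>\<^sub>E carrier (aug_kernel R Y)"
      using mod_homD(1)[OF k] PiE_mem[OF t] by auto
    have "?J Y (aug_mor R I X Y h (?e t)) = push R I X Y h (?J X (?e t))"
    proof
      fix y
      show "?J Y (aug_mor R I X Y h (?e t)) y = push R I X Y h (?J X (?e t)) y"
      proof (cases "y \<in> I \<rightarrow>\<^sub>E Y")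
        case False
        show ?thesis
          by (rule trans[OF free_outside[OF mod_homD(1)[OF JY mod_homD(1)[OF M(1) te]] False]
            free_outside[OF mod_homD(1)[OF P(1) mod_homD(1)[OF J te]] False, symmetric]])
      next
        case True
        have "?J Y (aug_mor R I X Y h (?e t)) y = (\<Otimes>i\<in>I. (\<lambda>i\<in>I. Mor (kbar R) X Y h (t i)) i (y i))"
          using True by (simp add: M(2)[OF t] tensor_coord_hom(2)[OF I fin(2) t'])
        also have "\<dots> = (\<Otimes>i\<in>I. \<Oplus>z\<in>X. t i z \<otimes> gen R (h z) (y i))"
          by (rule finprod_cong'[OF refl])
             (use kbar_mor_apply[OF fin(1) h PiE_mem[OF t]] tc in \<open>auto intro!: finsum_closed\<close>)
        also have "\<dots> = (\<Oplus>x\<in>I \<rightarrow>\<^sub>E X. (\<Otimes>i\<in>I. t i (x i)) \<otimes> (\<Otimes>i\<in>I. gen R (h (x i)) (y i)))"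
          by (rule finprod_finsum_distrib[OF I fin(1)]) (use tc in auto)
        also have "\<dots> = (\<Oplus>x\<in>I \<rightarrow>\<^sub>E X. if (\<lambda>i\<in>I. h (x i)) = y then ?J X (?e t) x else \<zero>)"
        proof (rule finsum_cong'[OF refl])
          fix x assume x: "x \<in> I \<rightarrow>\<^sub>E X"
          have "(\<forall>i\<in>I. h (x i) = y i) \<longleftrightarrow> (\<lambda>i\<in>I. h (x i)) = y"
            using True by (auto simp: fun_eq_iff PiE_iff extensional_def)
          thus "(\<Otimes>i\<in>I. t i (x i)) \<otimes> (\<Otimes>i\<in>I. gen R (h (x i)) (y i)) = (if (\<lambda>i\<in>I. h (x i)) = y then ?J X (?e t) x else \<zero>)"
            using x Pc by (simp add: tensor_coord_hom(2)[OF I fin(1) t] finprod_gen[OF I])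
        qed (use Pc in \<open>auto simp: tensor_coord_hom(2)[OF I fin(1) t]\<close>)
        also have "\<dots> = push R I X Y h (?J X (?e t)) y"
          by (rule P(3)[OF mod_homD(1)[OF J te], symmetric])
        finally show ?thesis .
      qed
    qed
    thus "compose (carrier ?T) (?J Y) (aug_mor R I X Y h) (?e t) = compose (carrier ?T) (push R I X Y h) (?J X) (?e t)"
      using te by (simp add: compose_def)
  qed
  thus ?thesis using T by (simp add: compose_def)
qed

text \<open>Generators with a common second point suffice. This matters later: any such generator is the
  image, under a map of sets, of the generator with \<open>2|I|\<close> different points.\<close>

lemma aug_tensor_hom_ext:
  assumes I: "finite I" and X: "finite X" "x0 \<in> X" and N: "Module.module R N"
    and f: "f \<in> mod_hom R (aug_tensor R I X) N" and g: "g \<in> mod_hom R (aug_tensor R I X) N"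
    and eq: "\<And>p. p \<in> I \<rightarrow>\<^sub>E X \<Longrightarrow> f (diff_tensor R I X p (\<lambda>_. x0)) = g (diff_tensor R I X p (\<lambda>_. x0))"
    and T: "T \<in> carrier (aug_tensor R I X)"
  shows "f T = g T"
proof -
  let ?F = "free_module R (I \<rightarrow>\<^sub>E X)" and ?J = "tensor_coord R I X"
  note tof = tensor_of_hom[OF I X]
  have JT: "?J T \<in> carrier ?F" by (rule mod_homD(1)[OF tensor_coord_hom(1)[OF I X(1)] T])
  have "compose (carrier ?F) f (tensor_of R I X x0) (?J T) = compose (carrier ?F) g (tensor_of R I X x0) (?J T)"
    by (rule free_hom_ext[OF R_cring N mod_hom_comp[OF free_module_R tof(1) f] mod_hom_comp[OF free_module_R tof(1) g] _ JT])
       (simp add: compose_def gen_carrier[OF R_cring] tof(2) eq)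
  thus ?thesis using JT tensor_of_coord[OF I X T] by (simp add: compose_def)
qed

end

section \<open>The natural maps defined by combinations of surjections\<close>

text \<open>A map \<open>f\<close> from \<open>J\<close> to \<open>I\<close> turns points \<open>x\<close> of \<open>X\<^sup>I\<close> into points \<open>x \<circ> f\<close> of \<open>X\<^sup>J\<close>. This is
  precomposition, while maps of sets act by postcomposition; the two commute, which is the source of
  all naturality here.\<close>

definition reindex ::
  "('k, 'r) ring_scheme \<Rightarrow> 'j set \<Rightarrow> 'i set \<Rightarrow> 'x set \<Rightarrow> ('j \<Rightarrow> 'i) \<Rightarrow> (('i \<Rightarrow> 'x) \<Rightarrow> 'k) \<Rightarrow> ('j \<Rightarrow> 'x) \<Rightarrow> 'k" where
  "reindex K J I X f = lin_ext K (I \<rightarrow>\<^sub>E X) (free_module K (J \<rightarrow>\<^sub>E X)) (\<lambda>x. gen K (\<lambda>j\<in>J. x (f j)))"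

definition theta ::
  "('k, 'r) ring_scheme \<Rightarrow> 'j set \<Rightarrow> 'i set \<Rightarrow> 'x set \<Rightarrow> (('j \<Rightarrow> 'i) \<Rightarrow> 'k) \<Rightarrow> (('i \<Rightarrow> 'x) \<Rightarrow> 'k) \<Rightarrow> ('j \<Rightarrow> 'x) \<Rightarrow> 'k" where
  "theta K J I X v = (\<lambda>\<phi>\<in>carrier (free_module K (I \<rightarrow>\<^sub>E X)).
     \<Oplus>\<^bsub>free_module K (J \<rightarrow>\<^sub>E X)\<^esub>f\<in>J \<rightarrow>\<^sub>E I. v f \<odot>\<^bsub>free_module K (J \<rightarrow>\<^sub>E X)\<^esub> reindex K J I X f \<phi>)"

definition surj_funs :: "'j set \<Rightarrow> 'i set \<Rightarrow> ('j \<Rightarrow> 'i) set" where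
  "surj_funs J I = {f \<in> J \<rightarrow>\<^sub>E I. f ` J = I}"

text \<open>The kernel of the restriction maps, with the coefficient of the restriction at \<open>g\<close> spelled out:
  the extensions of \<open>g\<close> to \<open>J\<close> are the maps \<open>g(j := i)\<close>, and all of them are onto if \<open>g\<close> is.\<close>

definition surj_kernel :: "('k, 'r) ring_scheme \<Rightarrow> 'j set \<Rightarrow> 'i set \<Rightarrow> (('j \<Rightarrow> 'i) \<Rightarrow> 'k) set" where
  "surj_kernel K J I = {v \<in> carrier (free_module K (surj_funs J I)).
     \<forall>j\<in>J. \<forall>g\<in>surj_funs (J - {j}) I. (\<Oplus>\<^bsub>K\<^esub>i\<in>I. v (g(j := i))) = \<zero>\<^bsub>K\<^esub>}"

context cring
begin

context
  fixes I :: "'i set" and J :: "'j set"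
  assumes I: "finite I" and J: "finite J"
begin

lemma reindex_hom:
  assumes X: "finite X" and f: "f \<in> J \<rightarrow> I"
  shows "reindex R J I X f \<in> mod_hom R (free_module R (I \<rightarrow>\<^sub>E X)) (free_module R (J \<rightarrow>\<^sub>E X))"
    "x \<in> I \<rightarrow>\<^sub>E X \<Longrightarrow> reindex R J I X f (gen R x) = gen R (\<lambda>j\<in>J. x (f j))"
    "\<phi> \<in> carrier (free_module R (I \<rightarrow>\<^sub>E X)) \<Longrightarrow>
       reindex R J I X f \<phi> y = (\<Oplus>x\<in>I \<rightarrow>\<^sub>E X. if (\<lambda>j\<in>J. x (f j)) = y then \<phi> x else \<zero>)"
proof -
  have IX: "finite (I \<rightarrow>\<^sub>E X)" using I X by (intro finite_PiE) auto
  have g: "(\<lambda>x. gen R (\<lambda>j\<in>J. x (f j))) \<in> (I \<rightarrow>\<^sub>E X) \<rightarrow> carrier (free_module R (J \<rightarrow>\<^sub>E X))"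
    by (rule Pi_I, rule gen_carrier[OF R_cring]) (use f in \<open>auto simp: PiE_iff\<close>)
  show "reindex R J I X f \<in> mod_hom R (free_module R (I \<rightarrow>\<^sub>E X)) (free_module R (J \<rightarrow>\<^sub>E X))"
    unfolding reindex_def by (rule lin_ext_hom[OF free_module_R g])
  show "x \<in> I \<rightarrow>\<^sub>E X \<Longrightarrow> reindex R J I X f (gen R x) = gen R (\<lambda>j\<in>J. x (f j))"
    unfolding reindex_def by (rule lin_ext_gen[OF free_module_R g])
  show "reindex R J I X f \<phi> y = (\<Oplus>x\<in>I \<rightarrow>\<^sub>E X. if (\<lambda>j\<in>J. x (f j)) = y then \<phi> x else \<zero>)"
    if \<phi>: "\<phi> \<in> carrier (free_module R (I \<rightarrow>\<^sub>E X))"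
    unfolding reindex_def lin_ext_apply[OF IX g \<phi>]
    by (rule finsum_cong'[OF refl]) (use free_mem[OF \<phi>] in \<open>auto simp: gen_def\<close>)
qed

lemma push_reindex:
  assumes X: "finite X" and Y: "finite Y" and h: "h \<in> X \<rightarrow> Y" and f': "f \<in> J \<rightarrow> I"
    and \<phi>: "\<phi> \<in> carrier (free_module R (I \<rightarrow>\<^sub>E X))"
  shows "push R J X Y h (reindex R J I X f \<phi>) = reindex R J I Y f (push R I X Y h \<phi>)"
proof -
  let ?F = "free_module R (I \<rightarrow>\<^sub>E X)"
  note P = push_hom[OF J X Y h] and PI = push_hom[OF I X Y h]
  have "compose (carrier ?F) (push R J X Y h) (reindex R J I X f) \<phi> =
    compose (carrier ?F) (reindex R J I Y f) (push R I X Y h) \<phi>"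
  proof (rule free_hom_ext[OF R_cring free_module_R mod_hom_comp[OF free_module_R reindex_hom(1)[OF X f'] P(1)]
        mod_hom_comp[OF free_module_R PI(1) reindex_hom(1)[OF Y f']] _ \<phi>])
    fix x assume x: "x \<in> I \<rightarrow>\<^sub>E X"
    have 1: "(\<lambda>j\<in>J. x (f j)) \<in> J \<rightarrow>\<^sub>E X" "(\<lambda>i\<in>I. h (x i)) \<in> I \<rightarrow>\<^sub>E Y"
      using x f' h by (auto simp: PiE_iff)
    have "(\<lambda>j\<in>J. h ((\<lambda>j\<in>J. x (f j)) j)) = (\<lambda>j\<in>J. (\<lambda>i\<in>I. h (x i)) (f j))"
      by (rule restrict_ext) (use f' in auto)
    thus "compose (carrier ?F) (push R J X Y h) (reindex R J I X f) (gen R x) =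
      compose (carrier ?F) (reindex R J I Y f) (push R I X Y h) (gen R x)"
      unfolding compose_def restrict_apply if_P[OF gen_carrier[OF R_cring x]] reindex_hom(2)[OF X f' x]
        PI(2)[OF x] P(2)[OF 1(1)] reindex_hom(2)[OF Y f' 1(2)] by (rule arg_cong)
  qed
  thus ?thesis
    using \<phi> by (simp add: compose_def)
qed

lemma surj_free:
  assumes "v \<in> carrier (free_module R (surj_funs J I))"
  shows "v \<in> carrier (free_module R (J \<rightarrow>\<^sub>E I))"
  using assms by (auto simp: free_carrier surj_funs_def)

context
  fixes X :: "'x set" and v
  assumes X: "finite X" and v: "v \<in> carrier (free_module R (J \<rightarrow>\<^sub>E I))"
begin

lemma theta_terms:
  assumes "f \<in> J \<rightarrow>\<^sub>E I" "\<phi> \<in> carrier (free_module R (I \<rightarrow>\<^sub>E X))"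
  shows "reindex R J I X f \<phi> \<in> carrier (free_module R (J \<rightarrow>\<^sub>E X))"
    "v f \<odot>\<^bsub>free_module R (J \<rightarrow>\<^sub>E X)\<^esub> reindex R J I X f \<phi> \<in> carrier (free_module R (J \<rightarrow>\<^sub>E X))"
proof -
  have f: "f \<in> J \<rightarrow> I" using assms(1) by auto
  show 1: "reindex R J I X f \<phi> \<in> carrier (free_module R (J \<rightarrow>\<^sub>E X))"
    by (rule mod_homD(1)[OF reindex_hom(1)[OF X f] assms(2)])
  show "v f \<odot>\<^bsub>free_module R (J \<rightarrow>\<^sub>E X)\<^esub> reindex R J I X f \<phi> \<in> carrier (free_module R (J \<rightarrow>\<^sub>E X))"
    by (rule module_closed(2)[OF free_module_R free_mem[OF v] 1])
qed

lemma theta_hom: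
  "theta R J I X v \<in> mod_hom R (free_module R (I \<rightarrow>\<^sub>E X)) (free_module R (J \<rightarrow>\<^sub>E X))"
proof -
  let ?F = "free_module R (I \<rightarrow>\<^sub>E X)" and ?G = "free_module R (J \<rightarrow>\<^sub>E X)"
  interpret F: Module.module R ?F by (rule free_module_R)
  interpret G: Module.module R ?G by (rule free_module_R)
  have JI: "finite (J \<rightarrow>\<^sub>E I)" using I J by (intro finite_PiE) auto
  note hom = reindex_hom(1)[OF X]
  note t = theta_terms
  show ?thesis
  proof (rule mod_homI)
    fix \<phi> assume \<phi>: "\<phi> \<in> carrier ?F"
    show "theta R J I X v \<phi> \<in> carrier ?G"
      unfolding theta_def using \<phi> t(2) by (auto intro!: G.M.finsum_closed simp del: free_ops)
  next
    show "theta R J I X v \<in> extensional (carrier ?F)" by (simp add: theta_def)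
  next
    fix \<phi> \<psi> assume \<phi>: "\<phi> \<in> carrier ?F" and \<psi>: "\<psi> \<in> carrier ?F"
    have "(\<Oplus>\<^bsub>?G\<^esub>f\<in>J \<rightarrow>\<^sub>E I. v f \<odot>\<^bsub>?G\<^esub> reindex R J I X f (\<phi> \<oplus>\<^bsub>?F\<^esub> \<psi>)) =
      (\<Oplus>\<^bsub>?G\<^esub>f\<in>J \<rightarrow>\<^sub>E I. v f \<odot>\<^bsub>?G\<^esub> reindex R J I X f \<phi> \<oplus>\<^bsub>?G\<^esub> v f \<odot>\<^bsub>?G\<^esub> reindex R J I X f \<psi>)"
    proof (rule G.M.finsum_cong'[OF refl])
      fix f assume f: "f \<in> J \<rightarrow>\<^sub>E I"
      hence f': "f \<in> J \<rightarrow> I" by auto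
      show "v f \<odot>\<^bsub>?G\<^esub> reindex R J I X f (\<phi> \<oplus>\<^bsub>?F\<^esub> \<psi>) = v f \<odot>\<^bsub>?G\<^esub> reindex R J I X f \<phi> \<oplus>\<^bsub>?G\<^esub> v f \<odot>\<^bsub>?G\<^esub> reindex R J I X f \<psi>"
        unfolding mod_homD(2)[OF hom[OF f'] \<phi> \<psi>]
        by (rule G.smult_r_distr[OF free_mem[OF v] t(1)[OF f \<phi>] t(1)[OF f \<psi>]])
    qed (use t(2) \<phi> \<psi> in \<open>auto intro!: G.M.a_closed simp del: free_ops\<close>)
    also have "\<dots> = (\<Oplus>\<^bsub>?G\<^esub>f\<in>J \<rightarrow>\<^sub>E I. v f \<odot>\<^bsub>?G\<^esub> reindex R J I X f \<phi>) \<oplus>\<^bsub>?G\<^esub> (\<Oplus>\<^bsub>?G\<^esub>f\<in>J \<rightarrow>\<^sub>E I. v f \<odot>\<^bsub>?G\<^esub> reindex R J I X f \<psi>)"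
      by (rule G.M.finsum_addf) (use t(2) \<phi> \<psi> in \<open>auto simp del: free_ops\<close>)
    finally show "theta R J I X v (\<phi> \<oplus>\<^bsub>?F\<^esub> \<psi>) = theta R J I X v \<phi> \<oplus>\<^bsub>?G\<^esub> theta R J I X v \<psi>"
      unfolding theta_def using \<phi> \<psi> F.M.a_closed[OF \<phi> \<psi>] by (simp del: free_ops)
  next
    fix c \<phi> assume c: "c \<in> carrier R" and \<phi>: "\<phi> \<in> carrier ?F"
    have "(\<Oplus>\<^bsub>?G\<^esub>f\<in>J \<rightarrow>\<^sub>E I. v f \<odot>\<^bsub>?G\<^esub> reindex R J I X f (c \<odot>\<^bsub>?F\<^esub> \<phi>)) =
      (\<Oplus>\<^bsub>?G\<^esub>f\<in>J \<rightarrow>\<^sub>E I. c \<odot>\<^bsub>?G\<^esub> (v f \<odot>\<^bsub>?G\<^esub> reindex R J I X f \<phi>))"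
    proof (rule G.M.finsum_cong'[OF refl])
      fix f assume f: "f \<in> J \<rightarrow>\<^sub>E I"
      hence f': "f \<in> J \<rightarrow> I" by auto
      show "v f \<odot>\<^bsub>?G\<^esub> reindex R J I X f (c \<odot>\<^bsub>?F\<^esub> \<phi>) = c \<odot>\<^bsub>?G\<^esub> (v f \<odot>\<^bsub>?G\<^esub> reindex R J I X f \<phi>)"
        unfolding mod_homD(3)[OF hom[OF f'] c \<phi>]
          G.smult_assoc1[OF free_mem[OF v] c t(1)[OF f \<phi>], symmetric] G.smult_assoc1[OF c free_mem[OF v] t(1)[OF f \<phi>], symmetric]
          m_comm[OF c free_mem[OF v]] ..
    qed (use t(2) \<phi> c in \<open>auto intro!: G.smult_closed simp del: free_ops\<close>)
    also have "\<dots> = c \<odot>\<^bsub>?G\<^esub> (\<Oplus>\<^bsub>?G\<^esub>f\<in>J \<rightarrow>\<^sub>E I. v f \<odot>\<^bsub>?G\<^esub> reindex R J I X f \<phi>)"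
      by (rule G.finsum_smult_ldistr[symmetric]) (use t(2) \<phi> c JI in \<open>auto simp del: free_ops\<close>)
    finally show "theta R J I X v (c \<odot>\<^bsub>?F\<^esub> \<phi>) = c \<odot>\<^bsub>?G\<^esub> theta R J I X v \<phi>"
      unfolding theta_def using \<phi> F.smult_closed[OF c \<phi>] by (simp del: free_ops)
  qed
qed

lemma theta_apply:
  assumes "\<phi> \<in> carrier (free_module R (I \<rightarrow>\<^sub>E X))"
  shows "theta R J I X v \<phi> y = (\<Oplus>f\<in>J \<rightarrow>\<^sub>E I. v f \<otimes> reindex R J I X f \<phi> y)"
proof -
  have JI: "finite (J \<rightarrow>\<^sub>E I)" using I J by (intro finite_PiE) auto
  have "theta R J I X v \<phi> y = (\<Oplus>f\<in>J \<rightarrow>\<^sub>E I. (v f \<odot>\<^bsub>free_module R (J \<rightarrow>\<^sub>E X)\<^esub> reindex R J I X f \<phi>) y)"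
    unfolding theta_def restrict_apply if_P[OF assms] by (rule finsum_free[OF JI theta_terms(2)[OF _ assms]])
  thus ?thesis by simp
qed

lemma push_theta:
  assumes Y: "finite Y" and h: "h \<in> X \<rightarrow> Y" and \<phi>: "\<phi> \<in> carrier (free_module R (I \<rightarrow>\<^sub>E X))"
  shows "push R J X Y h (theta R J I X v \<phi>) = (\<Oplus>\<^bsub>free_module R (J \<rightarrow>\<^sub>E Y)\<^esub>f\<in>J \<rightarrow>\<^sub>E I.
     v f \<odot>\<^bsub>free_module R (J \<rightarrow>\<^sub>E Y)\<^esub> reindex R J I Y f (push R I X Y h \<phi>))"
proof -
  let ?F = "free_module R (I \<rightarrow>\<^sub>E X)" and ?G = "free_module R (J \<rightarrow>\<^sub>E X)" and ?H = "free_module R (J \<rightarrow>\<^sub>E Y)"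
  interpret H: Module.module R ?H by (rule free_module_R)
  have JI: "finite (J \<rightarrow>\<^sub>E I)" using I J by (intro finite_PiE) auto
  note P = push_hom[OF J X Y h] and PI = push_hom[OF I X Y h]
  have "push R J X Y h (theta R J I X v \<phi>) = (\<Oplus>\<^bsub>?H\<^esub>f\<in>J \<rightarrow>\<^sub>E I. push R J X Y h (v f \<odot>\<^bsub>?G\<^esub> reindex R J I X f \<phi>))"
    unfolding theta_def restrict_apply if_P[OF \<phi>]
    by (rule mod_hom_finsum[OF free_module_R free_module_R P(1) JI theta_terms(2)[OF _ \<phi>]])
  also have "\<dots> = (\<Oplus>\<^bsub>?H\<^esub>f\<in>J \<rightarrow>\<^sub>E I. v f \<odot>\<^bsub>?H\<^esub> reindex R J I Y f (push R I X Y h \<phi>))"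
  proof (rule H.M.finsum_cong'[OF refl])
    have "v f \<odot>\<^bsub>?H\<^esub> reindex R J I Y f (push R I X Y h \<phi>) \<in> carrier ?H" if f: "f \<in> J \<rightarrow>\<^sub>E I" for f
    proof -
      have f': "f \<in> J \<rightarrow> I" using f by auto
      show ?thesis by (rule H.smult_closed[OF free_mem[OF v] mod_homD(1)[OF reindex_hom(1)[OF Y f'] mod_homD(1)[OF PI(1) \<phi>]]])
    qed
    thus "(\<lambda>f. v f \<odot>\<^bsub>?H\<^esub> reindex R J I Y f (push R I X Y h \<phi>)) \<in> (J \<rightarrow>\<^sub>E I) \<rightarrow> carrier ?H" by (rule Pi_I)
    fix f assume f: "f \<in> J \<rightarrow>\<^sub>E I"
    hence f': "f \<in> J \<rightarrow> I" by auto
    have "push R J X Y h (reindex R J I X f \<phi>) = reindex R J I Y f (push R I X Y h \<phi>)"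
      by (rule push_reindex[OF X Y h f' \<phi>])
    thus "push R J X Y h (v f \<odot>\<^bsub>?G\<^esub> reindex R J I X f \<phi>) = v f \<odot>\<^bsub>?H\<^esub> reindex R J I Y f (push R I X Y h \<phi>)"
      using mod_homD(3)[OF P(1) free_mem[OF v] theta_terms(1)[OF f \<phi>], of f] by simp
  qed
  finally show ?thesis .
qed

end

lemma theta_natural:
  assumes X: "finite X" and Y: "finite Y" and h: "h \<in> X \<rightarrow> Y" and v: "v \<in> carrier (free_module R (J \<rightarrow>\<^sub>E I))"
    and \<phi>: "\<phi> \<in> carrier (free_module R (I \<rightarrow>\<^sub>E X))"
  shows "push R J X Y h (theta R J I X v \<phi>) = theta R J I Y v (push R I X Y h \<phi>)"
  unfolding push_theta[OF X v Y h \<phi>] theta_def[of R J I Y] restrict_apply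
    if_P[OF mod_homD(1)[OF push_hom(1)[OF I X Y h] \<phi>]] ..

text \<open>The marginal in direction \<open>j\<close> no longer sees the values \<open>f j\<close>, so the summands can be grouped by
  the restriction \<open>g\<close> of \<open>f\<close> to \<open>J - {j}\<close>. If \<open>g\<close> misses a point \<open>i\<close>, the coordinate \<open>x\<^sub>i\<close> is summed
  freely and the marginal of \<open>\<phi>\<close> in direction \<open>i\<close> appears. If \<open>g\<close> is onto, the group carries the
  factor \<open>\<Sum>i. v (g(j := i))\<close>, which vanishes by the condition on \<open>v\<close>.\<close>

lemma theta_zero_marg:
  assumes X: "finite X" and v: "v \<in> surj_kernel R J I" and \<phi>: "\<phi> \<in> zero_marg R I X"
  shows "theta R J I X v \<phi> \<in> zero_marg R J X"
proof -
  have vs: "v \<in> carrier (free_module R (surj_funs J I))" using v by (simp add: surj_kernel_def)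
  note vF = surj_free[OF vs] and \<phi>F = zero_marg_free[OF \<phi>]
  note vc = free_mem[OF vF] and \<phi>c = free_mem[OF \<phi>F]
  have JI: "finite (J \<rightarrow>\<^sub>E I)" using I J by (intro finite_PiE) auto
  have IX: "finite (I \<rightarrow>\<^sub>E X)" using I X by (intro finite_PiE) auto
  have "(\<Oplus>z\<in>X. theta R J I X v \<phi> (y(j := z))) = \<zero>" if j: "j \<in> J" and y: "y \<in> J \<rightarrow>\<^sub>E X" for j y
  proof -
    \<comment> \<open>The marginal of the summand of \<open>f\<close>; it depends on \<open>f\<close> only away from \<open>j\<close>.\<close>
    define N where "N f = (\<Oplus>x\<in>I \<rightarrow>\<^sub>E X. if \<forall>k\<in>J - {j}. x (f k) = y k then \<phi> x else \<zero>)" for f :: "'j \<Rightarrow> 'i"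
    have Nc: "N f \<in> carrier R" for f unfolding N_def by (rule finsum_closed) (use \<phi>c in auto)
    have rc: "reindex R J I X f \<phi> y \<in> carrier R" if "f \<in> J \<rightarrow>\<^sub>E I" for f y
      by (rule free_mem[OF theta_terms(1)[OF X vF that \<phi>F]])
    have marg: "(\<Oplus>z\<in>X. reindex R J I X f \<phi> (y(j := z))) = N f" if f: "f \<in> J \<rightarrow>\<^sub>E I" for f
    proof -
      have f': "f \<in> J \<rightarrow> I" using f by auto
      have "(\<Oplus>z\<in>X. reindex R J I X f \<phi> (y(j := z))) =
        (\<Oplus>z\<in>X. \<Oplus>x\<in>I \<rightarrow>\<^sub>E X. if (\<lambda>j\<in>J. x (f j)) = y(j := z) then \<phi> x else \<zero>)"
        unfolding reindex_hom(3)[OF X f' \<phi>F] ..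
      also have "\<dots> = (\<Oplus>x\<in>I \<rightarrow>\<^sub>E X. \<Oplus>z\<in>X. if (\<lambda>j\<in>J. x (f j)) = y(j := z) then \<phi> x else \<zero>)"
        by (rule finsum_swap[OF X IX]) (use \<phi>c in auto)
      also have "\<dots> = N f"
        unfolding N_def
      proof (rule finsum_cong'[OF refl])
        fix x assume x: "x \<in> I \<rightarrow>\<^sub>E X"
        have iff: "(\<lambda>j\<in>J. x (f j)) = y(j := z) \<longleftrightarrow> (\<forall>k\<in>J - {j}. x (f k) = y k) \<and> z = x (f j)" for z
          using y j by (auto simp: fun_eq_iff PiE_iff extensional_def)
        have xf: "x (f j) \<in> X" using x f' j by auto
        show "(\<Oplus>z\<in>X. if (\<lambda>j\<in>J. x (f j)) = y(j := z) then \<phi> x else \<zero>) = (if \<forall>k\<in>J - {j}. x (f k) = y k then \<phi> x else \<zero>)"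
        proof (cases "\<forall>k\<in>J - {j}. x (f k) = y k")
          case True
          have "(\<Oplus>z\<in>X. if (\<forall>k\<in>J - {j}. x (f k) = y k) \<and> z = x (f j) then \<phi> x else \<zero>) =
            (if (\<forall>k\<in>J - {j}. x (f k) = y k) \<and> x (f j) = x (f j) then \<phi> x else \<zero>)"
            by (rule finsum_single[OF X xf]) (use \<phi>c in auto)
          thus ?thesis unfolding iff using True by simp
        next
          case False
          have "(\<Oplus>z\<in>X. if (\<lambda>j\<in>J. x (f j)) = y(j := z) then \<phi> x else \<zero>) = \<zero>"
            by (rule finsum_all_zero) (unfold iff, rule if_not_P, use False in blast)
          thus ?thesis unfolding if_not_P[OF False] .
        qed
      qed (use \<phi>c in auto)
      finally show ?thesis .
    qed
    have N0: "N f = \<zero>" if nf: "f ` (J - {j}) \<noteq> I" "f \<in> (J - {j}) \<rightarrow> I" for f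
    proof -
      obtain i where i: "i \<in> I" "i \<notin> f ` (J - {j})" using nf by auto
      have "N f = (\<Oplus>x\<in>(I - {i}) \<rightarrow>\<^sub>E X. \<Oplus>z\<in>X. if \<forall>k\<in>J - {j}. (x(i := z)) (f k) = y k then \<phi> (x(i := z)) else \<zero>)"
        unfolding N_def by (rule finsum_PiE_remove[OF I i(1)]) (use X \<phi>c in auto)
      also have "\<dots> = \<zero>"
      proof (rule finsum_all_zero)
        fix x assume x: "x \<in> (I - {i}) \<rightarrow>\<^sub>E X"
        have e: "(\<forall>k\<in>J - {j}. (x(i := z)) (f k) = y k) \<longleftrightarrow> (\<forall>k\<in>J - {j}. x (f k) = y k)" for z
          using i by auto
        show "(\<Oplus>z\<in>X. if \<forall>k\<in>J - {j}. (x(i := z)) (f k) = y k then \<phi> (x(i := z)) else \<zero>) = \<zero>"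
        proof (cases "(\<forall>k\<in>J - {j}. x (f k) = y k) \<and> X \<noteq> {}")
          case True
          then obtain z0 where z0: "z0 \<in> X" by auto
          have "x(i := z0) \<in> I \<rightarrow>\<^sub>E X" using PiE_fun_upd[of z0 "\<lambda>_. X" i x "I - {i}"] x z0 i by (simp add: insert_absorb)
          from zero_margD[OF \<phi> i(1) this] have "(\<Oplus>z\<in>X. \<phi> (x(i := z))) = \<zero>" by (simp add: fun_upd_def cong: if_cong)
          thus ?thesis unfolding e using True by (simp del: fun_upd_apply)
        next
          case False
          show ?thesis unfolding e by (rule finsum_all_zero) (rule if_not_P, use False in blast)
        qed
      qed
      finally show ?thesis .
    qed
    have "(\<Oplus>z\<in>X. theta R J I X v \<phi> (y(j := z))) = (\<Oplus>z\<in>X. \<Oplus>f\<in>J \<rightarrow>\<^sub>E I. v f \<otimes> reindex R J I X f \<phi> (y(j := z)))"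
      unfolding theta_apply[OF X vF \<phi>F] ..
    also have "\<dots> = (\<Oplus>f\<in>J \<rightarrow>\<^sub>E I. \<Oplus>z\<in>X. v f \<otimes> reindex R J I X f \<phi> (y(j := z)))"
      by (rule finsum_swap[OF X JI]) (rule m_closed[OF vc rc])
    also have "\<dots> = (\<Oplus>f\<in>J \<rightarrow>\<^sub>E I. v f \<otimes> N f)"
    proof (rule finsum_cong'[OF refl])
      fix f assume f: "f \<in> J \<rightarrow>\<^sub>E I"
      have "(\<Oplus>z\<in>X. v f \<otimes> reindex R J I X f \<phi> (y(j := z))) = v f \<otimes> (\<Oplus>z\<in>X. reindex R J I X f \<phi> (y(j := z)))"
        by (rule finsum_rdistr[OF X vc, symmetric]) (rule Pi_I, rule rc[OF f])
      thus "(\<Oplus>z\<in>X. v f \<otimes> reindex R J I X f \<phi> (y(j := z))) = v f \<otimes> N f" unfolding marg[OF f] .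
    qed (use vc Nc in auto)
    also have "\<dots> = (\<Oplus>g\<in>(J - {j}) \<rightarrow>\<^sub>E I. \<Oplus>i\<in>I. v (g(j := i)) \<otimes> N (g(j := i)))"
      by (rule finsum_PiE_remove[OF J j]) (use I vc Nc in auto)
    also have "\<dots> = \<zero>"
    proof (rule finsum_all_zero)
      fix g assume g: "g \<in> (J - {j}) \<rightarrow>\<^sub>E I"
      have Ng: "N (g(j := i)) = N g" for i
      proof -
        have "(\<forall>k\<in>J - {j}. x ((g(j := i)) k) = y k) \<longleftrightarrow> (\<forall>k\<in>J - {j}. x (g k) = y k)" for x by auto
        thus ?thesis unfolding N_def by presburger
      qed
      have "(\<Oplus>i\<in>I. v (g(j := i)) \<otimes> N (g(j := i))) = (\<Oplus>i\<in>I. v (g(j := i))) \<otimes> N g"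
        unfolding Ng by (rule finsum_ldistr[symmetric]) (use I Nc vc in auto)
      also have "\<dots> = \<zero>"
      proof (cases "g ` (J - {j}) = I")
        case True
        hence "g \<in> surj_funs (J - {j}) I" using g by (simp add: surj_funs_def)
        hence "(\<Oplus>i\<in>I. v (g(j := i))) = \<zero>" using v j by (simp add: surj_kernel_def)
        thus ?thesis using Nc by simp
      next
        case False
        have "g \<in> (J - {j}) \<rightarrow> I" using g by auto
        from N0[OF False this] show ?thesis using vc by (simp add: finsum_closed)
      qed
      finally show "(\<Oplus>i\<in>I. v (g(j := i)) \<otimes> N (g(j := i))) = \<zero>" .
    qed
    finally show ?thesis .
  qed
  thus ?thesis using mod_homD(1)[OF theta_hom[OF X vF] \<phi>F] by (simp add: zero_marg_def)
qed

end

end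

section \<open>Natural transformations between tensor powers\<close>

definition jointly_inj :: "'i set \<Rightarrow> ('i \<Rightarrow> 'x) \<Rightarrow> ('i \<Rightarrow> 'x) \<Rightarrow> bool" where
  "jointly_inj I p q \<longleftrightarrow> inj_on p I \<and> inj_on q I \<and> p ` I \<inter> q ` I = {}"

abbreviation kbar_tensor :: "('k, 'r) ring_scheme \<Rightarrow> 'i set \<Rightarrow> ('x, 'k, (('i \<Rightarrow> 'x \<Rightarrow> 'k) \<Rightarrow> 'k) set) fin_functor" where
  "kbar_tensor K I \<equiv> tensor_functor K I (\<lambda>_. kbar K)"

text \<open>These values determine \<open>\<eta>\<close> if the points \<open>p0 i\<close>, \<open>q0 i\<close> are all different. The points are parameters
  because equivariance rests on reading the values off at other points.\<close>

definition nat_coeff ::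
  "('k, 'r) ring_scheme \<Rightarrow> 'j set \<Rightarrow> 'i set \<Rightarrow> ('i \<Rightarrow> 'x) \<Rightarrow> ('i \<Rightarrow> 'x) \<Rightarrow>
     ('x set \<Rightarrow> (('i \<Rightarrow> 'x \<Rightarrow> 'k) \<Rightarrow> 'k) set \<Rightarrow> (('j \<Rightarrow> 'x \<Rightarrow> 'k) \<Rightarrow> 'k) set) \<Rightarrow> ('j \<Rightarrow> 'i) \<Rightarrow> 'k" where
  "nat_coeff K J I p0 q0 \<eta> f = (let Z = p0 ` I \<union> q0 ` I in
     if f \<in> surj_funs J I then tensor_coord K J Z (\<eta> Z (diff_tensor K I Z p0 q0)) (\<lambda>j\<in>J. p0 (f j)) else \<zero>\<^bsub>K\<^esub>)"

lemma surj_funs_update: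
  assumes "g \<in> surj_funs (J - {j}) I" "j \<in> J" "i \<in> I"
  shows "g(j := i) \<in> surj_funs J I"
proof -
  have 1: "g \<in> (J - {j}) \<rightarrow>\<^sub>E I" "g ` (J - {j}) = I" using assms(1) by (auto simp: surj_funs_def)
  have "g(j := i) \<in> insert j (J - {j}) \<rightarrow>\<^sub>E I" by (rule PiE_fun_upd[OF assms(3) 1(1)])
  hence 2: "g(j := i) \<in> J \<rightarrow>\<^sub>E I" using assms(2) by (simp add: insert_absorb)
  have "(g(j := i)) ` (J - {j}) = I" using 1(2) by (auto simp: image_def)
  hence "I \<subseteq> (g(j := i)) ` J" by auto
  moreover have "(g(j := i)) ` J \<subseteq> I" using PiE_mem[OF 2] by blast
  ultimately show ?thesis using 2 unfolding surj_funs_def by blast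
qed

text \<open>The universal property of the tensor with \<open>2|I|\<close> different points: its points can be moved to
  any other points.\<close>

lemma jointly_inj_extend:
  assumes p0: "jointly_inj I p0 q0" and p: "p \<in> I \<rightarrow> X" "q \<in> I \<rightarrow> X"
  obtains h where "h \<in> (p0 ` I \<union> q0 ` I) \<rightarrow>\<^sub>E X" "\<And>i. i \<in> I \<Longrightarrow> h (p0 i) = p i" "\<And>i. i \<in> I \<Longrightarrow> h (q0 i) = q i"
    "jointly_inj I p q \<Longrightarrow> inj_on h (p0 ` I \<union> q0 ` I)"
proof
  define h where "h = (\<lambda>x\<in>p0 ` I \<union> q0 ` I. if x \<in> p0 ` I then p (inv_into I p0 x) else q (inv_into I q0 x))"
  show hp: "h (p0 i) = p i" if "i \<in> I" for i
    using that p0 by (simp add: h_def jointly_inj_def)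
  show hq: "h (q0 i) = q i" if "i \<in> I" for i
  proof -
    have "q0 i \<notin> p0 ` I" using p0 that by (auto simp: jointly_inj_def)
    thus ?thesis using that p0 by (simp add: h_def jointly_inj_def)
  qed
  show "h \<in> (p0 ` I \<union> q0 ` I) \<rightarrow>\<^sub>E X"
  proof (rule PiE_I)
    fix x assume "x \<in> p0 ` I \<union> q0 ` I"
    thus "h x \<in> X" using hp hq p by auto
  qed (simp add: h_def)
  assume pq: "jointly_inj I p q"
  hence ne: "p i \<noteq> q k" if "i \<in> I" "k \<in> I" for i k using that by (auto simp: jointly_inj_def)
  show "inj_on h (p0 ` I \<union> q0 ` I)"
  proof (rule inj_onI)
    fix x y assume x: "x \<in> p0 ` I \<union> q0 ` I" and y: "y \<in> p0 ` I \<union> q0 ` I" and e: "h x = h y"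
    from x y consider i k where "i \<in> I" "k \<in> I" "x = p0 i" "y = p0 k" | i k where "i \<in> I" "k \<in> I" "x = p0 i" "y = q0 k"
      | i k where "i \<in> I" "k \<in> I" "x = q0 i" "y = p0 k" | i k where "i \<in> I" "k \<in> I" "x = q0 i" "y = q0 k" by blast
    thus "x = y"
    proof cases
      case 1 thus ?thesis using e pq hp by (auto simp: jointly_inj_def dest: inj_onD)
    next
      case 2 thus ?thesis using e ne[OF 2(1,2)] hp hq by simp
    next
      case 3 thus ?thesis using e ne[OF 3(2,1)] hp hq by simp
    next
      case 4 thus ?thesis using e pq hq by (auto simp: jointly_inj_def dest: inj_onD)
    qed
  qed
qed

lemma diff_tensor_cong:
  "(\<And>i. i \<in> I \<Longrightarrow> p i = p' i) \<Longrightarrow> (\<And>i. i \<in> I \<Longrightarrow> q i = q' i) \<Longrightarrow>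
     diff_tensor K I X p q = diff_tensor K I X p' q'"
  unfolding diff_tensor_def by (auto intro!: arg_cong[of _ _ "tensor_elt K I (\<lambda>_. aug_kernel K X)"] restrict_ext)

context cring
begin

lemma coord_diff_support:
  assumes "finite I" "finite X" "p \<in> I \<rightarrow> X" "q \<in> I \<rightarrow> X" "x \<in> I \<rightarrow>\<^sub>E X"
    and "tensor_coord R I X (diff_tensor R I X p q) x \<noteq> \<zero>" "i \<in> I"
  shows "x i = p i \<or> x i = q i"
proof (rule ccontr)
  assume "\<not> (x i = p i \<or> x i = q i)"
  hence "point_diff R (p i) (q i) (x i) = \<zero>" by (simp add: point_diff_def gen_def a_minus_def)
  hence "(\<Otimes>i\<in>I. point_diff R (p i) (q i) (x i)) = \<zero>" by (rule finprod_zero[OF assms(1,7)]) simp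
  thus False using assms(6) by (simp add: tensor_coord_diff[OF assms(1-5)])
qed

text \<open>The points \<open>p i\<close>, \<open>q i\<close> being different, a point \<open>x \<circ> f\<close> with \<open>x i \<in> {p i, q i}\<close> determines \<open>f\<close>,
  hence \<open>x\<close> because \<open>f\<close> is onto. So a single summand survives.\<close>

lemma theta_at:
  assumes I: "finite I" and J: "finite J" and X: "finite X" and p: "p \<in> I \<rightarrow> X" and q: "q \<in> I \<rightarrow> X"
    and pq: "jointly_inj I p q" and v: "v \<in> carrier (free_module R (surj_funs J I))"
    and f: "f \<in> surj_funs J I" and x: "x \<in> I \<rightarrow>\<^sub>E X" "\<And>i. i \<in> I \<Longrightarrow> x i = p i \<or> x i = q i"
  shows "theta R J I X v (tensor_coord R I X (diff_tensor R I X p q)) (\<lambda>j\<in>J. x (f j)) =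
    v f \<otimes> tensor_coord R I X (diff_tensor R I X p q) x"
proof -
  let ?e = "tensor_coord R I X (diff_tensor R I X p q)"
  have JI: "finite (J \<rightarrow>\<^sub>E I)" using I J by (intro finite_PiE) auto
  have IX: "finite (I \<rightarrow>\<^sub>E X)" using I X by (intro finite_PiE) auto
  have eF: "?e \<in> carrier (free_module R (I \<rightarrow>\<^sub>E X))"
    by (rule mod_homD(1)[OF tensor_coord_hom(1)[OF I X] diff_tensor_closed[OF X p q]])
  note vF = surj_free[OF I J v]
  have fJ: "f \<in> J \<rightarrow>\<^sub>E I" "f ` J = I" using f by (auto simp: surj_funs_def)
  have re: "reindex R J I X f ?e (\<lambda>j\<in>J. x (f j)) = ?e x"
  proof -
    have f': "f \<in> J \<rightarrow> I" using fJ by auto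
    have "(\<Oplus>x'\<in>I \<rightarrow>\<^sub>E X. if (\<lambda>j\<in>J. x' (f j)) = (\<lambda>j\<in>J. x (f j)) then ?e x' else \<zero>) =
      (if (\<lambda>j\<in>J. x (f j)) = (\<lambda>j\<in>J. x (f j)) then ?e x else \<zero>)"
    proof (rule finsum_single[OF IX x(1)])
      fix x' assume x': "x' \<in> I \<rightarrow>\<^sub>E X" "x' \<noteq> x"
      have "(\<lambda>j\<in>J. x' (f j)) \<noteq> (\<lambda>j\<in>J. x (f j))"
      proof
        assume e: "(\<lambda>j\<in>J. x' (f j)) = (\<lambda>j\<in>J. x (f j))"
        have "x' i = x i" if i: "i \<in> I" for i
        proof -
          obtain j where "j \<in> J" "f j = i" using i fJ(2) by auto
          thus ?thesis using fun_cong[OF e, of j] by simp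
        qed
        thus False using x' x(1) by (metis PiE_ext)
      qed
      thus "(if (\<lambda>j\<in>J. x' (f j)) = (\<lambda>j\<in>J. x (f j)) then ?e x' else \<zero>) = \<zero>" by (rule if_not_P)
    qed (use free_mem[OF eF] in auto)
    thus ?thesis unfolding reindex_hom(3)[OF I J X f' eF] by simp
  qed
  have other: "reindex R J I X g ?e (\<lambda>j\<in>J. x (f j)) = \<zero>" if g: "g \<in> J \<rightarrow>\<^sub>E I" "g \<noteq> f" for g
  proof -
    have g': "g \<in> J \<rightarrow> I" using g by auto
    show ?thesis unfolding reindex_hom(3)[OF I J X g' eF]
    proof (rule finsum_all_zero)
      fix x' assume x': "x' \<in> I \<rightarrow>\<^sub>E X"
      show "(if (\<lambda>j\<in>J. x' (g j)) = (\<lambda>j\<in>J. x (f j)) then ?e x' else \<zero>) = \<zero>"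
      proof (rule ccontr)
        assume "\<not> ?thesis"
        hence e: "(\<lambda>j\<in>J. x' (g j)) = (\<lambda>j\<in>J. x (f j))" and nz: "?e x' \<noteq> \<zero>" by metis+
        have "g j = f j" if j: "j \<in> J" for j
        proof -
          have gj: "g j \<in> I" "f j \<in> I" using j g(1) fJ(1) by auto
          have "x' (g j) = x (f j)" using fun_cong[OF e, of j] j by simp
          thus ?thesis using coord_diff_support[OF I X p q x' nz gj(1)] x(2)[OF gj(2)] pq gj
            unfolding jointly_inj_def by (metis IntI emptyE imageI inj_onD)
        qed
        thus False using g fJ(1) by (metis PiE_ext)
      qed
    qed
  qed
  have "theta R J I X v ?e (\<lambda>j\<in>J. x (f j)) = (\<Oplus>g\<in>J \<rightarrow>\<^sub>E I. v g \<otimes> reindex R J I X g ?e (\<lambda>j\<in>J. x (f j)))"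
    by (rule theta_apply[OF I J X vF eF])
  also have "\<dots> = v f \<otimes> reindex R J I X f ?e (\<lambda>j\<in>J. x (f j))"
  proof (rule finsum_single[OF JI fJ(1)])
    show "v f \<otimes> reindex R J I X f ?e (\<lambda>j\<in>J. x (f j)) \<in> carrier R"
      unfolding re by (rule m_closed[OF free_mem[OF vF] free_mem[OF eF]])
    show "v g \<otimes> reindex R J I X g ?e (\<lambda>j\<in>J. x (f j)) = \<zero>" if "g \<in> J \<rightarrow>\<^sub>E I" "g \<noteq> f" for g
      unfolding other[OF that] by (rule r_null[OF free_mem[OF vF]])
  qed
  finally show ?thesis unfolding re .
qed

end

locale kbar_nat_trans = cring R for R (structure) +
  fixes I :: "'i set" and J :: "'j set"
    and \<eta> :: "'x::infinite set \<Rightarrow> (('i \<Rightarrow> 'x \<Rightarrow> 'a) \<Rightarrow> 'a) set \<Rightarrow> (('j \<Rightarrow> 'x \<Rightarrow> 'a) \<Rightarrow> 'a) set"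
  assumes I: "finite I" "I \<noteq> {}" and J: "finite J"
    and \<eta>: "\<eta> \<in> nat_trans R (kbar_tensor R I) (kbar_tensor R J)"
begin

definition ev :: "'x set \<Rightarrow> ('i \<Rightarrow> 'x) \<Rightarrow> ('i \<Rightarrow> 'x) \<Rightarrow> ('j \<Rightarrow> 'x) \<Rightarrow> 'a" where
  "ev X p q = tensor_coord R J X (\<eta> X (diff_tensor R I X p q))"

lemma nat_hom: "X \<in> fin_sets \<Longrightarrow> \<eta> X \<in> mod_hom R (aug_tensor R I X) (aug_tensor R J X)"
  using \<eta> unfolding nat_trans_def Obj_tensor_kbar by auto

lemma nat_natural:
  "X \<in> fin_sets \<Longrightarrow> Y \<in> fin_sets \<Longrightarrow> h \<in> X \<rightarrow>\<^sub>E Y \<Longrightarrow> T \<in> carrier (aug_tensor R I X) \<Longrightarrow>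
     \<eta> Y (aug_mor R I X Y h T) = aug_mor R J X Y h (\<eta> X T)"
  using \<eta> unfolding nat_trans_def Obj_tensor_kbar by blast

lemma fin_setsD: "X \<in> fin_sets \<Longrightarrow> finite X"
  by (simp add: fin_sets_def)

lemma ev_zero_marg:
  assumes "X \<in> fin_sets" "p \<in> I \<rightarrow> X" "q \<in> I \<rightarrow> X"
  shows "ev X p q \<in> zero_marg R J X"
  unfolding ev_def
  by (rule tensor_coord_zero_marg[OF J fin_setsD[OF assms(1)]
        mod_homD(1)[OF nat_hom[OF assms(1)] diff_tensor_closed[OF fin_setsD[OF assms(1)] assms(2,3)]]])

lemmas ev_free = zero_marg_free[OF ev_zero_marg]

lemma ev_cong:
  "(\<And>i. i \<in> I \<Longrightarrow> p i = p' i) \<Longrightarrow> (\<And>i. i \<in> I \<Longrightarrow> q i = q' i) \<Longrightarrow> ev X p q = ev X p' q'"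
  unfolding ev_def by (simp cong: diff_tensor_cong)

lemma ev_push:
  assumes "X \<in> fin_sets" "Y \<in> fin_sets" "h \<in> X \<rightarrow>\<^sub>E Y" "p \<in> I \<rightarrow> X" "q \<in> I \<rightarrow> X"
  shows "ev Y (\<lambda>i. h (p i)) (\<lambda>i. h (q i)) = push R J X Y h (ev X p q)"
proof -
  note c = diff_tensor_closed[OF fin_setsD[OF assms(1)] assms(4,5)]
  have "\<eta> Y (diff_tensor R I Y (\<lambda>i. h (p i)) (\<lambda>i. h (q i))) = aug_mor R J X Y h (\<eta> X (diff_tensor R I X p q))"
    unfolding aug_mor_diff[OF assms, symmetric] by (rule nat_natural[OF assms(1-3) c])
  thus ?thesis unfolding ev_def
    using tensor_coord_natural[OF J assms(1-3) mod_homD(1)[OF nat_hom[OF assms(1)] c]] by simp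
qed

lemma ev_inj:
  assumes X: "X \<in> fin_sets" and Y: "Y \<in> fin_sets" and h: "h \<in> X \<rightarrow>\<^sub>E Y" "inj_on h X"
    and p: "p \<in> I \<rightarrow> X" and q: "q \<in> I \<rightarrow> X" and y: "y \<in> J \<rightarrow>\<^sub>E X"
  shows "ev Y (\<lambda>i. h (p i)) (\<lambda>i. h (q i)) (\<lambda>j\<in>J. h (y j)) = ev X p q y"
  unfolding ev_push[OF X Y h(1) p q]
proof (rule push_single[OF J fin_setsD[OF X] fin_setsD[OF Y] _ ev_free[OF X p q] y refl])
  show "h \<in> X \<rightarrow> Y" using h by auto
  fix x' assume x': "x' \<in> J \<rightarrow>\<^sub>E X" and e: "(\<lambda>j\<in>J. h (x' j)) = (\<lambda>j\<in>J. h (y j))"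
  show "x' = y"
  proof (rule PiE_ext[OF x' y])
    fix j assume j: "j \<in> J"
    have "h (x' j) = h (y j)" using fun_cong[OF e, of j] j by simp
    thus "x' j = y j" using h(2) x' y j by (auto dest: inj_onD)
  qed
qed

text \<open>The generator comes from the set of its own points, and pushing forward along an inclusion
  creates no values outside it.\<close>

lemma ev_outside:
  assumes X: "X \<in> fin_sets" and p: "p \<in> I \<rightarrow> X" and q: "q \<in> I \<rightarrow> X"
    and j: "j \<in> J" "y j \<notin> p ` I \<union> q ` I"
  shows "ev X p q y = \<zero>"
proof -
  let ?Z = "p ` I \<union> q ` I" and ?i = "\<lambda>x\<in>p ` I \<union> q ` I. x"
  have Z: "?Z \<in> fin_sets" using I by (auto simp: fin_sets_def)
  have i: "?i \<in> ?Z \<rightarrow>\<^sub>E X" using p q by auto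
  have pZ: "p \<in> I \<rightarrow> ?Z" "q \<in> I \<rightarrow> ?Z" by auto
  have "ev X p q = ev X (\<lambda>k. ?i (p k)) (\<lambda>k. ?i (q k))" by (rule ev_cong) auto
  also have "\<dots> = push R J ?Z X ?i (ev ?Z p q)" by (rule ev_push[OF Z X i pZ])
  finally have "ev X p q y = push R J ?Z X ?i (ev ?Z p q) y" by (rule fun_cong)
  also have "\<dots> = \<zero>"
  proof (rule push_none[OF J fin_setsD[OF Z] fin_setsD[OF X] _ ev_free[OF Z pZ]])
    show "?i \<in> ?Z \<rightarrow> X" using i by auto
    fix x assume x: "x \<in> J \<rightarrow>\<^sub>E ?Z"
    show "(\<lambda>j\<in>J. ?i (x j)) \<noteq> y"
    proof
      assume "(\<lambda>j\<in>J. ?i (x j)) = y"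
      hence "?i (x j) = y j" using j(1) by (metis restrict_apply')
      moreover have "x j \<in> ?Z" using x j(1) by blast
      ultimately show False using j(2) by simp
    qed
  qed
  finally show ?thesis .
qed

lemma ev_trivial:
  assumes X: "X \<in> fin_sets" and p: "p \<in> I \<rightarrow> X" and q: "q \<in> I \<rightarrow> X" and i: "i \<in> I" "p i = q i"
  shows "ev X p q = (\<lambda>_. \<zero>)"
proof -
  note fX = fin_setsD[OF X]
  have "diff_tensor R I X p q = \<zero>\<^bsub>aug_tensor R I X\<^esub>"
    unfolding diff_tensor_def
  proof (rule multilin_zero[OF tensor_elt_multilin[OF fX] aug_kernel_module[OF fX] tensor_module[OF fX] _ diff_tuple[OF fX p q] i(1)])
    show "tensor_elt R I (\<lambda>_. aug_kernel R X) \<in> (I \<rightarrow>\<^sub>E carrier (aug_kernel R X)) \<rightarrow> carrier (aug_tensor R I X)"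
      by (rule Pi_I) (rule tensor_elt_closed[OF fX])
    show "(\<lambda>i\<in>I. point_diff R (p i) (q i)) i = \<zero>\<^bsub>aug_kernel R X\<^esub>"
      using i by (simp add: point_diff_def a_minus_def r_neg)
  qed
  thus ?thesis unfolding ev_def
    using mod_hom_zero[OF tensor_module[OF fX] tensor_module[OF fX] nat_hom[OF X]]
      mod_hom_zero[OF tensor_module[OF fX] free_module_R tensor_coord_hom(1)[OF J fX]] by simp
qed

text \<open>Collapsing \<open>q i\<close> to \<open>p i\<close> makes the \<open>i\<close>-th factor of the generator zero, while a point \<open>y\<close> that
  meets neither \<open>p i\<close> nor \<open>q i\<close> is its own only preimage.\<close>

lemma ev_missing:
  assumes X: "X \<in> fin_sets" and p: "p \<in> I \<rightarrow> X" and q: "q \<in> I \<rightarrow> X" and y: "y \<in> J \<rightarrow>\<^sub>E X"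
    and i: "i \<in> I" "p i \<notin> y ` J" "q i \<notin> y ` J"
  shows "ev X p q y = \<zero>"
proof -
  let ?h = "\<lambda>x\<in>X. if x = q i then p i else x"
  have h: "?h \<in> X \<rightarrow>\<^sub>E X" using p i(1) by auto
  have pi: "p i \<in> X" "q i \<in> X" using p q i by auto
  have "ev X p q y = push R J X X ?h (ev X p q) y"
  proof (rule push_single[OF J fin_setsD[OF X] fin_setsD[OF X] _ ev_free[OF X p q] y, symmetric])
    show "?h \<in> X \<rightarrow> X" using h by auto
    show "(\<lambda>j\<in>J. ?h (y j)) = y"
    proof (rule PiE_ext[OF _ y])
      show "(\<lambda>j\<in>J. ?h (y j)) \<in> J \<rightarrow>\<^sub>E X" using PiE_mem[OF y] pi by (auto simp: PiE_iff)
      fix j assume j: "j \<in> J"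
      have "y j \<noteq> q i" using i(3) j by (metis imageI)
      thus "(\<lambda>j\<in>J. ?h (y j)) j = y j" using PiE_mem[OF y j] j by simp
    qed
    fix x' assume x': "x' \<in> J \<rightarrow>\<^sub>E X" and e: "(\<lambda>j\<in>J. ?h (x' j)) = y"
    show "x' = y"
    proof (rule PiE_ext[OF x' y])
      fix j assume j: "j \<in> J"
      have "?h (x' j) = y j" using fun_cong[OF e, of j] j by simp
      moreover have "y j \<noteq> p i" using i(2) j by (metis imageI)
      moreover have "x' j \<in> X" using x' j by auto
      ultimately show "x' j = y j" by (auto split: if_splits)
    qed
  qed
  also have "push R J X X ?h (ev X p q) = ev X (\<lambda>k. ?h (p k)) (\<lambda>k. ?h (q k))"
    by (rule ev_push[OF X X h p q, symmetric])
  also have "\<dots> = (\<lambda>_. \<zero>)"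
    by (rule ev_trivial[OF X _ _ i(1)]) (use p q h pi in auto)
  finally show ?thesis .
qed

lemma ev_split:
  assumes X: "X \<in> fin_sets" and p: "p \<in> I \<rightarrow> X" and q: "q \<in> I \<rightarrow> X" and i: "i \<in> I" and z: "z \<in> X"
  shows "ev X p q y = ev X p (q(i := z)) y \<oplus> ev X (p(i := z)) q y"
proof -
  note fX = fin_setsD[OF X]
  let ?t = "\<lambda>i\<in>I. point_diff R (p i) (q i)" and ?e = "tensor_elt R I (\<lambda>_. aug_kernel R X)"
  let ?T = "aug_tensor R I X"
  have t: "?t \<in> I \<rightarrow>\<^sub>E carrier (aug_kernel R X)" by (rule diff_tuple[OF fX p q])
  have piX: "p i \<in> X" "q i \<in> X" using p q i by auto
  have u: "point_diff R (p i) z \<in> carrier (aug_kernel R X)" "point_diff R z (q i) \<in> carrier (aug_kernel R X)"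
    using point_diff_aug[OF fX] piX z by auto
  have s: "point_diff R (p i) (q i) = point_diff R (p i) z \<oplus>\<^bsub>aug_kernel R X\<^esub> point_diff R z (q i)"
  proof
    fix s
    have "(gen R (p i) s \<ominus> gen R z s) \<oplus> (gen R z s \<ominus> gen R (q i) s) =
      gen R (p i) s \<oplus> (\<ominus> gen R z s \<oplus> (gen R z s \<oplus> \<ominus> gen R (q i) s))"
      by (simp add: a_minus_def a_assoc)
    also have "\<dots> = gen R (p i) s \<ominus> gen R (q i) s" by (simp add: a_minus_def r_neg1)
    finally show "point_diff R (p i) (q i) s = (point_diff R (p i) z \<oplus>\<^bsub>aug_kernel R X\<^esub> point_diff R z (q i)) s"
      by (simp add: point_diff_def)
  qed
  have "?t(i := point_diff R (p i) z \<oplus>\<^bsub>aug_kernel R X\<^esub> point_diff R z (q i)) = ?t"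
    unfolding s[symmetric] using i by (auto simp: fun_eq_iff)
  moreover have "?t(i := point_diff R (p i) z) = (\<lambda>k\<in>I. point_diff R (p k) ((q(i := z)) k))"
    using i by (auto simp: fun_eq_iff)
  moreover have "?t(i := point_diff R z (q i)) = (\<lambda>k\<in>I. point_diff R ((p(i := z)) k) (q k))"
    using i by (auto simp: fun_eq_iff)
  ultimately have D: "diff_tensor R I X p q = diff_tensor R I X p (q(i := z)) \<oplus>\<^bsub>?T\<^esub> diff_tensor R I X (p(i := z)) q"
    unfolding diff_tensor_def using multilinD(1)[OF tensor_elt_multilin[OF fX] t i u] by simp
  have m: "q(i := z) \<in> I \<rightarrow> X" "p(i := z) \<in> I \<rightarrow> X" using p q z by auto
  note c1 = diff_tensor_closed[OF fX p m(1)] and c2 = diff_tensor_closed[OF fX m(2) q]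
  note N = nat_hom[OF X] and C = tensor_coord_hom(1)[OF J fX]
  show ?thesis
    unfolding ev_def D mod_homD(2)[OF N c1 c2] mod_homD(2)[OF C mod_homD(1)[OF N c1] mod_homD(1)[OF N c2]]
    by simp
qed

text \<open>Insert a new point \<open>z\<close> and write \<open>[p i] - [q i] = ([p i] - [z]) + ([z] - [q i])\<close>. The first
  summand does not involve \<open>q i\<close> and the second does not involve \<open>p i\<close>, so neither contributes at a
  point meeting both. The infinite ambient type provides \<open>z\<close>.\<close>

lemma ev_mixed:
  assumes X: "X \<in> fin_sets" and p: "p \<in> I \<rightarrow> X" and q: "q \<in> I \<rightarrow> X" and pq: "jointly_inj I p q"
    and y: "y \<in> J \<rightarrow>\<^sub>E X" and i: "i \<in> I" and j: "j \<in> J" "y j = p i" and j': "j' \<in> J" "y j' = q i"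
  shows "ev X p q y = \<zero>"
proof -
  \<comment> \<open>A point outside \<open>X\<close>, so that it differs from all \<open>p k\<close> and \<open>q k\<close>.\<close>
  obtain z where z: "z \<notin> X" using ex_new_if_finite[OF infinite_UNIV fin_setsD[OF X]] by auto
  let ?Y = "insert z X" and ?i = "\<lambda>x\<in>X. x"
  have Y: "?Y \<in> fin_sets" using X by (simp add: fin_sets_def)
  have inc: "?i \<in> X \<rightarrow>\<^sub>E ?Y" "inj_on ?i X" by (auto simp: inj_on_def)
  have pY: "p \<in> I \<rightarrow> ?Y" "q \<in> I \<rightarrow> ?Y" using p q by auto
  have "ev X p q y = ev ?Y (\<lambda>k. ?i (p k)) (\<lambda>k. ?i (q k)) (\<lambda>j\<in>J. ?i (y j))"
    by (rule ev_inj[OF X Y inc p q y, symmetric])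
  also have "(\<lambda>j\<in>J. ?i (y j)) = y"
    by (rule PiE_ext[of _ J "\<lambda>_. X"]) (use y in \<open>auto simp: PiE_iff\<close>)
  also have "ev ?Y (\<lambda>k. ?i (p k)) (\<lambda>k. ?i (q k)) = ev ?Y p q"
    by (rule ev_cong) (use p q in auto)
  also have "\<dots> y = ev ?Y p (q(i := z)) y \<oplus> ev ?Y (p(i := z)) q y"
    by (rule ev_split[OF Y pY i]) simp
  also have "ev ?Y p (q(i := z)) y = \<zero>"
  proof (rule ev_outside[OF Y pY(1) _ j'(1)])
    show "q(i := z) \<in> I \<rightarrow> ?Y" using q by (simp add: Pi_iff)
    show "y j' \<notin> p ` I \<union> (q(i := z)) ` I"
      unfolding j'(2) using pq i z q by (auto simp: jointly_inj_def inj_on_def)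
  qed
  also have "ev ?Y (p(i := z)) q y = \<zero>"
  proof (rule ev_outside[OF Y _ pY(2) j(1)])
    show "p(i := z) \<in> I \<rightarrow> ?Y" using p by (simp add: Pi_iff)
    show "y j \<notin> (p(i := z)) ` I \<union> q ` I"
      unfolding j(2) using pq i z p by (auto simp: jointly_inj_def inj_on_def)
  qed
  finally show ?thesis by simp
qed

abbreviation coeff :: "('i \<Rightarrow> 'x) \<Rightarrow> ('i \<Rightarrow> 'x) \<Rightarrow> ('j \<Rightarrow> 'i) \<Rightarrow> 'a" where
  "coeff p0 q0 \<equiv> nat_coeff R J I p0 q0 \<eta>"

lemma coeff_ev:
  "coeff p0 q0 f = (if f \<in> surj_funs J I then ev (p0 ` I \<union> q0 ` I) p0 q0 (\<lambda>j\<in>J. p0 (f j)) else \<zero>)"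
  by (simp add: nat_coeff_def ev_def)

context
  fixes p0 q0 :: "'i \<Rightarrow> 'x"
  assumes p0q0: "jointly_inj I p0 q0"
begin

abbreviation "Z \<equiv> p0 ` I \<union> q0 ` I"

lemma Z: "Z \<in> fin_sets" "finite Z" "p0 \<in> I \<rightarrow> Z" "q0 \<in> I \<rightarrow> Z"
  using I by (auto simp: fin_sets_def)

text \<open>Naturality along the injection moving \<open>p0, q0\<close> to \<open>p, q\<close>: the coefficients do not depend on the
  points at which they are read off.\<close>

lemma coeff_eq:
  assumes X: "X \<in> fin_sets" and p: "p \<in> I \<rightarrow> X" and q: "q \<in> I \<rightarrow> X" and pq: "jointly_inj I p q"
    and f: "f \<in> surj_funs J I"
  shows "ev X p q (\<lambda>j\<in>J. p (f j)) = coeff p0 q0 f"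
proof -
  obtain h where h: "h \<in> Z \<rightarrow>\<^sub>E X" "\<And>i. i \<in> I \<Longrightarrow> h (p0 i) = p i" "\<And>i. i \<in> I \<Longrightarrow> h (q0 i) = q i" "inj_on h Z"
    using jointly_inj_extend[OF p0q0 p q] pq by metis
  have fI: "f j \<in> I" if "j \<in> J" for j using f that by (auto simp: surj_funs_def)
  have y: "(\<lambda>j\<in>J. p0 (f j)) \<in> J \<rightarrow>\<^sub>E Z" using fI by auto
  have "ev X (\<lambda>i. h (p0 i)) (\<lambda>i. h (q0 i)) (\<lambda>j\<in>J. h ((\<lambda>j\<in>J. p0 (f j)) j)) = ev Z p0 q0 (\<lambda>j\<in>J. p0 (f j))"
    by (rule ev_inj[OF Z(1) X h(1,4) Z(3,4) y])
  moreover have "ev X (\<lambda>i. h (p0 i)) (\<lambda>i. h (q0 i)) = ev X p q" by (rule ev_cong) (use h in auto)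
  moreover have "(\<lambda>j\<in>J. h ((\<lambda>j\<in>J. p0 (f j)) j)) = (\<lambda>j\<in>J. p (f j))"
    by (rule restrict_ext) (use h fI in auto)
  ultimately show ?thesis using f by (simp add: coeff_ev)
qed

lemma coeff_free: "coeff p0 q0 \<in> carrier (free_module R (surj_funs J I))"
proof (rule free_memI)
  have "finite (J \<rightarrow>\<^sub>E I)" using I J by (intro finite_PiE) auto
  thus "finite (surj_funs J I)" by (rule rev_finite_subset) (auto simp: surj_funs_def)
  show "coeff p0 q0 f \<in> carrier R" for f
    using free_mem[OF ev_free[OF Z(1,3,4)]] by (simp add: coeff_ev)
qed (simp add: coeff_ev)

text \<open>The vanishing marginal of the value of \<open>\<eta>\<close>, taken at the point \<open>p0 \<circ> g\<close>: the new coordinate runs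
  through the points \<open>p0 i\<close>, which yield the coefficients at the extensions of \<open>g\<close>, and through the
  points \<open>q0 i\<close>, which yield zero because \<open>g\<close> being onto already provides \<open>p0 i\<close>.\<close>

lemma coeff_kernel: "coeff p0 q0 \<in> surj_kernel R J I"
proof -
  have "(\<Oplus>i\<in>I. coeff p0 q0 (g(j := i))) = \<zero>" if j: "j \<in> J" and g: "g \<in> surj_funs (J - {j}) I" for j g
  proof -
    have gI: "g k \<in> I" if "k \<in> J - {j}" for k using g that by (auto simp: surj_funs_def)
    note gs = surj_funs_update[OF g j]
    \<comment> \<open>The value at \<open>j\<close> is overwritten, so any \<open>i0\<close> serves.\<close>
    obtain i0 where i0: "i0 \<in> I" using I by auto
    define y where "y = (\<lambda>k\<in>J. p0 ((g(j := i0)) k))"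
    have y: "y \<in> J \<rightarrow>\<^sub>E Z" using gI i0 by (auto simp: y_def)
    have yp: "y(j := p0 i) = (\<lambda>k\<in>J. p0 ((g(j := i)) k))" for i using j by (auto simp: y_def)
    note ec = free_mem[OF ev_free[OF Z(1,3,4)]]
    have disj: "p0 ` I \<inter> q0 ` I = {}" "inj_on p0 I" using p0q0 by (auto simp: jointly_inj_def)
    have "\<zero> = (\<Oplus>z\<in>Z. ev Z p0 q0 (y(j := z)))"
      by (rule zero_margD[OF ev_zero_marg[OF Z(1,3,4)] j y, symmetric])
    also have "\<dots> = (\<Oplus>z\<in>p0 ` I. ev Z p0 q0 (y(j := z))) \<oplus> (\<Oplus>z\<in>q0 ` I. ev Z p0 q0 (y(j := z)))"
      by (rule finsum_Un_disjoint) (use I disj ec in auto)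
    also have "(\<Oplus>z\<in>q0 ` I. ev Z p0 q0 (y(j := z))) = \<zero>"
    proof (rule finsum_all_zero)
      fix z assume "z \<in> q0 ` I"
      then obtain i where i: "i \<in> I" "z = q0 i" by auto
      obtain k where k: "k \<in> J - {j}" "g k = i" using g i(1) by (auto simp: surj_funs_def)
      have yz: "y(j := z) \<in> J \<rightarrow>\<^sub>E Z" using PiE_fun_upd[of z "\<lambda>_. Z" j y J] y i j by (simp add: insert_absorb)
      show "ev Z p0 q0 (y(j := z)) = \<zero>"
        by (rule ev_mixed[OF Z(1,3,4) p0q0 yz i(1), of k j]) (use k j i in \<open>auto simp: y_def\<close>)
    qed
    also have "(\<Oplus>z\<in>p0 ` I. ev Z p0 q0 (y(j := z))) = (\<Oplus>i\<in>I. ev Z p0 q0 (y(j := p0 i)))"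
      by (rule finsum_reindex[OF _ disj(2)]) (use ec in auto)
    also have "\<dots> = (\<Oplus>i\<in>I. coeff p0 q0 (g(j := i)))"
      by (rule finsum_cong'[OF refl]) (use ec gs in \<open>auto simp: yp coeff_ev\<close>)
    finally show ?thesis using free_mem[OF coeff_free] by (simp add: finsum_closed)
  qed
  thus ?thesis using coeff_free by (simp add: surj_kernel_def)
qed

text \<open>Exchanging \<open>p0 i\<close> and \<open>q0 i\<close> for the indices with \<open>x i = q0 i\<close> changes the generator by a sign,
  namely the coordinate of the generator at \<open>x\<close>, and turns \<open>x\<close> into the first family of points.\<close>

lemma ev_at:
  assumes f: "f \<in> surj_funs J I" and x: "x \<in> I \<rightarrow>\<^sub>E Z" "\<And>i. i \<in> I \<Longrightarrow> x i = p0 i \<or> x i = q0 i"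
  shows "ev Z p0 q0 (\<lambda>j\<in>J. x (f j)) = coeff p0 q0 f \<otimes> tensor_coord R I Z (diff_tensor R I Z p0 q0) x"
proof -
  define q where "q i = (if x i = p0 i then q0 i else p0 i)" for i
  let ?s = "tensor_coord R I Z (diff_tensor R I Z p0 q0) x" and ?T = "aug_tensor R I Z"
  have xq: "x \<in> I \<rightarrow> Z" "q \<in> I \<rightarrow> Z" using x by (auto simp: q_def)
  have ji: "inj_on p0 I" "inj_on q0 I" "\<And>i k. i \<in> I \<Longrightarrow> k \<in> I \<Longrightarrow> p0 i \<noteq> q0 k"
    using p0q0 by (auto simp: jointly_inj_def)
  have "jointly_inj I x q"
    unfolding jointly_inj_def
  proof (intro conjI inj_onI)
    fix i k assume ik: "i \<in> I" "k \<in> I"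
    show "i = k" if "x i = x k" using that x(2)[OF ik(1)] x(2)[OF ik(2)] ji(3)[OF ik] ji(3)[OF ik(2,1)]
        inj_onD[OF ji(1) _ ik] inj_onD[OF ji(2) _ ik] by metis
    show "i = k" if "q i = q k" using that x(2)[OF ik(1)] x(2)[OF ik(2)] ji(3)[OF ik] ji(3)[OF ik(2,1)]
        inj_onD[OF ji(1) _ ik] inj_onD[OF ji(2) _ ik] unfolding q_def by metis
  next
    have "x i \<noteq> q k" if ik: "i \<in> I" "k \<in> I" for i k
      using x(2)[OF ik(1)] x(2)[OF ik(2)] ji(3)[OF ik] ji(3)[OF ik(2,1)] ji(3)[OF ik(2,2)]
        inj_onD[OF ji(1) _ ik] inj_onD[OF ji(2) _ ik] unfolding q_def by metis
    thus "x ` I \<inter> q ` I = {}" by auto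
  qed
  note evx = coeff_eq[OF Z(1) xq this f]
  note c1 = diff_tensor_closed[OF Z(2,3,4)] and c2 = diff_tensor_closed[OF Z(2) xq]
  note C = tensor_coord_hom(1)[OF I(1) Z(2)] and CJ = tensor_coord_hom(1)[OF J Z(2)] and N = nat_hom[OF Z(1)]
  have s: "?s \<in> carrier R" by (rule free_mem[OF mod_homD(1)[OF C c1]])
  \<comment> \<open>The sign is kept as the product \<open>?s\<close> of its factors, so that no parity has to be counted.\<close>
  have "diff_tensor R I Z p0 q0 = ?s \<odot>\<^bsub>?T\<^esub> diff_tensor R I Z x q"
  proof (rule tensor_coord_inj[OF I(1) Z(2) _ c1 module_closed(2)[OF tensor_module[OF Z(2)] s c2]])
    show "Z \<noteq> {}" using I by auto
    show "tensor_coord R I Z (diff_tensor R I Z p0 q0) = tensor_coord R I Z (?s \<odot>\<^bsub>?T\<^esub> diff_tensor R I Z x q)"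
    proof
      fix y
      show "tensor_coord R I Z (diff_tensor R I Z p0 q0) y = tensor_coord R I Z (?s \<odot>\<^bsub>?T\<^esub> diff_tensor R I Z x q) y"
      proof (cases "y \<in> I \<rightarrow>\<^sub>E Z")
        case False
        show ?thesis
          by (rule trans[OF free_outside[OF mod_homD(1)[OF C c1] False]
            free_outside[OF mod_homD(1)[OF C module_closed(2)[OF tensor_module[OF Z(2)] s c2]] False, symmetric]])
      next
        case True
        have "tensor_coord R I Z (diff_tensor R I Z p0 q0) y = (\<Otimes>i\<in>I. point_diff R (p0 i) (q0 i) (y i))"
          by (rule tensor_coord_diff[OF I(1) Z(2,3,4) True])
        also have "\<dots> = (\<Otimes>i\<in>I. point_diff R (p0 i) (q0 i) (x i) \<otimes> point_diff R (x i) (q i) (y i))"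
        proof (rule finprod_cong'[OF refl])
          fix i assume i: "i \<in> I"
          have ne: "p0 i \<noteq> q0 i" "q0 i \<noteq> p0 i" using ji(3)[OF i i] by auto
          from x(2)[OF i] show "point_diff R (p0 i) (q0 i) (y i) = point_diff R (p0 i) (q0 i) (x i) \<otimes> point_diff R (x i) (q i) (y i)"
          proof
            assume "x i = p0 i"
            thus ?thesis using ne by (simp add: point_diff_def q_def gen_def a_minus_def)
          next
            assume "x i = q0 i"
            thus ?thesis using ne by (simp add: point_diff_def q_def gen_def a_minus_def l_minus r_minus)
          qed
        qed auto
        also have "\<dots> = ?s \<otimes> tensor_coord R I Z (diff_tensor R I Z x q) y"
          unfolding tensor_coord_diff[OF I(1) Z(2,3,4) x(1)] tensor_coord_diff[OF I(1) Z(2) xq True]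
          by (rule finprod_multf) auto
        also have "\<dots> = tensor_coord R I Z (?s \<odot>\<^bsub>?T\<^esub> diff_tensor R I Z x q) y"
          unfolding mod_homD(3)[OF C s c2] by simp
        finally show ?thesis .
      qed
    qed
  qed
  hence "ev Z p0 q0 = ?s \<odot>\<^bsub>free_module R (J \<rightarrow>\<^sub>E Z)\<^esub> ev Z x q"
    unfolding ev_def using mod_homD(3)[OF N s c2] mod_homD(3)[OF CJ s mod_homD(1)[OF N c2]] by simp
  hence "ev Z p0 q0 (\<lambda>j\<in>J. x (f j)) = ?s \<otimes> coeff p0 q0 f" unfolding evx[symmetric] by simp
  thus ?thesis using m_comm[OF s free_mem[OF coeff_free]] by simp
qed

text \<open>Both sides are supported at the points \<open>x \<circ> f\<close> with \<open>f\<close> onto and \<open>x i \<in> {p0 i, q0 i}\<close>, and agree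
  there. For the left-hand side this is the conjunction of the two vanishing statements: each pair
  \<open>{p0 i, q0 i}\<close> is met in exactly one point, which defines \<open>x\<close>, and \<open>f\<close> records to which pair a value
  of \<open>y\<close> belongs.\<close>

lemma ev_theta: "ev Z p0 q0 = theta R J I Z (coeff p0 q0) (tensor_coord R I Z (diff_tensor R I Z p0 q0))"
proof
  fix y
  let ?e = "tensor_coord R I Z (diff_tensor R I Z p0 q0)"
  note c1 = diff_tensor_closed[OF Z(2,3,4)] and C = tensor_coord_hom(1)[OF I(1) Z(2)]
  note eF = mod_homD(1)[OF C c1] and vF = surj_free[OF I(1) J coeff_free]
  show "ev Z p0 q0 y = theta R J I Z (coeff p0 q0) ?e y"
  proof (cases "\<exists>f\<in>surj_funs J I. \<exists>x\<in>I \<rightarrow>\<^sub>E Z. (\<forall>i\<in>I. x i = p0 i \<or> x i = q0 i) \<and> y = (\<lambda>j\<in>J. x (f j))")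
    case True
    then obtain f x where f: "f \<in> surj_funs J I" and x: "x \<in> I \<rightarrow>\<^sub>E Z" "\<And>i. i \<in> I \<Longrightarrow> x i = p0 i \<or> x i = q0 i"
      and y: "y = (\<lambda>j\<in>J. x (f j))" by blast
    show ?thesis unfolding y
      by (rule trans[OF ev_at[OF f x] theta_at[OF I(1) J Z(2,3,4) p0q0 coeff_free f x, symmetric]])
  next
    case none: False
    have "theta R J I Z (coeff p0 q0) ?e y = (\<Oplus>f\<in>J \<rightarrow>\<^sub>E I. coeff p0 q0 f \<otimes> reindex R J I Z f ?e y)"
      by (rule theta_apply[OF I(1) J Z(2) vF eF])
    also have "\<dots> = \<zero>"
    proof (rule finsum_all_zero)
      fix f assume f: "f \<in> J \<rightarrow>\<^sub>E I"
      hence f': "f \<in> J \<rightarrow> I" by auto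
      show "coeff p0 q0 f \<otimes> reindex R J I Z f ?e y = \<zero>"
      proof (cases "f \<in> surj_funs J I")
        case False
        hence "coeff p0 q0 f = \<zero>" by (simp add: coeff_ev)
        thus ?thesis using free_mem[OF mod_homD(1)[OF reindex_hom(1)[OF I(1) J Z(2) f'] eF]] by simp
      next
        case True
        have "reindex R J I Z f ?e y = \<zero>"
          unfolding reindex_hom(3)[OF I(1) J Z(2) f' eF]
        proof (rule finsum_all_zero)
          fix x assume x: "x \<in> I \<rightarrow>\<^sub>E Z"
          show "(if (\<lambda>j\<in>J. x (f j)) = y then ?e x else \<zero>) = \<zero>"
          proof (rule ccontr)
            assume "\<not> ?thesis"
            hence y: "y = (\<lambda>j\<in>J. x (f j))" and nz: "?e x \<noteq> \<zero>" by metis+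
            have "\<forall>i\<in>I. x i = p0 i \<or> x i = q0 i" using coord_diff_support[OF I(1) Z(2,3,4) x nz] by blast
            thus False using none True x y by blast
          qed
        qed
        thus ?thesis using r_null[OF free_mem[OF coeff_free]] by simp
      qed
    qed
    also have "\<zero> = ev Z p0 q0 y"
    proof (rule ccontr)
      assume nz: "\<zero> \<noteq> ev Z p0 q0 y"
      have y: "y \<in> J \<rightarrow>\<^sub>E Z" using free_outside[OF ev_free[OF Z(1,3,4)], of y] nz by metis
      have miss: "p0 i \<in> y ` J \<or> q0 i \<in> y ` J" if "i \<in> I" for i
        using ev_missing[OF Z(1,3,4) y that] nz by metis
      have mixed: "\<not> (p0 i \<in> y ` J \<and> q0 i \<in> y ` J)" if "i \<in> I" for i
      proof
        assume "p0 i \<in> y ` J \<and> q0 i \<in> y ` J"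
        then obtain j j' where j: "j \<in> J" "y j = p0 i" and j': "j' \<in> J" "y j' = q0 i" by (metis imageE)
        show False using ev_mixed[OF Z(1,3,4) p0q0 y that j j'] nz by metis
      qed
      have "\<forall>j\<in>J. \<exists>i\<in>I. y j = p0 i \<or> y j = q0 i" using y by (fastforce simp: PiE_iff)
      then obtain f' where f': "\<And>j. j \<in> J \<Longrightarrow> f' j \<in> I \<and> (y j = p0 (f' j) \<or> y j = q0 (f' j))" by metis
      define f where "f = restrict f' J"
      have f: "f j \<in> I" "y j = p0 (f j) \<or> y j = q0 (f j)" if "j \<in> J" for j
        using f'[OF that] that by (auto simp: f_def)
      have ji: "inj_on p0 I" "inj_on q0 I" "\<And>i k. i \<in> I \<Longrightarrow> k \<in> I \<Longrightarrow> p0 i \<noteq> q0 k"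
        using p0q0 by (auto simp: jointly_inj_def)
      have surj: "f \<in> surj_funs J I"
      proof -
        have "i \<in> f ` J" if i: "i \<in> I" for i
        proof -
          obtain j where j: "j \<in> J" "y j = p0 i \<or> y j = q0 i" using miss[OF i] by (metis imageE)
          have "f j = i" using j(2) f[OF j(1)] ji i by (metis inj_onD)
          thus ?thesis using j(1) by blast
        qed
        moreover have "f \<in> J \<rightarrow>\<^sub>E I" using f' by (auto simp: f_def)
        ultimately show ?thesis by (auto simp: surj_funs_def)
      qed
      define x where "x = (\<lambda>i\<in>I. if p0 i \<in> y ` J then p0 i else q0 i)"
      have x: "x \<in> I \<rightarrow>\<^sub>E Z" "\<forall>i\<in>I. x i = p0 i \<or> x i = q0 i" by (auto simp: x_def)
      have "y = (\<lambda>j\<in>J. x (f j))"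
      proof (rule PiE_ext[OF y])
        show "(\<lambda>j\<in>J. x (f j)) \<in> J \<rightarrow>\<^sub>E Z" using f(1) x(1) by auto
        fix j assume j: "j \<in> J"
        have "x (f j) = y j"
        proof (cases "y j = p0 (f j)")
          case True
          hence "p0 (f j) \<in> y ` J" using j by (metis imageI)
          thus ?thesis using True f(1)[OF j] by (simp add: x_def)
        next
          case False
          hence q: "y j = q0 (f j)" using f(2)[OF j] by blast
          hence "q0 (f j) \<in> y ` J" using j by (metis imageI)
          hence "p0 (f j) \<notin> y ` J" using mixed[OF f(1)[OF j]] by blast
          thus ?thesis using q f(1)[OF j] by (simp add: x_def)
        qed
        thus "y j = (\<lambda>j\<in>J. x (f j)) j" using j by simp
      qed
      thus False using none surj x by blast
    qed
    finally show ?thesis by (rule sym)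
  qed
qed

text \<open>Every natural transformation is given by its coefficients: both sides are natural, and any
  spanning generator is the image of the universal one.\<close>

theorem coord_nat_eq_theta:
  assumes X: "X \<in> fin_sets" and T: "T \<in> carrier (aug_tensor R I X)"
  shows "tensor_coord R J X (\<eta> X T) = theta R J I X (coeff p0 q0) (tensor_coord R I X T)"
proof -
  let ?A = "aug_tensor R I X"
  note fX = fin_setsD[OF X]
  obtain x0 where x0: "x0 \<in> X" using X by (auto simp: fin_sets_def)
  note vF = surj_free[OF I(1) J coeff_free]
  note N = nat_hom[OF X] and CJ = tensor_coord_hom(1)[OF J fX] and C = tensor_coord_hom(1)[OF I(1) fX]
    and th = theta_hom[OF I(1) J fX vF] and TM = tensor_module[OF fX]
  have "compose (carrier ?A) (tensor_coord R J X) (\<eta> X) T =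
    compose (carrier ?A) (theta R J I X (coeff p0 q0)) (tensor_coord R I X) T"
  proof (rule aug_tensor_hom_ext[OF I(1) fX x0 free_module_R mod_hom_comp[OF TM N CJ] mod_hom_comp[OF TM C th] _ T])
    fix p assume p: "p \<in> I \<rightarrow>\<^sub>E X"
    have pX: "p \<in> I \<rightarrow> X" "(\<lambda>_. x0) \<in> I \<rightarrow> X" using p x0 by auto
    obtain h where h: "h \<in> Z \<rightarrow>\<^sub>E X" "\<And>i. i \<in> I \<Longrightarrow> h (p0 i) = p i" "\<And>i. i \<in> I \<Longrightarrow> h (q0 i) = x0"
      using jointly_inj_extend[OF p0q0 pX] by metis
    have hZ: "h \<in> Z \<rightarrow> X" using h by auto
    let ?D = "diff_tensor R I X p (\<lambda>_. x0)"
    note c0 = diff_tensor_closed[OF Z(2,3,4)]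
    have D: "diff_tensor R I X (\<lambda>i. h (p0 i)) (\<lambda>i. h (q0 i)) = ?D" by (rule diff_tensor_cong) (use h in auto)
    have "tensor_coord R J X (\<eta> X ?D) = ev X (\<lambda>i. h (p0 i)) (\<lambda>i. h (q0 i))" unfolding ev_def D ..
    also have "\<dots> = push R J Z X h (ev Z p0 q0)" by (rule ev_push[OF Z(1) X h(1) Z(3,4)])
    also have "\<dots> = theta R J I X (coeff p0 q0) (push R I Z X h (tensor_coord R I Z (diff_tensor R I Z p0 q0)))"
      unfolding ev_theta
      by (rule theta_natural[OF I(1) J Z(2) fX hZ vF mod_homD(1)[OF tensor_coord_hom(1)[OF I(1) Z(2)] c0]])
    also have "push R I Z X h (tensor_coord R I Z (diff_tensor R I Z p0 q0)) = tensor_coord R I X ?D"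
      unfolding tensor_coord_natural[OF I(1) Z(1) X h(1) c0, symmetric] aug_mor_diff[OF Z(1) X h(1) Z(3,4)] D ..
    finally show "compose (carrier ?A) (tensor_coord R J X) (\<eta> X) ?D =
        compose (carrier ?A) (theta R J I X (coeff p0 q0)) (tensor_coord R I X) ?D"
      unfolding compose_def restrict_apply if_P[OF diff_tensor_closed[OF fX pX]] .
  qed
  thus ?thesis using T by (simp add: compose_def)
qed

end

end

section \<open>The inverse of the passage to coefficients\<close>

definition nat_of ::
  "('k, 'r) ring_scheme \<Rightarrow> 'j set \<Rightarrow> 'i set \<Rightarrow> (('j \<Rightarrow> 'i) \<Rightarrow> 'k) \<Rightarrow>
     'x set \<Rightarrow> (('i \<Rightarrow> 'x \<Rightarrow> 'k) \<Rightarrow> 'k) set \<Rightarrow> (('j \<Rightarrow> 'x \<Rightarrow> 'k) \<Rightarrow> 'k) set" where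
  "nat_of K J I v = (\<lambda>X\<in>fin_sets. \<lambda>T\<in>carrier (aug_tensor K I X).
     tensor_of K J X (SOME x. x \<in> X) (theta K J I X v (tensor_coord K I X T)))"

abbreviation surj_kernel_module ::
  "('k, 'r) ring_scheme \<Rightarrow> 'j set \<Rightarrow> 'i set \<Rightarrow> ('k, ('j \<Rightarrow> 'i) \<Rightarrow> 'k) module" where
  "surj_kernel_module K J I \<equiv> free_module K (surj_funs J I) \<lparr>carrier := surj_kernel K J I\<rparr>"

text \<open>Even and odd members of a sequence of different points.\<close>

lemma jointly_inj_exists:
  assumes "finite I"
  obtains p q :: "'i \<Rightarrow> 'x::infinite" where "jointly_inj I p q"
proof -
  obtain e :: "'i \<Rightarrow> nat" where e: "inj_on e I" using finite_imp_inj_to_nat_seg[OF assms] by blast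
  obtain u :: "nat \<Rightarrow> 'x" where u: "inj u" using infinite_countable_subset[OF infinite_UNIV] by blast
  have "jointly_inj I (\<lambda>i. u (2 * e i)) (\<lambda>i. u (2 * e i + 1))"
    unfolding jointly_inj_def
  proof (intro conjI inj_onI)
    show "(\<lambda>i. u (2 * e i)) ` I \<inter> (\<lambda>i. u (2 * e i + 1)) ` I = {}"
    proof -
      have "u (2 * e i) \<noteq> u (2 * e k + 1)" for i k
      proof
        assume "u (2 * e i) = u (2 * e k + 1)"
        hence "2 * e i = 2 * e k + 1" by (rule injD[OF u])
        thus False by presburger
      qed
      thus ?thesis by auto
    qed
  next
    fix i k assume "i \<in> I" "k \<in> I" "u (2 * e i) = u (2 * e k)"
    thus "i = k" using injD[OF u] e by (fastforce dest: inj_onD)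
  next
    fix i k assume "i \<in> I" "k \<in> I" "u (2 * e i + 1) = u (2 * e k + 1)"
    thus "i = k" using injD[OF u] e by (fastforce dest: inj_onD)
  qed
  thus ?thesis by (rule that)
qed

lemma mod_hom_add:
  assumes M: "Module.module K M" and N: "Module.module K N" and f: "f \<in> mod_hom K M N" and g: "g \<in> mod_hom K M N"
  shows "(\<lambda>v\<in>carrier M. f v \<oplus>\<^bsub>N\<^esub> g v) \<in> mod_hom K M N"
proof -
  interpret M: Module.module K M by fact
  interpret N: Module.module K N by fact
  show ?thesis
  proof (rule mod_homI)
    fix x y assume "x \<in> carrier M" "y \<in> carrier M"
    thus "(\<lambda>v\<in>carrier M. f v \<oplus>\<^bsub>N\<^esub> g v) (x \<oplus>\<^bsub>M\<^esub> y) =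
      (\<lambda>v\<in>carrier M. f v \<oplus>\<^bsub>N\<^esub> g v) x \<oplus>\<^bsub>N\<^esub> (\<lambda>v\<in>carrier M. f v \<oplus>\<^bsub>N\<^esub> g v) y"
      using mod_homD(1,2)[OF f] mod_homD(1,2)[OF g] by (simp add: N.M.a_ac)
  next
    fix c x assume "c \<in> carrier K" "x \<in> carrier M"
    thus "(\<lambda>v\<in>carrier M. f v \<oplus>\<^bsub>N\<^esub> g v) (c \<odot>\<^bsub>M\<^esub> x) = c \<odot>\<^bsub>N\<^esub> (\<lambda>v\<in>carrier M. f v \<oplus>\<^bsub>N\<^esub> g v) x"
      using mod_homD(1,3)[OF f] mod_homD(1,3)[OF g] by (simp add: N.smult_r_distr)
  qed (use mod_homD(1)[OF f] mod_homD(1)[OF g] in auto)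
qed

lemma mod_hom_smult:
  assumes M: "Module.module K M" and N: "Module.module K N" and f: "f \<in> mod_hom K M N" and d: "d \<in> carrier K"
  shows "(\<lambda>v\<in>carrier M. d \<odot>\<^bsub>N\<^esub> f v) \<in> mod_hom K M N"
proof -
  interpret M: Module.module K M by fact
  interpret N: Module.module K N by fact
  show ?thesis
  proof (rule mod_homI)
    fix x y assume "x \<in> carrier M" "y \<in> carrier M"
    thus "(\<lambda>v\<in>carrier M. d \<odot>\<^bsub>N\<^esub> f v) (x \<oplus>\<^bsub>M\<^esub> y) =
      (\<lambda>v\<in>carrier M. d \<odot>\<^bsub>N\<^esub> f v) x \<oplus>\<^bsub>N\<^esub> (\<lambda>v\<in>carrier M. d \<odot>\<^bsub>N\<^esub> f v) y"
      using mod_homD(1,2)[OF f] d by (simp add: N.smult_r_distr)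
  next
    fix c x assume "c \<in> carrier K" "x \<in> carrier M"
    thus "(\<lambda>v\<in>carrier M. d \<odot>\<^bsub>N\<^esub> f v) (c \<odot>\<^bsub>M\<^esub> x) = c \<odot>\<^bsub>N\<^esub> (\<lambda>v\<in>carrier M. d \<odot>\<^bsub>N\<^esub> f v) x"
      using mod_homD(1,3)[OF f] d by (simp add: N.smult_assoc1[symmetric] M.R.m_comm)
  qed (use mod_homD(1)[OF f] d in auto)
qed

lemma nat_transD:
  assumes "\<eta> \<in> nat_trans K F G"
  shows "X \<in> fin_sets \<Longrightarrow> \<eta> X \<in> mod_hom K (Obj F X) (Obj G X)"
    "X \<in> fin_sets \<Longrightarrow> Y \<in> fin_sets \<Longrightarrow> f \<in> X \<rightarrow>\<^sub>E Y \<Longrightarrow> v \<in> carrier (Obj F X) \<Longrightarrow>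
       \<eta> Y (Mor F X Y f v) = Mor G X Y f (\<eta> X v)"
    "\<eta> \<in> extensional fin_sets"
  using assms unfolding nat_trans_def by (auto simp: PiE_def)

lemma nat_transI:
  assumes "\<And>X. X \<in> fin_sets \<Longrightarrow> \<eta> X \<in> mod_hom K (Obj F X) (Obj G X)"
    "\<And>X Y f v. X \<in> fin_sets \<Longrightarrow> Y \<in> fin_sets \<Longrightarrow> f \<in> X \<rightarrow>\<^sub>E Y \<Longrightarrow> v \<in> carrier (Obj F X) \<Longrightarrow>
       \<eta> Y (Mor F X Y f v) = Mor G X Y f (\<eta> X v)"
    "\<eta> \<in> extensional fin_sets"
  shows "\<eta> \<in> nat_trans K F G"
  using assms unfolding nat_trans_def by (auto simp: PiE_def)

text \<open>Sums and multiples are again natural because the maps of the target functor are linear. This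
  lets isomorphisms be composed with one defined on natural transformations.\<close>

lemma Hom_functors_closed:
  fixes \<eta> \<theta> :: "'x set \<Rightarrow> 'm \<Rightarrow> 'n"
  assumes F: "is_fin_functor K F" and G: "is_fin_functor K G" and \<eta>: "\<eta> \<in> nat_trans K F G"
  shows "\<theta> \<in> nat_trans K F G \<Longrightarrow> \<eta> \<oplus>\<^bsub>Hom_functors K F G\<^esub> \<theta> \<in> nat_trans K F G"
    "c \<in> carrier K \<Longrightarrow> c \<odot>\<^bsub>Hom_functors K F G\<^esub> \<eta> \<in> nat_trans K F G"
proof -
  note FM = is_fin_functorD(1)[OF F] and GM = is_fin_functorD(1)[OF G]
    and Fh = is_fin_functorD(2)[OF F] and Gh = is_fin_functorD(2)[OF G]
  show "\<eta> \<oplus>\<^bsub>Hom_functors K F G\<^esub> \<theta> \<in> nat_trans K F G" if \<theta>: "\<theta> \<in> nat_trans K F G"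
  proof (rule nat_transI)
    fix X :: "'x set" assume X: "X \<in> fin_sets"
    show "(\<eta> \<oplus>\<^bsub>Hom_functors K F G\<^esub> \<theta>) X \<in> mod_hom K (Obj F X) (Obj G X)"
      using mod_hom_add[OF FM[OF X] GM[OF X] nat_transD(1)[OF \<eta> X] nat_transD(1)[OF \<theta> X]] X by (simp add: Hom_functors_def)
  next
    fix X Y :: "'x set" and f v assume *: "X \<in> fin_sets" "Y \<in> fin_sets" "f \<in> X \<rightarrow>\<^sub>E Y" "v \<in> carrier (Obj F X)"
    show "(\<eta> \<oplus>\<^bsub>Hom_functors K F G\<^esub> \<theta>) Y (Mor F X Y f v) = Mor G X Y f ((\<eta> \<oplus>\<^bsub>Hom_functors K F G\<^esub> \<theta>) X v)"
      using * nat_transD(2)[OF \<eta> *] nat_transD(2)[OF \<theta> *] mod_homD(1)[OF Fh[OF *(1-3)] *(4)]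
        mod_homD(2)[OF Gh[OF *(1-3)] mod_homD(1)[OF nat_transD(1)[OF \<eta> *(1)] *(4)] mod_homD(1)[OF nat_transD(1)[OF \<theta> *(1)] *(4)]]
      by (simp add: Hom_functors_def)
  qed (simp add: Hom_functors_def)
  show "c \<odot>\<^bsub>Hom_functors K F G\<^esub> \<eta> \<in> nat_trans K F G" if c: "c \<in> carrier K"
  proof (rule nat_transI)
    fix X :: "'x set" assume X: "X \<in> fin_sets"
    show "(c \<odot>\<^bsub>Hom_functors K F G\<^esub> \<eta>) X \<in> mod_hom K (Obj F X) (Obj G X)"
      using mod_hom_smult[OF FM[OF X] GM[OF X] nat_transD(1)[OF \<eta> X] c] X by (simp add: Hom_functors_def)
  next
    fix X Y :: "'x set" and f v assume *: "X \<in> fin_sets" "Y \<in> fin_sets" "f \<in> X \<rightarrow>\<^sub>E Y" "v \<in> carrier (Obj F X)"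
    show "(c \<odot>\<^bsub>Hom_functors K F G\<^esub> \<eta>) Y (Mor F X Y f v) = Mor G X Y f ((c \<odot>\<^bsub>Hom_functors K F G\<^esub> \<eta>) X v)"
      using * nat_transD(2)[OF \<eta> *] mod_homD(1)[OF Fh[OF *(1-3)] *(4)]
        mod_homD(3)[OF Gh[OF *(1-3)] c mod_homD(1)[OF nat_transD(1)[OF \<eta> *(1)] *(4)]]
      by (simp add: Hom_functors_def)
  qed (simp add: Hom_functors_def)
qed

context cring
begin

lemma kbar_tensor_functor: "is_fin_functor R (kbar_tensor R I)"
  by (intro tensor_functor_is_functor kbar_is_functor R_cring)

context
  fixes I :: "'i set" and J :: "'j set"
  assumes I: "finite I" "I \<noteq> {}" and J: "finite J"
begin

lemma kernel_free: "v \<in> surj_kernel R J I \<Longrightarrow> v \<in> carrier (free_module R (surj_funs J I))"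
  by (simp add: surj_kernel_def)

lemma coord_nat_of:
  assumes X: "X \<in> fin_sets" and v: "v \<in> surj_kernel R J I" and T: "T \<in> carrier (aug_tensor R I X)"
  shows "tensor_coord R J X (nat_of R J I v X T) = theta R J I X v (tensor_coord R I X T)"
proof -
  have fX: "finite X" "(SOME x. x \<in> X) \<in> X" using X some_in_eq by (auto simp: fin_sets_def)
  have "nat_of R J I v X T = tensor_of R J X (SOME x. x \<in> X) (theta R J I X v (tensor_coord R I X T))"
    using X T by (simp add: nat_of_def)
  thus ?thesis
    using tensor_coord_of[OF J fX theta_zero_marg[OF I(1) J fX(1) v tensor_coord_zero_marg[OF I(1) fX(1) T]]] by simp
qed

lemma nat_of_hom:
  assumes X: "X \<in> fin_sets" and v: "v \<in> surj_kernel R J I"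
  shows "nat_of R J I v X \<in> mod_hom R (aug_tensor R I X) (aug_tensor R J X)"
proof -
  have fX: "finite X" "(SOME x. x \<in> X) \<in> X" using X some_in_eq by (auto simp: fin_sets_def)
  have "nat_of R J I v X = compose (carrier (aug_tensor R I X)) (tensor_of R J X (SOME x. x \<in> X))
      (compose (carrier (aug_tensor R I X)) (theta R J I X v) (tensor_coord R I X))"
    using X by (simp add: nat_of_def compose_def cong: restrict_cong)
  thus ?thesis
    using mod_hom_comp[OF tensor_module[OF fX(1)] mod_hom_comp[OF tensor_module[OF fX(1)] tensor_coord_hom(1)[OF I(1) fX(1)]
       theta_hom[OF I(1) J fX(1) surj_free[OF I(1) J kernel_free[OF v]]]] tensor_of_hom(1)[OF J fX]] by simp
qed

text \<open>Naturality is checked in coordinates, which are injective.\<close>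

lemma nat_of_nat_trans:
  assumes v: "v \<in> surj_kernel R J I"
  shows "nat_of R J I v \<in> nat_trans R (kbar_tensor R I) (kbar_tensor R J)"
proof -
  have "nat_of R J I v Y (aug_mor R I X Y h T) = aug_mor R J X Y h (nat_of R J I v X T)"
    if X: "X \<in> fin_sets" and Y: "Y \<in> fin_sets" and h: "h \<in> X \<rightarrow>\<^sub>E Y" and T: "T \<in> carrier (aug_tensor R I X)" for X Y h T
  proof -
    have fin: "finite X" "finite Y" "Y \<noteq> {}" using X Y by (auto simp: fin_sets_def)
    have hXY: "h \<in> X \<rightarrow> Y" using h by auto
    note MT = mod_homD(1)[OF aug_mor_hom(1)[OF X Y h] T] and NT = mod_homD(1)[OF nat_of_hom[OF X v] T]
    note vF = surj_free[OF I(1) J kernel_free[OF v]]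
    show ?thesis
    proof (rule tensor_coord_inj[OF J fin(2,3) mod_homD(1)[OF nat_of_hom[OF Y v] MT] mod_homD(1)[OF aug_mor_hom(1)[OF X Y h] NT]])
      show "tensor_coord R J Y (nat_of R J I v Y (aug_mor R I X Y h T)) = tensor_coord R J Y (aug_mor R J X Y h (nat_of R J I v X T))"
        unfolding coord_nat_of[OF Y v MT] tensor_coord_natural[OF I(1) X Y h T] tensor_coord_natural[OF J X Y h NT]
          coord_nat_of[OF X v T]
        by (rule theta_natural[OF I(1) J fin(1,2) hXY vF mod_homD(1)[OF tensor_coord_hom(1)[OF I(1) fin(1)] T], symmetric])
    qed
  qed
  moreover have "nat_of R J I v \<in> extensional fin_sets" by (simp add: nat_of_def)
  ultimately show ?thesis using nat_of_hom[OF _ v] by (intro nat_transI) (simp_all add: Obj_tensor_kbar)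
qed

text \<open>Injectivity is the reconstruction of a transformation from its coefficients. For surjectivity,
  the coefficients of the transformation given by \<open>v\<close> are read off at \<open>p0 \<circ> f\<close>, where the universal
  generator has coordinate \<open>1\<close>.\<close>

theorem nat_coeff_iso:
  fixes p0 q0 :: "'i \<Rightarrow> 'x::infinite"
  assumes p0q0: "jointly_inj I p0 q0"
  shows "restrict (nat_coeff R J I p0 q0) (nat_trans R (kbar_tensor R I) (kbar_tensor R J)) \<in>
    mod_iso R (Hom_functors R (kbar_tensor R I) (kbar_tensor R J)) (surj_kernel_module R J I)"
proof -
  let ?F = "kbar_tensor R I :: ('x, 'a, _) fin_functor" and ?G = "kbar_tensor R J :: ('x, 'a, _) fin_functor"
  let ?H = "Hom_functors R ?F ?G" and ?N = "nat_trans R ?F ?G"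
  let ?\<Phi> = "restrict (nat_coeff R J I p0 q0) ?N" and ?M = "surj_kernel_module R J I"
  let ?Z = "p0 ` I \<union> q0 ` I"
  let ?d = "diff_tensor R I ?Z p0 q0"
  have Z: "?Z \<in> fin_sets" "finite ?Z" "p0 \<in> I \<rightarrow> ?Z" "q0 \<in> I \<rightarrow> ?Z"
    using I by (auto simp: fin_sets_def)
  have loc: "kbar_nat_trans R I J \<eta>" if "\<eta> \<in> ?N" for \<eta>
    by unfold_locales (use I J that in auto)
  have H: "carrier ?H = ?N" by (simp add: Hom_functors_def)
  note CJ = tensor_coord_hom(1)[OF J] and D = diff_tensor_closed[OF Z(2,3,4)]
  have hom: "\<eta> X \<in> mod_hom R (aug_tensor R I X) (aug_tensor R J X)" if "\<eta> \<in> ?N" "X \<in> fin_sets" for \<eta> X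
    by (rule kbar_nat_trans.nat_hom[OF loc[OF that(1)] that(2)])
  have kern: "nat_coeff R J I p0 q0 \<eta> \<in> surj_kernel R J I" if "\<eta> \<in> ?N" for \<eta>
    by (rule kbar_nat_trans.coeff_kernel[OF loc[OF that] p0q0])
  note closed = Hom_functors_closed[OF kbar_tensor_functor kbar_tensor_functor]
  have "?\<Phi> \<in> mod_hom R ?H ?M"
  proof (rule mod_homI, unfold H)
    fix \<eta> \<theta> assume \<eta>: "\<eta> \<in> ?N" and \<theta>: "\<theta> \<in> ?N"
    note \<eta>D = mod_homD(1)[OF hom[OF \<eta> Z(1)] D] and \<theta>D = mod_homD(1)[OF hom[OF \<theta> Z(1)] D]
    have "(\<eta> \<oplus>\<^bsub>?H\<^esub> \<theta>) ?Z ?d = \<eta> ?Z ?d \<oplus>\<^bsub>aug_tensor R J ?Z\<^esub> \<theta> ?Z ?d"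
      using Z(1) D by (simp add: Hom_functors_def Obj_tensor_kbar)
    hence "tensor_coord R J ?Z ((\<eta> \<oplus>\<^bsub>?H\<^esub> \<theta>) ?Z ?d) y = tensor_coord R J ?Z (\<eta> ?Z ?d) y \<oplus> tensor_coord R J ?Z (\<theta> ?Z ?d) y" for y
      by (simp add: mod_homD(2)[OF CJ[OF Z(2)] \<eta>D \<theta>D])
    hence "nat_coeff R J I p0 q0 (\<eta> \<oplus>\<^bsub>?H\<^esub> \<theta>) = (\<lambda>f. nat_coeff R J I p0 q0 \<eta> f \<oplus> nat_coeff R J I p0 q0 \<theta> f)"
      by (simp add: nat_coeff_def Let_def fun_eq_iff)
    thus "?\<Phi> (\<eta> \<oplus>\<^bsub>?H\<^esub> \<theta>) = ?\<Phi> \<eta> \<oplus>\<^bsub>?M\<^esub> ?\<Phi> \<theta>"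
      using \<eta> \<theta> closed(1)[OF \<eta> \<theta>] by (simp add: free_module_def)
  next
    fix c \<eta> assume c: "c \<in> carrier R" and \<eta>: "\<eta> \<in> ?N"
    note \<eta>D = mod_homD(1)[OF hom[OF \<eta> Z(1)] D]
    have "(c \<odot>\<^bsub>?H\<^esub> \<eta>) ?Z ?d = c \<odot>\<^bsub>aug_tensor R J ?Z\<^esub> \<eta> ?Z ?d"
      using Z(1) D by (simp add: Hom_functors_def Obj_tensor_kbar)
    hence "tensor_coord R J ?Z ((c \<odot>\<^bsub>?H\<^esub> \<eta>) ?Z ?d) y = c \<otimes> tensor_coord R J ?Z (\<eta> ?Z ?d) y" for y
      by (simp add: mod_homD(3)[OF CJ[OF Z(2)] c \<eta>D])
    hence "nat_coeff R J I p0 q0 (c \<odot>\<^bsub>?H\<^esub> \<eta>) = (\<lambda>f. c \<otimes> nat_coeff R J I p0 q0 \<eta> f)"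
      using c by (simp add: nat_coeff_def Let_def fun_eq_iff)
    thus "?\<Phi> (c \<odot>\<^bsub>?H\<^esub> \<eta>) = c \<odot>\<^bsub>?M\<^esub> ?\<Phi> \<eta>"
      using \<eta> closed(2)[OF \<eta> c] by (simp add: free_module_def)
  qed (use kern in auto)
  moreover have "bij_betw ?\<Phi> ?N (surj_kernel R J I)"
  proof (rule bij_betw_imageI)
    show "inj_on ?\<Phi> ?N"
    proof (rule inj_onI)
      fix \<eta> \<theta> assume \<eta>: "\<eta> \<in> ?N" and \<theta>: "\<theta> \<in> ?N" and "?\<Phi> \<eta> = ?\<Phi> \<theta>"
      hence e: "nat_coeff R J I p0 q0 \<eta> = nat_coeff R J I p0 q0 \<theta>" by simp
      show "\<eta> = \<theta>"
      proof (rule extensionalityI[OF nat_transD(3)[OF \<eta>] nat_transD(3)[OF \<theta>]])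
        fix X :: "'x set" assume X: "X \<in> fin_sets"
        hence fX: "finite X" "X \<noteq> {}" by (auto simp: fin_sets_def)
        show "\<eta> X = \<theta> X"
        proof (rule extensionalityI[of _ "carrier (aug_tensor R I X)"])
          show "\<eta> X \<in> extensional (carrier (aug_tensor R I X))" "\<theta> X \<in> extensional (carrier (aug_tensor R I X))"
            using hom[OF \<eta> X] hom[OF \<theta> X] by (auto simp: mod_hom_def PiE_def)
          fix T assume T: "T \<in> carrier (aug_tensor R I X)"
          show "\<eta> X T = \<theta> X T"
            by (rule tensor_coord_inj[OF J fX mod_homD(1)[OF hom[OF \<eta> X] T] mod_homD(1)[OF hom[OF \<theta> X] T]])
              (unfold kbar_nat_trans.coord_nat_eq_theta[OF loc[OF \<eta>] p0q0 X T]
                kbar_nat_trans.coord_nat_eq_theta[OF loc[OF \<theta>] p0q0 X T] e, rule refl)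
        qed
      qed
    qed
    show "?\<Phi> ` ?N = surj_kernel R J I"
    proof
      show "?\<Phi> ` ?N \<subseteq> surj_kernel R J I" using kern by auto
      show "surj_kernel R J I \<subseteq> ?\<Phi> ` ?N"
      proof
        fix v assume v: "v \<in> surj_kernel R J I"
        note vs = kernel_free[OF v]
        have nc: "nat_coeff R J I p0 q0 (nat_of R J I v) = v"
        proof
          fix f
          show "nat_coeff R J I p0 q0 (nat_of R J I v) f = v f"
          proof (cases "f \<in> surj_funs J I")
            case False
            thus ?thesis using free_outside[OF vs] by (simp add: nat_coeff_def Let_def)
          next
            case True
            let ?x = "restrict p0 I"
            have x: "?x \<in> I \<rightarrow>\<^sub>E ?Z" by auto
            have "(\<lambda>j\<in>J. p0 (f j)) = (\<lambda>j\<in>J. ?x (f j))"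
              by (rule restrict_ext) (use True in \<open>auto simp: surj_funs_def\<close>)
            hence "nat_coeff R J I p0 q0 (nat_of R J I v) f = theta R J I ?Z v (tensor_coord R I ?Z ?d) (\<lambda>j\<in>J. ?x (f j))"
              using True by (simp add: nat_coeff_def Let_def coord_nat_of[OF Z(1) v D])
            also have "\<dots> = v f \<otimes> tensor_coord R I ?Z ?d ?x"
              by (rule theta_at[OF I(1) J Z(2,3,4) p0q0 vs True x]) simp
            also have "tensor_coord R I ?Z ?d ?x = (\<Otimes>i\<in>I. point_diff R (p0 i) (q0 i) (?x i))"
              by (rule tensor_coord_diff[OF I(1) Z(2,3,4) x])
            also have "\<dots> = \<one>"
            proof (rule finprod_one_eqI)
              fix i assume i: "i \<in> I"
              hence "p0 i \<noteq> q0 i" using p0q0 by (auto simp: jointly_inj_def)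
              thus "point_diff R (p0 i) (q0 i) (?x i) = \<one>" using i by (simp add: point_diff_def gen_def a_minus_def)
            qed
            finally show ?thesis using free_mem[OF vs] by simp
          qed
        qed
        have "v = ?\<Phi> (nat_of R J I v)" unfolding restrict_apply if_P[OF nat_of_nat_trans[OF v]] nc ..
        thus "v \<in> ?\<Phi> ` ?N" by (rule image_eqI[OF _ nat_of_nat_trans[OF v]])
      qed
    qed
  qed
  ultimately show ?thesis by (simp add: mod_iso_def H)
qed

end

end

section \<open>The symmetric group actions\<close>

text \<open>Inside the locale of rings the usual notation for inverse functions denotes ring inverses.\<close>

abbreviation perm_inv :: "('a \<Rightarrow> 'a) \<Rightarrow> 'a \<Rightarrow> 'a" where
  "perm_inv \<equiv> inv_into UNIV"

lemma Obj_kbar_power: "Obj (kbar_power K n) X = aug_tensor K {1..n} X"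
  unfolding kbar_power_def by (rule Obj_tensor_kbar)

lemma surjs_eq: "surjs S a = surj_funs S {1..a}"
  by (auto simp: surjs_def surj_funs_def)

lemma finite_surj_funs: "finite J \<Longrightarrow> finite I \<Longrightarrow> finite (surj_funs J I)"
  by (rule finite_subset[of _ "J \<rightarrow>\<^sub>E I"]) (auto simp: surj_funs_def intro!: finite_PiE)

lemma surj_funs_conj:
  assumes \<sigma>: "\<sigma> permutes I" and \<tau>: "\<tau> permutes J" and f: "f \<in> surj_funs J I"
  shows "(\<lambda>j\<in>J. \<sigma> (f (\<tau> j))) \<in> surj_funs J I"
proof -
  have "(\<lambda>j\<in>J. \<sigma> (f (\<tau> j))) ` J = \<sigma> ` f ` \<tau> ` J" by (auto simp: image_def)
  also have "\<dots> = I" using f permutes_image[OF \<sigma>] permutes_image[OF \<tau>] by (simp add: surj_funs_def)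
  finally have i: "(\<lambda>j\<in>J. \<sigma> (f (\<tau> j))) ` J = I" .
  hence "(\<lambda>j\<in>J. \<sigma> (f (\<tau> j))) \<in> J \<rightarrow>\<^sub>E I" by (intro PiE_I) (auto simp del: restrict_apply simp: restrict_def)
  thus ?thesis using i unfolding surj_funs_def by blast
qed

context cring
begin

lemma place_perm_hom:
  assumes X: "finite X" and \<sigma>: "\<sigma> permutes {1..n}"
  shows "place_perm R n \<sigma> X \<in> mod_hom R (aug_tensor R {1..n} X) (aug_tensor R {1..n} X)"
    "t \<in> {1..n} \<rightarrow>\<^sub>E carrier (aug_kernel R X) \<Longrightarrow>
      place_perm R n \<sigma> X (tensor_elt R {1..n} (\<lambda>_. aug_kernel R X) t) =
        tensor_elt R {1..n} (\<lambda>_. aug_kernel R X) (\<lambda>i\<in>{1..n}. t (\<sigma> i))"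
proof -
  let ?I = "{1..n}" and ?A = "aug_kernel R X"
  let ?e = "tensor_elt R ?I (\<lambda>_. ?A)" and ?g = "\<lambda>t. tensor_elt R {1..n} (\<lambda>_. aug_kernel R X) (\<lambda>i\<in>{1..n}. t (\<sigma> i))"
  have A: "\<And>i. i \<in> ?I \<Longrightarrow> Module.module R ?A" by (rule aug_kernel_module[OF X])
  have t': "(\<lambda>i\<in>?I. t (\<sigma> i)) \<in> ?I \<rightarrow>\<^sub>E carrier ?A" if t: "t \<in> ?I \<rightarrow>\<^sub>E carrier ?A" for t
    by (rule PiE_I) (use PiE_mem[OF t] permutes_in_image[OF \<sigma>] in auto)
  have upd: "(\<lambda>k\<in>?I. (t(i := w)) (\<sigma> k)) = (\<lambda>k\<in>?I. t (\<sigma> k))(perm_inv \<sigma> i := w)" if i: "i \<in> ?I" for t i w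
  proof
    fix k
    have s: "perm_inv \<sigma> i \<in> ?I" using i permutes_in_image[OF permutes_inv[OF \<sigma>]] by blast
    have "\<sigma> k = i \<longleftrightarrow> k = perm_inv \<sigma> i" using permutes_inverses[OF \<sigma>] by metis
    thus "(\<lambda>k\<in>?I. (t(i := w)) (\<sigma> k)) k = ((\<lambda>k\<in>?I. t (\<sigma> k))(perm_inv \<sigma> i := w)) k"
      using s by (cases "k = perm_inv \<sigma> i") (auto simp del: atLeastAtMost_iff)
  qed
  have m: "multilin R ?I (\<lambda>_. ?A) (aug_tensor R ?I X) ?g"
  proof (rule multilinI)
    fix t i x y assume t: "t \<in> ?I \<rightarrow>\<^sub>E carrier ?A" and i: "i \<in> ?I" and x: "x \<in> carrier ?A" and y: "y \<in> carrier ?A"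
    have s: "perm_inv \<sigma> i \<in> ?I" using i permutes_in_image[OF permutes_inv[OF \<sigma>]] by blast
    show "?g (t(i := x \<oplus>\<^bsub>?A\<^esub> y)) = ?g (t(i := x)) \<oplus>\<^bsub>aug_tensor R ?I X\<^esub> ?g (t(i := y))"
      unfolding upd[OF i] by (rule multilinD(1)[OF tensor_elt_multilin[OF X] t'[OF t] s x y])
  next
    fix t i c x assume t: "t \<in> ?I \<rightarrow>\<^sub>E carrier ?A" and i: "i \<in> ?I" and c: "c \<in> carrier R" and x: "x \<in> carrier ?A"
    have s: "perm_inv \<sigma> i \<in> ?I" using i permutes_in_image[OF permutes_inv[OF \<sigma>]] by blast
    show "?g (t(i := c \<odot>\<^bsub>?A\<^esub> x)) = c \<odot>\<^bsub>aug_tensor R ?I X\<^esub> ?g (t(i := x))"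
      unfolding upd[OF i] by (rule multilinD(2)[OF tensor_elt_multilin[OF X] t'[OF t] s c x])
  qed
  have g: "?g \<in> (?I \<rightarrow>\<^sub>E carrier ?A) \<rightarrow> carrier (aug_tensor R ?I X)"
    by (rule Pi_I) (rule tensor_elt_closed[OF X t'])
  show "place_perm R n \<sigma> X \<in> mod_hom R (aug_tensor R ?I X) (aug_tensor R ?I X)"
    unfolding place_perm_def Obj_kbar_power by (rule tensor_lift_hom(1)[OF R_cring A tensor_module[OF X] g m])
  show "t \<in> ?I \<rightarrow>\<^sub>E carrier ?A \<Longrightarrow> place_perm R n \<sigma> X (?e t) = ?g t"
    unfolding place_perm_def Obj_kbar_power by (rule tensor_lift_hom(2)[OF R_cring A tensor_module[OF X] g m])
qed

lemma place_perm_diff: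
  assumes X: "finite X" and \<sigma>: "\<sigma> permutes {1..n}" and p: "p \<in> {1..n} \<rightarrow> X" and q: "q \<in> {1..n} \<rightarrow> X"
  shows "place_perm R n \<sigma> X (diff_tensor R {1..n} X p q) = diff_tensor R {1..n} X (\<lambda>i. p (\<sigma> i)) (\<lambda>i. q (\<sigma> i))"
proof -
  have "(\<lambda>i\<in>{1..n}. (\<lambda>i\<in>{1..n}. point_diff R (p i) (q i)) (\<sigma> i)) = (\<lambda>i\<in>{1..n}. point_diff R (p (\<sigma> i)) (q (\<sigma> i)))"
    by (rule restrict_ext) (use permutes_in_image[OF \<sigma>] in auto)
  thus ?thesis unfolding diff_tensor_def place_perm_hom(2)[OF X \<sigma> diff_tuple[OF X p q]] by (rule arg_cong)
qed

lemma reindex_perm: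
  assumes I: "finite I" and X: "finite X" and \<sigma>: "\<sigma> permutes I"
    and \<phi>: "\<phi> \<in> carrier (free_module R (I \<rightarrow>\<^sub>E X))" and y: "y \<in> I \<rightarrow>\<^sub>E X"
  shows "reindex R I I X \<sigma> \<phi> y = \<phi> (\<lambda>i\<in>I. y (perm_inv \<sigma> i))"
proof -
  let ?y = "\<lambda>i\<in>I. y (perm_inv \<sigma> i)"
  have \<sigma>I: "\<sigma> \<in> I \<rightarrow> I" using permutes_in_image[OF \<sigma>] by auto
  have IX: "finite (I \<rightarrow>\<^sub>E X)" using I X by (intro finite_PiE) auto
  have y': "?y \<in> I \<rightarrow>\<^sub>E X" using y permutes_in_image[OF permutes_inv[OF \<sigma>]] by (auto simp: PiE_iff)
  have iff: "(\<lambda>j\<in>I. x (\<sigma> j)) = y \<longleftrightarrow> x = ?y" if x: "x \<in> I \<rightarrow>\<^sub>E X" for x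
  proof
    assume e: "(\<lambda>j\<in>I. x (\<sigma> j)) = y"
    show "x = ?y"
    proof (rule PiE_ext[OF x y'])
      fix i assume i: "i \<in> I"
      hence "perm_inv \<sigma> i \<in> I" using permutes_in_image[OF permutes_inv[OF \<sigma>]] by blast
      thus "x i = ?y i" using fun_cong[OF e, of "perm_inv \<sigma> i"] i permutes_inverses(1)[OF \<sigma>] by simp
    qed
  next
    assume e: "x = ?y"
    show "(\<lambda>j\<in>I. x (\<sigma> j)) = y"
    proof (rule PiE_ext[OF _ y])
      show "(\<lambda>j\<in>I. x (\<sigma> j)) \<in> I \<rightarrow>\<^sub>E X" using x \<sigma>I by (auto simp: PiE_iff)
      fix i assume i: "i \<in> I"
      thus "(\<lambda>j\<in>I. x (\<sigma> j)) i = y i" using \<sigma>I unfolding e by (simp add: permutes_inverses(2)[OF \<sigma>] Pi_iff)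
    qed
  qed
  have "(\<Oplus>x\<in>I \<rightarrow>\<^sub>E X. if (\<lambda>j\<in>I. x (\<sigma> j)) = y then \<phi> x else \<zero>) = (if (\<lambda>j\<in>I. ?y (\<sigma> j)) = y then \<phi> ?y else \<zero>)"
  proof (rule finsum_single[OF IX y'])
    show "(if (\<lambda>j\<in>I. ?y (\<sigma> j)) = y then \<phi> ?y else \<zero>) \<in> carrier R" using free_mem[OF \<phi>] by (metis zero_closed)
    show "(if (\<lambda>j\<in>I. x (\<sigma> j)) = y then \<phi> x else \<zero>) = \<zero>" if "x \<in> I \<rightarrow>\<^sub>E X" "x \<noteq> ?y" for x
      using iff[OF that(1)] that(2) by (intro if_not_P) blast
  qed
  also have "\<dots> = \<phi> ?y" using iff[OF y'] by (intro if_P) blast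
  finally show ?thesis unfolding reindex_hom(3)[OF I I X \<sigma>I \<phi>] .
qed

text \<open>Permuting tensor factors is reindexing in coordinates, so it commutes with pushing forward and
  is therefore natural.\<close>

lemma coord_place_perm:
  assumes X: "finite X" and \<sigma>: "\<sigma> permutes {1..n}" and T: "T \<in> carrier (aug_tensor R {1..n} X)"
  shows "tensor_coord R {1..n} X (place_perm R n \<sigma> X T) = reindex R {1..n} {1..n} X \<sigma> (tensor_coord R {1..n} X T)"
proof -
  let ?I = "{1..n}" and ?T = "aug_tensor R {1..n} X" and ?J = "tensor_coord R {1..n} X" and ?e = "tensor_elt R {1..n} (\<lambda>_. aug_kernel R X)"
  have I: "finite ?I" by simp
  have \<sigma>I: "\<sigma> \<in> ?I \<rightarrow> ?I" using permutes_in_image[OF \<sigma>] by auto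
  note J = tensor_coord_hom(1)[OF I X] and P = place_perm_hom(1)[OF X \<sigma>] and TM = tensor_module[OF X]
    and H = reindex_hom(1)[OF I I X \<sigma>I]
  have "compose (carrier ?T) ?J (place_perm R n \<sigma> X) T = compose (carrier ?T) (reindex R ?I ?I X \<sigma>) ?J T"
  proof (rule tensor_hom_ext[OF R_cring aug_kernel_module[OF X] free_module_R mod_hom_comp[OF TM P J] mod_hom_comp[OF TM J H] _ T])
    fix t assume t: "t \<in> ?I \<rightarrow>\<^sub>E carrier (aug_kernel R X)"
    have te: "?e t \<in> carrier ?T" by (rule tensor_elt_closed[OF X t])
    have tc: "t i s \<in> carrier R" if "i \<in> ?I" for i s by (rule aug_kernel_mem[OF PiE_mem[OF t that]])
    have t': "(\<lambda>i\<in>?I. t (\<sigma> i)) \<in> ?I \<rightarrow>\<^sub>E carrier (aug_kernel R X)"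
      by (rule PiE_I) (use PiE_mem[OF t] funcset_mem[OF \<sigma>I] in auto)
    have "?J (place_perm R n \<sigma> X (?e t)) = reindex R ?I ?I X \<sigma> (?J (?e t))"
    proof
      fix y
      show "?J (place_perm R n \<sigma> X (?e t)) y = reindex R ?I ?I X \<sigma> (?J (?e t)) y"
      proof (cases "y \<in> ?I \<rightarrow>\<^sub>E X")
        case False
        show ?thesis
          by (rule trans[OF free_outside[OF mod_homD(1)[OF J mod_homD(1)[OF P te]] False]
            free_outside[OF mod_homD(1)[OF H mod_homD(1)[OF J te]] False, symmetric]])
      next
        case True
        let ?y = "\<lambda>i\<in>?I. y (perm_inv \<sigma> i)"
        have y': "?y \<in> ?I \<rightarrow>\<^sub>E X"
          by (rule PiE_I) (use PiE_mem[OF True] permutes_in_image[OF permutes_inv[OF \<sigma>]] in auto)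
        have "?J (place_perm R n \<sigma> X (?e t)) y = (\<Otimes>i\<in>?I. (\<lambda>i\<in>?I. t (\<sigma> i)) i (y i))"
          unfolding place_perm_hom(2)[OF X \<sigma> t] tensor_coord_hom(2)[OF I X t'] using True by (rule if_P)
        also have "\<dots> = (\<Otimes>i\<in>?I. t (\<sigma> i) (?y (\<sigma> i)))"
          by (rule finprod_cong'[OF refl])
             (use tc funcset_mem[OF \<sigma>I] permutes_inverses(2)[OF \<sigma>] in \<open>auto simp del: atLeastAtMost_iff\<close>)
        also have "\<dots> = (\<Otimes>i\<in>\<sigma> ` ?I. t i (?y i))"
          by (rule finprod_reindex[symmetric])
             (use tc permutes_image[OF \<sigma>] permutes_inj_on[OF \<sigma>] in \<open>auto simp del: atLeastAtMost_iff\<close>)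
        also have "\<dots> = (\<Otimes>i\<in>?I. t i (?y i))" unfolding permutes_image[OF \<sigma>] ..
        also have "\<dots> = ?J (?e t) ?y"
          unfolding tensor_coord_hom(2)[OF I X t] using y' by (rule if_P[symmetric])
        also have "\<dots> = reindex R ?I ?I X \<sigma> (?J (?e t)) y"
          by (rule reindex_perm[OF I X \<sigma> mod_homD(1)[OF J te] True, symmetric])
        finally show ?thesis .
      qed
    qed
    thus "compose (carrier ?T) ?J (place_perm R n \<sigma> X) (?e t) = compose (carrier ?T) (reindex R ?I ?I X \<sigma>) ?J (?e t)"
      unfolding compose_def restrict_apply if_P[OF te] .
  qed
  thus ?thesis unfolding compose_def restrict_apply if_P[OF T] .
qed

lemma place_perm_natural:
  assumes X: "X \<in> fin_sets" and Y: "Y \<in> fin_sets" and h: "h \<in> X \<rightarrow>\<^sub>E Y" and \<sigma>: "\<sigma> permutes {1..n}"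
    and T: "T \<in> carrier (aug_tensor R {1..n} X)"
  shows "place_perm R n \<sigma> Y (aug_mor R {1..n} X Y h T) = aug_mor R {1..n} X Y h (place_perm R n \<sigma> X T)"
proof -
  let ?I = "{1..n}"
  have I: "finite ?I" by simp
  have fin: "finite X" "finite Y" "Y \<noteq> {}" using X Y by (auto simp: fin_sets_def)
  have \<sigma>I: "\<sigma> \<in> ?I \<rightarrow> ?I" using permutes_in_image[OF \<sigma>] by auto
  have hXY: "h \<in> X \<rightarrow> Y" using h by auto
  note M = mod_homD(1)[OF aug_mor_hom(1)[OF X Y h]] and PX = mod_homD(1)[OF place_perm_hom(1)[OF fin(1) \<sigma>]]
    and PY = mod_homD(1)[OF place_perm_hom(1)[OF fin(2) \<sigma>]]
  show ?thesis
  proof (rule tensor_coord_inj[OF I fin(2,3) PY[OF M[OF T]] M[OF PX[OF T]]])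
    show "tensor_coord R ?I Y (place_perm R n \<sigma> Y (aug_mor R ?I X Y h T)) = tensor_coord R ?I Y (aug_mor R ?I X Y h (place_perm R n \<sigma> X T))"
      unfolding coord_place_perm[OF fin(2) \<sigma> M[OF T]] tensor_coord_natural[OF I X Y h T]
        tensor_coord_natural[OF I X Y h PX[OF T]] coord_place_perm[OF fin(1) \<sigma> T]
      by (rule push_reindex[OF I I fin(1,2) hXY \<sigma>I mod_homD(1)[OF tensor_coord_hom(1)[OF I fin(1)] T], symmetric])
  qed
qed

lemma Hom_act_nat_trans:
  fixes \<eta> :: "'x set \<Rightarrow> ((nat \<Rightarrow> 'x \<Rightarrow> 'a) \<Rightarrow> 'a) set \<Rightarrow> ((nat \<Rightarrow> 'x \<Rightarrow> 'a) \<Rightarrow> 'a) set"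
  assumes \<eta>: "\<eta> \<in> nat_trans R (kbar_tensor R {1..a}) (kbar_tensor R {1..b})"
    and \<sigma>: "\<sigma> permutes {1..a}" and \<tau>: "\<tau> permutes {1..b}"
  shows "Hom_act R a b \<sigma> \<tau> \<eta> \<in> nat_trans R (kbar_tensor R {1..a}) (kbar_tensor R {1..b})"
proof (rule nat_transI, unfold Obj_tensor_kbar)
  note N = nat_transD[OF \<eta>, unfolded Obj_tensor_kbar]
  fix X :: "'x set" assume X: "X \<in> fin_sets"
  hence fX: "finite X" by (simp add: fin_sets_def)
  have "Hom_act R a b \<sigma> \<tau> \<eta> X = compose (carrier (aug_tensor R {1..a} X)) (place_perm R b \<tau> X)
      (compose (carrier (aug_tensor R {1..a} X)) (\<eta> X) (place_perm R a \<sigma> X))"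
    using X by (simp add: Hom_act_def Obj_kbar_power compose_def cong: restrict_cong)
  thus "Hom_act R a b \<sigma> \<tau> \<eta> X \<in> mod_hom R (aug_tensor R {1..a} X) (aug_tensor R {1..b} X)"
    using mod_hom_comp[OF tensor_module[OF fX] mod_hom_comp[OF tensor_module[OF fX] place_perm_hom(1)[OF fX \<sigma>] N(1)[OF X]]
       place_perm_hom(1)[OF fX \<tau>]] by simp
next
  note N = nat_transD[OF \<eta>, unfolded Obj_tensor_kbar]
  fix X Y :: "'x set" and h T assume X: "X \<in> fin_sets" and Y: "Y \<in> fin_sets" and h: "h \<in> X \<rightarrow>\<^sub>E Y"
    and T: "T \<in> carrier (aug_tensor R {1..a} X)"
  have fX: "finite X" "finite Y" using X Y by (auto simp: fin_sets_def)
  note P = mod_homD(1)[OF place_perm_hom(1)[OF fX(1) \<sigma>] T] and M = mod_homD(1)[OF aug_mor_hom(1)[OF X Y h] T]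
  have act: "Hom_act R a b \<sigma> \<tau> \<eta> X T = place_perm R b \<tau> X (\<eta> X (place_perm R a \<sigma> X T))"
    if "X \<in> fin_sets" "T \<in> carrier (aug_tensor R {1..a} X)" for X T
    using that by (simp add: Hom_act_def Obj_kbar_power)
  show "Hom_act R a b \<sigma> \<tau> \<eta> Y (aug_mor R {1..a} X Y h T) = aug_mor R {1..b} X Y h (Hom_act R a b \<sigma> \<tau> \<eta> X T)"
    unfolding act[OF X T] act[OF Y M] place_perm_natural[OF X Y h \<sigma> T] N(2)[OF X Y h P]
    by (rule place_perm_natural[OF X Y h \<tau> mod_homD(1)[OF N(1)[OF X] P]])
next
  show "Hom_act R a b \<sigma> \<tau> \<eta> \<in> extensional fin_sets" by (simp add: Hom_act_def)
qed

text \<open>The generator of \<open>f\<close> is sent to that of \<open>\<sigma> \<circ> f \<circ> \<tau>\<close>; inverses appear for coefficients.\<close>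

lemma kOmega_act_apply:
  assumes \<sigma>: "\<sigma> permutes {1..a}" and \<tau>: "\<tau> permutes {1..b}"
    and v: "v \<in> carrier (free_module R (surj_funs {1..b} {1..a}))" and f: "f \<in> surj_funs {1..b} {1..a}"
  shows "kOmega_act R a b \<sigma> \<tau> v f = v (\<lambda>j\<in>{1..b}. perm_inv \<sigma> (f (perm_inv \<tau> j)))"
proof -
  let ?S = "surj_funs {1..b} {1..a}" and ?f = "\<lambda>j\<in>{1..b}. perm_inv \<sigma> (f (perm_inv \<tau> j))"
  have S: "finite ?S" by (rule finite_surj_funs) auto
  have f': "?f \<in> ?S" by (rule surj_funs_conj[OF permutes_inv[OF \<sigma>] permutes_inv[OF \<tau>] f])
  have g: "(\<lambda>f. gen R (\<lambda>i\<in>{1..b}. \<sigma> (f (\<tau> i)))) \<in> ?S \<rightarrow> carrier (free_module R ?S)"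
    by (rule Pi_I) (rule gen_carrier[OF R_cring surj_funs_conj[OF \<sigma> \<tau>]])
  have iff: "f = (\<lambda>i\<in>{1..b}. \<sigma> (g (\<tau> i))) \<longleftrightarrow> g = ?f" if g: "g \<in> ?S" for g
  proof
    assume e: "f = (\<lambda>i\<in>{1..b}. \<sigma> (g (\<tau> i)))"
    show "g = ?f"
    proof (rule PiE_ext[of _ "{1..b}" "\<lambda>_. {1..a}"])
      fix j assume j: "j \<in> {1..b}"
      have "perm_inv \<tau> j \<in> {1..b}" using j permutes_in_image[OF permutes_inv[OF \<tau>]] by blast
      hence "f (perm_inv \<tau> j) = \<sigma> (g j)" unfolding e using permutes_inverses(1)[OF \<tau>] by simp
      thus "g j = ?f j" using j permutes_inverses(2)[OF \<sigma>] by simp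
    qed (use g f' in \<open>auto simp: surj_funs_def\<close>)
  next
    assume e: "g = ?f"
    show "f = (\<lambda>i\<in>{1..b}. \<sigma> (g (\<tau> i)))"
    proof (rule PiE_ext[of _ "{1..b}" "\<lambda>_. {1..a}"])
      fix j assume j: "j \<in> {1..b}"
      have "\<tau> j \<in> {1..b}" using j permutes_in_image[OF \<tau>] by blast
      hence "g (\<tau> j) = perm_inv \<sigma> (f j)" unfolding e using permutes_inverses(2)[OF \<tau>] by simp
      thus "f j = (\<lambda>i\<in>{1..b}. \<sigma> (g (\<tau> i))) j" using j permutes_inverses(1)[OF \<sigma>] by simp
    qed (use f surj_funs_conj[OF \<sigma> \<tau> g] in \<open>auto simp: surj_funs_def\<close>)
  qed
  have "kOmega_act R a b \<sigma> \<tau> v f = (\<Oplus>g\<in>?S. v g \<otimes> gen R (\<lambda>i\<in>{1..b}. \<sigma> (g (\<tau> i))) f)"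
    unfolding kOmega_act_def kOmega_def surjs_eq by (rule lin_ext_apply[OF S g v])
  also have "\<dots> = v ?f \<otimes> gen R (\<lambda>i\<in>{1..b}. \<sigma> (?f (\<tau> i))) f"
  proof (rule finsum_single[OF S f'])
    show "v ?f \<otimes> gen R (\<lambda>i\<in>{1..b}. \<sigma> (?f (\<tau> i))) f \<in> carrier R" using free_mem[OF v] by simp
    fix g assume "g \<in> ?S" "g \<noteq> ?f"
    hence "gen R (\<lambda>i\<in>{1..b}. \<sigma> (g (\<tau> i))) f = \<zero>" using iff[of g] unfolding gen_def by metis
    thus "v g \<otimes> gen R (\<lambda>i\<in>{1..b}. \<sigma> (g (\<tau> i))) f = \<zero>" using free_mem[OF v] by simp
  qed
  also have "gen R (\<lambda>i\<in>{1..b}. \<sigma> (?f (\<tau> i))) f = \<one>" using iff[OF f'] unfolding gen_def by metis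
  also have "v ?f \<otimes> \<one> = v ?f" by (rule r_one[OF free_mem[OF v]])
  finally show ?thesis .
qed

lemma kOmega_act_closed:
  assumes \<sigma>: "\<sigma> permutes {1..a}" and \<tau>: "\<tau> permutes {1..b}"
    and v: "v \<in> carrier (free_module R (surj_funs {1..b} {1..a}))"
  shows "kOmega_act R a b \<sigma> \<tau> v \<in> carrier (free_module R (surj_funs {1..b} {1..a}))"
proof -
  have "kOmega_act R a b \<sigma> \<tau> \<in> mod_hom R (free_module R (surj_funs {1..b} {1..a})) (free_module R (surj_funs {1..b} {1..a}))"
    unfolding kOmega_act_def kOmega_def surjs_eq
    by (rule lin_ext_hom[OF free_module_R]) (rule Pi_I, rule gen_carrier[OF R_cring surj_funs_conj[OF \<sigma> \<tau>]])
  from mod_homD(1)[OF this v] show ?thesis .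
qed

text \<open>The source permutation replaces the points \<open>p0, q0\<close> by \<open>p0 \<circ> \<sigma>, q0 \<circ> \<sigma>\<close>, and the target
  permutation replaces the point \<open>p0 \<circ> f\<close> by \<open>p0 \<circ> f \<circ> \<tau>\<inverse>\<close>, which equals
  \<open>(p0 \<circ> \<sigma>) \<circ> (\<sigma>\<inverse> \<circ> f \<circ> \<tau>\<inverse>)\<close>. Since coefficients do not depend on the points used, this reads off the
  coefficient at \<open>\<sigma>\<inverse> \<circ> f \<circ> \<tau>\<inverse>\<close>.\<close>

theorem nat_coeff_act:
  fixes \<eta> :: "'x::infinite set \<Rightarrow> ((nat \<Rightarrow> 'x \<Rightarrow> 'a) \<Rightarrow> 'a) set \<Rightarrow> ((nat \<Rightarrow> 'x \<Rightarrow> 'a) \<Rightarrow> 'a) set"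
  assumes \<eta>: "\<eta> \<in> nat_trans R (kbar_tensor R {1..a}) (kbar_tensor R {1..b})" and a: "0 < a"
    and \<sigma>: "\<sigma> permutes {1..a}" and \<tau>: "\<tau> permutes {1..b}" and p0q0: "jointly_inj {1..a} p0 q0"
  shows "nat_coeff R {1..b} {1..a} p0 q0 (Hom_act R a b \<sigma> \<tau> \<eta>) =
    kOmega_act R a b \<sigma> \<tau> (nat_coeff R {1..b} {1..a} p0 q0 \<eta>)"
proof
  let ?I = "{1..a}" and ?J = "{1..b}" and ?v = "nat_coeff R {1..b} {1..a} p0 q0 \<eta>"
  interpret kbar_nat_trans R ?I ?J \<eta> by unfold_locales (use a \<eta> in auto)
  let ?Z = "p0 ` ?I \<union> q0 ` ?I"
  note Z = Z[OF p0q0]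
  fix f
  show "nat_coeff R ?J ?I p0 q0 (Hom_act R a b \<sigma> \<tau> \<eta>) f = kOmega_act R a b \<sigma> \<tau> ?v f"
  proof (cases "f \<in> surj_funs ?J ?I")
    case False
    show ?thesis
      using free_outside[OF kOmega_act_closed[OF \<sigma> \<tau> coeff_free[OF p0q0]] False] False by (simp add: nat_coeff_def Let_def)
  next
    case True
    let ?p = "\<lambda>i. p0 (\<sigma> i)" and ?q = "\<lambda>i. q0 (\<sigma> i)" and ?f = "\<lambda>j\<in>?J. perm_inv \<sigma> (f (perm_inv \<tau> j))"
    let ?d = "diff_tensor R ?I ?Z p0 q0"
    have \<sigma>I: "\<sigma> i \<in> ?I" if "i \<in> ?I" for i using that permutes_in_image[OF \<sigma>] by blast
    have \<tau>J: "perm_inv \<tau> j \<in> ?J" if "j \<in> ?J" for j using that permutes_in_image[OF permutes_inv[OF \<tau>]] by blast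
    have fI: "f j \<in> ?I" if "j \<in> ?J" for j using True that by (auto simp: surj_funs_def)
    have f': "?f \<in> surj_funs ?J ?I" by (rule surj_funs_conj[OF permutes_inv[OF \<sigma>] permutes_inv[OF \<tau>] True])
    have pq: "?p \<in> ?I \<rightarrow> ?Z" "?q \<in> ?I \<rightarrow> ?Z" using \<sigma>I by blast+
    have ji: "jointly_inj ?I ?p ?q"
    proof -
      have i: "inj_on \<sigma> ?I" by (rule permutes_inj_on[OF \<sigma>])
      have p: "inj_on p0 (\<sigma> ` ?I)" "inj_on q0 (\<sigma> ` ?I)" "p0 ` \<sigma> ` ?I \<inter> q0 ` \<sigma> ` ?I = {}"
        using p0q0 unfolding permutes_image[OF \<sigma>] jointly_inj_def by auto
      show ?thesis unfolding jointly_inj_def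
        using comp_inj_on[OF i p(1)] comp_inj_on[OF i p(2)] p(3) by (simp add: comp_def image_image)
    qed
    let ?y = "\<lambda>j\<in>?J. p0 (f j)"
    have y: "?y \<in> ?J \<rightarrow>\<^sub>E ?Z" using fI by auto
    note D = diff_tensor_closed[OF Z(2,3,4)] and D' = diff_tensor_closed[OF Z(2) pq]
    note ED = mod_homD(1)[OF nat_hom[OF Z(1)] D']
    have "Hom_act R a b \<sigma> \<tau> \<eta> ?Z ?d = place_perm R b \<tau> ?Z (\<eta> ?Z (place_perm R a \<sigma> ?Z ?d))"
      using Z(1) D by (simp add: Hom_act_def Obj_kbar_power)
    also have "place_perm R a \<sigma> ?Z ?d = diff_tensor R ?I ?Z ?p ?q"
      by (rule place_perm_diff[OF Z(2) \<sigma> Z(3,4)])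
    finally have "nat_coeff R ?J ?I p0 q0 (Hom_act R a b \<sigma> \<tau> \<eta>) f =
        tensor_coord R ?J ?Z (place_perm R b \<tau> ?Z (\<eta> ?Z (diff_tensor R ?I ?Z ?p ?q))) ?y"
      using True unfolding nat_coeff_def Let_def by (simp only: if_True)
    also have "\<dots> = reindex R ?J ?J ?Z \<tau> (ev ?Z ?p ?q) ?y"
      unfolding ev_def coord_place_perm[OF Z(2) \<tau> ED] ..
    also have "\<dots> = ev ?Z ?p ?q (\<lambda>j\<in>?J. ?y (perm_inv \<tau> j))"
      by (rule reindex_perm[OF _ Z(2) \<tau> ev_free[OF Z(1) pq] y]) simp
    also have "(\<lambda>j\<in>?J. ?y (perm_inv \<tau> j)) = (\<lambda>j\<in>?J. ?p (?f j))"
      by (rule restrict_ext) (use \<tau>J permutes_inverses(1)[OF \<sigma>] in \<open>simp del: atLeastAtMost_iff\<close>)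
    also have "ev ?Z ?p ?q (\<lambda>j\<in>?J. ?p (?f j)) = ?v ?f"
      by (rule coeff_eq[OF p0q0 Z(1) pq ji f'])
    also have "\<dots> = kOmega_act R a b \<sigma> \<tau> ?v f"
      by (rule kOmega_act_apply[OF \<sigma> \<tau> coeff_free[OF p0q0] True, symmetric])
    finally show ?thesis .
  qed
qed

section \<open>The kernel of the restriction maps\<close>

lemma restrict_update:
  assumes "g \<in> (J - {j}) \<rightarrow>\<^sub>E I" shows "restrict (g(j := i)) (J - {j}) = g"
  using assms by (auto simp: fun_eq_iff PiE_iff extensional_def)

lemma kOmega_restrict_hom:
  fixes S S' :: "'s set"
  assumes "finite S"
  shows "kOmega_restrict R a S S' \<in> mod_hom R (kOmega R S a) (kOmega R S' a)"
    "v \<in> carrier (kOmega R S a) \<Longrightarrow>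
       kOmega_restrict R a S S' v g =
         (\<Oplus>f\<in>surjs S a. v f \<otimes> (if restrict f S' \<in> surjs S' a then gen R (restrict f S') g else \<zero>))"
proof -
  interpret F: Module.module R "free_module R (surjs S' a)" by (rule free_module_R)
  have fin: "finite (surjs S a)" unfolding surjs_eq using assms by (intro finite_surj_funs) auto
  have g: "(\<lambda>f. if restrict f S' \<in> surjs S' a then gen R (restrict f S') else \<zero>\<^bsub>kOmega R S' a\<^esub>)
     \<in> surjs S a \<rightarrow> carrier (free_module R (surjs S' a))"
    unfolding kOmega_def using gen_carrier[OF R_cring] F.M.zero_closed by (auto simp del: free_ops)
  show "kOmega_restrict R a S S' \<in> mod_hom R (kOmega R S a) (kOmega R S' a)"
    unfolding kOmega_restrict_def kOmega_def by (rule lin_ext_hom[OF free_module_R g[unfolded kOmega_def]])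
  show "kOmega_restrict R a S S' v g =
         (\<Oplus>f\<in>surjs S a. v f \<otimes> (if restrict f S' \<in> surjs S' a then gen R (restrict f S') g else \<zero>))"
    if "v \<in> carrier (kOmega R S a)"
  proof -
    have "(if c then gen R h else \<zero>\<^bsub>kOmega R S' a\<^esub>) g = (if c then gen R h g else \<zero>)" for c and h :: "'s \<Rightarrow> nat"
      by (simp add: kOmega_def)
    thus ?thesis using lin_ext_apply[OF fin g, of v g] that by (simp add: kOmega_restrict_def kOmega_def)
  qed
qed

lemma kOmega_restrict_apply:
  assumes S: "finite S" and j: "j \<in> S" and v: "v \<in> carrier (kOmega R S a)" and g: "g \<in> surj_funs (S - {j}) {1..a}"
  shows "kOmega_restrict R a S (S - {j}) v g = (\<Oplus>i\<in>{1..a}. v (g(j := i)))"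
proof -
  let ?I = "{1..a}"
  have vF: "v \<in> carrier (free_module R (surj_funs S ?I))" using v by (simp add: kOmega_def surjs_eq)
  note vc = free_mem[OF vF]
  have SI: "finite (S \<rightarrow>\<^sub>E ?I)" "finite ((S - {j}) \<rightarrow>\<^sub>E ?I)" using S by (auto intro!: finite_PiE)
  have gP: "g \<in> (S - {j}) \<rightarrow>\<^sub>E ?I" using g by (simp add: surj_funs_def)
  have "kOmega_restrict R a S (S - {j}) v g = (\<Oplus>f\<in>surj_funs S ?I. if restrict f (S - {j}) = g then v f else \<zero>)"
    unfolding kOmega_restrict_hom(2)[OF S v] surjs_eq
    by (rule finsum_cong'[OF refl]) (use vc g in \<open>auto simp: gen_def\<close>)
  also have "\<dots> = (\<Oplus>f\<in>S \<rightarrow>\<^sub>E ?I. if restrict f (S - {j}) = g then v f else \<zero>)"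
    by (rule add.finprod_mono_neutral_cong_left)
       (use SI vc free_outside[OF vF] in \<open>auto simp: surj_funs_def\<close>)
  also have "\<dots> = (\<Oplus>h\<in>(S - {j}) \<rightarrow>\<^sub>E ?I. \<Oplus>i\<in>?I. if restrict (h(j := i)) (S - {j}) = g then v (h(j := i)) else \<zero>)"
    by (rule finsum_PiE_remove[OF S j]) (use vc in auto)
  also have "\<dots> = (\<Oplus>i\<in>?I. if restrict (g(j := i)) (S - {j}) = g then v (g(j := i)) else \<zero>)"
  proof (rule finsum_single[OF SI(2) gP])
    show "(\<Oplus>i\<in>?I. if restrict (g(j := i)) (S - {j}) = g then v (g(j := i)) else \<zero>) \<in> carrier R"
      by (rule finsum_closed) (use vc in auto)
    fix h assume h: "h \<in> (S - {j}) \<rightarrow>\<^sub>E ?I" "h \<noteq> g"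
    show "(\<Oplus>i\<in>?I. if restrict (h(j := i)) (S - {j}) = g then v (h(j := i)) else \<zero>) = \<zero>"
      by (rule finsum_all_zero) (unfold restrict_update[OF h(1)], rule if_not_P[OF h(2)])
  qed
  also have "\<dots> = (\<Oplus>i\<in>?I. v (g(j := i)))" unfolding restrict_update[OF gP] by simp
  finally show ?thesis .
qed

lemma cosubsets_one: "cosubsets b 1 = (\<lambda>j. {1..b} - {j}) ` {1..b}"
proof (intro subset_antisym subsetI)
  fix B assume "B \<in> cosubsets b 1"
  hence B: "B \<subseteq> {1..b}" "card B + 1 = b" by (auto simp: cosubsets_def)
  have "card ({1..b} - B) = 1" using B by (subst card_Diff_subset) (auto intro: finite_subset)
  then obtain j where j: "{1..b} - B = {j}" by (rule card_1_singletonE)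
  hence "B = {1..b} - {j}" "j \<in> {1..b}" using B(1) by blast+
  thus "B \<in> (\<lambda>j. {1..b} - {j}) ` {1..b}" by blast
next
  fix B assume "B \<in> (\<lambda>j. {1..b} - {j}) ` {1..b}"
  then obtain j where "j \<in> {1..b}" "B = {1..b} - {j}" by blast
  thus "B \<in> cosubsets b 1" by (auto simp: cosubsets_def)
qed

lemma kernel_iff_restrict:
  fixes b :: nat
  assumes v: "v \<in> carrier (kOmega R {1..b} a)"
  shows "v \<in> surj_kernel R {1..b} {1..a} \<longleftrightarrow>
    (\<forall>j\<in>{1..b}. kOmega_restrict R a {1..b} ({1..b} - {j}) v = \<zero>\<^bsub>kOmega R ({1..b} - {j}) a\<^esub>)"
proof -
  have S: "finite {1..b}" by simp
  have vF: "v \<in> carrier (free_module R (surj_funs {1..b} {1..a}))" using v by (simp add: kOmega_def surjs_eq)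
  have "(kOmega_restrict R a {1..b} ({1..b} - {j}) v = \<zero>\<^bsub>kOmega R ({1..b} - {j}) a\<^esub>) \<longleftrightarrow>
     (\<forall>g\<in>surj_funs ({1..b} - {j}) {1..a}. (\<Oplus>i\<in>{1..a}. v (g(j := i))) = \<zero>)" if j: "j \<in> {1..b}" for j
  proof -
    have c: "kOmega_restrict R a {1..b} ({1..b} - {j}) v \<in> carrier (free_module R (surj_funs ({1..b} - {j}) {1..a}))"
      using mod_homD(1)[OF kOmega_restrict_hom(1)[OF S] v] by (simp add: kOmega_def surjs_eq)
    have z: "\<zero>\<^bsub>kOmega R ({1..b} - {j}) a\<^esub> = (\<lambda>_. \<zero>)" by (simp add: kOmega_def)
    show ?thesis
      unfolding z
    proof
      assume "kOmega_restrict R a {1..b} ({1..b} - {j}) v = (\<lambda>_. \<zero>)"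
      thus "\<forall>g\<in>surj_funs ({1..b} - {j}) {1..a}. (\<Oplus>i\<in>{1..a}. v (g(j := i))) = \<zero>"
        using kOmega_restrict_apply[OF S j v] by metis
    next
      assume "\<forall>g\<in>surj_funs ({1..b} - {j}) {1..a}. (\<Oplus>i\<in>{1..a}. v (g(j := i))) = \<zero>"
      thus "kOmega_restrict R a {1..b} ({1..b} - {j}) v = (\<lambda>_. \<zero>)"
        using kOmega_restrict_apply[OF S j v] free_outside[OF c] by metis
    qed
  qed
  thus ?thesis using vF by (simp add: surj_kernel_def del: atLeastAtMost_iff)
qed

lemma ker_R_carrier: "carrier (ker_R R b a) = surj_kernel R {1..b} {1..a}"
proof -
  have "R_map R b a v = \<zero>\<^bsub>R_target R b a\<^esub> \<longleftrightarrow> v \<in> surj_kernel R {1..b} {1..a}"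
    if v: "v \<in> carrier (kOmega R {1..b} a)" for v
  proof -
    have "R_map R b a v = \<zero>\<^bsub>R_target R b a\<^esub> \<longleftrightarrow>
      (\<forall>B\<in>cosubsets b 1. kOmega_restrict R a {1..b} B v = \<zero>\<^bsub>kOmega R B a\<^esub>)"
      using v by (auto simp: R_map_def R_target_def dsum_module_def fun_eq_iff restrict_def)
    thus ?thesis unfolding kernel_iff_restrict[OF v] cosubsets_one by blast
  qed
  moreover have "v \<in> carrier (kOmega R {1..b} a)" if "v \<in> surj_kernel R {1..b} {1..a}" for v
    using that by (simp add: surj_kernel_def kOmega_def surjs_eq)
  ultimately show ?thesis by (auto simp: ker_R_def a_kernel_def')
qed

lemma ker_R_eq: "ker_R R b a = surj_kernel_module R {1..b} {1..a}"
  using ker_R_carrier[of b a] by (simp add: ker_R_def kOmega_def surjs_eq)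

lemma surj_kernel_submodule:
  assumes I: "finite I"
  shows "submodule (surj_kernel R J I) R (free_module R (surj_funs J I))"
proof -
  interpret F: Module.module R "free_module R (surj_funs J I)" by (rule free_module_R)
  have closed: "u \<oplus>\<^bsub>free_module R (surj_funs J I)\<^esub> v \<in> surj_kernel R J I" if u: "u \<in> surj_kernel R J I" and v: "v \<in> surj_kernel R J I" for u v
  proof -
    have uv: "u \<in> carrier (free_module R (surj_funs J I))" "v \<in> carrier (free_module R (surj_funs J I))"
      using u v by (auto simp: surj_kernel_def)
    have "(\<Oplus>i\<in>I. u (g(j := i)) \<oplus> v (g(j := i))) = (\<Oplus>i\<in>I. u (g(j := i))) \<oplus> (\<Oplus>i\<in>I. v (g(j := i)))" for g j
      by (rule finsum_addf) (use free_mem[OF uv(1)] free_mem[OF uv(2)] in auto)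
    thus ?thesis using u v F.M.a_closed[OF uv] by (simp add: surj_kernel_def)
  qed
  have scaled: "c \<odot>\<^bsub>free_module R (surj_funs J I)\<^esub> v \<in> surj_kernel R J I" if c: "c \<in> carrier R" and v: "v \<in> surj_kernel R J I" for c v
  proof -
    have vF: "v \<in> carrier (free_module R (surj_funs J I))" using v by (auto simp: surj_kernel_def)
    have "(\<Oplus>i\<in>I. c \<otimes> v (g(j := i))) = c \<otimes> (\<Oplus>i\<in>I. v (g(j := i)))" for g j
      by (rule finsum_rdistr[OF I c, symmetric]) (use free_mem[OF vF] in auto)
    thus ?thesis using v F.smult_closed[OF c vF] c by (simp add: surj_kernel_def)
  qed
  show ?thesis
  proof (rule F.submoduleI)
    show "surj_kernel R J I \<subseteq> carrier (free_module R (surj_funs J I))" by (auto simp: surj_kernel_def)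
    show "\<zero>\<^bsub>free_module R (surj_funs J I)\<^esub> \<in> surj_kernel R J I"
      using F.M.zero_closed by (simp add: surj_kernel_def finsum_zero)
    fix v assume v: "v \<in> surj_kernel R J I"
    have "v \<in> carrier (free_module R (surj_funs J I))" using v by (auto simp: surj_kernel_def)
    hence "\<ominus>\<^bsub>free_module R (surj_funs J I)\<^esub> v = (\<ominus> \<one>) \<odot>\<^bsub>free_module R (surj_funs J I)\<^esub> v"
      by (simp add: F.smult_l_minus del: free_ops)
    thus "\<ominus>\<^bsub>free_module R (surj_funs J I)\<^esub> v \<in> surj_kernel R J I" using scaled[OF _ v, of "\<ominus> \<one>"] by simp
  qed (use closed scaled in auto)
qed

text \<open>The sum over the extensions of \<open>g\<close> becomes the sum over the extensions of \<open>\<sigma>\<inverse> \<circ> g \<circ> \<tau>\<inverse>\<close> by the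
  new value at \<open>\<tau> j\<close>, permuted by \<open>\<sigma>\<inverse>\<close>.\<close>

lemma surj_kernel_act:
  assumes \<sigma>: "\<sigma> permutes {1..a}" and \<tau>: "\<tau> permutes {1..b}" and v: "v \<in> surj_kernel R {1..b} {1..a}"
  shows "kOmega_act R a b \<sigma> \<tau> v \<in> surj_kernel R {1..b} {1..a}"
proof -
  let ?I = "{1..a}" and ?J = "{1..b}"
  have vF: "v \<in> carrier (free_module R (surj_funs ?J ?I))" using v by (simp add: surj_kernel_def)
  note vc = free_mem[OF vF]
  have "(\<Oplus>i\<in>?I. kOmega_act R a b \<sigma> \<tau> v (g(j := i))) = \<zero>" if j: "j \<in> ?J" and g: "g \<in> surj_funs (?J - {j}) ?I" for j g
  proof -
    let ?j = "\<tau> j" and ?g = "\<lambda>k\<in>?J - {\<tau> j}. perm_inv \<sigma> (g (perm_inv \<tau> k))"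
    have j': "?j \<in> ?J" using j permutes_in_image[OF \<tau>] by blast
    have gP: "g \<in> (?J - {j}) \<rightarrow>\<^sub>E ?I" "g ` (?J - {j}) = ?I" using g by (auto simp: surj_funs_def)
    have im: "perm_inv \<tau> ` (?J - {?j}) = ?J - {j}"
      using permutes_image[OF permutes_inv[OF \<tau>]] permutes_inverses(2)[OF \<tau>]
      by (subst image_set_diff[OF permutes_inj[OF permutes_inv[OF \<tau>]]]) simp
    have "?g ` (?J - {?j}) = perm_inv \<sigma> ` g ` perm_inv \<tau> ` (?J - {?j})" by (auto simp: image_def)
    also have "\<dots> = ?I" unfolding im gP(2) by (rule permutes_image[OF permutes_inv[OF \<sigma>]])
    finally have gi: "?g ` (?J - {?j}) = ?I" .
    have g': "?g \<in> surj_funs (?J - {?j}) ?I"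
    proof -
      have "?g k \<in> ?I" if "k \<in> ?J - {?j}" for k using gi that by blast
      hence "?g \<in> (?J - {?j}) \<rightarrow>\<^sub>E ?I" using restrict_extensional unfolding PiE_iff by blast
      thus ?thesis using gi unfolding surj_funs_def by blast
    qed
    have "(\<Oplus>i\<in>?I. kOmega_act R a b \<sigma> \<tau> v (g(j := i))) = (\<Oplus>i\<in>?I. v (?g(?j := perm_inv \<sigma> i)))"
    proof (rule finsum_cong'[OF refl])
      fix i assume i: "i \<in> ?I"
      have "(\<lambda>k\<in>?J. perm_inv \<sigma> ((g(j := i)) (perm_inv \<tau> k))) = ?g(?j := perm_inv \<sigma> i)"
      proof
        fix k
        have "perm_inv \<tau> k = j \<longleftrightarrow> k = ?j" using permutes_inverses[OF \<tau>] by metis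
        thus "(\<lambda>k\<in>?J. perm_inv \<sigma> ((g(j := i)) (perm_inv \<tau> k))) k = (?g(?j := perm_inv \<sigma> i)) k"
          using j' by (cases "k = ?j") (auto simp del: atLeastAtMost_iff)
      qed
      thus "kOmega_act R a b \<sigma> \<tau> v (g(j := i)) = v (?g(?j := perm_inv \<sigma> i))"
        using kOmega_act_apply[OF \<sigma> \<tau> vF surj_funs_update[OF g j i]] by simp
    qed (use vc in auto)
    also have "\<dots> = (\<Oplus>i\<in>perm_inv \<sigma> ` ?I. v (?g(?j := i)))"
      by (rule finsum_reindex[symmetric]) (use vc permutes_inj_on[OF permutes_inv[OF \<sigma>]] in auto)
    also have "\<dots> = (\<Oplus>i\<in>?I. v (?g(?j := i)))" unfolding permutes_image[OF permutes_inv[OF \<sigma>]] ..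
    also have "\<dots> = \<zero>" using v j' g' unfolding surj_kernel_def by blast
    finally show ?thesis .
  qed
  thus ?thesis using kOmega_act_closed[OF \<sigma> \<tau> vF] unfolding surj_kernel_def by blast
qed

end

section \<open>Binary tensor products and orientation modules\<close>

context cring
begin

lemma pres_proj:
  assumes W: "W \<subseteq> carrier (free_module R S)"
  defines "q \<equiv> \<lambda>x\<in>carrier (free_module R S). submod_span R (free_module R S) W +>\<^bsub>free_module R S\<^esub> x"
  shows "q \<in> mod_hom R (free_module R S) (pres_module R S W)"
    "w \<in> W \<Longrightarrow> q w = \<zero>\<^bsub>pres_module R S W\<^esub>"
    "s \<in> S \<Longrightarrow> q (gen R s) = pres_gen R S W s"
proof -
  interpret F: Module.module R "free_module R S" by (rule free_module_R)
  note sub = span_submodule[OF free_module_R W]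
  show "q \<in> mod_hom R (free_module R S) (pres_module R S W)"
    unfolding q_def pres_module_def by (rule quot_facts(2)[OF free_module_R sub(1)])
  show "q w = \<zero>\<^bsub>pres_module R S W\<^esub>" if w: "w \<in> W"
  proof -
    have "submod_span R (free_module R S) W +>\<^bsub>free_module R S\<^esub> w = submod_span R (free_module R S) W"
      using w W sub(2) by (intro F.M.a_coset_join2 submodule.axioms(1)[OF sub(1)]) auto
    thus ?thesis using w W by (auto simp: q_def pres_module_def quot_module_def)
  qed
  show "s \<in> S \<Longrightarrow> q (gen R s) = pres_gen R S W s"
    by (simp add: q_def pres_gen_def gen_carrier[OF R_cring])
qed

context
  fixes M :: "('a, 'm) module" and N :: "('a, 'n) module"
  assumes M: "Module.module R M" and N: "Module.module R N"
begin

interpretation M: Module.module R M by (rule M)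
interpretation N: Module.module R N by (rule N)

abbreviation "MN \<equiv> carrier M \<times> carrier N"
abbreviation "F2 \<equiv> free_module R (carrier M \<times> carrier N)"

lemma tensor2_relsE:
  assumes "w \<in> tensor2_rels R M N"
  obtains x x' y where "x \<in> carrier M" "x' \<in> carrier M" "y \<in> carrier N"
      "w = gen R (x \<oplus>\<^bsub>M\<^esub> x', y) \<ominus>\<^bsub>F2\<^esub> (gen R (x, y) \<oplus>\<^bsub>F2\<^esub> gen R (x', y))"
    | x y y' where "x \<in> carrier M" "y \<in> carrier N" "y' \<in> carrier N"
      "w = gen R (x, y \<oplus>\<^bsub>N\<^esub> y') \<ominus>\<^bsub>F2\<^esub> (gen R (x, y) \<oplus>\<^bsub>F2\<^esub> gen R (x, y'))"
    | c x y where "c \<in> carrier R" "x \<in> carrier M" "y \<in> carrier N"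
      "w = gen R (c \<odot>\<^bsub>M\<^esub> x, y) \<ominus>\<^bsub>F2\<^esub> c \<odot>\<^bsub>F2\<^esub> gen R (x, y)"
    | c x y where "c \<in> carrier R" "x \<in> carrier M" "y \<in> carrier N"
      "w = gen R (x, c \<odot>\<^bsub>N\<^esub> y) \<ominus>\<^bsub>F2\<^esub> c \<odot>\<^bsub>F2\<^esub> gen R (x, y)"
proof -
  from assms show thesis
    unfolding tensor2_rels_def Let_def
    by (elim UnE CollectE exE conjE)
       (rule that(1), assumption+, rule that(2), assumption+, rule that(3), assumption+, rule that(4), assumption+)
qed

lemma tensor2_gen: "x \<in> carrier M \<Longrightarrow> y \<in> carrier N \<Longrightarrow> gen R (x, y) \<in> carrier F2"
  by (rule gen_carrier[OF R_cring]) simp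

lemma tensor2_rels_carrier: "tensor2_rels R M N \<subseteq> carrier F2"
proof
  interpret F: Module.module R F2 by (rule free_module_R)
  fix w assume "w \<in> tensor2_rels R M N"
  thus "w \<in> carrier F2"
    by (cases rule: tensor2_relsE)
       (auto simp del: free_ops intro!: F.M.minus_closed F.M.a_closed F.smult_closed tensor2_gen)
qed

lemma tensor2_module: "Module.module R (tensor2 R M N)"
  unfolding tensor2_def by (rule pres_is_module[OF R_cring tensor2_rels_carrier])

lemma tensor2_elt_closed: "x \<in> carrier M \<Longrightarrow> y \<in> carrier N \<Longrightarrow> tensor2_elt R M N x y \<in> carrier (tensor2 R M N)"
  unfolding tensor2_def tensor2_elt_def by (rule pres_gen_carrier[OF R_cring tensor2_rels_carrier]) simp

text \<open>One equivalence serves both directions of the universal property: applied to the quotient map it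
  gives bilinearity of the tensor symbol, applied to the linear extension of a bilinear map it gives
  well-definedness.\<close>

lemma tensor2_kills:
  assumes P: "Module.module R P" and h: "h \<in> mod_hom R F2 P"
  shows "(\<forall>w\<in>tensor2_rels R M N. h w = \<zero>\<^bsub>P\<^esub>) \<longleftrightarrow>
    (\<forall>x\<in>carrier M. \<forall>x'\<in>carrier M. \<forall>y\<in>carrier N. h (gen R (x \<oplus>\<^bsub>M\<^esub> x', y)) = h (gen R (x, y)) \<oplus>\<^bsub>P\<^esub> h (gen R (x', y))) \<and>
    (\<forall>x\<in>carrier M. \<forall>y\<in>carrier N. \<forall>y'\<in>carrier N. h (gen R (x, y \<oplus>\<^bsub>N\<^esub> y')) = h (gen R (x, y)) \<oplus>\<^bsub>P\<^esub> h (gen R (x, y'))) \<and>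
    (\<forall>c\<in>carrier R. \<forall>x\<in>carrier M. \<forall>y\<in>carrier N. h (gen R (c \<odot>\<^bsub>M\<^esub> x, y)) = c \<odot>\<^bsub>P\<^esub> h (gen R (x, y))) \<and>
    (\<forall>c\<in>carrier R. \<forall>x\<in>carrier M. \<forall>y\<in>carrier N. h (gen R (x, c \<odot>\<^bsub>N\<^esub> y)) = c \<odot>\<^bsub>P\<^esub> h (gen R (x, y)))"
    (is "?L \<longleftrightarrow> ?R")
proof -
  interpret F: Module.module R F2 by (rule free_module_R)
  interpret P: Module.module R P by (rule P)
  note hc = mod_homD(1)[OF h]
  have hm: "h (x \<ominus>\<^bsub>F2\<^esub> y) = \<zero>\<^bsub>P\<^esub> \<longleftrightarrow> h x = h y" if "x \<in> carrier F2" "y \<in> carrier F2" for x y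
    using mod_hom_minus[OF F.module_axioms P h that]
      P.M.add.inv_solve_right[OF P.M.zero_closed hc[OF that(1)] hc[OF that(2)]] hc[OF that(2)]
    by (auto simp: a_minus_def)
  have r1: "h (gen R (x \<oplus>\<^bsub>M\<^esub> x', y) \<ominus>\<^bsub>F2\<^esub> (gen R (x, y) \<oplus>\<^bsub>F2\<^esub> gen R (x', y))) = \<zero>\<^bsub>P\<^esub> \<longleftrightarrow>
      h (gen R (x \<oplus>\<^bsub>M\<^esub> x', y)) = h (gen R (x, y)) \<oplus>\<^bsub>P\<^esub> h (gen R (x', y))"
    if "x \<in> carrier M" "x' \<in> carrier M" "y \<in> carrier N" for x x' y
    unfolding hm[OF tensor2_gen[OF M.M.a_closed[OF that(1,2)] that(3)] F.M.a_closed[OF tensor2_gen[OF that(1,3)] tensor2_gen[OF that(2,3)]]]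
      mod_homD(2)[OF h tensor2_gen[OF that(1,3)] tensor2_gen[OF that(2,3)]] ..
  have r2: "h (gen R (x, y \<oplus>\<^bsub>N\<^esub> y') \<ominus>\<^bsub>F2\<^esub> (gen R (x, y) \<oplus>\<^bsub>F2\<^esub> gen R (x, y'))) = \<zero>\<^bsub>P\<^esub> \<longleftrightarrow>
      h (gen R (x, y \<oplus>\<^bsub>N\<^esub> y')) = h (gen R (x, y)) \<oplus>\<^bsub>P\<^esub> h (gen R (x, y'))"
    if "x \<in> carrier M" "y \<in> carrier N" "y' \<in> carrier N" for x y y'
    unfolding hm[OF tensor2_gen[OF that(1) N.M.a_closed[OF that(2,3)]] F.M.a_closed[OF tensor2_gen[OF that(1,2)] tensor2_gen[OF that(1,3)]]]
      mod_homD(2)[OF h tensor2_gen[OF that(1,2)] tensor2_gen[OF that(1,3)]] ..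
  have r3: "h (gen R (c \<odot>\<^bsub>M\<^esub> x, y) \<ominus>\<^bsub>F2\<^esub> c \<odot>\<^bsub>F2\<^esub> gen R (x, y)) = \<zero>\<^bsub>P\<^esub> \<longleftrightarrow>
      h (gen R (c \<odot>\<^bsub>M\<^esub> x, y)) = c \<odot>\<^bsub>P\<^esub> h (gen R (x, y))"
    if "c \<in> carrier R" "x \<in> carrier M" "y \<in> carrier N" for c x y
    unfolding hm[OF tensor2_gen[OF M.smult_closed[OF that(1,2)] that(3)] F.smult_closed[OF that(1) tensor2_gen[OF that(2,3)]]]
      mod_homD(3)[OF h that(1) tensor2_gen[OF that(2,3)]] ..
  have r4: "h (gen R (x, c \<odot>\<^bsub>N\<^esub> y) \<ominus>\<^bsub>F2\<^esub> c \<odot>\<^bsub>F2\<^esub> gen R (x, y)) = \<zero>\<^bsub>P\<^esub> \<longleftrightarrow>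
      h (gen R (x, c \<odot>\<^bsub>N\<^esub> y)) = c \<odot>\<^bsub>P\<^esub> h (gen R (x, y))"
    if "c \<in> carrier R" "x \<in> carrier M" "y \<in> carrier N" for c x y
    unfolding hm[OF tensor2_gen[OF that(2) N.smult_closed[OF that(1,3)]] F.smult_closed[OF that(1) tensor2_gen[OF that(2,3)]]]
      mod_homD(3)[OF h that(1) tensor2_gen[OF that(2,3)]] ..
  show ?thesis
  proof
    assume L: ?L
    have mem:
      "x \<in> carrier M \<Longrightarrow> x' \<in> carrier M \<Longrightarrow> y \<in> carrier N \<Longrightarrow>
        gen R (x \<oplus>\<^bsub>M\<^esub> x', y) \<ominus>\<^bsub>F2\<^esub> (gen R (x, y) \<oplus>\<^bsub>F2\<^esub> gen R (x', y)) \<in> tensor2_rels R M N"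
      "x \<in> carrier M \<Longrightarrow> y \<in> carrier N \<Longrightarrow> y' \<in> carrier N \<Longrightarrow>
        gen R (x, y \<oplus>\<^bsub>N\<^esub> y') \<ominus>\<^bsub>F2\<^esub> (gen R (x, y) \<oplus>\<^bsub>F2\<^esub> gen R (x, y')) \<in> tensor2_rels R M N"
      "c \<in> carrier R \<Longrightarrow> x \<in> carrier M \<Longrightarrow> y \<in> carrier N \<Longrightarrow>
        gen R (c \<odot>\<^bsub>M\<^esub> x, y) \<ominus>\<^bsub>F2\<^esub> c \<odot>\<^bsub>F2\<^esub> gen R (x, y) \<in> tensor2_rels R M N"
      "c \<in> carrier R \<Longrightarrow> x \<in> carrier M \<Longrightarrow> y \<in> carrier N \<Longrightarrow>
        gen R (x, c \<odot>\<^bsub>N\<^esub> y) \<ominus>\<^bsub>F2\<^esub> c \<odot>\<^bsub>F2\<^esub> gen R (x, y) \<in> tensor2_rels R M N" for x x' y y' c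
      unfolding tensor2_rels_def Let_def
      by (blast intro: UnI1 UnI2)+
    show ?R
      by (intro conjI ballI) (simp_all only: r1[symmetric] r2[symmetric] r3[symmetric] r4[symmetric] bspec[OF L] mem)
  next
    assume B: ?R
    show ?L
    proof
      fix w assume "w \<in> tensor2_rels R M N"
      thus "h w = \<zero>\<^bsub>P\<^esub>"
        by (cases rule: tensor2_relsE) (simp_all only: r1 r2 r3 r4 B)
    qed
  qed
qed

lemma tensor2_elt_bilinear:
  "x \<in> carrier M \<Longrightarrow> x' \<in> carrier M \<Longrightarrow> y \<in> carrier N \<Longrightarrow>
     tensor2_elt R M N (x \<oplus>\<^bsub>M\<^esub> x') y = tensor2_elt R M N x y \<oplus>\<^bsub>tensor2 R M N\<^esub> tensor2_elt R M N x' y"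
  "x \<in> carrier M \<Longrightarrow> y \<in> carrier N \<Longrightarrow> y' \<in> carrier N \<Longrightarrow>
     tensor2_elt R M N x (y \<oplus>\<^bsub>N\<^esub> y') = tensor2_elt R M N x y \<oplus>\<^bsub>tensor2 R M N\<^esub> tensor2_elt R M N x y'"
  "c \<in> carrier R \<Longrightarrow> x \<in> carrier M \<Longrightarrow> y \<in> carrier N \<Longrightarrow>
     tensor2_elt R M N (c \<odot>\<^bsub>M\<^esub> x) y = c \<odot>\<^bsub>tensor2 R M N\<^esub> tensor2_elt R M N x y"
  "c \<in> carrier R \<Longrightarrow> x \<in> carrier M \<Longrightarrow> y \<in> carrier N \<Longrightarrow>
     tensor2_elt R M N x (c \<odot>\<^bsub>N\<^esub> y) = c \<odot>\<^bsub>tensor2 R M N\<^esub> tensor2_elt R M N x y"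
proof -
  note q = pres_proj[OF tensor2_rels_carrier, folded tensor2_def]
  let ?q = "\<lambda>x\<in>carrier F2. submod_span R F2 (tensor2_rels R M N) +>\<^bsub>F2\<^esub> x"
  have e: "tensor2_elt R M N x y = ?q (gen R (x, y))" if "x \<in> carrier M" "y \<in> carrier N" for x y
    unfolding tensor2_elt_def by (rule q(3)[symmetric]) (use that in simp)
  have "\<forall>w\<in>tensor2_rels R M N. ?q w = \<zero>\<^bsub>tensor2 R M N\<^esub>" using q(2) by blast
  note B = this[unfolded tensor2_kills[OF tensor2_module q(1)]]
  show "tensor2_elt R M N (x \<oplus>\<^bsub>M\<^esub> x') y = tensor2_elt R M N x y \<oplus>\<^bsub>tensor2 R M N\<^esub> tensor2_elt R M N x' y"
    if "x \<in> carrier M" "x' \<in> carrier M" "y \<in> carrier N"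
    unfolding e[OF M.M.a_closed[OF that(1,2)] that(3)] e[OF that(1,3)] e[OF that(2,3)] using B that by blast
  show "tensor2_elt R M N x (y \<oplus>\<^bsub>N\<^esub> y') = tensor2_elt R M N x y \<oplus>\<^bsub>tensor2 R M N\<^esub> tensor2_elt R M N x y'"
    if "x \<in> carrier M" "y \<in> carrier N" "y' \<in> carrier N"
    unfolding e[OF that(1) N.M.a_closed[OF that(2,3)]] e[OF that(1,2)] e[OF that(1,3)] using B that by blast
  show "tensor2_elt R M N (c \<odot>\<^bsub>M\<^esub> x) y = c \<odot>\<^bsub>tensor2 R M N\<^esub> tensor2_elt R M N x y"
    if "c \<in> carrier R" "x \<in> carrier M" "y \<in> carrier N"
    unfolding e[OF M.smult_closed[OF that(1,2)] that(3)] e[OF that(2,3)] using B that by blast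
  show "tensor2_elt R M N x (c \<odot>\<^bsub>N\<^esub> y) = c \<odot>\<^bsub>tensor2 R M N\<^esub> tensor2_elt R M N x y"
    if "c \<in> carrier R" "x \<in> carrier M" "y \<in> carrier N"
    unfolding e[OF that(2) N.smult_closed[OF that(1,3)]] e[OF that(2,3)] using B that by blast
qed

lemma tensor2_elt_zero: "y \<in> carrier N \<Longrightarrow> tensor2_elt R M N \<zero>\<^bsub>M\<^esub> y = \<zero>\<^bsub>tensor2 R M N\<^esub>"
proof -
  interpret T: Module.module R "tensor2 R M N" by (rule tensor2_module)
  assume y: "y \<in> carrier N"
  have "tensor2_elt R M N (\<zero> \<odot>\<^bsub>M\<^esub> \<zero>\<^bsub>M\<^esub>) y = \<zero> \<odot>\<^bsub>tensor2 R M N\<^esub> tensor2_elt R M N \<zero>\<^bsub>M\<^esub> y"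
    by (rule tensor2_elt_bilinear(3)) (use y in auto)
  thus ?thesis using tensor2_elt_closed[OF M.M.zero_closed y] by simp
qed

lemma tensor2_lift:
  assumes P: "Module.module R P" and g: "\<And>x y. x \<in> carrier M \<Longrightarrow> y \<in> carrier N \<Longrightarrow> g (x, y) \<in> carrier P"
    and "\<And>x x' y. x \<in> carrier M \<Longrightarrow> x' \<in> carrier M \<Longrightarrow> y \<in> carrier N \<Longrightarrow> g (x \<oplus>\<^bsub>M\<^esub> x', y) = g (x, y) \<oplus>\<^bsub>P\<^esub> g (x', y)"
    and "\<And>x y y'. x \<in> carrier M \<Longrightarrow> y \<in> carrier N \<Longrightarrow> y' \<in> carrier N \<Longrightarrow> g (x, y \<oplus>\<^bsub>N\<^esub> y') = g (x, y) \<oplus>\<^bsub>P\<^esub> g (x, y')"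
    and "\<And>c x y. c \<in> carrier R \<Longrightarrow> x \<in> carrier M \<Longrightarrow> y \<in> carrier N \<Longrightarrow> g (c \<odot>\<^bsub>M\<^esub> x, y) = c \<odot>\<^bsub>P\<^esub> g (x, y)"
    and "\<And>c x y. c \<in> carrier R \<Longrightarrow> x \<in> carrier M \<Longrightarrow> y \<in> carrier N \<Longrightarrow> g (x, c \<odot>\<^bsub>N\<^esub> y) = c \<odot>\<^bsub>P\<^esub> g (x, y)"
  shows "pres_lift R MN (tensor2_rels R M N) P g \<in> mod_hom R (tensor2 R M N) P"
    "x \<in> carrier M \<Longrightarrow> y \<in> carrier N \<Longrightarrow> pres_lift R MN (tensor2_rels R M N) P g (tensor2_elt R M N x y) = g (x, y)"
proof -
  have gP: "g \<in> MN \<rightarrow> carrier P" using g by auto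
  have e: "lin_ext R MN P g (gen R (x, y)) = g (x, y)" if "x \<in> carrier M" "y \<in> carrier N" for x y
    by (rule lin_ext_gen[OF P gP]) (use that in simp)
  have k: "\<forall>w\<in>tensor2_rels R M N. lin_ext R MN P g w = \<zero>\<^bsub>P\<^esub>"
    unfolding tensor2_kills[OF P lin_ext_hom[OF P gP]]
    by (intro conjI ballI) (simp_all only: e M.M.a_closed N.M.a_closed M.smult_closed N.smult_closed assms(3-6))
  note L = pres_lift_hom[OF R_cring tensor2_rels_carrier P gP bspec[OF k]]
  show "pres_lift R MN (tensor2_rels R M N) P g \<in> mod_hom R (tensor2 R M N) P"
    unfolding tensor2_def by (rule L(1))
  show "x \<in> carrier M \<Longrightarrow> y \<in> carrier N \<Longrightarrow> pres_lift R MN (tensor2_rels R M N) P g (tensor2_elt R M N x y) = g (x, y)"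
    unfolding tensor2_elt_def by (rule L(2), assumption, rule SigmaI)
qed

lemma tensor2_hom_ext:
  assumes "Module.module R P" "h \<in> mod_hom R (tensor2 R M N) P" "h' \<in> mod_hom R (tensor2 R M N) P"
    and "\<And>x y. x \<in> carrier M \<Longrightarrow> y \<in> carrier N \<Longrightarrow> h (tensor2_elt R M N x y) = h' (tensor2_elt R M N x y)"
    and "T \<in> carrier (tensor2 R M N)"
  shows "h T = h' T"
  by (rule pres_hom_ext[OF R_cring tensor2_rels_carrier assms(1) assms(2,3)[unfolded tensor2_def] _ assms(5)[unfolded tensor2_def]])
     (use assms(4) in \<open>auto simp: tensor2_elt_def\<close>)

end

lemma tensor2_map_elt:
  assumes M: "Module.module R M" and N: "Module.module R N" and M': "Module.module R M'" and N': "Module.module R N'"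
    and f: "f \<in> mod_hom R M M'" and g: "g \<in> mod_hom R N N'" and x: "x \<in> carrier M" and y: "y \<in> carrier N"
  shows "tensor2_map R M N M' N' f g (tensor2_elt R M N x y) = tensor2_elt R M' N' (f x) (g y)"
proof -
  let ?g = "\<lambda>(x, y). tensor2_elt R M' N' (f x) (g y)"
  note b = tensor2_elt_bilinear[OF M' N']
  have "pres_lift R (carrier M \<times> carrier N) (tensor2_rels R M N) (tensor2 R M' N') ?g (tensor2_elt R M N x y) = ?g (x, y)"
    by (rule tensor2_lift(2)[OF M N tensor2_module[OF M' N'] _ _ _ _ _ x y])
       (simp_all add: mod_homD[OF f] mod_homD[OF g] b tensor2_elt_closed[OF M' N'])
  thus ?thesis by (simp add: tensor2_map_def)
qed

text \<open>A linear form with value \<open>1\<close> on \<open>u\<close> gives a retraction of \<open>x \<mapsto> x \<otimes> u\<close>. It detects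
  whether a tensor with an orientation of at most one point vanishes.\<close>

lemma tensor2_rank_one:
  assumes M: "Module.module R M" and N: "Module.module R N" and u: "u \<in> carrier N"
    and \<theta>: "\<theta> \<in> mod_hom R N (self_module R)" and \<theta>u: "\<theta> u = \<one>"
  obtains \<mu> where "\<mu> \<in> mod_hom R (tensor2 R M N) M" "\<And>x. x \<in> carrier M \<Longrightarrow> \<mu> (tensor2_elt R M N x u) = x"
    "\<And>x y. x \<in> carrier M \<Longrightarrow> y \<in> carrier N \<Longrightarrow> \<mu> (tensor2_elt R M N x y) = \<theta> y \<odot>\<^bsub>M\<^esub> x"
proof -
  interpret M: Module.module R M by (rule M)
  let ?g = "\<lambda>(x, y). \<theta> y \<odot>\<^bsub>M\<^esub> x" and ?\<mu> = "pres_lift R (carrier M \<times> carrier N) (tensor2_rels R M N) M (\<lambda>(x, y). \<theta> y \<odot>\<^bsub>M\<^esub> x)"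
  have \<theta>c: "\<theta> y \<in> carrier R" if "y \<in> carrier N" for y using mod_homD(1)[OF \<theta> that] by simp
  have L: "?\<mu> \<in> mod_hom R (tensor2 R M N) M"
    "x \<in> carrier M \<Longrightarrow> y \<in> carrier N \<Longrightarrow> ?\<mu> (tensor2_elt R M N x y) = ?g (x, y)" for x y
    by (rule tensor2_lift[OF M N M];
        simp add: \<theta>c mod_homD(2,3)[OF \<theta>] M.smult_r_distr M.smult_l_distr M.smult_assoc1[symmetric] m_comm)+
  show ?thesis
    by (rule that[OF L(1)]) (use L(2) u \<theta>u in auto)
qed

lemma ext_rels_carrier:
  assumes "Module.module R M"
  shows "ext_rels R n M \<subseteq> carrier (free_module R ({..<n} \<rightarrow>\<^sub>E carrier M))"
  unfolding ext_rels_def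
proof (rule Un_least)
  show "multilin_rels R {..<n} (\<lambda>_. M) \<subseteq> carrier (free_module R ({..<n} \<rightarrow>\<^sub>E carrier M))"
    by (rule multilin_rels_carrier[OF R_cring assms])
qed (auto intro: gen_carrier[OF R_cring])

lemma orient_module: "Module.module R (orient R S)"
  unfolding orient_def ext_power_def by (rule pres_is_module[OF R_cring ext_rels_carrier[OF free_module_R]])

lemma ext_rels_0: "ext_rels R 0 M = {}"
  by (simp add: ext_rels_def multilin_rels_def)

lemma ext_rels_1: "ext_rels R (Suc 0) M = multilin_rels R {..<Suc 0} (\<lambda>_. M)"
  by (auto simp: ext_rels_def)

text \<open>The empty wedge product. The empty tuple is the function that is undefined everywhere.\<close>

definition or_empty where "or_empty = ext_elt R 0 (free_module R {}) (\<lambda>_. undefined)"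

definition or_point where "or_point x = orient_wedge R {} x or_empty"

lemma or_empty: "or_empty \<in> carrier (orient R {})"
  unfolding or_empty_def orient_def ext_elt_def ext_power_def card.empty
  by (rule pres_gen_carrier[OF R_cring ext_rels_carrier[OF free_module_R]]) simp

text \<open>In degree zero there are no relations and one generator, so the orientation module of the empty
  set is a copy of the ring.\<close>

lemma or_empty_coord:
  obtains \<theta> :: "((nat \<Rightarrow> 's \<Rightarrow> 'a) \<Rightarrow> 'a) set \<Rightarrow> 'a" where "\<theta> \<in> mod_hom R (orient R {}) (self_module R)" "\<theta> or_empty = \<one>"
    "\<And>\<alpha>. \<alpha> \<in> carrier (orient R {}) \<Longrightarrow> \<alpha> = \<theta> \<alpha> \<odot>\<^bsub>orient R {}\<^esub> or_empty"
proof -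
  let ?F = "free_module R ({} :: 's set)" and ?O = "orient R ({} :: 's set)"
  let ?S = "{..<0::nat} \<rightarrow>\<^sub>E carrier ?F"
  define \<theta> where "\<theta> = pres_lift R ?S {} (self_module R) (\<lambda>_. \<one>)"
  interpret O: Module.module R ?O by (rule orient_module)
  note S = self_is_module[OF R_cring]
  have O: "?O = pres_module R ?S {}" by (simp add: orient_def ext_power_def ext_rels_0)
  have e: "or_empty = pres_gen R ?S {} (\<lambda>_. undefined)" by (simp add: or_empty_def ext_elt_def ext_rels_0)
  have g: "(\<lambda>_. \<one>) \<in> ?S \<rightarrow> carrier (self_module R)" by simp
  note L = pres_lift_hom[OF R_cring empty_subsetI S g, folded \<theta>_def]
  have \<theta>: "\<theta> \<in> mod_hom R ?O (self_module R)" unfolding O by (rule L(1)) simp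
  have \<theta>1: "\<theta> or_empty = \<one>" unfolding e by (rule L(2)) simp_all
  have \<theta>c: "\<theta> \<alpha> \<in> carrier R" if "\<alpha> \<in> carrier ?O" for \<alpha> using mod_homD(1)[OF \<theta> that] by simp
  have oe: "or_empty \<in> carrier ?O" by (rule or_empty)
  note id = id_mod_hom[OF O.module_axioms]
  have h: "(\<lambda>\<alpha>\<in>carrier ?O. \<theta> \<alpha> \<odot>\<^bsub>?O\<^esub> or_empty) \<in> mod_hom R ?O ?O"
    by (rule mod_homI)
       (use \<theta>c oe mod_homD(2,3)[OF \<theta>] in \<open>simp_all add: O.smult_l_distr O.smult_assoc1\<close>)
  have "(\<lambda>\<alpha>\<in>carrier ?O. \<alpha>) \<alpha> = (\<lambda>\<alpha>\<in>carrier ?O. \<theta> \<alpha> \<odot>\<^bsub>?O\<^esub> or_empty) \<alpha>" if \<alpha>: "\<alpha> \<in> carrier ?O" for \<alpha>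
  proof (rule pres_hom_ext[OF R_cring empty_subsetI orient_module _ _ _ \<alpha>[unfolded O]])
    show "(\<lambda>\<alpha>\<in>carrier ?O. \<alpha>) \<in> mod_hom R (pres_module R ?S {}) ?O" using id by (simp only: O)
    show "(\<lambda>\<alpha>\<in>carrier ?O. \<theta> \<alpha> \<odot>\<^bsub>?O\<^esub> or_empty) \<in> mod_hom R (pres_module R ?S {}) ?O" using h by (simp only: O)
    fix s assume "s \<in> ?S"
    hence "s = (\<lambda>_. undefined)" by simp
    hence "pres_gen R ?S {} s = or_empty" by (simp only: e)
    thus "(\<lambda>\<alpha>\<in>carrier ?O. \<alpha>) (pres_gen R ?S {} s) = (\<lambda>\<alpha>\<in>carrier ?O. \<theta> \<alpha> \<odot>\<^bsub>?O\<^esub> or_empty) (pres_gen R ?S {} s)"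
      using oe \<theta>1 O.smult_one[OF oe] by (simp only: restrict_apply if_True)
  qed
  hence "\<alpha> = \<theta> \<alpha> \<odot>\<^bsub>?O\<^esub> or_empty" if "\<alpha> \<in> carrier ?O" for \<alpha>
    using that by (simp only: restrict_apply if_True)
  thus ?thesis using that[OF \<theta> \<theta>1] by blast
qed

lemma orient_wedge_hom:
  fixes x :: 's
  shows "orient_wedge R {} x \<in> mod_hom R (orient R {}) (orient R {x})"
  and or_point_eq: "or_point x = ext_elt R (Suc 0) (free_module R {x}) (case_nat (gen R x) (\<lambda>_. undefined))"
proof -
  let ?F = "free_module R ({} :: 's set)"
  let ?S = "{..<0::nat} \<rightarrow>\<^sub>E carrier ?F" and ?g = "\<lambda>t. ext_elt R (Suc 0) (free_module R {x}) (case_nat (gen R x) t)"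
  have O: "orient R ({} :: 's set) = pres_module R ?S {}" by (simp add: orient_def ext_power_def ext_rels_0)
  have e: "or_empty = pres_gen R ?S {} (\<lambda>_. undefined)" by (simp add: or_empty_def ext_elt_def ext_rels_0)
  have w: "orient_wedge R {} x = pres_lift R ?S {} (orient R {x}) ?g"
    by (simp add: orient_wedge_def ext_rels_0)
  have g: "?g \<in> ?S \<rightarrow> carrier (orient R {x})"
  proof (rule Pi_I)
    fix t assume "t \<in> ?S"
    hence t: "t = (\<lambda>_. undefined)" by simp
    have "case_nat (gen R x) t \<in> {..<Suc 0} \<rightarrow>\<^sub>E carrier (free_module R {x})"
      unfolding t by (rule PiE_I) (auto split: nat.split intro: gen_carrier[OF R_cring])
    moreover have "card {x} = Suc 0" by simp
    ultimately show "?g t \<in> carrier (orient R {x})"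
      unfolding orient_def ext_elt_def ext_power_def
      using pres_gen_carrier[OF R_cring ext_rels_carrier[OF free_module_R, of "Suc 0" "{x}"]] by simp
  qed
  note L = pres_lift_hom[OF R_cring empty_subsetI orient_module g]
  show "orient_wedge R {} x \<in> mod_hom R (orient R {}) (orient R {x})" unfolding w O by (rule L(1)) simp
  show "or_point x = ext_elt R (Suc 0) (free_module R {x}) (case_nat (gen R x) (\<lambda>_. undefined))"
    unfolding or_point_def w e by (rule L(2)) simp_all
qed

lemma or_point: "or_point x \<in> carrier (orient R {x})"
  unfolding or_point_def by (rule mod_homD(1)[OF orient_wedge_hom(1) or_empty])

text \<open>Evaluation of the only factor at \<open>x\<close>; in degree one the relation \<open>\<alpha> \<and> \<alpha> = 0\<close> is vacuous.\<close>

lemma or_point_coord: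
  obtains \<theta> where "\<theta> \<in> mod_hom R (orient R {x}) (self_module R)" "\<theta> (or_point x) = \<one>"
proof -
  let ?F = "free_module R {x}"
  let ?S = "{..<Suc 0} \<rightarrow>\<^sub>E carrier ?F" and ?W = "ext_rels R (Suc 0) (free_module R {x})"
  let ?g = "\<lambda>t. t 0 x"
  note S = self_is_module[OF R_cring] and W = ext_rels_carrier[OF free_module_R]
  have O: "orient R {x} = pres_module R ?S ?W" by (simp add: orient_def ext_power_def)
  have g: "?g \<in> ?S \<rightarrow> carrier (self_module R)"
  proof (rule Pi_I)
    fix t assume "t \<in> ?S"
    hence "t 0 \<in> carrier ?F" by (rule PiE_mem) simp
    thus "t 0 x \<in> carrier (self_module R)" by (simp add: free_mem)
  qed
  have e: "lin_ext R ?S (self_module R) ?g (gen R t) = t 0 x" if "t \<in> ?S" for t by (rule lin_ext_gen[OF S g that])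
  have u: "t(0 := w) \<in> ?S" if "t \<in> ?S" "w \<in> carrier ?F" for t w
  proof -
    have "t(0 := w) \<in> insert 0 {..<Suc 0} \<rightarrow>\<^sub>E carrier ?F" by (rule PiE_fun_upd[OF that(2,1)])
    moreover have "insert 0 {..<Suc 0} = {..<Suc 0}" by auto
    ultimately show ?thesis by (simp only: )
  qed
  note cl = module_closed[where M = ?F, OF free_module_R]
  have m: "multilin R {..<Suc 0} (\<lambda>_. ?F) (self_module R) (\<lambda>t. lin_ext R ?S (self_module R) ?g (gen R t))"
  proof (rule multilinI)
    fix t i y z assume t: "t \<in> ?S" and i: "i \<in> {..<Suc 0}" and y: "y \<in> carrier ?F" and z: "z \<in> carrier ?F"
    have i0: "i = 0" using i by simp
    show "lin_ext R ?S (self_module R) ?g (gen R (t(i := y \<oplus>\<^bsub>?F\<^esub> z))) =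
      lin_ext R ?S (self_module R) ?g (gen R (t(i := y))) \<oplus>\<^bsub>self_module R\<^esub> lin_ext R ?S (self_module R) ?g (gen R (t(i := z)))"
      unfolding i0 e[OF u[OF t cl(1)[OF y z]]] e[OF u[OF t y]] e[OF u[OF t z]] by simp
  next
    fix t i c y assume t: "t \<in> ?S" and i: "i \<in> {..<Suc 0}" and c: "c \<in> carrier R" and y: "y \<in> carrier ?F"
    have i0: "i = 0" using i by simp
    show "lin_ext R ?S (self_module R) ?g (gen R (t(i := c \<odot>\<^bsub>?F\<^esub> y))) =
      c \<odot>\<^bsub>self_module R\<^esub> lin_ext R ?S (self_module R) ?g (gen R (t(i := y)))"
      unfolding i0 e[OF u[OF t cl(2)[OF c y]]] e[OF u[OF t y]] by simp
  qed
  have "\<forall>w\<in>multilin_rels R {..<Suc 0} (\<lambda>_. ?F). lin_ext R ?S (self_module R) ?g w = \<zero>\<^bsub>self_module R\<^esub>"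
    by (rule iffD2[OF multilin_kills[OF R_cring free_module_R S lin_ext_hom[OF S g]] m])
  hence k: "\<And>w. w \<in> ?W \<Longrightarrow> lin_ext R ?S (self_module R) ?g w = \<zero>\<^bsub>self_module R\<^esub>" unfolding ext_rels_1 by blast
  note L = pres_lift_hom[OF R_cring W S g k]
  have "case_nat (gen R x) (\<lambda>_. undefined) \<in> ?S"
    by (rule PiE_I) (auto split: nat.split intro: gen_carrier[OF R_cring])
  hence "pres_lift R ?S ?W (self_module R) ?g (or_point x) = \<one>"
    unfolding or_point_eq ext_elt_def by (subst L(2)) (simp_all add: gen_def)
  thus ?thesis using L(1) by (intro that[of "pres_lift R ?S ?W (self_module R) ?g"]) (simp_all only: O)
qed

end

section \<open>The zeroth cohomology of the Koszul complex\<close>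

context cring
begin

lemma kOmega_module: "Module.module R (kOmega R S a)"
  unfolding kOmega_def by (rule free_module_R)

text \<open>The cochain \<open>v \<otimes> 1\<close>. The only subset of full cardinality is \<open>{1..b}\<close>, so cochains of degree zero
  are families with one member.\<close>

definition kz_elt :: "nat \<Rightarrow> nat \<Rightarrow> ((nat \<Rightarrow> nat) \<Rightarrow> 'a) \<Rightarrow> nat set \<Rightarrow> 'a kz_carrier" where
  "kz_elt a b v = (\<lambda>B\<in>{{1..b}}. tensor2_elt R (kOmega R {1..b} a) (orient R {}) v or_empty)"

lemma cosubsets_zero: "cosubsets b 0 = {{1..b}}"
proof -
  have "B = {1..b}" if "B \<subseteq> {1..b}" "card B = b" for B
    by (rule card_subset_eq) (use that in auto)
  thus ?thesis by (auto simp: cosubsets_def)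
qed

lemma dsum_module_cong:
  assumes "\<And>i. i \<in> I \<Longrightarrow> M i = M' i" shows "dsum_module I M = dsum_module I M'"
proof -
  have "(\<Pi>\<^sub>E i\<in>I. carrier (M i)) = (\<Pi>\<^sub>E i\<in>I. carrier (M' i))" by (rule PiE_cong) (simp only: assms)
  moreover have "(\<lambda>i\<in>I. \<zero>\<^bsub>M i\<^esub>) = (\<lambda>i\<in>I. \<zero>\<^bsub>M' i\<^esub>)" by (rule restrict_ext) (simp only: assms)
  moreover have "(\<lambda>i\<in>I. u i \<oplus>\<^bsub>M i\<^esub> v i) = (\<lambda>i\<in>I. u i \<oplus>\<^bsub>M' i\<^esub> v i)" for u v by (rule restrict_ext) (simp only: assms)
  moreover have "(\<lambda>i\<in>I. c \<odot>\<^bsub>M i\<^esub> v i) = (\<lambda>i\<in>I. c \<odot>\<^bsub>M' i\<^esub> v i)" for c v by (rule restrict_ext) (simp only: assms)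
  ultimately show ?thesis unfolding dsum_module_def by simp
qed

lemma Kz_Ch_0:
  "Ch (Kz R a b) 0 = dsum_module {{1..b}} (\<lambda>B. tensor2 R (kOmega R {1..b} a) (orient R {}))"
proof -
  have "Ch (Kz R a b) 0 = dsum_module {{1..b}} (Kz_summand R a b)"
    unfolding cosubsets_zero[symmetric] by (simp add: Kz_def)
  also have "\<dots> = dsum_module {{1..b}} (\<lambda>B. tensor2 R (kOmega R {1..b} a) (orient R {}))"
    by (rule dsum_module_cong) (simp only: singleton_iff Kz_summand_def Diff_cancel)
  finally show ?thesis .
qed

text \<open>The retraction of \<open>v \<mapsto> v \<otimes> 1\<close> is an inverse, because scalars move across the tensor sign and
  every orientation of the empty set is a multiple of the empty wedge.\<close>

lemma kOmega_rank_one: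
  obtains \<mu> where "\<mu> \<in> mod_hom R (tensor2 R (kOmega R {1..b::nat} a) (orient R ({} :: nat set))) (kOmega R {1..b} a)"
    "\<And>v. v \<in> carrier (kOmega R {1..b} a) \<Longrightarrow> \<mu> (tensor2_elt R (kOmega R {1..b} a) (orient R {}) v or_empty) = v"
    "\<And>T. T \<in> carrier (tensor2 R (kOmega R {1..b} a) (orient R {})) \<Longrightarrow>
       tensor2_elt R (kOmega R {1..b} a) (orient R {}) (\<mu> T) or_empty = T"
proof -
  let ?M = "kOmega R {1..b} a" and ?O = "orient R ({} :: nat set)"
  let ?T = "tensor2 R ?M ?O" and ?e = "tensor2_elt R ?M ?O"
  note M = kOmega_module[of "{1..b}" a] and O = orient_module[of "{} :: nat set"]
  interpret T: Module.module R ?T by (rule tensor2_module[OF M O])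
  have oe: "or_empty \<in> carrier ?O" by (rule or_empty)
  obtain \<theta> where \<theta>: "\<theta> \<in> mod_hom R ?O (self_module R)" "\<theta> or_empty = \<one>"
    "\<And>\<alpha>. \<alpha> \<in> carrier ?O \<Longrightarrow> \<alpha> = \<theta> \<alpha> \<odot>\<^bsub>?O\<^esub> or_empty" by (rule or_empty_coord) blast
  obtain \<mu> where \<mu>: "\<mu> \<in> mod_hom R ?T ?M" "\<And>x. x \<in> carrier ?M \<Longrightarrow> \<mu> (?e x or_empty) = x"
    "\<And>x y. x \<in> carrier ?M \<Longrightarrow> y \<in> carrier ?O \<Longrightarrow> \<mu> (?e x y) = \<theta> y \<odot>\<^bsub>?M\<^esub> x"
    by (rule tensor2_rank_one[OF M O oe \<theta>(1,2)]) blast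
  note b = tensor2_elt_bilinear[OF M O]
  note id = id_mod_hom[OF tensor2_module[OF M O]]
  have h: "(\<lambda>T\<in>carrier ?T. ?e (\<mu> T) or_empty) \<in> mod_hom R ?T ?T"
  proof (rule mod_homI)
    fix x y assume x: "x \<in> carrier ?T" and y: "y \<in> carrier ?T"
    show "(\<lambda>T\<in>carrier ?T. ?e (\<mu> T) or_empty) (x \<oplus>\<^bsub>?T\<^esub> y) =
      (\<lambda>T\<in>carrier ?T. ?e (\<mu> T) or_empty) x \<oplus>\<^bsub>?T\<^esub> (\<lambda>T\<in>carrier ?T. ?e (\<mu> T) or_empty) y"
      unfolding restrict_apply if_P[OF x] if_P[OF y] if_P[OF T.M.a_closed[OF x y]] mod_homD(2)[OF \<mu>(1) x y]
      by (rule b(1)[OF mod_homD(1)[OF \<mu>(1) x] mod_homD(1)[OF \<mu>(1) y] oe])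
  next
    fix c x assume c: "c \<in> carrier R" and x: "x \<in> carrier ?T"
    show "(\<lambda>T\<in>carrier ?T. ?e (\<mu> T) or_empty) (c \<odot>\<^bsub>?T\<^esub> x) = c \<odot>\<^bsub>?T\<^esub> (\<lambda>T\<in>carrier ?T. ?e (\<mu> T) or_empty) x"
      unfolding restrict_apply if_P[OF x] if_P[OF T.smult_closed[OF c x]] mod_homD(3)[OF \<mu>(1) c x]
      by (rule b(3)[OF c mod_homD(1)[OF \<mu>(1) x] oe])
  qed (use tensor2_elt_closed[OF M O mod_homD(1)[OF \<mu>(1)] oe] in auto)
  have "(\<lambda>T\<in>carrier ?T. ?e (\<mu> T) or_empty) T = (\<lambda>T\<in>carrier ?T. T) T" if T: "T \<in> carrier ?T" for T
  proof (rule tensor2_hom_ext[OF M O tensor2_module[OF M O] h id _ T])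
    fix x y assume x: "x \<in> carrier ?M" and y: "y \<in> carrier ?O"
    have \<theta>y: "\<theta> y \<in> carrier R" using mod_homD(1)[OF \<theta>(1) y] by simp
    have "?e (\<mu> (?e x y)) or_empty = ?e (\<theta> y \<odot>\<^bsub>?M\<^esub> x) or_empty" unfolding \<mu>(3)[OF x y] ..
    also have "\<dots> = ?e x (\<theta> y \<odot>\<^bsub>?O\<^esub> or_empty)" unfolding b(3)[OF \<theta>y x oe] b(4)[OF \<theta>y x oe] ..
    also have "\<dots> = ?e x y" using \<theta>(3)[OF y] by (simp only: )
    finally show "(\<lambda>T\<in>carrier ?T. ?e (\<mu> T) or_empty) (?e x y) = (\<lambda>T\<in>carrier ?T. T) (?e x y)"
      unfolding restrict_apply if_P[OF tensor2_elt_closed[OF M O x y]] .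
  qed
  hence e: "?e (\<mu> T) or_empty = T" if "T \<in> carrier ?T" for T using that by (simp only: restrict_apply if_True)
  show ?thesis by (rule that[OF \<mu>(1)]) (rule \<mu>(2) e, assumption)+
qed

lemma restrict_elt_zero_iff:
  fixes b :: nat
  assumes v: "v \<in> carrier (kOmega R {1..b} a)" and j: "j \<in> {1..b}"
  shows "tensor2_elt R (kOmega R ({1..b} - {j}) a) (orient R {j}) (kOmega_restrict R a {1..b} ({1..b} - {j}) v) (or_point j)
      = \<zero>\<^bsub>tensor2 R (kOmega R ({1..b} - {j}) a) (orient R {j})\<^esub> \<longleftrightarrow>
    kOmega_restrict R a {1..b} ({1..b} - {j}) v = \<zero>\<^bsub>kOmega R ({1..b} - {j}) a\<^esub>"
proof -
  let ?M = "kOmega R ({1..b} - {j}) a" and ?O = "orient R {j}"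
  let ?w = "kOmega_restrict R a {1..b} ({1..b} - {j}) v"
  note M = kOmega_module[of "{1..b} - {j}" a] and O = orient_module[of "{j}"]
  have w: "?w \<in> carrier ?M" by (rule mod_homD(1)[OF kOmega_restrict_hom(1) v]) simp
  have op: "or_point j \<in> carrier ?O" by (rule or_point)
  obtain \<theta> where \<theta>: "\<theta> \<in> mod_hom R ?O (self_module R)" "\<theta> (or_point j) = \<one>" by (rule or_point_coord)
  obtain \<mu> where \<mu>: "\<mu> \<in> mod_hom R (tensor2 R ?M ?O) ?M" "\<And>x. x \<in> carrier ?M \<Longrightarrow> \<mu> (tensor2_elt R ?M ?O x (or_point j)) = x"
    by (rule tensor2_rank_one[OF M O op \<theta>]) blast
  show ?thesis
  proof
    assume "tensor2_elt R ?M ?O ?w (or_point j) = \<zero>\<^bsub>tensor2 R ?M ?O\<^esub>"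
    hence "\<mu> \<zero>\<^bsub>tensor2 R ?M ?O\<^esub> = ?w" using \<mu>(2)[OF w] by (simp only: )
    thus "?w = \<zero>\<^bsub>?M\<^esub>" unfolding mod_hom_zero[OF tensor2_module[OF M O] M \<mu>(1)] by (rule sym)
  next
    assume z: "?w = \<zero>\<^bsub>?M\<^esub>"
    show "tensor2_elt R ?M ?O ?w (or_point j) = \<zero>\<^bsub>tensor2 R ?M ?O\<^esub>"
      unfolding z by (rule tensor2_elt_zero[OF M O op])
  qed
qed

lemma kz_elt_closed:
  assumes "v \<in> carrier (kOmega R {1..b} a)" shows "kz_elt a b v \<in> carrier (Ch (Kz R a b) 0)"
  unfolding Kz_Ch_0 dsum_module_def kz_elt_def mk_module_simps
  using tensor2_elt_closed[OF kOmega_module orient_module assms or_empty] by simp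

text \<open>Only \<open>x = j\<close> lies in the complement of \<open>{1..b} - {j}\<close>, so the component of the differential is a
  single tensor.\<close>

lemma Kz_Diff_0:
  assumes v: "v \<in> carrier (kOmega R {1..b} a)" and j: "j \<in> {1..b}"
  shows "Diff (Kz R a b) 0 (kz_elt a b v) ({1..b} - {j}) =
    tensor2_elt R (kOmega R ({1..b} - {j}) a) (orient R {j}) (kOmega_restrict R a {1..b} ({1..b} - {j}) v) (or_point j)"
proof -
  let ?J = "{1..b}" and ?B = "{1..b} - {j}"
  let ?S = "Kz_summand R a b ?B"
  have d: "?J - ?J = {}" "?J - ?B = {j}" "insert j ?B = ?J" using j by auto
  have S: "?S = tensor2 R (kOmega R ?B a) (orient R {j})" unfolding Kz_summand_def d(2) ..
  interpret S: Module.module R ?S unfolding S by (rule tensor2_module[OF kOmega_module orient_module])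
  have w: "kOmega_restrict R a ?J ?B v \<in> carrier (kOmega R ?B a)"
    by (rule mod_homD(1)[OF kOmega_restrict_hom(1) v]) simp
  have Bc: "?B \<in> cosubsets b (Suc 0)" using cosubsets_one[of b] j by (auto simp: One_nat_def[symmetric] simp del: One_nat_def)
  have y: "kz_elt a b v ?J = tensor2_elt R (kOmega R ?J a) (orient R {}) v or_empty" by (simp add: kz_elt_def)
  have comp: "Kz_component R a b ?J j (kz_elt a b v ?J) =
    tensor2_elt R (kOmega R ?B a) (orient R {j}) (kOmega_restrict R a ?J ?B v) (or_point j)"
    unfolding Kz_component_def y d(1,2) or_point_def
    by (rule tensor2_map_elt[OF kOmega_module orient_module kOmega_module orient_module kOmega_restrict_hom(1) orient_wedge_hom(1) v or_empty]) simp
  have c: "tensor2_elt R (kOmega R ?B a) (orient R {j}) (kOmega_restrict R a ?J ?B v) (or_point j) \<in> carrier ?S"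
    unfolding S by (rule tensor2_elt_closed[OF kOmega_module orient_module w or_point])
  have y0: "kz_elt a b v \<in> carrier (dsum_module (cosubsets b 0) (Kz_summand R a b))"
    using kz_elt_closed[OF v] by (simp add: Kz_def)
  have "Diff (Kz R a b) 0 (kz_elt a b v) ?B = (\<Oplus>\<^bsub>?S\<^esub>x\<in>?J - ?B. Kz_component R a b (insert x ?B) x (kz_elt a b v (insert x ?B)))"
    using y0 Bc by (simp add: Kz_def)
  also have "\<dots> = Kz_component R a b (insert j ?B) j (kz_elt a b v (insert j ?B))"
    unfolding d(2) by (rule S.M.finsum_single) (use c comp in \<open>simp_all only: d(3), auto\<close>)
  finally show ?thesis unfolding d(3) comp .
qed

lemma Kz_kernel_iff:
  assumes v: "v \<in> carrier (kOmega R {1..b} a)"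
  shows "Diff (Kz R a b) 0 (kz_elt a b v) = \<zero>\<^bsub>Ch (Kz R a b) (Suc 0)\<^esub> \<longleftrightarrow> v \<in> surj_kernel R {1..b} {1..a}"
proof -
  let ?C = "cosubsets b (Suc 0)"
  have C: "?C = (\<lambda>j. {1..b} - {j}) ` {1..b}" using cosubsets_one[of b] by (simp only: One_nat_def)
  have y0: "kz_elt a b v \<in> carrier (dsum_module (cosubsets b 0) (Kz_summand R a b))"
    using kz_elt_closed[OF v] by (simp add: Kz_def)
  have z: "\<zero>\<^bsub>Ch (Kz R a b) (Suc 0)\<^esub> = (\<lambda>B\<in>?C. \<zero>\<^bsub>Kz_summand R a b B\<^esub>)" by (simp add: Kz_def dsum_module_def)
  have ext: "Diff (Kz R a b) 0 (kz_elt a b v) \<in> extensional ?C" using y0 by (simp add: Kz_def)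
  have "Diff (Kz R a b) 0 (kz_elt a b v) = \<zero>\<^bsub>Ch (Kz R a b) (Suc 0)\<^esub> \<longleftrightarrow>
    (\<forall>B\<in>?C. Diff (Kz R a b) 0 (kz_elt a b v) B = \<zero>\<^bsub>Kz_summand R a b B\<^esub>)"
  proof
    assume "\<forall>B\<in>?C. Diff (Kz R a b) 0 (kz_elt a b v) B = \<zero>\<^bsub>Kz_summand R a b B\<^esub>"
    thus "Diff (Kz R a b) 0 (kz_elt a b v) = \<zero>\<^bsub>Ch (Kz R a b) (Suc 0)\<^esub>"
      unfolding z by (intro extensionalityI[OF ext restrict_extensional]) simp
  qed (simp add: z)
  also have "\<dots> \<longleftrightarrow> (\<forall>j\<in>{1..b}. Diff (Kz R a b) 0 (kz_elt a b v) ({1..b} - {j}) = \<zero>\<^bsub>Kz_summand R a b ({1..b} - {j})\<^esub>)"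
    unfolding C by blast
  also have "\<dots> \<longleftrightarrow> (\<forall>j\<in>{1..b}. kOmega_restrict R a {1..b} ({1..b} - {j}) v = \<zero>\<^bsub>kOmega R ({1..b} - {j}) a\<^esub>)"
  proof (rule ball_cong[OF refl])
    fix j assume j: "j \<in> {1..b}"
    hence d: "{1..b} - ({1..b} - {j}) = {j}" by auto
    show "(Diff (Kz R a b) 0 (kz_elt a b v) ({1..b} - {j}) = \<zero>\<^bsub>Kz_summand R a b ({1..b} - {j})\<^esub>) \<longleftrightarrow>
      kOmega_restrict R a {1..b} ({1..b} - {j}) v = \<zero>\<^bsub>kOmega R ({1..b} - {j}) a\<^esub>"
      unfolding Kz_Diff_0[OF v j] Kz_summand_def d by (rule restrict_elt_zero_iff[OF v j])
  qed
  also have "\<dots> \<longleftrightarrow> v \<in> surj_kernel R {1..b} {1..a}" by (rule kernel_iff_restrict[OF v, symmetric])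
  finally show ?thesis .
qed

lemma kz_elt_linear:
  assumes v: "v \<in> carrier (kOmega R {1..b} a)"
  shows "u \<in> carrier (kOmega R {1..b} a) \<Longrightarrow>
      kz_elt a b (u \<oplus>\<^bsub>kOmega R {1..b} a\<^esub> v) = kz_elt a b u \<oplus>\<^bsub>Ch (Kz R a b) 0\<^esub> kz_elt a b v"
    "c \<in> carrier R \<Longrightarrow> kz_elt a b (c \<odot>\<^bsub>kOmega R {1..b} a\<^esub> v) = c \<odot>\<^bsub>Ch (Kz R a b) 0\<^esub> kz_elt a b v"
proof -
  note b = tensor2_elt_bilinear[OF kOmega_module orient_module]
  show "kz_elt a b (u \<oplus>\<^bsub>kOmega R {1..b} a\<^esub> v) = kz_elt a b u \<oplus>\<^bsub>Ch (Kz R a b) 0\<^esub> kz_elt a b v"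
    if u: "u \<in> carrier (kOmega R {1..b} a)"
    unfolding Kz_Ch_0 dsum_module_def kz_elt_def mk_module_simps b(1)[OF u v or_empty] by (rule restrict_ext) simp
  show "kz_elt a b (c \<odot>\<^bsub>kOmega R {1..b} a\<^esub> v) = c \<odot>\<^bsub>Ch (Kz R a b) 0\<^esub> kz_elt a b v"
    if c: "c \<in> carrier R"
    unfolding Kz_Ch_0 dsum_module_def kz_elt_def mk_module_simps b(3)[OF c v or_empty] by (rule restrict_ext) simp
qed

lemma kz_elt_bij: "bij_betw (kz_elt a b) (carrier (kOmega R {1..b} a)) (carrier (Ch (Kz R a b) 0))"
proof -
  let ?M = "kOmega R {1..b} a" and ?O = "orient R ({} :: nat set)"
  obtain \<mu> where \<mu>: "\<mu> \<in> mod_hom R (tensor2 R ?M ?O) ?M"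
    "\<And>v. v \<in> carrier ?M \<Longrightarrow> \<mu> (tensor2_elt R ?M ?O v or_empty) = v"
    "\<And>T. T \<in> carrier (tensor2 R ?M ?O) \<Longrightarrow> tensor2_elt R ?M ?O (\<mu> T) or_empty = T"
    by (rule kOmega_rank_one) blast
  have C: "carrier (Ch (Kz R a b) 0) = (\<Pi>\<^sub>E B\<in>{{1..b}}. carrier (tensor2 R ?M ?O))"
    unfolding Kz_Ch_0 dsum_module_def mk_module_simps ..
  show ?thesis
  proof (rule bij_betw_byWitness[where f' = "\<lambda>y. \<mu> (y {1..b})"])
    show "\<forall>v\<in>carrier ?M. \<mu> (kz_elt a b v {1..b}) = v" using \<mu>(2) by (simp add: kz_elt_def)
    show "\<forall>y\<in>carrier (Ch (Kz R a b) 0). kz_elt a b (\<mu> (y {1..b})) = y"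
    proof
      fix y assume y: "y \<in> carrier (Ch (Kz R a b) 0)"
      have "y {1..b} \<in> carrier (tensor2 R ?M ?O)" using y unfolding C by (rule PiE_mem) simp
      hence e: "tensor2_elt R ?M ?O (\<mu> (y {1..b})) or_empty = y {1..b}" by (rule \<mu>(3))
      show "kz_elt a b (\<mu> (y {1..b})) = y"
      proof (rule extensionalityI[of _ "{{1..b}}"])
        show "kz_elt a b (\<mu> (y {1..b})) \<in> extensional {{1..b}}" by (simp add: kz_elt_def)
        show "y \<in> extensional {{1..b}}" using y unfolding C PiE_iff by blast
        fix B assume "B \<in> {{1..b}}"
        thus "kz_elt a b (\<mu> (y {1..b})) B = y B" using e by (simp add: kz_elt_def)
      qed
    qed
    show "kz_elt a b ` carrier ?M \<subseteq> carrier (Ch (Kz R a b) 0)" using kz_elt_closed by blast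
    show "(\<lambda>y. \<mu> (y {1..b})) ` carrier (Ch (Kz R a b) 0) \<subseteq> carrier ?M"
    proof (rule image_subsetI)
      fix y assume y: "y \<in> carrier (Ch (Kz R a b) 0)"
      have "y {1..b} \<in> carrier (tensor2 R ?M ?O)" using y unfolding C by (rule PiE_mem) simp
      thus "\<mu> (y {1..b}) \<in> carrier ?M" by (rule mod_homD(1)[OF \<mu>(1)])
    qed
  qed
qed

lemma Collect_image_eq: "f ` A = B \<Longrightarrow> {y \<in> B. P y} = f ` {x \<in> A. P (f x)}"
  by auto

text \<open>There are no coboundaries but zero in degree zero, so the classes are the singletons of cocycles.\<close>

theorem ker_R_cohomology_iso:
  "(\<lambda>v\<in>carrier (ker_R R b a). {kz_elt a b v}) \<in> mod_iso R (ker_R R b a) (cohomology (Kz R a b) 0)"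
proof -
  let ?M = "kOmega R {1..b} a" and ?C = "Ch (Kz R a b) 0" and ?k = "kz_elt a b"
  define Z where "Z = ?C\<lparr>carrier := a_kernel ?C (Ch (Kz R a b) (Suc 0)) (Diff (Kz R a b) 0)\<rparr>"
  let ?K = "surj_kernel R {1..b} {1..a}"
  note M = kOmega_module[of "{1..b}" a]
  interpret M: Module.module R ?M by (rule M)
  interpret T: Module.module R "tensor2 R ?M (orient R ({} :: nat set))" by (rule tensor2_module[OF M orient_module])
  have KM: "v \<in> carrier ?M" if "v \<in> ?K" for v using that by (simp add: surj_kernel_def kOmega_def surjs_eq)
  have sub: "submodule ?K R ?M" using surj_kernel_submodule[of "{1..a}" "{1..b}"] by (simp add: kOmega_def surjs_eq)
  have Ka: "u \<oplus>\<^bsub>?M\<^esub> v \<in> ?K" if "u \<in> ?K" "v \<in> ?K" for u v using M.submoduleE(5)[OF sub that] .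
  have Ks: "c \<odot>\<^bsub>?M\<^esub> v \<in> ?K" if "c \<in> carrier R" "v \<in> ?K" for c v using M.submoduleE(4)[OF sub that] .
  have kR: "carrier (ker_R R b a) = ?K" "add (ker_R R b a) = add ?M" "smult (ker_R R b a) = smult ?M"
    by (simp_all add: ker_R_carrier) (simp_all add: ker_R_def)
  have ops: "add Z = add ?C" "smult Z = smult ?C" by (simp_all add: Z_def)
  have Zc: "carrier Z = ?k ` ?K"
  proof -
    have "carrier Z = {y \<in> carrier ?C. Diff (Kz R a b) 0 y = \<zero>\<^bsub>Ch (Kz R a b) (Suc 0)\<^esub>}"
      by (simp add: Z_def a_kernel_def')
    also have "\<dots> = ?k ` {v \<in> carrier ?M. Diff (Kz R a b) 0 (?k v) = \<zero>\<^bsub>Ch (Kz R a b) (Suc 0)\<^esub>}"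
      by (rule Collect_image_eq[OF bij_betw_imp_surj_on[OF kz_elt_bij]])
    also have "{v \<in> carrier ?M. Diff (Kz R a b) 0 (?k v) = \<zero>\<^bsub>Ch (Kz R a b) (Suc 0)\<^esub>} = ?K"
      using Kz_kernel_iff KM by blast
    finally show ?thesis .
  qed
  have cob: "coboundaries (Kz R a b) 0 = {?k \<zero>\<^bsub>?M\<^esub>}"
  proof -
    have "?k \<zero>\<^bsub>?M\<^esub> = \<zero>\<^bsub>?C\<^esub>"
      unfolding kz_elt_def Kz_Ch_0 dsum_module_def mk_module_simps tensor2_elt_zero[OF M orient_module or_empty] ..
    thus ?thesis by (simp add: coboundaries_def)
  qed
  have H: "cohomology (Kz R a b) 0 = quot_module Z {?k \<zero>\<^bsub>?M\<^esub>}" by (simp add: cohomology_def Z_def cob)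
  have coset: "{?k \<zero>\<^bsub>?M\<^esub>} +>\<^bsub>Z\<^esub> ?k v = {?k v}" if v: "v \<in> ?K" for v
  proof -
    have "?k \<zero>\<^bsub>?M\<^esub> \<oplus>\<^bsub>?C\<^esub> ?k v = ?k v"
      unfolding kz_elt_linear(1)[OF KM[OF v] M.M.zero_closed, symmetric] M.M.l_zero[OF KM[OF v]] ..
    thus ?thesis by (simp add: a_r_coset_def' ops)
  qed
  have Hc: "carrier (cohomology (Kz R a b) 0) = (\<lambda>v. {?k v}) ` ?K"
    unfolding H quot_module_def mk_module_simps using Zc coset by (auto simp: A_RCOSETS_def' )
  have Ha: "{?k u} \<oplus>\<^bsub>cohomology (Kz R a b) 0\<^esub> {?k v} = {?k (u \<oplus>\<^bsub>?M\<^esub> v)}" if "u \<in> ?K" "v \<in> ?K" for u v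
    unfolding H quot_module_def mk_module_simps kz_elt_linear(1)[OF KM[OF that(2)] KM[OF that(1)]]
    by (simp add: set_add_def' ops)
  have Hs: "c \<odot>\<^bsub>cohomology (Kz R a b) 0\<^esub> {?k v} = {?k (c \<odot>\<^bsub>?M\<^esub> v)}" if c: "c \<in> carrier R" and v: "v \<in> ?K" for c v
    unfolding H quot_module_def mk_module_simps
    using coset[OF Ks[OF c v]] kz_elt_linear(2)[OF KM[OF v] c] by (simp add: ops)
  have inj: "inj_on (\<lambda>v. {?k v}) ?K"
  proof (rule inj_onI)
    fix u v assume "u \<in> ?K" "v \<in> ?K" "{?k u} = {?k v}"
    thus "u = v" using inj_onD[OF bij_betw_imp_inj_on[OF kz_elt_bij[of a b]], of u v] KM by blast
  qed
  have "(\<lambda>v\<in>?K. {?k v}) \<in> mod_hom R (ker_R R b a) (cohomology (Kz R a b) 0)"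
  proof (rule mod_homI, unfold kR Hc)
    fix u v assume u: "u \<in> ?K" and v: "v \<in> ?K"
    show "(\<lambda>v\<in>?K. {?k v}) (u \<oplus>\<^bsub>?M\<^esub> v) = (\<lambda>v\<in>?K. {?k v}) u \<oplus>\<^bsub>cohomology (Kz R a b) 0\<^esub> (\<lambda>v\<in>?K. {?k v}) v"
      unfolding restrict_apply if_P[OF u] if_P[OF v] if_P[OF Ka[OF u v]] Ha[OF u v] ..
  next
    fix c v assume c: "c \<in> carrier R" and v: "v \<in> ?K"
    show "(\<lambda>v\<in>?K. {?k v}) (c \<odot>\<^bsub>?M\<^esub> v) = c \<odot>\<^bsub>cohomology (Kz R a b) 0\<^esub> (\<lambda>v\<in>?K. {?k v}) v"
      unfolding restrict_apply if_P[OF v] if_P[OF Ks[OF c v]] Hs[OF c v] ..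
  qed (simp_all only: restrict_extensional restrict_apply if_True image_eqI)
  moreover have "bij_betw (\<lambda>v\<in>?K. {?k v}) ?K ((\<lambda>v. {?k v}) ` ?K)"
    using inj by (simp add: bij_betw_def inj_on_def image_def)
  ultimately show ?thesis unfolding mod_iso_def kR(1) Hc by simp
qed

end

section \<open>The isomorphisms\<close>

theorem corollary7p4:
  fixes K :: "('k, 'r) ring_scheme" and a b :: nat
  assumes "cring K" and "0 < a" and "0 < b"
  shows "submodule (carrier (ker_R K b a)) K (kOmega K {1..b} a)
    \<and> (\<forall>\<sigma> \<tau>. \<sigma> permutes {1..a} \<longrightarrow> \<tau> permutes {1..b} \<longrightarrow>
         (\<forall>v\<in>carrier (ker_R K b a). kOmega_act K a b \<sigma> \<tau> v \<in> carrier (ker_R K b a)))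
    \<and> (\<exists>\<phi>\<in>mod_iso K
            (Hom_functors K (kbar_power K a :: ('x::infinite, 'k, _) fin_functor) (kbar_power K b))
            (cohomology (Kz K a b) 0).
        \<exists>\<psi>\<in>mod_iso K (cohomology (Kz K a b) 0) (ker_R K b a).
          \<forall>\<sigma> \<tau>. \<sigma> permutes {1..a} \<longrightarrow> \<tau> permutes {1..b} \<longrightarrow>
            (\<forall>\<eta>\<in>nat_trans K (kbar_power K a) (kbar_power K b).
               \<psi> (\<phi> (Hom_act K a b \<sigma> \<tau> \<eta>)) = kOmega_act K a b \<sigma> \<tau> (\<psi> (\<phi> \<eta>))))"
proof (intro conjI allI impI ballI)
  interpret cring K by fact
  have sub: "submodule (surj_kernel K {1..b} {1..a}) K (kOmega K {1..b} a)"
    using surj_kernel_submodule[of "{1..a}" "{1..b}"] by (simp add: kOmega_def surjs_eq)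
  show "submodule (carrier (ker_R K b a)) K (kOmega K {1..b} a)" unfolding ker_R_carrier by (rule sub)
  show "kOmega_act K a b \<sigma> \<tau> v \<in> carrier (ker_R K b a)"
    if "\<sigma> permutes {1..a}" "\<tau> permutes {1..b}" "v \<in> carrier (ker_R K b a)" for \<sigma> \<tau> v
    using surj_kernel_act[OF that(1,2)] that(3) unfolding ker_R_carrier by blast
  \<comment> \<open>The points at which coefficients are read off; any choice gives the same map.\<close>
  obtain p q :: "nat \<Rightarrow> 'x" where pq: "jointly_inj {1..a} p q" using jointly_inj_exists[of "{1..a}"] by auto
  let ?F = "kbar_power K a :: ('x, 'k, _) fin_functor" and ?G = "kbar_power K b :: ('x, 'k, _) fin_functor"
  let ?N = "nat_trans K ?F ?G" and ?H = "Hom_functors K ?F ?G"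
  let ?\<Phi> = "restrict (nat_coeff K {1..b} {1..a} p q) ?N"
  define \<kappa> where "\<kappa> = (\<lambda>v\<in>carrier (ker_R K b a). {kz_elt a b v})"
  \<comment> \<open>With \<open>\<psi>\<close> inverse to \<open>\<kappa>\<close> and \<open>\<phi>\<close> the composite of \<open>\<kappa>\<close> with the coefficient map, equivariance of \<open>\<psi> \<circ> \<phi>\<close>
    is that of the coefficient map.\<close>
  define \<psi> where "\<psi> = restrict (inv_into (carrier (ker_R K b a)) \<kappa>) (carrier (cohomology (Kz K a b) 0))"
  have \<kappa>: "\<kappa> \<in> mod_iso K (ker_R K b a) (cohomology (Kz K a b) 0)" unfolding \<kappa>_def by (rule ker_R_cohomology_iso)
  have kM: "Module.module K (ker_R K b a)"
    unfolding ker_R_eq by (rule submodule.submodule_is_module[OF surj_kernel_submodule free_module_R]) simp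
  have \<psi>: "\<psi> \<in> mod_iso K (cohomology (Kz K a b) 0) (ker_R K b a)"
    unfolding \<psi>_def by (rule mod_iso_sym[OF kM \<kappa>])
  have I: "finite {1..a}" "{1..a} \<noteq> {}" "finite {1..b}" using assms(2) by auto
  have \<Phi>: "?\<Phi> \<in> mod_iso K ?H (ker_R K b a)"
    unfolding kbar_power_def ker_R_eq by (rule nat_coeff_iso[OF I pq])
  have H: "carrier ?H = ?N" by (simp add: Hom_functors_def)
  have closed: "\<And>\<eta> \<theta>. \<eta> \<in> carrier ?H \<Longrightarrow> \<theta> \<in> carrier ?H \<Longrightarrow> \<eta> \<oplus>\<^bsub>?H\<^esub> \<theta> \<in> carrier ?H"
    "\<And>c \<eta>. c \<in> carrier K \<Longrightarrow> \<eta> \<in> carrier ?H \<Longrightarrow> c \<odot>\<^bsub>?H\<^esub> \<eta> \<in> carrier ?H"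
    unfolding H by (rule Hom_functors_closed[OF kbar_power_is_functor[OF assms(1)] kbar_power_is_functor[OF assms(1)]]; assumption)+
  define \<phi> where "\<phi> = compose (carrier ?H) \<kappa> ?\<Phi>"
  have \<phi>: "\<phi> \<in> mod_iso K ?H (cohomology (Kz K a b) 0)"
    unfolding \<phi>_def by (rule mod_iso_comp[OF closed \<Phi> \<kappa>])
  have \<psi>\<phi>: "\<psi> (\<phi> \<eta>) = nat_coeff K {1..b} {1..a} p q \<eta>" if \<eta>: "\<eta> \<in> ?N" for \<eta>
  proof -
    have b: "bij_betw \<kappa> (carrier (ker_R K b a)) (carrier (cohomology (Kz K a b) 0))" using \<kappa> by (simp add: mod_iso_def)
    have c: "?\<Phi> \<eta> \<in> carrier (ker_R K b a)" using \<Phi> \<eta> mod_homD(1)[of ?\<Phi> K ?H "ker_R K b a" \<eta>] by (simp add: mod_iso_def H)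
    have "\<psi> (\<phi> \<eta>) = \<psi> (\<kappa> (?\<Phi> \<eta>))" using \<eta> by (simp add: \<phi>_def compose_def H)
    also have "\<dots> = inv_into (carrier (ker_R K b a)) \<kappa> (\<kappa> (?\<Phi> \<eta>))"
      unfolding \<psi>_def by (rule restrict_apply'[OF bij_betwE[OF b, THEN bspec, OF c]])
    also have "\<dots> = ?\<Phi> \<eta>" by (rule inv_into_f_f[OF bij_betw_imp_inj_on[OF b] c])
    finally show ?thesis using \<eta> by simp
  qed
  show "\<exists>\<phi>\<in>mod_iso K ?H (cohomology (Kz K a b) 0). \<exists>\<psi>\<in>mod_iso K (cohomology (Kz K a b) 0) (ker_R K b a).
      \<forall>\<sigma> \<tau>. \<sigma> permutes {1..a} \<longrightarrow> \<tau> permutes {1..b} \<longrightarrow>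
        (\<forall>\<eta>\<in>?N. \<psi> (\<phi> (Hom_act K a b \<sigma> \<tau> \<eta>)) = kOmega_act K a b \<sigma> \<tau> (\<psi> (\<phi> \<eta>)))"
  proof (rule bexI[OF _ \<phi>], rule bexI[OF _ \<psi>], intro allI impI ballI)
    fix \<sigma> \<tau> \<eta> assume \<sigma>: "\<sigma> permutes {1..a}" and \<tau>: "\<tau> permutes {1..b}" and \<eta>: "\<eta> \<in> ?N"
    have \<eta>': "\<eta> \<in> nat_trans K (kbar_tensor K {1..a}) (kbar_tensor K {1..b})" using \<eta> by (simp only: kbar_power_def)
    have act: "Hom_act K a b \<sigma> \<tau> \<eta> \<in> ?N" unfolding kbar_power_def by (rule Hom_act_nat_trans[OF \<eta>' \<sigma> \<tau>])
    show "\<psi> (\<phi> (Hom_act K a b \<sigma> \<tau> \<eta>)) = kOmega_act K a b \<sigma> \<tau> (\<psi> (\<phi> \<eta>))"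
      unfolding \<psi>\<phi>[OF \<eta>] \<psi>\<phi>[OF act] by (rule nat_coeff_act[OF \<eta>' assms(2) \<sigma> \<tau> pq])
  qed
qed

end
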